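(* Let $R=\bigoplus_{n\ge 0}R_n$ be a standard graded Noetherian ring with irrelevant ideal $R_+$, and let $M$ be a finitely generated graded $R$-module. Suppose $\mathfrak a$ is a homogeneous ideal that is radically h-$M$-licci with $R_+$ of length $2$, i.e. there are homogeneous ideals $\mathfrak b, I, J$ of $R$ such that $\mathfrak a$ and $\mathfrak b$ are h-linked by $I$ over $M$, $\mathfrak b$ and $R_+$ are h-linked by $J$ over $M$, and $\sqrt{R_+ + (0:_R M)}=\sqrt{J+(0:_R M)}$. Let $t:=\operatorname{grade}(I,M)$. Then, for all $i$ and all $n\gg 0$, $$H^i_{\mathfrak a}(M)_n\cong\begin{cases}0, & i\neq t,\\ H^t_I(M)_n, & i=t.\end{cases}$$
   Context: A standard graded Noetherian ring is $R=\bigoplus_{n\ge 0}R_n$ with $R_0$ commutative Noetherian and $R$ generated as an $R_0$-algebra by finitely many elements of degree one; $R_+=\bigoplus_{n\ge 1}R_n$. For a homogeneous ideal $\mathfrak a$, the local cohomology modules $H^i_{\mathfrak a}(M)$ carry their natural grading, and $H^i_{\mathfrak a}(M)_n$ is the $n$-th graded component. $\operatorname{grade}(I,M)$ is the length of a maximal $M$-regular sequence in $I$. Homogeneous ideals $\mathfrak a,\mathfrak b$ of $R$ are h-linked by $I$ over $M$ if $\mathfrak aM\neq M\neq\mathfrak bM$, $I\subseteq\mathfrak a\cap\mathfrak b$ is an ideal generated by a homogeneous $M$-regular sequence (possibly empty, i.e. $I=0$), $\mathfrak bM=IM:_M\mathfrak a$ and $\mathfrak aM=IM:_M\mathfrak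 b$. *)

theory Defs
  imports "HOL-Algebra.Module" "HOL-Algebra.Ideal_Product" "HOL-Algebra.Ring_Divisibility"
    "HOL-Algebra.Generated_Rings"
begin

section \<open>Graded rings and modules\<close>

definition direct_sum_decomposition :: "('a, 'x) ring_scheme \<Rightarrow> ('i \<Rightarrow> 'a set) \<Rightarrow> bool" where
  "direct_sum_decomposition G A \<longleftrightarrow>
     (\<forall>i. additive_subgroup (A i) G) \<and>
     (\<forall>x \<in> carrier G. \<exists>!c. (\<forall>i. c i \<in> A i) \<and> finite {i. c i \<noteq> \<zero>\<^bsub>G\<^esub>} \<and>
        x = (\<Oplus>\<^bsub>G\<^esub> i \<in> {i. c i \<noteq> \<zero>\<^bsub>G\<^esub>}. c i))"

locale standard_graded_ring = cring R for R (structure) +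
  fixes gr :: "nat \<Rightarrow> 'a set"
  assumes gr_decomposition: "direct_sum_decomposition R gr"
    and gr_one: "\<one> \<in> gr 0"
    and gr_mult: "r \<in> gr m \<Longrightarrow> s \<in> gr n \<Longrightarrow> r \<otimes> s \<in> gr (m + n)"
    and gr_0_noetherian: "noetherian_ring (R\<lparr>carrier := gr 0\<rparr>)"
    and gr_generated: "\<exists>S. finite S \<and> S \<subseteq> gr 1 \<and> generate_ring R (gr 0 \<union> S) = carrier R"

text \<open>Modules over the \<open>\<nat>\<close>-graded ring are graded by all integers.\<close>

locale graded_module = module R M for R (structure) and M (structure) +
  fixes gr :: "nat \<Rightarrow> 'a set" and gM :: "int \<Rightarrow> 'c set"
  assumes gM_decomposition: "direct_sum_decomposition M gM"
    and gM_smult: "r \<in> gr m \<Longrightarrow> x \<in> gM n \<Longrightarrow> r \<odot>\<^bsub>M\<^esub> x \<in> gM (int m + n)"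

definition homogeneous_ideal :: "('r, 'x) ring_scheme \<Rightarrow> (nat \<Rightarrow> 'r set) \<Rightarrow> 'r set \<Rightarrow> bool" where
  "homogeneous_ideal R gr I \<longleftrightarrow> ideal I R \<and> I = Idl\<^bsub>R\<^esub> (I \<inter> (\<Union>n. gr n))"

definition irrelevant_ideal :: "('r, 'x) ring_scheme \<Rightarrow> (nat \<Rightarrow> 'r set) \<Rightarrow> 'r set" where
  "irrelevant_ideal R gr =
     {\<Oplus>\<^bsub>R\<^esub> n \<in> F. c n | c F. finite F \<and> F \<subseteq> {1..} \<and> (\<forall>n \<in> F. c n \<in> gr n)}"

definition radical :: "('r, 'x) ring_scheme \<Rightarrow> 'r set \<Rightarrow> 'r set" where
  "radical R I = {r \<in> carrier R. \<exists>k::nat. r [^]\<^bsub>R\<^esub> k \<in> I}"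


section \<open>Ideals acting on modules, regular sequences, linkage\<close>

definition submodule_span ::
    "('r, 'x) ring_scheme \<Rightarrow> ('r, 'm, 'y) module_scheme \<Rightarrow> 'm set \<Rightarrow> 'm set" where
  "submodule_span R M S = \<Inter>{N. submodule N R M \<and> S \<subseteq> N}"

definition finitely_generated_module ::
    "('r, 'x) ring_scheme \<Rightarrow> ('r, 'm, 'y) module_scheme \<Rightarrow> bool" where
  "finitely_generated_module R M \<longleftrightarrow>
     (\<exists>S. finite S \<and> S \<subseteq> carrier M \<and> submodule_span R M S = carrier M)"

definition ideal_smult ::
    "('r, 'x) ring_scheme \<Rightarrow> ('r, 'm, 'y) module_scheme \<Rightarrow> 'r set \<Rightarrow> 'm set" where
  "ideal_smult R M I = submodule_span R M {r \<odot>\<^bsub>M\<^esub> x | r x. r \<in> I \<and> x \<in> carrier M}"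

definition module_colon :: "('r, 'm, 'y) module_scheme \<Rightarrow> 'm set \<Rightarrow> 'r set \<Rightarrow> 'm set" where
  "module_colon M N I = {x \<in> carrier M. \<forall>r \<in> I. r \<odot>\<^bsub>M\<^esub> x \<in> N}"

definition annihilator ::
    "('r, 'x) ring_scheme \<Rightarrow> ('r, 'm, 'y) module_scheme \<Rightarrow> 'r set" where
  "annihilator R M = {r \<in> carrier R. \<forall>x \<in> carrier M. r \<odot>\<^bsub>M\<^esub> x = \<zero>\<^bsub>M\<^esub>}"

text \<open>The second conjunct says that \<open>x\<^sub>k\<close> is a nonzerodivisor on \<open>M/(x\<^sub>0, \<dots>, x\<^sub>k\<^sub>-\<^sub>1)M\<close>.\<close>

definition regular_sequence ::
    "('r, 'x) ring_scheme \<Rightarrow> ('r, 'm, 'y) module_scheme \<Rightarrow> 'r list \<Rightarrow> bool" where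
  "regular_sequence R M xs \<longleftrightarrow>
     set xs \<subseteq> carrier R \<and>
     (\<forall>k < length xs. \<forall>m \<in> carrier M.
        xs ! k \<odot>\<^bsub>M\<^esub> m \<in> ideal_smult R M (Idl\<^bsub>R\<^esub> (set (take k xs))) \<longrightarrow>
        m \<in> ideal_smult R M (Idl\<^bsub>R\<^esub> (set (take k xs)))) \<and>
     ideal_smult R M (Idl\<^bsub>R\<^esub> (set xs)) \<noteq> carrier M"

definition maximal_regular_sequence ::
    "('r, 'x) ring_scheme \<Rightarrow> ('r, 'm, 'y) module_scheme \<Rightarrow> 'r set \<Rightarrow> 'r list \<Rightarrow> bool" where
  "maximal_regular_sequence R M I xs \<longleftrightarrow>
     set xs \<subseteq> I \<and> regular_sequence R M xs \<and> (\<forall>x \<in> I. \<not> regular_sequence R M (xs @ [x]))"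

text \<open>By Rees' theorem the description is unique when \<open>R\<close> is Noetherian, \<open>M\<close> is finitely
  generated and \<open>IM \<noteq> M\<close>.\<close>

definition grade ::
    "('r, 'x) ring_scheme \<Rightarrow> 'r set \<Rightarrow> ('r, 'm, 'y) module_scheme \<Rightarrow> nat" where
  "grade R I M = (THE t. \<exists>xs. maximal_regular_sequence R M I xs \<and> length xs = t)"

definition h_linked ::
    "('r, 'x) ring_scheme \<Rightarrow> (nat \<Rightarrow> 'r set) \<Rightarrow> ('r, 'm, 'y) module_scheme \<Rightarrow>
     'r set \<Rightarrow> 'r set \<Rightarrow> 'r set \<Rightarrow> bool" where
  "h_linked R gr M I \<aa> \<bb> \<longleftrightarrow>
     homogeneous_ideal R gr \<aa> \<and> homogeneous_ideal R gr \<bb> \<and>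
     ideal_smult R M \<aa> \<noteq> carrier M \<and> ideal_smult R M \<bb> \<noteq> carrier M \<and>
     I \<subseteq> \<aa> \<inter> \<bb> \<and>
     (\<exists>xs. set xs \<subseteq> (\<Union>n. gr n) \<and> regular_sequence R M xs \<and> I = Idl\<^bsub>R\<^esub> (set xs)) \<and>
     ideal_smult R M \<bb> = module_colon M (ideal_smult R M I) \<aa> \<and>
     ideal_smult R M \<aa> = module_colon M (ideal_smult R M I) \<bb>"


section \<open>Homomorphisms and injective resolutions of graded modules\<close>

definition module_hom ::
    "('r, 'x) ring_scheme \<Rightarrow> ('r, 'm, 'y) module_scheme \<Rightarrow> ('r, 'n, 'z) module_scheme \<Rightarrow>
     ('m \<Rightarrow> 'n) set" where
  "module_hom R M N = {f \<in> carrier M \<rightarrow> carrier N.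
     (\<forall>x \<in> carrier M. \<forall>y \<in> carrier M. f (x \<oplus>\<^bsub>M\<^esub> y) = f x \<oplus>\<^bsub>N\<^esub> f y) \<and>
     (\<forall>r \<in> carrier R. \<forall>x \<in> carrier M. f (r \<odot>\<^bsub>M\<^esub> x) = r \<odot>\<^bsub>N\<^esub> f x)}"

definition modules_isomorphic ::
    "('r, 'x) ring_scheme \<Rightarrow> ('r, 'm, 'y) module_scheme \<Rightarrow> ('r, 'n, 'z) module_scheme \<Rightarrow> bool" where
  "modules_isomorphic R M N \<longleftrightarrow> (\<exists>f \<in> module_hom R M N. bij_betw f (carrier M) (carrier N))"

text \<open>Morphisms of graded modules are homogeneous of degree zero.\<close>

definition graded_hom ::
    "('r, 'x) ring_scheme \<Rightarrow> ('r, 'm, 'y) module_scheme \<Rightarrow> (int \<Rightarrow> 'm set) \<Rightarrow>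
     ('r, 'n, 'z) module_scheme \<Rightarrow> (int \<Rightarrow> 'n set) \<Rightarrow> ('m \<Rightarrow> 'n) set" where
  "graded_hom R M gM N gN = {f \<in> module_hom R M N. \<forall>n. f ` gM n \<subseteq> gN n}"

text \<open>Injective objects of the category of graded modules. HOL cannot quantify over all types
  inside a definition, so the test modules \<open>A \<rightarrow> B\<close> have carriers in the one type \<open>'r \<times> 'e\<close>.
  Carriers and gradings being arbitrary, copies of all shifts of \<open>R\<close> and of its homogeneous ideals
  occur among them, so by the graded version of Baer's criterion this is no weaker than injectivity
  with respect to graded modules on any other type.\<close>

definition graded_injective ::
    "('r, 'x) ring_scheme \<Rightarrow> (nat \<Rightarrow> 'r set) \<Rightarrow> ('r, 'e) module \<Rightarrow> (int \<Rightarrow> 'e set) \<Rightarrow> bool" where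
  "graded_injective R gr E gE \<longleftrightarrow>
     (\<forall>(A :: ('r, 'r \<times> 'e) module) gA (B :: ('r, 'r \<times> 'e) module) gB u v.
        graded_module R A gr gA \<and> graded_module R B gr gB \<and>
        u \<in> graded_hom R A gA B gB \<and> inj_on u (carrier A) \<and> v \<in> graded_hom R A gA E gE \<longrightarrow>
        (\<exists>w \<in> graded_hom R B gB E gE. \<forall>x \<in> carrier A. w (u x) = v x))"

text \<open>\<open>0 \<rightarrow> M \<rightarrow> E\<^sup>0 \<rightarrow> E\<^sup>1 \<rightarrow> \<dots>\<close> is exact, with augmentation \<open>\<epsilon>\<close> and differentials \<open>d i\<close>.\<close>

definition graded_injective_resolution ::
    "('r, 'x) ring_scheme \<Rightarrow> (nat \<Rightarrow> 'r set) \<Rightarrow>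
     ('r, 'm, 'y) module_scheme \<Rightarrow> (int \<Rightarrow> 'm set) \<Rightarrow>
     (nat \<Rightarrow> ('r, 'e) module) \<Rightarrow> (nat \<Rightarrow> int \<Rightarrow> 'e set) \<Rightarrow> ('m \<Rightarrow> 'e) \<Rightarrow> (nat \<Rightarrow> 'e \<Rightarrow> 'e) \<Rightarrow> bool" where
  "graded_injective_resolution R gr M gM E gE \<epsilon> d \<longleftrightarrow>
     (\<forall>i. graded_module R (E i) gr (gE i) \<and> graded_injective R gr (E i) (gE i)) \<and>
     \<epsilon> \<in> graded_hom R M gM (E 0) (gE 0) \<and> inj_on \<epsilon> (carrier M) \<and>
     (\<forall>i. d i \<in> graded_hom R (E i) (gE i) (E (Suc i)) (gE (Suc i))) \<and>
     \<epsilon> ` carrier M = {x \<in> carrier (E 0). d 0 x = \<zero>\<^bsub>E (Suc 0)\<^esub>} \<and>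
     (\<forall>i. d i ` carrier (E i) =
          {x \<in> carrier (E (Suc i)). d (Suc i) x = \<zero>\<^bsub>E (Suc (Suc i))\<^esub>})"


section \<open>Local cohomology\<close>

definition torsion ::
    "('r, 'x) ring_scheme \<Rightarrow> 'r set \<Rightarrow> ('r, 'm, 'y) module_scheme \<Rightarrow> 'm set" where
  "torsion R \<aa> M =
     {x \<in> carrier M. \<exists>k::nat. \<forall>r \<in> \<aa> [^]\<^bsub>ideals_set R\<^esub> k. r \<odot>\<^bsub>M\<^esub> x = \<zero>\<^bsub>M\<^esub>}"

text \<open>The module structure on the cosets of a submodule; the ring multiplication and unit carried
  along by the record type of modules have no meaning here.\<close>

definition quotient_module :: "('r, 'm) module \<Rightarrow> 'm set \<Rightarrow> ('r, 'm set) module" where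
  "quotient_module M N =
     \<lparr>carrier = a_rcosets\<^bsub>M\<^esub> N, monoid.mult = (\<lambda>_ _. N), one = N, ring.zero = N, add = set_add M,
      smult = (\<lambda>r C. N <+>\<^bsub>M\<^esub> ((\<lambda>x. r \<odot>\<^bsub>M\<^esub> x) ` C))\<rparr>"

definition torsion_cocycles ::
    "('r, 'x) ring_scheme \<Rightarrow> (nat \<Rightarrow> ('r, 'e) module) \<Rightarrow> (nat \<Rightarrow> 'e \<Rightarrow> 'e) \<Rightarrow>
     'r set \<Rightarrow> nat \<Rightarrow> 'e set" where
  "torsion_cocycles R E d \<aa> i = {x \<in> torsion R \<aa> (E i). d i x = \<zero>\<^bsub>E (Suc i)\<^esub>}"

definition torsion_coboundaries ::
    "('r, 'x) ring_scheme \<Rightarrow> (nat \<Rightarrow> ('r, 'e) module) \<Rightarrow> (nat \<Rightarrow> 'e \<Rightarrow> 'e) \<Rightarrow>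
     'r set \<Rightarrow> nat \<Rightarrow> 'e set" where
  "torsion_coboundaries R E d \<aa> i =
     (case i of 0 \<Rightarrow> {\<zero>\<^bsub>E 0\<^esub>} | Suc j \<Rightarrow> d j ` torsion R \<aa> (E j))"

text \<open>If \<open>(E, d)\<close> is a graded injective resolution of \<open>M\<close>, this is the \<open>i\<close>-th right derived
  functor of the \<open>\<aa>\<close>-torsion functor at \<open>M\<close>, that is \<open>H\<^sup>i\<^sub>\<aa>(M)\<close>. As usual for derived functors, it is computed
  from a chosen resolution, on which it depends only up to graded isomorphism; no universal choice
  of resolution is made, since the type \<open>'e\<close> has to be large enough to accommodate one.\<close>

definition local_cohomology ::
    "('r, 'x) ring_scheme \<Rightarrow> (nat \<Rightarrow> ('r, 'e) module) \<Rightarrow> (nat \<Rightarrow> 'e \<Rightarrow> 'e) \<Rightarrow>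
     'r set \<Rightarrow> nat \<Rightarrow> ('r, 'e set) module" where
  "local_cohomology R E d \<aa> i =
     quotient_module ((E i)\<lparr>carrier := torsion_cocycles R E d \<aa> i\<rparr>) (torsion_coboundaries R E d \<aa> i)"

text \<open>The \<open>n\<close>-th graded component consists of the classes of homogeneous cocycles of degree \<open>n\<close>.
  It is a module over the degree zero part of \<open>R\<close>.\<close>

definition local_cohomology_component ::
    "('r, 'x) ring_scheme \<Rightarrow> (nat \<Rightarrow> ('r, 'e) module) \<Rightarrow> (nat \<Rightarrow> int \<Rightarrow> 'e set) \<Rightarrow>
     (nat \<Rightarrow> 'e \<Rightarrow> 'e) \<Rightarrow> 'r set \<Rightarrow> nat \<Rightarrow> int \<Rightarrow> ('r, 'e set) module" where
  "local_cohomology_component R E gE d \<aa> i n =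
     (local_cohomology R E d \<aa> i)
       \<lparr>carrier := {torsion_coboundaries R E d \<aa> i +>\<^bsub>E i\<^esub> x | x.
                      x \<in> torsion_cocycles R E d \<aa> i \<inter> gE i n}\<rparr>"

end

theory Submission
  imports Defs
begin

text \<open>The linkage hypotheses give \<open>\<aa>\<^sup>p (R\<^sub>+)\<^sup>q \<subseteq> I + Ann M\<close> for some \<open>p\<close>, \<open>q\<close>. Since local cohomology does not
  see \<open>Ann M\<close>, the inclusion of the \<open>\<aa>\<close>-torsion into the \<open>I\<close>-torsion of the resolution is a quasi-isomorphism
  in degree \<open>n\<close> as soon as \<open>Ext\<^sup>j(P/W, M)\<^sub>n = 0\<close> for all homogeneous ideals \<open>W \<subseteq> P\<close> with \<open>P/W\<close> killed by a
  power of \<open>R\<^sub>+\<close>. Filtering \<open>P/W\<close> by cyclic modules reduces this to \<open>Ext\<^sup>j(R/R\<^sub>+, M)\<close>, which is finitely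
  generated and killed by \<open>R\<^sub>+\<close> and hence zero in large degrees; the bound does not depend on \<open>P/W\<close> because
  \<open>R\<close> is generated in nonnegative degrees. Finally \<open>H\<^sup>i\<^sub>I(M)\<close> vanishes for \<open>i \<noteq> t\<close>, as \<open>I\<close> is
  generated by an \<open>M\<close>-regular sequence, whose length is \<open>grade(I, M)\<close> by Rees' theorem. No resolution of another module
  is needed: all Ext modules are taken in the first variable, where they can be described by elements of the
  given resolution.\<close>


section \<open>Homogeneous components\<close>

text \<open>Linkage gives \<aa>\<bb>M \<subseteq> IM, a statement about submodules; returning to
  ideals by an integrality argument costs powers and a summand from Ann M. Hence \<aa> and I are
  compared through \<aa> + (H) and I + (H) for a finite set H of homogeneous elements of Ann M.
  Adding H is harmless in every degree: for h in Ann M the quotient of torsion by h-torsion is a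
  localization at h, and a power of h kills its cohomology. Only the passage between I + (H) and
  \<aa> + (H) needs large degrees. The only resolution at hand is that of M, in a fixed type
  \<open>'e\<close>, so the vanishing of H_I outside t cannot run through resolutions of M/xM.
  Instead the elements of the sequence join the support one at a time; the invariant is that one
  cohomology module is left and that the later elements stay weakly regular on it. Each comparison
  is expressed as exactness of a quotient of two torsion subcomplexes, a condition on elements that
  can be composed and cancelled. Rees' theorem is proved by exchanging sequences while following
  nonzero elements of quotients of M that an ideal kills.\<close>

definition hcomp :: "('a, 'x) ring_scheme \<Rightarrow> ('i \<Rightarrow> 'a set) \<Rightarrow> 'i \<Rightarrow> 'a \<Rightarrow> 'a" where
  "hcomp G A i x = (THE c. (\<forall>i. c i \<in> A i) \<and> finite {i. c i \<noteq> \<zero>\<^bsub>G\<^esub>} \<and>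
        x = (\<Oplus>\<^bsub>G\<^esub> i \<in> {i. c i \<noteq> \<zero>\<^bsub>G\<^esub>}. c i)) i"

locale graded_group = abelian_group G for G (structure) +
  fixes A :: "'i \<Rightarrow> 'a set"
  assumes decomposition: "direct_sum_decomposition G A"
begin

lemma piece_subgroup: "additive_subgroup (A i) G"
  using decomposition by (simp add: direct_sum_decomposition_def)

lemma piece_carrier: "x \<in> A i \<Longrightarrow> x \<in> carrier G"
  using additive_subgroup.a_Hcarr[OF piece_subgroup] .

lemma piece_zero [simp, intro]: "\<zero> \<in> A i"
  using additive_subgroup.zero_closed[OF piece_subgroup] .

lemma piece_add: "x \<in> A i \<Longrightarrow> y \<in> A i \<Longrightarrow> x \<oplus> y \<in> A i"
  using additive_subgroup.a_closed[OF piece_subgroup] .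

lemma piece_neg: "x \<in> A i \<Longrightarrow> \<ominus> x \<in> A i"
  using additive_subgroup.a_inv_closed[OF piece_subgroup] .

lemma hcomp_spec:
  assumes "x \<in> carrier G"
  shows "(\<forall>i. hcomp G A i x \<in> A i) \<and> finite {i. hcomp G A i x \<noteq> \<zero>} \<and>
        x = (\<Oplus> i \<in> {i. hcomp G A i x \<noteq> \<zero>}. hcomp G A i x)"
proof -
  have "\<exists>!c. (\<forall>i. c i \<in> A i) \<and> finite {i. c i \<noteq> \<zero>} \<and> x = (\<Oplus> i \<in> {i. c i \<noteq> \<zero>}. c i)"
    using decomposition assms by (auto simp: direct_sum_decomposition_def)
  from theI'[OF this] show ?thesis
    unfolding hcomp_def by simp
qed

lemma hcomp_piece: "x \<in> carrier G \<Longrightarrow> hcomp G A i x \<in> A i"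
  using hcomp_spec by blast

lemma hcomp_closed [simp]: "x \<in> carrier G \<Longrightarrow> hcomp G A i x \<in> carrier G"
  using hcomp_piece piece_carrier by blast

lemma hcomp_finite: "x \<in> carrier G \<Longrightarrow> finite {i. hcomp G A i x \<noteq> \<zero>}"
  using hcomp_spec by blast

text \<open>The index set \<open>F\<close> may be larger than the support, so components can be read
  off from finite sums as they arise.\<close>

lemma hcomp_unique:
  assumes c: "\<And>i. c i \<in> A i" and F: "finite F" "\<And>i. i \<notin> F \<Longrightarrow> c i = \<zero>"
    and x: "x = (\<Oplus> i \<in> F. c i)"
  shows "hcomp G A i x = c i"
proof -
  have carr: "c i \<in> carrier G" for i using c piece_carrier by blast
  have xc: "x \<in> carrier G" unfolding x using carr by (auto intro!: finsum_closed)
  have sub: "{i. c i \<noteq> \<zero>} \<subseteq> F" using F(2) by auto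
  have "x = (\<Oplus> i \<in> {i. c i \<noteq> \<zero>}. c i)"
    unfolding x by (rule add.finprod_mono_neutral_cong_left[symmetric]) (use F sub carr in auto)
  hence "(\<forall>i. c i \<in> A i) \<and> finite {i. c i \<noteq> \<zero>} \<and> x = (\<Oplus> i \<in> {i. c i \<noteq> \<zero>}. c i)"
    using c finite_subset[OF sub F(1)] by blast
  moreover have "\<exists>!c. (\<forall>i. c i \<in> A i) \<and> finite {i. c i \<noteq> \<zero>} \<and> x = (\<Oplus> i \<in> {i. c i \<noteq> \<zero>}. c i)"
    using decomposition xc by (auto simp: direct_sum_decomposition_def)
  ultimately show ?thesis
    using hcomp_spec[OF xc] by metis
qed

lemma hcomp_same: "a \<in> A i \<Longrightarrow> hcomp G A i a = a"
  and hcomp_other: "a \<in> A i \<Longrightarrow> j \<noteq> i \<Longrightarrow> hcomp G A j a = \<zero>"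
proof -
  assume a: "a \<in> A i"
  have "hcomp G A j a = (if j = i then a else \<zero>)" for j
    by (rule hcomp_unique[where F = "{i}"]) (use a piece_carrier in auto)
  thus "hcomp G A i a = a" "j \<noteq> i \<Longrightarrow> hcomp G A j a = \<zero>" by auto
qed

lemma hcomp_zero [simp]: "hcomp G A i \<zero> = \<zero>"
  using hcomp_same[OF piece_zero] .

lemma hcomp_add:
  assumes "x \<in> carrier G" "y \<in> carrier G"
  shows "hcomp G A i (x \<oplus> y) = hcomp G A i x \<oplus> hcomp G A i y"
proof (rule hcomp_unique)
  let ?c = "hcomp G A"
  let ?F = "{i. ?c i x \<noteq> \<zero>} \<union> {i. ?c i y \<noteq> \<zero>}"
  show "?c i x \<oplus> ?c i y \<in> A i" for i
    using assms hcomp_piece piece_add by blast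
  show "finite ?F" using hcomp_finite assms by blast
  show "?c i x \<oplus> ?c i y = \<zero>" if "i \<notin> ?F" for i using that by auto
  have "(\<Oplus> i \<in> ?F. ?c i z) = z" if "z \<in> carrier G" "{i. ?c i z \<noteq> \<zero>} \<subseteq> ?F" for z
  proof -
    have "(\<Oplus> i \<in> {i. ?c i z \<noteq> \<zero>}. ?c i z) = (\<Oplus> i \<in> ?F. ?c i z)"
      by (rule add.finprod_mono_neutral_cong_left) (use that \<open>finite ?F\<close> in auto)
    thus ?thesis using hcomp_spec[OF that(1)] by metis
  qed
  from this[of x] this[of y] show "x \<oplus> y = (\<Oplus> i \<in> ?F. ?c i x \<oplus> ?c i y)"
    using assms by (subst finsum_addf) auto
qed

lemma hcomp_neg:
  assumes "x \<in> carrier G" shows "hcomp G A i (\<ominus> x) = \<ominus> hcomp G A i x"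
proof -
  have "hcomp G A i x \<oplus> hcomp G A i (\<ominus> x) = \<zero>"
    using hcomp_add[of x "\<ominus> x" i] assms by (simp add: r_neg)
  thus ?thesis using assms by (metis a_comm a_inv_closed hcomp_closed minus_equality)
qed

lemma hcomp_minus:
  "x \<in> carrier G \<Longrightarrow> y \<in> carrier G \<Longrightarrow> hcomp G A i (x \<ominus> y) = hcomp G A i x \<ominus> hcomp G A i y"
  by (simp add: a_minus_def hcomp_add hcomp_neg)

lemma homogeneous_induct [consumes 1, case_names zero piece add]:
  assumes x: "x \<in> carrier G" and "P \<zero>" and piece: "\<And>i a. a \<in> A i \<Longrightarrow> P a"
    and add: "\<And>x y. x \<in> carrier G \<Longrightarrow> y \<in> carrier G \<Longrightarrow> P x \<Longrightarrow> P y \<Longrightarrow> P (x \<oplus> y)"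
  shows "P x"
proof -
  have c: "hcomp G A i x \<in> A i" for i using hcomp_piece[OF x] .
  have "P (\<Oplus> i \<in> F. hcomp G A i x)" if "finite F" for F
    using that
  proof induction
    case empty thus ?case using \<open>P \<zero>\<close> by simp
  next
    case (insert j F)
    thus ?case using x c piece by (auto intro!: add finsum_closed)
  qed
  thus ?thesis using hcomp_spec[OF x] by metis
qed

lemma sum_of_hcomps_induct:
  assumes x: "x \<in> carrier G" and "P \<zero>"
    and add: "\<And>i y. y \<in> carrier G \<Longrightarrow> P y \<Longrightarrow> P (hcomp G A i x \<oplus> y)"
  shows "P x"
proof -
  have "P (\<Oplus> i \<in> F. hcomp G A i x)" if "finite F" for F
    using that
  proof induction
    case empty thus ?case using \<open>P \<zero>\<close> by simp
  next
    case (insert j F)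
    thus ?case using x by (auto intro!: add finsum_closed)
  qed
  thus ?thesis using hcomp_spec[OF x] by metis
qed

lemma hcomp_eq_zeroD: "x \<in> carrier G \<Longrightarrow> (\<And>i. hcomp G A i x = \<zero>) \<Longrightarrow> x = \<zero>"
  by (rule sum_of_hcomps_induct) auto

end

text \<open>The degree change \<open>s\<close> is the identity for differentials, a translation for
  multiplication by a homogeneous element, and k \<mapsto> k + n for evaluating ring elements at an
  element of degree n. The second conclusion covers the degrees missed by \<open>s\<close>, such as
  those below m for translation by m on the natural numbers.\<close>

lemma hcomp_graded_map:
  assumes "graded_group G A" "graded_group H B"
    and f: "f \<in> carrier G \<rightarrow> carrier H"
    and f_add: "\<And>x y. x \<in> carrier G \<Longrightarrow> y \<in> carrier G \<Longrightarrow> f (x \<oplus>\<^bsub>G\<^esub> y) = f x \<oplus>\<^bsub>H\<^esub> f y"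
    and f_graded: "\<And>i x. x \<in> A i \<Longrightarrow> f x \<in> B (s i)" and "inj s" and x: "x \<in> carrier G"
  shows "hcomp H B (s i) (f x) = f (hcomp G A i x)"
    and "j \<notin> range s \<Longrightarrow> hcomp H B j (f x) = \<zero>\<^bsub>H\<^esub>"
proof -
  interpret G: graded_group G A by fact
  interpret H: graded_group H B by fact
  have f0: "f \<zero>\<^bsub>G\<^esub> = \<zero>\<^bsub>H\<^esub>"
    using f_add[of "\<zero>\<^bsub>G\<^esub>" "\<zero>\<^bsub>G\<^esub>"] f by (metis G.l_zero G.zero_closed H.add.r_cancel_one funcset_mem)
  show "hcomp H B (s i) (f x) = f (hcomp G A i x)"
    using x
  proof (induction rule: G.homogeneous_induct)
    case zero thus ?case by (simp add: f0)
  next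
    case (piece j a)
    show ?case
    proof (cases "i = j")
      case True thus ?thesis using piece by (simp add: G.hcomp_same H.hcomp_same f_graded)
    next
      case False
      hence "s i \<noteq> s j" using \<open>inj s\<close> by (auto dest: injD)
      thus ?thesis using False G.hcomp_other[OF piece False] H.hcomp_other[OF f_graded[OF piece]] f0
        by simp
    qed
  next
    case (add x y)
    have "f x \<in> carrier H" "f y \<in> carrier H" using add f by auto
    thus ?case using add by (simp add: f_add G.hcomp_add H.hcomp_add)
  qed
  show "hcomp H B j (f x) = \<zero>\<^bsub>H\<^esub>" if j: "j \<notin> range s"
    using x
  proof (induction rule: G.homogeneous_induct)
    case zero thus ?case by (simp add: f0)
  next
    case (piece i a)
    thus ?case using H.hcomp_other[OF f_graded[OF piece]] j by auto
  next
    case (add x y)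
    have "f x \<in> carrier H" "f y \<in> carrier H" using add f by auto
    thus ?case using add by (simp add: f_add H.hcomp_add)
  qed
qed

section \<open>Noetherian modules\<close>

text \<open>Submodules over a set \<open>A\<close> of operators; letting \<open>A\<close> grow from \<open>R\<^sub>0\<close> by one generator of \<open>R\<close>
  at a time gives Hilbert's basis theorem without polynomial rings.\<close>

definition operator_subgroup :: "('r, 'm, 'y) module_scheme \<Rightarrow> 'r set \<Rightarrow> 'm set \<Rightarrow> bool" where
  "operator_subgroup M A S \<longleftrightarrow> additive_subgroup S M \<and> (\<forall>a \<in> A. \<forall>x \<in> S. a \<odot>\<^bsub>M\<^esub> x \<in> S)"

inductive_set operator_span :: "('r, 'm, 'y) module_scheme \<Rightarrow> 'r set \<Rightarrow> 'm set \<Rightarrow> 'm set"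
  for M and A and F where
    zero: "\<zero>\<^bsub>M\<^esub> \<in> operator_span M A F"
  | incl: "x \<in> F \<Longrightarrow> x \<in> operator_span M A F"
  | neg: "x \<in> operator_span M A F \<Longrightarrow> \<ominus>\<^bsub>M\<^esub> x \<in> operator_span M A F"
  | add: "x \<in> operator_span M A F \<Longrightarrow> y \<in> operator_span M A F \<Longrightarrow> x \<oplus>\<^bsub>M\<^esub> y \<in> operator_span M A F"
  | smult: "a \<in> A \<Longrightarrow> x \<in> operator_span M A F \<Longrightarrow> a \<odot>\<^bsub>M\<^esub> x \<in> operator_span M A F"

definition noetherian_over :: "('r, 'm, 'y) module_scheme \<Rightarrow> 'r set \<Rightarrow> 'm set \<Rightarrow> bool" where
  "noetherian_over M A N \<longleftrightarrow>
     (\<forall>S. operator_subgroup M A S \<and> S \<subseteq> N \<longrightarrow>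
        (\<exists>F. finite F \<and> F \<subseteq> S \<and> S \<subseteq> operator_span M A F))"

lemma noetherian_overE:
  assumes "noetherian_over M A N" "operator_subgroup M A S" "S \<subseteq> N"
  obtains F where "finite F" "F \<subseteq> S" "S \<subseteq> operator_span M A F"
proof -
  have "\<exists>F. finite F \<and> F \<subseteq> S \<and> S \<subseteq> operator_span M A F"
    using assms(2,3) assms(1)[unfolded noetherian_over_def, rule_format, of S] by simp
  thus thesis using that by (elim exE conjE)
qed

lemma operator_span_mono:
  assumes "F \<subseteq> F'" "A \<subseteq> A'"
  shows "operator_span M A F \<subseteq> operator_span M A' F'"
proof
  fix x assume "x \<in> operator_span M A F"
  thus "x \<in> operator_span M A' F'"
    by induction (use assms in \<open>auto intro: operator_span.intros\<close>)
qed

text \<open>Each derivation of membership in a span uses finitely many generators, so a finite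
  subset of the span can be traded for a finite part of \<open>X\<close> that generates it.\<close>

lemma operator_span_finite_support:
  assumes "finite G" "G \<subseteq> operator_span M A X"
  shows "\<exists>F. finite F \<and> F \<subseteq> X \<and> G \<subseteq> operator_span M A F"
proof -
  have single: "\<exists>F. finite F \<and> F \<subseteq> X \<and> g \<in> operator_span M A F" if "g \<in> operator_span M A X" for g
    using that
  proof induction
    case zero thus ?case by (intro exI[of _ "{}"]) (auto intro: operator_span.zero)
  next
    case (incl x) thus ?case by (intro exI[of _ "{x}"]) (auto intro: operator_span.incl)
  next
    case (neg x) thus ?case by (blast intro: operator_span.neg)
  next
    case (smult a x) thus ?case by (blast intro: operator_span.smult)
  next
    case (add x y)
    then obtain F F' where F: "finite F" "F \<subseteq> X" "x \<in> operator_span M A F"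
      "finite F'" "F' \<subseteq> X" "y \<in> operator_span M A F'" by blast
    hence "x \<oplus>\<^bsub>M\<^esub> y \<in> operator_span M A (F \<union> F')"
      using operator_span_mono[of F "F \<union> F'" A A M]
        operator_span_mono[of F' "F \<union> F'" A A M] by (auto intro: operator_span.add)
    thus ?case using F by (intro exI[of _ "F \<union> F'"]) auto
  qed
  show ?thesis
    using assms
  proof (induction G)
    case empty thus ?case by (intro exI[of _ "{}"]) auto
  next
    case (insert g G')
    then obtain F F' where F: "finite F" "F \<subseteq> X" "G' \<subseteq> operator_span M A F"
      "finite F'" "F' \<subseteq> X" "g \<in> operator_span M A F'"
      using single[of g] by auto
    thus ?case
      using operator_span_mono[of F "F \<union> F'" A A M]
        operator_span_mono[of F' "F \<union> F'" A A M] by (intro exI[of _ "F \<union> F'"]) auto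
  qed
qed

text \<open>Expressions a_0 + x a_1 + ... + x^(k-1) a_(k-1) with coefficients in \<open>N\<close>,
  evaluated in \<open>M\<close>. The index counts terms, so \<open>0\<close> gives the zero
  submodule.\<close>

primrec polynomials_below :: "('r, 'x) ring_scheme \<Rightarrow> ('r, 'm, 'y) module_scheme \<Rightarrow>
    'r \<Rightarrow> 'm set \<Rightarrow> nat \<Rightarrow> 'm set" where
  "polynomials_below R M x N 0 = {\<zero>\<^bsub>M\<^esub>}"
| "polynomials_below R M x N (Suc k) =
     {y \<oplus>\<^bsub>M\<^esub> (x [^]\<^bsub>R\<^esub> k) \<odot>\<^bsub>M\<^esub> a | y a. y \<in> polynomials_below R M x N k \<and> a \<in> N}"

context module
begin

lemma operator_subgroupI:
  assumes "S \<subseteq> carrier M" "\<zero>\<^bsub>M\<^esub> \<in> S" "\<And>x. x \<in> S \<Longrightarrow> \<ominus>\<^bsub>M\<^esub> x \<in> S"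
    "\<And>x y. x \<in> S \<Longrightarrow> y \<in> S \<Longrightarrow> x \<oplus>\<^bsub>M\<^esub> y \<in> S" "\<And>a x. a \<in> A \<Longrightarrow> x \<in> S \<Longrightarrow> a \<odot>\<^bsub>M\<^esub> x \<in> S"
  shows "operator_subgroup M A S"
  unfolding operator_subgroup_def
proof (intro conjI ballI additive_subgroupI)
  show "subgroup S (add_monoid M)"
    by (rule subgroup.intro) (use assms in \<open>auto simp: a_inv_def[symmetric]\<close>)
qed (use assms in auto)

lemma operator_subgroupD:
  assumes "operator_subgroup M A S"
  shows "S \<subseteq> carrier M" "x \<in> S \<Longrightarrow> x \<in> carrier M" "\<zero>\<^bsub>M\<^esub> \<in> S" "x \<in> S \<Longrightarrow> \<ominus>\<^bsub>M\<^esub> x \<in> S"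
    "x \<in> S \<Longrightarrow> y \<in> S \<Longrightarrow> x \<oplus>\<^bsub>M\<^esub> y \<in> S" "x \<in> S \<Longrightarrow> y \<in> S \<Longrightarrow> x \<ominus>\<^bsub>M\<^esub> y \<in> S"
    "a \<in> A \<Longrightarrow> x \<in> S \<Longrightarrow> a \<odot>\<^bsub>M\<^esub> x \<in> S"
proof -
  interpret S: additive_subgroup S M using assms by (simp add: operator_subgroup_def)
  show "S \<subseteq> carrier M" "x \<in> S \<Longrightarrow> x \<in> carrier M" by (auto simp: S.a_Hcarr)
  show "\<zero>\<^bsub>M\<^esub> \<in> S" by simp
  show neg: "\<ominus>\<^bsub>M\<^esub> x \<in> S" if "x \<in> S" for x using that M.abelian_group_axioms by (simp add: S.a_inv_closed)
  show add: "x \<oplus>\<^bsub>M\<^esub> y \<in> S" if "x \<in> S" "y \<in> S" for x y using that by (rule S.a_closed)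
  show "x \<in> S \<Longrightarrow> y \<in> S \<Longrightarrow> x \<ominus>\<^bsub>M\<^esub> y \<in> S" unfolding a_minus_def using neg add by blast
  show "a \<in> A \<Longrightarrow> x \<in> S \<Longrightarrow> a \<odot>\<^bsub>M\<^esub> x \<in> S" using assms by (simp add: operator_subgroup_def)
qed

lemma operator_subgroup_inter:
  "operator_subgroup M A S \<Longrightarrow> operator_subgroup M A T \<Longrightarrow> operator_subgroup M A (S \<inter> T)"
  by (rule operator_subgroupI) (simp_all add: operator_subgroupD subset_eq)

lemma operator_span_subgroup:
  assumes F: "F \<subseteq> carrier M" and A: "A \<subseteq> carrier R"
  shows "operator_subgroup M A (operator_span M A F)"
proof (rule operator_subgroupI)
  show "operator_span M A F \<subseteq> carrier M"
  proof
    fix x assume "x \<in> operator_span M A F"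
    thus "x \<in> carrier M" by induction (use F A in auto)
  qed
qed (auto intro: operator_span.intros)

lemma operator_span_minimal:
  assumes S: "operator_subgroup M A S" and "F \<subseteq> S"
  shows "operator_span M A F \<subseteq> S"
proof
  fix x assume "x \<in> operator_span M A F"
  thus "x \<in> S" by induction (use assms operator_subgroupD[OF S] in auto)
qed

lemma operator_subgroup_cancel:
  assumes "operator_subgroup M A S" "t \<in> S" "s \<ominus>\<^bsub>M\<^esub> t \<in> S" "s \<in> carrier M"
  shows "s \<in> S"
proof -
  have "(s \<ominus>\<^bsub>M\<^esub> t) \<oplus>\<^bsub>M\<^esub> t = s"
    using assms operator_subgroupD(2)[OF assms(1,2)] by (simp add: a_minus_def M.a_assoc M.l_neg)
  thus ?thesis using operator_subgroupD(5)[OF assms(1,3,2)] by simp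
qed

lemma diff_same_tail:
  assumes "y \<in> carrier M" "y' \<in> carrier M" "b \<in> carrier M"
  shows "(y \<oplus>\<^bsub>M\<^esub> b) \<ominus>\<^bsub>M\<^esub> (y' \<oplus>\<^bsub>M\<^esub> b) = y \<ominus>\<^bsub>M\<^esub> y'"
proof -
  have "(y \<oplus>\<^bsub>M\<^esub> b) \<ominus>\<^bsub>M\<^esub> (y' \<oplus>\<^bsub>M\<^esub> b) = y \<oplus>\<^bsub>M\<^esub> (\<ominus>\<^bsub>M\<^esub> y' \<oplus>\<^bsub>M\<^esub> (b \<oplus>\<^bsub>M\<^esub> \<ominus>\<^bsub>M\<^esub> b))"
    using assms by (simp add: a_minus_def M.minus_add M.a_ac)
  thus ?thesis using assms by (simp add: M.r_neg a_minus_def)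
qed

lemma interchange:
  assumes "x \<in> carrier M" "y \<in> carrier M" "u \<in> carrier M" "v \<in> carrier M"
  shows "(x \<oplus>\<^bsub>M\<^esub> u) \<oplus>\<^bsub>M\<^esub> (y \<oplus>\<^bsub>M\<^esub> v) = (x \<oplus>\<^bsub>M\<^esub> y) \<oplus>\<^bsub>M\<^esub> (u \<oplus>\<^bsub>M\<^esub> v)"
  using assms by (simp add: M.a_ac)

lemma smult_commute:
  "a \<in> carrier R \<Longrightarrow> b \<in> carrier R \<Longrightarrow> x \<in> carrier M \<Longrightarrow> a \<odot>\<^bsub>M\<^esub> (b \<odot>\<^bsub>M\<^esub> x) = b \<odot>\<^bsub>M\<^esub> (a \<odot>\<^bsub>M\<^esub> x)"
  by (metis smult_assoc1 R.m_comm)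

text \<open>The coefficients of m occurring in a submodule S of N + Am form an ideal of A. Lifts to
  S of finitely many generators of this ideal, together with generators of S \<inter> N, generate
  S.\<close>

lemma noetherian_over_adjoin_vector:
  assumes A: "subring A R" "noetherian_ring (R\<lparr>carrier := A\<rparr>)"
    and N: "operator_subgroup M A N" "noetherian_over M A N" and m: "m \<in> carrier M"
  defines "N' \<equiv> {y \<oplus>\<^bsub>M\<^esub> a \<odot>\<^bsub>M\<^esub> m | y a. y \<in> N \<and> a \<in> A}"
  shows "operator_subgroup M A N'" "noetherian_over M A N'" "N \<subseteq> N'" "m \<in> N'"
proof -
  have Ac: "A \<subseteq> carrier R" using subringE(1)[OF A(1)] .
  note Nc = operator_subgroupD(2)[OF N(1)]
  note A_simps = subringE(2,3,5-7)[OF A(1)]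
  show N': "operator_subgroup M A N'"
  proof (rule operator_subgroupI)
    show "N' \<subseteq> carrier M" using Ac m Nc by (auto simp: N'_def)
    have "\<zero>\<^bsub>M\<^esub> = \<zero>\<^bsub>M\<^esub> \<oplus>\<^bsub>M\<^esub> \<zero> \<odot>\<^bsub>M\<^esub> m" using m by simp
    thus "\<zero>\<^bsub>M\<^esub> \<in> N'" unfolding N'_def using operator_subgroupD(3)[OF N(1)] A_simps by blast
    fix s assume "s \<in> N'"
    then obtain y a where s: "s = y \<oplus>\<^bsub>M\<^esub> a \<odot>\<^bsub>M\<^esub> m" "y \<in> N" "a \<in> A" by (auto simp: N'_def)
    have "\<ominus>\<^bsub>M\<^esub> s = \<ominus>\<^bsub>M\<^esub> y \<oplus>\<^bsub>M\<^esub> (\<ominus> a) \<odot>\<^bsub>M\<^esub> m"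
      using s m Nc Ac by (auto simp: M.minus_add smult_l_minus)
    thus "\<ominus>\<^bsub>M\<^esub> s \<in> N'"
      unfolding N'_def using operator_subgroupD(4)[OF N(1) s(2)] A_simps(3)[OF s(3)] by blast
    fix t assume "t \<in> N'"
    then obtain z b where t: "t = z \<oplus>\<^bsub>M\<^esub> b \<odot>\<^bsub>M\<^esub> m" "z \<in> N" "b \<in> A" by (auto simp: N'_def)
    have "s \<oplus>\<^bsub>M\<^esub> t = (y \<oplus>\<^bsub>M\<^esub> z) \<oplus>\<^bsub>M\<^esub> (a \<oplus> b) \<odot>\<^bsub>M\<^esub> m"
      unfolding s t using s t m Nc Ac by (subst interchange) (auto simp: smult_l_distr subset_eq)
    thus "s \<oplus>\<^bsub>M\<^esub> t \<in> N'"
      unfolding N'_def using operator_subgroupD(5)[OF N(1) s(2) t(2)] A_simps(5)[OF s(3) t(3)] by blast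
  next
    fix c s assume c: "c \<in> A" and "s \<in> N'"
    then obtain y a where s: "s = y \<oplus>\<^bsub>M\<^esub> a \<odot>\<^bsub>M\<^esub> m" "y \<in> N" "a \<in> A" by (auto simp: N'_def)
    have "c \<odot>\<^bsub>M\<^esub> s = c \<odot>\<^bsub>M\<^esub> y \<oplus>\<^bsub>M\<^esub> (c \<otimes> a) \<odot>\<^bsub>M\<^esub> m"
      using s c m Nc Ac by (auto simp: smult_r_distr smult_assoc1 subset_eq)
    thus "c \<odot>\<^bsub>M\<^esub> s \<in> N'"
      unfolding N'_def using operator_subgroupD(7)[OF N(1) c s(2)] A_simps(4)[OF c s(3)] by blast
  qed
  show "N \<subseteq> N'"
  proof
    fix y assume "y \<in> N"
    moreover from this have "y = y \<oplus>\<^bsub>M\<^esub> \<zero> \<odot>\<^bsub>M\<^esub> m" using Nc m by simp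
    ultimately show "y \<in> N'" unfolding N'_def using A_simps by blast
  qed
  have "m = \<zero>\<^bsub>M\<^esub> \<oplus>\<^bsub>M\<^esub> \<one> \<odot>\<^bsub>M\<^esub> m" using m by simp
  thus "m \<in> N'" unfolding N'_def using operator_subgroupD(3)[OF N(1)] A_simps by blast
  interpret A: noetherian_ring "R\<lparr>carrier := A\<rparr>" by fact
  define L where "L S = {a \<in> A. \<exists>y \<in> N. y \<oplus>\<^bsub>M\<^esub> a \<odot>\<^bsub>M\<^esub> m \<in> S}" for S
  have L_ideal: "ideal (L S) (R\<lparr>carrier := A\<rparr>)" if S: "operator_subgroup M A S" for S
  proof (rule idealI)
    show "ring (R\<lparr>carrier := A\<rparr>)" ..
    have mult: "c \<otimes> a \<in> L S" if "a \<in> L S" "c \<in> A" for a c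
    proof -
      from that obtain y where y: "a \<in> A" "y \<in> N" "y \<oplus>\<^bsub>M\<^esub> a \<odot>\<^bsub>M\<^esub> m \<in> S" by (auto simp: L_def)
      have "c \<odot>\<^bsub>M\<^esub> (y \<oplus>\<^bsub>M\<^esub> a \<odot>\<^bsub>M\<^esub> m) = c \<odot>\<^bsub>M\<^esub> y \<oplus>\<^bsub>M\<^esub> (c \<otimes> a) \<odot>\<^bsub>M\<^esub> m"
        using y that m Nc Ac by (auto simp: smult_r_distr smult_assoc1 subset_eq)
      thus ?thesis unfolding L_def
        using operator_subgroupD(7)[OF N(1), of c y] operator_subgroupD(7)[OF S that(2) y(3)] A_simps(4) y that
        by auto
    qed
    show "subgroup (L S) (add_monoid (R\<lparr>carrier := A\<rparr>))"
    proof (rule A.add.subgroupI)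
      show "L S \<subseteq> carrier (R\<lparr>carrier := A\<rparr>)" by (auto simp: L_def)
      have "\<zero>\<^bsub>M\<^esub> \<oplus>\<^bsub>M\<^esub> \<zero> \<odot>\<^bsub>M\<^esub> m \<in> S" using m operator_subgroupD(3)[OF S] by simp
      thus "L S \<noteq> {}" unfolding L_def using operator_subgroupD(3)[OF N(1)] A_simps by blast
      fix a assume a: "a \<in> L S"
      have "\<ominus> \<one> \<otimes> a \<in> L S" using mult[OF a] A_simps by blast
      hence "\<ominus> a \<in> L S" using a Ac by (auto simp: L_def subset_eq R.l_minus)
      \<comment> \<open>Negation in the record with restricted carrier is a different term and has
        to be identified with negation in \<open>R\<close>.\<close>
      moreover have "\<ominus>\<^bsub>R\<lparr>carrier := A\<rparr>\<^esub> a = \<ominus> a"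
      proof -
        have "\<ominus> a \<in> A" "a \<in> A" "a \<in> carrier R" using a A_simps(3) Ac by (auto simp: L_def)
        thus ?thesis using A.minus_equality[of "\<ominus> a" a] by (simp add: R.l_neg)
      qed
      ultimately show "\<ominus>\<^bsub>R\<lparr>carrier := A\<rparr>\<^esub> a \<in> L S" by simp
      fix b assume b: "b \<in> L S"
      from a obtain y where y: "a \<in> A" "y \<in> N" "y \<oplus>\<^bsub>M\<^esub> a \<odot>\<^bsub>M\<^esub> m \<in> S" by (auto simp: L_def)
      from b obtain z where z: "b \<in> A" "z \<in> N" "z \<oplus>\<^bsub>M\<^esub> b \<odot>\<^bsub>M\<^esub> m \<in> S" by (auto simp: L_def)
      have "(y \<oplus>\<^bsub>M\<^esub> a \<odot>\<^bsub>M\<^esub> m) \<oplus>\<^bsub>M\<^esub> (z \<oplus>\<^bsub>M\<^esub> b \<odot>\<^bsub>M\<^esub> m) = (y \<oplus>\<^bsub>M\<^esub> z) \<oplus>\<^bsub>M\<^esub> (a \<oplus> b) \<odot>\<^bsub>M\<^esub> m"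
        using y z m Nc Ac by (subst interchange) (auto simp: smult_l_distr subset_eq)
      hence "a \<oplus> b \<in> L S" unfolding L_def
        using operator_subgroupD(5)[OF N(1), of y z] operator_subgroupD(5)[OF S y(3) z(3)] A_simps(5) y z
        by auto
      thus "a \<oplus>\<^bsub>R\<lparr>carrier := A\<rparr>\<^esub> b \<in> L S" by simp
    qed
    fix a c assume "a \<in> L S" "c \<in> carrier (R\<lparr>carrier := A\<rparr>)"
    thus "c \<otimes>\<^bsub>R\<lparr>carrier := A\<rparr>\<^esub> a \<in> L S" "a \<otimes>\<^bsub>R\<lparr>carrier := A\<rparr>\<^esub> c \<in> L S"
      using mult[of a c] Ac by (auto simp: L_def R.m_comm subset_eq)
  qed
  show "noetherian_over M A N'"
    unfolding noetherian_over_def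
  proof (intro allI impI, elim conjE)
    fix S assume S: "operator_subgroup M A S" "S \<subseteq> N'"
    obtain G where G: "G \<subseteq> A" "finite G" "L S = Idl\<^bsub>R\<lparr>carrier := A\<rparr>\<^esub> G"
      using A.finetely_gen[OF L_ideal[OF S(1)]] by auto
    have "G \<subseteq> L S" using G A.genideal_self[of G] by simp
    then obtain g where g: "\<And>a. a \<in> G \<Longrightarrow> g a \<in> N \<and> g a \<oplus>\<^bsub>M\<^esub> a \<odot>\<^bsub>M\<^esub> m \<in> S"
      unfolding L_def by (simp add: subset_eq Bex_def) metis
    obtain F where F: "finite F" "F \<subseteq> S \<inter> N" "S \<inter> N \<subseteq> operator_span M A F"
      using N(2) operator_subgroup_inter[OF S(1) N(1)] unfolding noetherian_over_def by (metis inf_le2)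
    define H where "H = F \<union> (\<lambda>a. g a \<oplus>\<^bsub>M\<^esub> a \<odot>\<^bsub>M\<^esub> m) ` G"
    have H: "finite H" "H \<subseteq> S" using G F g by (auto simp: H_def)
    have T: "operator_subgroup M A (operator_span M A H)"
      using H operator_subgroupD(1)[OF S(1)] Ac by (intro operator_span_subgroup) auto
    have "G \<subseteq> L (operator_span M A H)"
      using g G unfolding L_def H_def by (blast intro: operator_span.incl)
    hence LL: "L S \<subseteq> L (operator_span M A H)"
      unfolding G(3) using A.genideal_minimal[OF L_ideal[OF T]] by blast
    have "S \<subseteq> operator_span M A H"
    proof
      fix s assume s: "s \<in> S"
      then obtain y a where ya: "s = y \<oplus>\<^bsub>M\<^esub> a \<odot>\<^bsub>M\<^esub> m" "y \<in> N" "a \<in> A" using S by (auto simp: N'_def)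
      hence "a \<in> L S" using s by (auto simp: L_def)
      then obtain z where z: "z \<in> N" "z \<oplus>\<^bsub>M\<^esub> a \<odot>\<^bsub>M\<^esub> m \<in> operator_span M A H" using LL by (auto simp: L_def)
      \<comment> \<open>\<open>s\<close> and \<open>?t\<close> have the same coefficient of m, so
        their difference lies in S \<inter> N.\<close>
      let ?t = "z \<oplus>\<^bsub>M\<^esub> a \<odot>\<^bsub>M\<^esub> m"
      have tS: "?t \<in> S" using operator_span_minimal[OF S(1) H(2)] z by blast
      have "s \<ominus>\<^bsub>M\<^esub> ?t = y \<ominus>\<^bsub>M\<^esub> z" using ya z m Nc Ac by (auto simp: diff_same_tail subset_eq)
      hence "s \<ominus>\<^bsub>M\<^esub> ?t \<in> S \<inter> N"
        using operator_subgroupD(6)[OF S(1) s tS] operator_subgroupD(6)[OF N(1) ya(2) z(1)] by simp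
      hence "s \<ominus>\<^bsub>M\<^esub> ?t \<in> operator_span M A H"
        using F(3) operator_span_mono[of F H A A M] by (auto simp: H_def)
      thus "s \<in> operator_span M A H"
        using operator_subgroup_cancel[OF T z(2)] operator_subgroupD(2)[OF S(1) s] by blast
    qed
    thus "\<exists>F. finite F \<and> F \<subseteq> S \<and> S \<subseteq> operator_span M A F" using H by blast
  qed
qed

lemma polynomials_below_subgroup:
  assumes A: "A \<subseteq> carrier R" and N: "operator_subgroup M A N" and x: "x \<in> carrier R"
  shows "operator_subgroup M A (polynomials_below R M x N k)"
proof (induction k)
  case 0
  show ?case by (rule operator_subgroupI) (use A in auto)
next
  case (Suc k)
  let ?P = "polynomials_below R M x N k" and ?x = "x [^] k"
  note Nc = operator_subgroupD(2)[OF N] and Pc = operator_subgroupD(2)[OF Suc]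
  have xk: "?x \<in> carrier R" using x by simp
  show ?case
  proof (rule operator_subgroupI)
    show "polynomials_below R M x N (Suc k) \<subseteq> carrier M" using Nc Pc xk by auto
    have "\<zero>\<^bsub>M\<^esub> = \<zero>\<^bsub>M\<^esub> \<oplus>\<^bsub>M\<^esub> ?x \<odot>\<^bsub>M\<^esub> \<zero>\<^bsub>M\<^esub>" using xk by simp
    thus "\<zero>\<^bsub>M\<^esub> \<in> polynomials_below R M x N (Suc k)"
      using operator_subgroupD(3)[OF N] operator_subgroupD(3)[OF Suc] by (simp, blast)
    fix s assume "s \<in> polynomials_below R M x N (Suc k)"
    then obtain y a where s: "s = y \<oplus>\<^bsub>M\<^esub> ?x \<odot>\<^bsub>M\<^esub> a" "y \<in> ?P" "a \<in> N" by auto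
    have "\<ominus>\<^bsub>M\<^esub> s = \<ominus>\<^bsub>M\<^esub> y \<oplus>\<^bsub>M\<^esub> ?x \<odot>\<^bsub>M\<^esub> (\<ominus>\<^bsub>M\<^esub> a)"
      using s xk Nc Pc by (simp add: M.minus_add smult_r_minus)
    thus "\<ominus>\<^bsub>M\<^esub> s \<in> polynomials_below R M x N (Suc k)"
      using operator_subgroupD(4)[OF N s(3)] operator_subgroupD(4)[OF Suc s(2)] by (simp, blast)
    fix t assume "t \<in> polynomials_below R M x N (Suc k)"
    then obtain z b where t: "t = z \<oplus>\<^bsub>M\<^esub> ?x \<odot>\<^bsub>M\<^esub> b" "z \<in> ?P" "b \<in> N" by auto
    have "s \<oplus>\<^bsub>M\<^esub> t = (y \<oplus>\<^bsub>M\<^esub> z) \<oplus>\<^bsub>M\<^esub> ?x \<odot>\<^bsub>M\<^esub> (a \<oplus>\<^bsub>M\<^esub> b)"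
      unfolding s t using s t xk Nc Pc by (subst interchange) (simp_all add: smult_r_distr)
    thus "s \<oplus>\<^bsub>M\<^esub> t \<in> polynomials_below R M x N (Suc k)"
      using operator_subgroupD(5)[OF N s(3) t(3)] operator_subgroupD(5)[OF Suc s(2) t(2)] by (simp, blast)
  next
    fix c s assume c: "c \<in> A" and "s \<in> polynomials_below R M x N (Suc k)"
    then obtain y a where s: "s = y \<oplus>\<^bsub>M\<^esub> ?x \<odot>\<^bsub>M\<^esub> a" "y \<in> ?P" "a \<in> N" by auto
    have "c \<odot>\<^bsub>M\<^esub> s = c \<odot>\<^bsub>M\<^esub> y \<oplus>\<^bsub>M\<^esub> ?x \<odot>\<^bsub>M\<^esub> (c \<odot>\<^bsub>M\<^esub> a)"
      using s c A xk Nc Pc by (simp add: smult_r_distr smult_commute subset_eq)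
    thus "c \<odot>\<^bsub>M\<^esub> s \<in> polynomials_below R M x N (Suc k)"
      using operator_subgroupD(7)[OF N c s(3)] operator_subgroupD(7)[OF Suc c s(2)] by (simp, blast)
  qed
qed

lemma polynomials_below_shift:
  assumes A: "A \<subseteq> carrier R" and N: "operator_subgroup M A N" and x: "x \<in> carrier R"
    and "y \<in> polynomials_below R M x N k"
  shows "x \<odot>\<^bsub>M\<^esub> y \<in> polynomials_below R M x N (Suc k)"
  using assms(4)
proof (induction k arbitrary: y)
  case 0
  hence "x \<odot>\<^bsub>M\<^esub> y = \<zero>\<^bsub>M\<^esub>" using x by simp
  thus ?case by (simp only: operator_subgroupD(3)[OF polynomials_below_subgroup[OF A N x]])
next
  case (Suc k)
  note Nc = operator_subgroupD(2)[OF N]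
    and Pc = operator_subgroupD(2)[OF polynomials_below_subgroup[OF A N x]]
  from Suc.prems obtain z a where y: "y = z \<oplus>\<^bsub>M\<^esub> (x [^] k) \<odot>\<^bsub>M\<^esub> a" "z \<in> polynomials_below R M x N k" "a \<in> N"
    by auto
  have "x \<odot>\<^bsub>M\<^esub> y = x \<odot>\<^bsub>M\<^esub> z \<oplus>\<^bsub>M\<^esub> (x [^] Suc k) \<odot>\<^bsub>M\<^esub> a"
    using y x Nc Pc[OF y(2)] by (simp add: smult_r_distr smult_assoc1[symmetric] R.m_comm)
  moreover note Suc.IH[OF y(2)]
  ultimately show ?case using y(3) by (subst polynomials_below.simps(2)) blast
qed

lemma polynomials_below_Suc:
  assumes A: "A \<subseteq> carrier R" and N: "operator_subgroup M A N" and x: "x \<in> carrier R"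
  shows "polynomials_below R M x N k \<subseteq> polynomials_below R M x N (Suc k)"
proof
  fix y assume y: "y \<in> polynomials_below R M x N k"
  hence "y = y \<oplus>\<^bsub>M\<^esub> (x [^] k) \<odot>\<^bsub>M\<^esub> \<zero>\<^bsub>M\<^esub>"
    using x operator_subgroupD(2)[OF polynomials_below_subgroup[OF A N x]] by simp
  thus "y \<in> polynomials_below R M x N (Suc k)"
    using y operator_subgroupD(3)[OF N] by (subst polynomials_below.simps(2)) blast
qed

text \<open>Hilbert's argument. \<open>L S k\<close> collects the leading coefficients of elements
  of S with k + 1 terms. These submodules of N grow with k because S is stable under x, so they are
  constant from some K on; lifts of their generators for k \<le> K generate S.\<close>

lemma noetherian_over_adjoin_operator:
  assumes A: "A \<subseteq> carrier R" and N: "operator_subgroup M A N" "noetherian_over M A N"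
    and x: "x \<in> carrier R"
  defines "N' \<equiv> (\<Union>k. polynomials_below R M x N k)"
  shows "operator_subgroup M (insert x A) N'" "noetherian_over M (insert x A) N'" "N \<subseteq> N'"
proof -
  let ?P = "polynomials_below R M x N" and ?A = "insert x A"
  have A': "?A \<subseteq> carrier R" using A x by auto
  note P = polynomials_below_subgroup[OF A N(1) x]
  note Nc = operator_subgroupD(2)[OF N(1)] and Pc = operator_subgroupD(2)[OF P]
  have mono: "k \<le> l \<Longrightarrow> ?P k \<subseteq> ?P l" for k l
    by (rule lift_Suc_mono_le) (rule polynomials_below_Suc[OF A N(1) x])
  show "operator_subgroup M ?A N'"
  proof (rule operator_subgroupI)
    show "N' \<subseteq> carrier M" "\<zero>\<^bsub>M\<^esub> \<in> N'"
      using Pc operator_subgroupD(3)[OF P] by (auto simp: N'_def)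
    show "\<ominus>\<^bsub>M\<^esub> y \<in> N'" if "y \<in> N'" for y
      using that operator_subgroupD(4)[OF P] by (auto simp: N'_def)
    fix y z assume "y \<in> N'" "z \<in> N'"
    then obtain k l where "y \<in> ?P k" "z \<in> ?P l" by (auto simp: N'_def)
    hence "y \<in> ?P (max k l)" "z \<in> ?P (max k l)" using mono[of k "max k l"] mono[of l "max k l"] by auto
    from operator_subgroupD(5)[OF P this] show "y \<oplus>\<^bsub>M\<^esub> z \<in> N'" by (auto simp: N'_def)
  next
    fix a y assume a: "a \<in> ?A" "y \<in> N'"
    then obtain k where k: "y \<in> ?P k" by (auto simp: N'_def)
    have "a \<odot>\<^bsub>M\<^esub> y \<in> ?P (Suc k) \<union> ?P k"
      using a polynomials_below_shift[OF A N(1) x k] operator_subgroupD(7)[OF P _ k] by blast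
    thus "a \<odot>\<^bsub>M\<^esub> y \<in> N'" unfolding N'_def by blast
  qed
  show "N \<subseteq> N'"
  proof
    fix y assume "y \<in> N"
    hence "y = \<zero>\<^bsub>M\<^esub> \<oplus>\<^bsub>M\<^esub> (x [^] (0 :: nat)) \<odot>\<^bsub>M\<^esub> y" "y \<in> N" using Nc by auto
    hence "y \<in> ?P (Suc 0)" by (auto simp del: nat_pow_0)
    thus "y \<in> N'" unfolding N'_def by blast
  qed
  define L where "L S k = {a \<in> N. \<exists>y \<in> ?P k. y \<oplus>\<^bsub>M\<^esub> (x [^] k) \<odot>\<^bsub>M\<^esub> a \<in> S}" for S and k :: nat
  have L: "operator_subgroup M A (L S k)" if S: "operator_subgroup M ?A S" for S k
  proof (rule operator_subgroupI)
    let ?x = "x [^] k"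
    have xk: "?x \<in> carrier R" using x by simp
    show "L S k \<subseteq> carrier M" using Nc by (auto simp: L_def)
    have "\<zero>\<^bsub>M\<^esub> \<oplus>\<^bsub>M\<^esub> ?x \<odot>\<^bsub>M\<^esub> \<zero>\<^bsub>M\<^esub> \<in> S" using xk operator_subgroupD(3)[OF S] by simp
    thus "\<zero>\<^bsub>M\<^esub> \<in> L S k" unfolding L_def using operator_subgroupD(3)[OF N(1)] operator_subgroupD(3)[OF P] by blast
    fix a assume "a \<in> L S k"
    then obtain y where y: "a \<in> N" "y \<in> ?P k" "y \<oplus>\<^bsub>M\<^esub> ?x \<odot>\<^bsub>M\<^esub> a \<in> S" by (auto simp: L_def)
    have "\<ominus>\<^bsub>M\<^esub> (y \<oplus>\<^bsub>M\<^esub> ?x \<odot>\<^bsub>M\<^esub> a) = \<ominus>\<^bsub>M\<^esub> y \<oplus>\<^bsub>M\<^esub> ?x \<odot>\<^bsub>M\<^esub> (\<ominus>\<^bsub>M\<^esub> a)"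
      using y xk Nc Pc by (simp add: M.minus_add smult_r_minus)
    thus "\<ominus>\<^bsub>M\<^esub> a \<in> L S k" unfolding L_def
      using operator_subgroupD(4)[OF N(1) y(1)] operator_subgroupD(4)[OF P y(2)] operator_subgroupD(4)[OF S y(3)]
      by auto
    fix b assume "b \<in> L S k"
    then obtain z where z: "b \<in> N" "z \<in> ?P k" "z \<oplus>\<^bsub>M\<^esub> ?x \<odot>\<^bsub>M\<^esub> b \<in> S" by (auto simp: L_def)
    have "(y \<oplus>\<^bsub>M\<^esub> ?x \<odot>\<^bsub>M\<^esub> a) \<oplus>\<^bsub>M\<^esub> (z \<oplus>\<^bsub>M\<^esub> ?x \<odot>\<^bsub>M\<^esub> b) = (y \<oplus>\<^bsub>M\<^esub> z) \<oplus>\<^bsub>M\<^esub> ?x \<odot>\<^bsub>M\<^esub> (a \<oplus>\<^bsub>M\<^esub> b)"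
      using y z xk Nc Pc by (subst interchange) (simp_all add: smult_r_distr)
    thus "a \<oplus>\<^bsub>M\<^esub> b \<in> L S k" unfolding L_def
      using operator_subgroupD(5)[OF N(1) y(1) z(1)] operator_subgroupD(5)[OF P y(2) z(2)]
        operator_subgroupD(5)[OF S y(3) z(3)] by auto
  next
    let ?x = "x [^] k"
    have xk: "?x \<in> carrier R" using x by simp
    fix c a assume c: "c \<in> A" and "a \<in> L S k"
    then obtain y where y: "a \<in> N" "y \<in> ?P k" "y \<oplus>\<^bsub>M\<^esub> ?x \<odot>\<^bsub>M\<^esub> a \<in> S" by (auto simp: L_def)
    have "c \<odot>\<^bsub>M\<^esub> (y \<oplus>\<^bsub>M\<^esub> ?x \<odot>\<^bsub>M\<^esub> a) = c \<odot>\<^bsub>M\<^esub> y \<oplus>\<^bsub>M\<^esub> ?x \<odot>\<^bsub>M\<^esub> (c \<odot>\<^bsub>M\<^esub> a)"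
      using y c A xk Nc Pc by (simp add: smult_r_distr smult_commute subset_eq)
    thus "c \<odot>\<^bsub>M\<^esub> a \<in> L S k" unfolding L_def
      using operator_subgroupD(7)[OF N(1) c y(1)] operator_subgroupD(7)[OF P c y(2)]
        operator_subgroupD(7)[OF S _ y(3), of c] c by auto
  qed
  have L_Suc: "L S k \<subseteq> L S (Suc k)" if S: "operator_subgroup M ?A S" for S k
  proof
    fix a assume "a \<in> L S k"
    then obtain y where y: "a \<in> N" "y \<in> ?P k" "y \<oplus>\<^bsub>M\<^esub> (x [^] k) \<odot>\<^bsub>M\<^esub> a \<in> S" by (auto simp: L_def)
    have "x \<odot>\<^bsub>M\<^esub> (y \<oplus>\<^bsub>M\<^esub> (x [^] k) \<odot>\<^bsub>M\<^esub> a) = x \<odot>\<^bsub>M\<^esub> y \<oplus>\<^bsub>M\<^esub> (x [^] Suc k) \<odot>\<^bsub>M\<^esub> a"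
      using y x Nc Pc by (simp add: smult_r_distr smult_assoc1[symmetric] R.m_comm)
    moreover have "x \<odot>\<^bsub>M\<^esub> y \<in> ?P (Suc k)" using polynomials_below_shift[OF A N(1) x y(2)] .
    moreover have "x \<odot>\<^bsub>M\<^esub> (y \<oplus>\<^bsub>M\<^esub> (x [^] k) \<odot>\<^bsub>M\<^esub> a) \<in> S" by (rule operator_subgroupD(7)[OF S _ y(3)]) simp
    ultimately show "a \<in> L S (Suc k)"
      unfolding L_def using y(1) by (simp del: polynomials_below.simps nat_pow_Suc) metis
  qed
  have L_mono: "k \<le> l \<Longrightarrow> L S k \<subseteq> L S l" if "operator_subgroup M ?A S" for S k l
    by (rule lift_Suc_mono_le) (rule L_Suc[OF that])
  show "noetherian_over M ?A N'"
    unfolding noetherian_over_def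
  proof (intro allI impI, elim conjE)
    fix S assume S: "operator_subgroup M ?A S" "S \<subseteq> N'"
    have fg: "\<exists>F. finite F \<and> F \<subseteq> T \<and> T \<subseteq> operator_span M A F" if "operator_subgroup M A T" "T \<subseteq> N" for T
      using N(2) that unfolding noetherian_over_def by blast
    have U: "operator_subgroup M A (\<Union>k. L S k)"
    proof (rule operator_subgroupI)
      show "(\<Union>k. L S k) \<subseteq> carrier M" "\<zero>\<^bsub>M\<^esub> \<in> (\<Union>k. L S k)"
        using operator_subgroupD(2,3)[OF L[OF S(1)]] by auto
      show "\<ominus>\<^bsub>M\<^esub> y \<in> (\<Union>k. L S k)" if "y \<in> (\<Union>k. L S k)" for y
        using that operator_subgroupD(4)[OF L[OF S(1)]] by auto
      show "c \<odot>\<^bsub>M\<^esub> y \<in> (\<Union>k. L S k)" if "c \<in> A" "y \<in> (\<Union>k. L S k)" for c y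
        using that operator_subgroupD(7)[OF L[OF S(1)]] by auto
      fix y z assume "y \<in> (\<Union>k. L S k)" "z \<in> (\<Union>k. L S k)"
      then obtain k l where "y \<in> L S k" "z \<in> L S l" by auto
      hence "y \<in> L S (max k l)" "z \<in> L S (max k l)"
        using L_mono[OF S(1), of k "max k l"] L_mono[OF S(1), of l "max k l"] by auto
      from operator_subgroupD(5)[OF L[OF S(1)] this] show "y \<oplus>\<^bsub>M\<^esub> z \<in> (\<Union>k. L S k)" by blast
    qed
    have "(\<Union>k. L S k) \<subseteq> N" by (auto simp: L_def)
    from fg[OF U this] obtain F where F: "finite F" "F \<subseteq> (\<Union>k. L S k)" "(\<Union>k. L S k) \<subseteq> operator_span M A F"
      by blast
    have "\<exists>K. F \<subseteq> L S K"
      using F(1,2)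
    proof (induction F)
      case empty thus ?case by simp
    next
      case (insert a F)
      then obtain K k where "F \<subseteq> L S K" "a \<in> L S k" by auto
      hence "insert a F \<subseteq> L S (max K k)"
        using L_mono[OF S(1), of k "max K k"] L_mono[OF S(1), of K "max K k"] by auto
      thus ?case by blast
    qed
    then obtain K where "F \<subseteq> L S K" by blast
    hence LK: "L S k \<subseteq> L S K" for k
      using operator_span_minimal[OF L[OF S(1)]] F(3) by blast
    \<comment> \<open>\<open>G\<close> keeps only the lifts in S; the coefficients they lift stay
      under the quantifier, so that a single function has to be chosen.\<close>
    have "\<forall>k. \<exists>G. finite G \<and> G \<subseteq> S \<and> (\<exists>F. F \<subseteq> {a \<in> N. \<exists>y \<in> ?P k. y \<oplus>\<^bsub>M\<^esub> (x [^] k) \<odot>\<^bsub>M\<^esub> a \<in> G} \<and> L S k \<subseteq> operator_span M A F)"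
    proof
      fix k
      obtain F where F: "finite F" "F \<subseteq> L S k" "L S k \<subseteq> operator_span M A F"
        using fg[OF L[OF S(1), of k]] by (auto simp: L_def)
      then obtain g where g: "\<And>a. a \<in> F \<Longrightarrow> a \<in> N \<and> g a \<in> ?P k \<and> g a \<oplus>\<^bsub>M\<^esub> (x [^] k) \<odot>\<^bsub>M\<^esub> a \<in> S"
        unfolding L_def by (simp add: subset_eq Bex_def) metis
      have "finite ((\<lambda>a. g a \<oplus>\<^bsub>M\<^esub> (x [^] k) \<odot>\<^bsub>M\<^esub> a) ` F)" "(\<lambda>a. g a \<oplus>\<^bsub>M\<^esub> (x [^] k) \<odot>\<^bsub>M\<^esub> a) ` F \<subseteq> S"
        "F \<subseteq> {a \<in> N. \<exists>y \<in> ?P k. y \<oplus>\<^bsub>M\<^esub> (x [^] k) \<odot>\<^bsub>M\<^esub> a \<in> (\<lambda>a. g a \<oplus>\<^bsub>M\<^esub> (x [^] k) \<odot>\<^bsub>M\<^esub> a) ` F}"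
        using F(1) g by auto
      thus "\<exists>G. finite G \<and> G \<subseteq> S \<and> (\<exists>F. F \<subseteq> {a \<in> N. \<exists>y \<in> ?P k. y \<oplus>\<^bsub>M\<^esub> (x [^] k) \<odot>\<^bsub>M\<^esub> a \<in> G} \<and> L S k \<subseteq> operator_span M A F)"
        using F(3) by blast
    qed
    from choice[OF this] obtain G where "\<forall>k. finite (G k) \<and> G k \<subseteq> S \<and>
      (\<exists>F. F \<subseteq> {a \<in> N. \<exists>y \<in> ?P k. y \<oplus>\<^bsub>M\<^esub> (x [^] k) \<odot>\<^bsub>M\<^esub> a \<in> G k} \<and> L S k \<subseteq> operator_span M A F)"
      by (elim exE)
    hence G: "\<And>k. finite (G k)" "\<And>k. G k \<subseteq> S"
      "\<And>k. \<exists>F. F \<subseteq> {a \<in> N. \<exists>y \<in> ?P k. y \<oplus>\<^bsub>M\<^esub> (x [^] k) \<odot>\<^bsub>M\<^esub> a \<in> G k} \<and> L S k \<subseteq> operator_span M A F"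
      by simp_all
    define H where "H = (\<Union>k \<in> {..K}. G k)"
    have H: "finite H" "H \<subseteq> S" using G(1,2) by (auto simp: H_def)
    let ?T = "operator_span M ?A H"
    have T: "operator_subgroup M ?A ?T"
      using H operator_subgroupD(1)[OF S(1)] A' by (intro operator_span_subgroup) auto
    have TS: "?T \<subseteq> S" using operator_span_minimal[OF S(1) H(2)] .
    have low: "L S k \<subseteq> L ?T k" if "k \<le> K" for k
    proof -
      obtain F where F: "F \<subseteq> {a \<in> N. \<exists>y \<in> ?P k. y \<oplus>\<^bsub>M\<^esub> (x [^] k) \<odot>\<^bsub>M\<^esub> a \<in> G k}" "L S k \<subseteq> operator_span M A F"
        using G(3) by blast
      have "G k \<subseteq> ?T" using that by (auto simp: H_def intro: operator_span.incl)
      hence "F \<subseteq> L ?T k" using F(1) unfolding L_def by blast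
      thus ?thesis using operator_span_minimal[OF L[OF T]] F(2) by blast
    qed
    \<comment> \<open>Beyond K, \<open>L S k\<close> lies in \<open>L S K\<close>, and
      multiplication by x moves the leading coefficients found in \<open>?T\<close> upwards.\<close>
    have lead: "L S k \<subseteq> L ?T k" for k
    proof (cases "k \<le> K")
      case False
      thus ?thesis using LK[of k] low[of K] L_mono[OF T, of K k] by fastforce
    qed (rule low)
    \<comment> \<open>Induction on the number of terms: cancelling the leading term with an element
      of \<open>?T\<close> leaves an element of S with fewer terms.\<close>
    have "S \<inter> ?P k \<subseteq> ?T" for k
    proof (induction k)
      case 0 thus ?case by (auto intro: operator_span.zero)
    next
      case (Suc k)
      show ?case
      proof
        fix s assume s: "s \<in> S \<inter> ?P (Suc k)"
        then obtain y a where y: "s = y \<oplus>\<^bsub>M\<^esub> (x [^] k) \<odot>\<^bsub>M\<^esub> a" "y \<in> ?P k" "a \<in> N" by auto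
        hence "a \<in> L S k" using s by (auto simp: L_def)
        then obtain z where z: "z \<in> ?P k" "z \<oplus>\<^bsub>M\<^esub> (x [^] k) \<odot>\<^bsub>M\<^esub> a \<in> ?T" using lead by (auto simp: L_def)
        let ?t = "z \<oplus>\<^bsub>M\<^esub> (x [^] k) \<odot>\<^bsub>M\<^esub> a"
        have "s \<ominus>\<^bsub>M\<^esub> ?t = y \<ominus>\<^bsub>M\<^esub> z" using y z x Nc Pc by (simp add: diff_same_tail)
        moreover have "s \<ominus>\<^bsub>M\<^esub> ?t \<in> S" using s z TS by (intro operator_subgroupD(6)[OF S(1)]) auto
        ultimately have "s \<ominus>\<^bsub>M\<^esub> ?t \<in> ?T"
          using operator_subgroupD(6)[OF P y(2) z(1)] Suc by auto
        thus "s \<in> ?T"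
          using operator_subgroup_cancel[OF T z(2)] operator_subgroupD(2)[OF S(1)] s by blast
      qed
    qed
    hence "S \<subseteq> ?T" using S(2) unfolding N'_def by blast
    thus "\<exists>F. finite F \<and> F \<subseteq> S \<and> S \<subseteq> operator_span M ?A F" using H by blast
  qed
qed

end

section \<open>Finitely generated modules over the graded ring are Noetherian\<close>

lemma (in module) operator_subgroup_generate_ring:
  assumes N: "operator_subgroup M A N" and A: "A \<subseteq> carrier R" and "generate_ring R A = carrier R"
  shows "operator_subgroup M (carrier R) N"
proof (rule operator_subgroupI)
  note Nc = operator_subgroupD[OF N]
  show "a \<odot>\<^bsub>M\<^esub> x \<in> N" if "a \<in> carrier R" "x \<in> N" for a x
  proof -
    have "a \<in> generate_ring R A" using that assms(3) by simp
    hence "\<forall>x \<in> N. a \<odot>\<^bsub>M\<^esub> x \<in> N"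
    proof induction
      case (a_inv h)
      thus ?case using Nc(2,4) R.generate_ring_in_carrier[OF A] by (simp add: smult_l_minus)
    next
      case (eng_add h1 h2)
      thus ?case using Nc(2,5) R.generate_ring_in_carrier[OF A] by (simp add: smult_l_distr)
    next
      case (eng_mult h1 h2)
      thus ?case using Nc(2) R.generate_ring_in_carrier[OF A] by (simp add: smult_assoc1)
    qed (use Nc in auto)
    thus ?thesis using that by blast
  qed
qed (use operator_subgroupD[OF N] in auto)

lemma (in module) submodule_iff_operator_subgroup:
  "submodule N R M \<longleftrightarrow> operator_subgroup M (carrier R) N"
proof
  assume N: "submodule N R M"
  have "\<zero>\<^bsub>M\<^esub> \<in> N" using submodule.axioms(1)[OF N] subgroup.one_closed by fastforce
  thus "operator_subgroup M (carrier R) N"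
    using submoduleE[OF N] by (intro operator_subgroupI) auto
next
  assume N: "operator_subgroup M (carrier R) N"
  show "submodule N R M" by (rule submoduleI) (use operator_subgroupD[OF N] in auto)
qed

lemma (in module) submodule_span_eq:
  assumes "F \<subseteq> carrier M"
  shows "submodule_span R M F = operator_span M (carrier R) F"
  unfolding submodule_span_def submodule_iff_operator_subgroup
  using operator_span_minimal operator_span_subgroup[OF assms subset_refl]
  by (auto intro: operator_span.incl)

lemma noetherian_over_mono:
  assumes N: "noetherian_over M A N" and A: "A \<subseteq> A'"
  shows "noetherian_over M A' N"
  unfolding noetherian_over_def
proof (intro allI impI, elim conjE)
  fix S assume "operator_subgroup M A' S" "S \<subseteq> N"
  moreover from this have "operator_subgroup M A S" using A unfolding operator_subgroup_def by blast
  ultimately show "\<exists>F. finite F \<and> F \<subseteq> S \<and> S \<subseteq> operator_span M A' F"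
    using N operator_span_mono[OF subset_refl A] unfolding noetherian_over_def by (meson subset_trans)
qed

context standard_graded_ring
begin

lemma graded_group_gr: "graded_group R gr"
  by (intro graded_group.intro graded_group_axioms.intro gr_decomposition is_abelian_group)

sublocale gr: graded_group R gr by (rule graded_group_gr)

lemma gr_0_subring: "subring (gr 0) R"
  using gr_one gr_mult[of _ 0 _ 0] by (intro subringI) (auto simp: gr.piece_carrier gr.piece_neg gr.piece_add)

text \<open>The generators of M are adjoined as vectors over R_0, then the degree-one generators of
  R as operators. The result is stable under R, since R is generated by these operators, and
  contains the generators of M; so it is M.\<close>

lemma finitely_generated_imp_noetherian:
  assumes "module R M" and "finitely_generated_module R M"
  shows "noetherian_over M (carrier R) (carrier M)"
proof -
  interpret module R M by fact
  obtain X where X: "finite X" "X \<subseteq> carrier M" "submodule_span R M X = carrier M"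
    using assms(2) unfolding finitely_generated_module_def by blast
  obtain S where S: "finite S" "S \<subseteq> gr 1" "generate_ring R (gr 0 \<union> S) = carrier R"
    using gr_generated by blast
  have gr0: "gr 0 \<subseteq> carrier R" using gr.piece_carrier by blast
  have "\<exists>N. operator_subgroup M (gr 0) N \<and> noetherian_over M (gr 0) N \<and> X \<subseteq> N"
    using X(1,2)
  proof (induction X)
    case empty
    have "operator_subgroup M (gr 0) {\<zero>\<^bsub>M\<^esub>}"
      by (rule operator_subgroupI) (use gr0 in auto)
    moreover have "noetherian_over M (gr 0) {\<zero>\<^bsub>M\<^esub>}"
      unfolding noetherian_over_def by (auto intro!: exI[of _ "{}"] operator_span.zero)
    ultimately show ?case by blast
  next
    case (insert m X)
    then obtain N where N: "operator_subgroup M (gr 0) N" "noetherian_over M (gr 0) N" "X \<subseteq> N" by blast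
    have "m \<in> carrier M" using insert by simp
    from noetherian_over_adjoin_vector[OF gr_0_subring gr_0_noetherian N(1,2) this] N(3)
    show ?case by blast
  qed
  then obtain N0 where N0: "operator_subgroup M (gr 0) N0" "noetherian_over M (gr 0) N0" "X \<subseteq> N0" by blast
  have Sc: "S \<subseteq> carrier R" using S(2) gr.piece_carrier by blast
  have "\<exists>N. operator_subgroup M (gr 0 \<union> S) N \<and> noetherian_over M (gr 0 \<union> S) N \<and> X \<subseteq> N"
    using S(1) Sc
  proof (induction S)
    case empty thus ?case using N0 by auto
  next
    case (insert x S)
    then obtain N where N: "operator_subgroup M (gr 0 \<union> S) N" "noetherian_over M (gr 0 \<union> S) N" "X \<subseteq> N"
      by auto
    have "gr 0 \<union> S \<subseteq> carrier R" "x \<in> carrier R" using gr0 insert by auto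
    from noetherian_over_adjoin_operator[OF this(1) N(1,2) this(2)] N(3)
    show ?case by auto
  qed
  then obtain N where N: "operator_subgroup M (gr 0 \<union> S) N" "noetherian_over M (gr 0 \<union> S) N" "X \<subseteq> N"
    by blast
  have A: "gr 0 \<union> S \<subseteq> carrier R" using gr0 Sc by blast
  have N': "operator_subgroup M (carrier R) N" using operator_subgroup_generate_ring[OF N(1) A S(3)] .
  have "carrier M \<subseteq> N"
    using operator_span_minimal[OF N' N(3)] X submodule_span_eq[OF X(2)] by simp
  hence "N = carrier M" using operator_subgroupD(1)[OF N'] by blast
  thus ?thesis using noetherian_over_mono[OF N(2) A] by simp
qed

end

text \<open>R as a module over itself. Writing the record out keeps the extension field of
  \<open>R\<close> out of its type.\<close>

abbreviation regular_module :: "('r, 'x) ring_scheme \<Rightarrow> ('r, 'r) module" where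
  "regular_module R \<equiv> \<lparr>carrier = carrier R, monoid.mult = monoid.mult R, one = \<one>\<^bsub>R\<^esub>, ring.zero = \<zero>\<^bsub>R\<^esub>,
     add = add R, smult = monoid.mult R\<rparr>"

lemma (in cring) module_regular: "module R (regular_module R)"
proof (rule moduleI)
  show "abelian_group (regular_module R)"
    by (rule abelian_groupI) (auto simp: a_ac intro: bexI[of _ "\<ominus> x" for x] l_neg)
qed (auto simp: is_cring l_distr r_distr m_assoc)

lemma (in cring) regular_module_minus:
  assumes "x \<in> carrier R" shows "\<ominus>\<^bsub>regular_module R\<^esub> x = \<ominus> x"
proof -
  interpret M: module R "regular_module R" by (rule module_regular)
  show ?thesis using M.minus_equality[of "\<ominus> x" x] assms by (simp add: l_neg)
qed

lemma (in cring) submodule_regular_iff: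
  "submodule I R (regular_module R) \<longleftrightarrow> ideal I R"
proof -
  interpret M: module R "regular_module R" by (rule module_regular)
  show ?thesis
  proof
    assume I: "submodule I R (regular_module R)"
    note D = M.operator_subgroupD[OF I[unfolded M.submodule_iff_operator_subgroup]]
    have "additive_subgroup I R"
      by (intro additive_subgroup.intro add.subgroupI)
        (use D regular_module_minus in \<open>auto simp: a_inv_def[symmetric] subset_eq\<close>)
    moreover have l: "x \<otimes> a \<in> I" if "a \<in> I" "x \<in> carrier R" for a x using D(7)[OF that(2,1)] by simp
    moreover have "a \<otimes> x \<in> I" if "a \<in> I" "x \<in> carrier R" for a x
      using l[OF that] D(2)[OF that(1)] that by (simp add: m_comm)
    ultimately show "ideal I R"
      by (intro idealI additive_subgroup.a_subgroup) (auto simp: ring_axioms)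
  next
    assume "ideal I R"
    then interpret I: ideal I R .
    show "submodule I R (regular_module R)"
      by (rule M.submoduleI) (use I.a_subset in \<open>auto simp: regular_module_minus I.a_inv_closed I.I_l_closed subset_eq\<close>)
  qed
qed

lemma (in standard_graded_ring) noetherian: "noetherian_ring R"
proof (rule noetherian_ringI)
  interpret M: module R "regular_module R" by (rule module_regular)
  have "finitely_generated_module R (regular_module R)"
    unfolding finitely_generated_module_def
  proof (intro exI[of _ "{\<one>}"] conjI)
    have "x \<in> submodule_span R (regular_module R) {\<one>}" if "x \<in> carrier R" for x
      using M.submodule_span_eq[of "{\<one>}"] that operator_span.smult[of x "carrier R" \<one> "regular_module R" "{\<one>}"]
      by (simp add: operator_span.incl)
    moreover have "submodule_span R (regular_module R) {\<one>} \<subseteq> carrier R"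
      unfolding submodule_span_def using M.carrier_is_submodule by auto
    ultimately show "submodule_span R (regular_module R) {\<one>} = carrier (regular_module R)" by auto
  qed auto
  note N = finitely_generated_imp_noetherian[OF module_regular this]
  fix I assume I: "ideal I R"
  hence I': "operator_subgroup (regular_module R) (carrier R) I"
    by (simp add: submodule_regular_iff M.submodule_iff_operator_subgroup[symmetric])
  have "I \<subseteq> carrier (regular_module R)" using M.operator_subgroupD(1)[OF I'] .
  then obtain F where F: "finite F" "F \<subseteq> I" "I \<subseteq> operator_span (regular_module R) (carrier R) F"
    using N[unfolded noetherian_over_def, rule_format, OF conjI[OF I' \<open>I \<subseteq> carrier (regular_module R)\<close>]] by blast
  have Fc: "F \<subseteq> carrier R" using F M.operator_subgroupD(1)[OF I'] by auto
  have "operator_subgroup (regular_module R) (carrier R) (Idl F)"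
    using genideal_ideal[OF Fc] by (simp add: submodule_regular_iff M.submodule_iff_operator_subgroup[symmetric])
  from M.operator_span_minimal[OF this genideal_self[OF Fc]] F(3) have "I \<subseteq> Idl F" by blast
  moreover have "Idl F \<subseteq> I" using genideal_minimal[OF I F(2)] .
  ultimately show "\<exists>A \<subseteq> carrier R. finite A \<and> I = Idl A" using F(1) Fc by blast
qed

section \<open>Zero divisors and the grade\<close>

lemma (in noetherian_ring) maximal_ideal_in_family:
  assumes "C \<noteq> {}" and C: "\<And>I. I \<in> C \<Longrightarrow> ideal I R"
  shows "\<exists>I \<in> C. \<forall>J \<in> C. I \<subseteq> J \<longrightarrow> J = I"
proof (rule subset_Zorn_nonempty[OF assms(1)])
  fix D assume D: "D \<noteq> {}" "subset.chain C D"
  hence "subset.chain {I. ideal I R} D" using C unfolding subset_chain_def by blast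
  from ideal_chain_is_trivial[OF D(1) this] show "\<Union>D \<in> C"
    using D(2) unfolding subset_chain_def by blast
qed

text \<open>Induction over proper subsets. If one prime contains another, the smaller one is
  dropped. Otherwise there are P in the family and x in I avoiding all the other primes, and some y
  in I lies in all of these but not in P; then x or x + y avoids everything.\<close>

lemma (in cring) prime_avoidance:
  assumes "finite \<P>" "\<And>P. P \<in> \<P> \<Longrightarrow> primeideal P R" and I: "ideal I R"
    and "\<And>P. P \<in> \<P> \<Longrightarrow> \<not> I \<subseteq> P"
  shows "\<exists>x \<in> I. \<forall>P \<in> \<P>. x \<notin> P"
  using assms(1,2,4)
proof (induction \<P> rule: finite_psubset_induct)
  case (psubset \<P>)
  interpret I: ideal I R by (rule I)
  consider "\<P> = {}" | P Q where "P \<in> \<P>" "Q \<in> \<P>" "P \<noteq> Q" "Q \<subseteq> P"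
    | P where "P \<in> \<P>" "\<And>Q. Q \<in> \<P> - {P} \<Longrightarrow> \<not> Q \<subseteq> P" by blast
  thus ?case
  proof cases
    case 1 thus ?thesis using I.zero_closed by blast
  next
    case 2
    have "\<P> - {Q} \<subset> \<P>" using 2 by blast
    then obtain x where "x \<in> I" "\<forall>P \<in> \<P> - {Q}. x \<notin> P"
      using psubset.IH[OF \<open>\<P> - {Q} \<subset> \<P>\<close>] psubset.prems by blast
    thus ?thesis using 2 by blast
  next
    case 3
    have "\<P> - {P} \<subset> \<P>" using 3 by blast
    then obtain x where x: "x \<in> I" "\<forall>Q \<in> \<P> - {P}. x \<notin> Q"
      using psubset.IH[OF \<open>\<P> - {P} \<subset> \<P>\<close>] psubset.prems by blast
    interpret P: primeideal P R using psubset.prems 3 by blast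
    have fin: "finite (\<P> - {P})" using psubset.hyps by blast
    \<comment> \<open>Each further prime Q contributes a factor from Q outside P, and primeness
      keeps the product outside P.\<close>
    have "\<exists>y \<in> I. y \<notin> P \<and> (\<forall>Q \<in> \<Q>. y \<in> Q)" if "\<Q> \<subseteq> \<P> - {P}" for \<Q>
      using finite_subset[OF that fin] that
    proof (induction \<Q>)
      case empty
      thus ?case using psubset.prems(2) 3(1) by blast
    next
      case (insert Q \<Q>)
      then obtain y where y: "y \<in> I" "y \<notin> P" "\<forall>Q \<in> \<Q>. y \<in> Q" by blast
      obtain q where q: "q \<in> Q" "q \<notin> P" using 3(2) insert by blast
      have id: "ideal Q' R" if "Q' \<in> insert Q \<Q>" for Q'
        using that insert psubset.prems(1) by (auto simp: primeideal.axioms(1))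
      have c: "y \<in> carrier R" "q \<in> carrier R"
        using I.a_Hcarr[OF y(1)] ideal.Icarr[OF id q(1)] by auto
      have "y \<otimes> q \<in> I" using I.I_r_closed y c by blast
      moreover have "y \<otimes> q \<notin> P" using P.I_prime[OF c] y q by blast
      moreover have "y \<otimes> q \<in> Q'" if "Q' \<in> insert Q \<Q>" for Q'
        using ideal.I_l_closed[OF id[OF that], of q y] ideal.I_r_closed[OF id[OF that], of y q] that y q c by auto
      ultimately show ?case by blast
    qed
    then obtain y where y: "y \<in> I" "y \<notin> P" "\<forall>Q \<in> \<P> - {P}. y \<in> Q" by blast
    show ?thesis
    proof (cases "x \<in> P")
      case False thus ?thesis using x by blast
    next
      case True
      have c: "x \<in> carrier R" "y \<in> carrier R" using x y I.a_Hcarr by auto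
      have cancel: "a \<in> Q" if "ideal Q R" "a \<oplus> b \<in> Q" "b \<in> Q" "a \<in> carrier R" for Q a b
      proof -
        interpret Q: ideal Q R by fact
        have "(a \<oplus> b) \<oplus> \<ominus> b \<in> Q" using that Q.a_inv_closed by (simp add: Q.a_closed)
        moreover have "(a \<oplus> b) \<oplus> \<ominus> b = a" using that Q.a_Hcarr by (simp add: a_assoc r_neg)
        ultimately show ?thesis by simp
      qed
      have "x \<oplus> y \<notin> Q" if "Q \<in> \<P>" for Q
      proof -
        have Q: "ideal Q R" using psubset.prems(1)[OF that] by (rule primeideal.axioms(1))
        show ?thesis
        proof (cases "Q = P")
          case True
          thus ?thesis using cancel[OF Q, of y x] \<open>x \<in> P\<close> y c by (auto simp: a_comm)
        next
          case False
          thus ?thesis using cancel[OF Q, of x y] x y c that by auto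
        qed
      qed
      thus ?thesis using x y I.a_closed by blast
    qed
  qed
qed

section \<open>Regular sequences on a subquotient\<close>

definition nonzerodivisor_mod :: "('r, 'm, 'y) module_scheme \<Rightarrow> 'm set \<Rightarrow> 'm set \<Rightarrow> 'r \<Rightarrow> bool" where
  "nonzerodivisor_mod M X N x \<longleftrightarrow> (\<forall>m \<in> X. x \<odot>\<^bsub>M\<^esub> m \<in> N \<longrightarrow> m \<in> N)"

definition add_multiples :: "('r, 'm, 'y) module_scheme \<Rightarrow> 'm set \<Rightarrow> 'm set \<Rightarrow> 'r \<Rightarrow> 'm set" where
  "add_multiples M X N x = {n \<oplus>\<^bsub>M\<^esub> x \<odot>\<^bsub>M\<^esub> m | n m. n \<in> N \<and> m \<in> X}"

text \<open>Below, \<open>N\<close> and \<open>X\<close> stand for the quotient \<open>X/N\<close>, so that no quotient modules have to be formed.\<close>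

primrec weakly_regular :: "('r, 'm, 'y) module_scheme \<Rightarrow> 'm set \<Rightarrow> 'm set \<Rightarrow> 'r list \<Rightarrow> bool" where
  "weakly_regular M X N [] \<longleftrightarrow> True"
| "weakly_regular M X N (x # xs) \<longleftrightarrow>
     nonzerodivisor_mod M X N x \<and> weakly_regular M X (add_multiples M X N x) xs"

primrec extend_by :: "('r, 'm, 'y) module_scheme \<Rightarrow> 'm set \<Rightarrow> 'm set \<Rightarrow> 'r list \<Rightarrow> 'm set" where
  "extend_by M X N [] = N"
| "extend_by M X N (x # xs) = extend_by M X (add_multiples M X N x) xs"

lemma extend_append: "extend_by M X N (xs @ ys) = extend_by M X (extend_by M X N xs) ys"
  by (induction xs arbitrary: N) auto

lemma weakly_regular_append:
  "weakly_regular M X N (xs @ ys) \<longleftrightarrow> weakly_regular M X N xs \<and> weakly_regular M X (extend_by M X N xs) ys"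
  by (induction xs arbitrary: N) auto

lemma weakly_regular_nth:
  "weakly_regular M X N xs \<longleftrightarrow> (\<forall>k < length xs. nonzerodivisor_mod M X (extend_by M X N (take k xs)) (xs ! k))"
proof (induction xs arbitrary: N)
  case (Cons x xs)
  show ?case by (simp add: All_less_Suc2 Cons.IH)
qed simp

context module
begin

abbreviation "is_submodule \<equiv> operator_subgroup M (carrier R)"

lemma zero_submodule: "is_submodule {\<zero>\<^bsub>M\<^esub>}"
  by (rule operator_subgroupI) auto

lemma carrier_submodule: "is_submodule (carrier M)"
  by (rule operator_subgroupI) auto

lemma add_multiples_submodule:
  assumes N: "is_submodule N" and X: "is_submodule X" and x: "x \<in> carrier R"
  shows "is_submodule (add_multiples M X N x)"
proof -
  note Nc = operator_subgroupD(2)[OF N] and Xc = operator_subgroupD(2)[OF X]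
  show ?thesis
  proof (rule operator_subgroupI)
    show "add_multiples M X N x \<subseteq> carrier M" using Nc Xc x by (auto simp: add_multiples_def)
    have "\<zero>\<^bsub>M\<^esub> = \<zero>\<^bsub>M\<^esub> \<oplus>\<^bsub>M\<^esub> x \<odot>\<^bsub>M\<^esub> \<zero>\<^bsub>M\<^esub>" using x by simp
    thus "\<zero>\<^bsub>M\<^esub> \<in> add_multiples M X N x"
      using operator_subgroupD(3)[OF N] operator_subgroupD(3)[OF X] unfolding add_multiples_def by blast
    fix s assume "s \<in> add_multiples M X N x"
    then obtain y a where s: "s = y \<oplus>\<^bsub>M\<^esub> x \<odot>\<^bsub>M\<^esub> a" "y \<in> N" "a \<in> X" by (auto simp: add_multiples_def)
    have "\<ominus>\<^bsub>M\<^esub> s = \<ominus>\<^bsub>M\<^esub> y \<oplus>\<^bsub>M\<^esub> x \<odot>\<^bsub>M\<^esub> (\<ominus>\<^bsub>M\<^esub> a)"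
      using s x Nc Xc by (simp add: M.minus_add smult_r_minus)
    thus "\<ominus>\<^bsub>M\<^esub> s \<in> add_multiples M X N x"
      using operator_subgroupD(4)[OF N s(2)] operator_subgroupD(4)[OF X s(3)] unfolding add_multiples_def by blast
    fix t assume "t \<in> add_multiples M X N x"
    then obtain z b where t: "t = z \<oplus>\<^bsub>M\<^esub> x \<odot>\<^bsub>M\<^esub> b" "z \<in> N" "b \<in> X" by (auto simp: add_multiples_def)
    have "s \<oplus>\<^bsub>M\<^esub> t = (y \<oplus>\<^bsub>M\<^esub> z) \<oplus>\<^bsub>M\<^esub> x \<odot>\<^bsub>M\<^esub> (a \<oplus>\<^bsub>M\<^esub> b)"
      unfolding s t using s t x Nc Xc by (subst interchange) (simp_all add: smult_r_distr)
    thus "s \<oplus>\<^bsub>M\<^esub> t \<in> add_multiples M X N x"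
      using operator_subgroupD(5)[OF N s(2) t(2)] operator_subgroupD(5)[OF X s(3) t(3)]
      unfolding add_multiples_def by blast
  next
    fix c s assume c: "c \<in> carrier R" and "s \<in> add_multiples M X N x"
    then obtain y a where s: "s = y \<oplus>\<^bsub>M\<^esub> x \<odot>\<^bsub>M\<^esub> a" "y \<in> N" "a \<in> X" by (auto simp: add_multiples_def)
    have "c \<odot>\<^bsub>M\<^esub> s = c \<odot>\<^bsub>M\<^esub> y \<oplus>\<^bsub>M\<^esub> x \<odot>\<^bsub>M\<^esub> (c \<odot>\<^bsub>M\<^esub> a)"
      using s c x Nc Xc by (simp add: smult_r_distr smult_commute)
    thus "c \<odot>\<^bsub>M\<^esub> s \<in> add_multiples M X N x"
      using operator_subgroupD(7)[OF N c s(2)] operator_subgroupD(7)[OF X c s(3)] unfolding add_multiples_def by blast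
  qed
qed

lemma add_multiplesI: "n \<in> N \<Longrightarrow> m \<in> X \<Longrightarrow> n \<oplus>\<^bsub>M\<^esub> x \<odot>\<^bsub>M\<^esub> m \<in> add_multiples M X N x"
  unfolding add_multiples_def by blast

lemma add_multiples_incl:
  assumes N: "is_submodule N" and X: "is_submodule X" and x: "x \<in> carrier R"
  shows "N \<subseteq> add_multiples M X N x" "m \<in> X \<Longrightarrow> x \<odot>\<^bsub>M\<^esub> m \<in> add_multiples M X N x"
proof
  fix n assume "n \<in> N"
  thus "n \<in> add_multiples M X N x"
    using add_multiplesI[of n N "\<zero>\<^bsub>M\<^esub>" X x] operator_subgroupD(2)[OF N] operator_subgroupD(3)[OF X] x by simp
next
  assume "m \<in> X"
  thus "x \<odot>\<^bsub>M\<^esub> m \<in> add_multiples M X N x"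
    using add_multiplesI[of "\<zero>\<^bsub>M\<^esub>" N m X x] operator_subgroupD(2)[OF X] operator_subgroupD(3)[OF N] x by simp
qed

lemma add_multiples_minimal:
  assumes "is_submodule T" "N \<subseteq> T" "\<And>m. m \<in> X \<Longrightarrow> x \<odot>\<^bsub>M\<^esub> m \<in> T"
  shows "add_multiples M X N x \<subseteq> T"
  unfolding add_multiples_def using assms(2,3) operator_subgroupD(5)[OF assms(1)] by blast

lemma add_multiples_commute:
  assumes N: "is_submodule N" and X: "is_submodule X" and x: "x \<in> carrier R" and y: "y \<in> carrier R"
  shows "add_multiples M X (add_multiples M X N x) y = add_multiples M X (add_multiples M X N y) x"
proof -
  have "add_multiples M X (add_multiples M X N x) y \<subseteq> add_multiples M X (add_multiples M X N y) x"
    if "x \<in> carrier R" "y \<in> carrier R" for x y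
  proof -
    note Ny = add_multiples_submodule[OF N X that(2)]
    note T = add_multiples_submodule[OF Ny X that(1)]
    show ?thesis
      using add_multiples_incl[OF Ny X that(1)] add_multiples_incl[OF N X that(2)]
      by (intro add_multiples_minimal[OF T]) blast+
  qed
  thus ?thesis using x y by blast
qed

lemma extend_submodule:
  "is_submodule N \<Longrightarrow> is_submodule X \<Longrightarrow> set xs \<subseteq> carrier R \<Longrightarrow> is_submodule (extend_by M X N xs)"
  by (induction xs arbitrary: N) (auto intro: add_multiples_submodule)

lemma extend_add_multiples:
  "is_submodule N \<Longrightarrow> is_submodule X \<Longrightarrow> set xs \<subseteq> carrier R \<Longrightarrow> x \<in> carrier R \<Longrightarrow>
     extend_by M X (add_multiples M X N x) xs = add_multiples M X (extend_by M X N xs) x"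
proof (induction xs arbitrary: N)
  case (Cons y ys)
  hence "extend_by M X (add_multiples M X N x) (y # ys) = extend_by M X (add_multiples M X (add_multiples M X N y) x) ys"
    by (simp add: add_multiples_commute)
  also have "\<dots> = add_multiples M X (extend_by M X (add_multiples M X N y) ys) x"
    using Cons.prems by (intro Cons.IH add_multiples_submodule) auto
  finally show ?case by simp
qed simp

lemma add_cancel_submodule:
  assumes N: "is_submodule N" and "a \<oplus>\<^bsub>M\<^esub> b \<in> N" "b \<in> N" "a \<in> carrier M"
  shows "a \<in> N"
proof -
  have "(a \<oplus>\<^bsub>M\<^esub> b) \<ominus>\<^bsub>M\<^esub> b = a"
    using assms operator_subgroupD(2)[OF N assms(3)] by (simp add: a_minus_def M.a_assoc M.r_neg)
  thus ?thesis using operator_subgroupD(6)[OF N assms(2,3)] by simp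
qed

lemma move_multiple:
  assumes "x \<odot>\<^bsub>M\<^esub> m = n \<oplus>\<^bsub>M\<^esub> z \<odot>\<^bsub>M\<^esub> (n' \<oplus>\<^bsub>M\<^esub> x \<odot>\<^bsub>M\<^esub> c)"
    and c: "x \<in> carrier R" "z \<in> carrier R" "m \<in> carrier M" "n \<in> carrier M" "n' \<in> carrier M" "c \<in> carrier M"
  shows "x \<odot>\<^bsub>M\<^esub> (m \<ominus>\<^bsub>M\<^esub> z \<odot>\<^bsub>M\<^esub> c) = n \<oplus>\<^bsub>M\<^esub> z \<odot>\<^bsub>M\<^esub> n'"
proof -
  let ?w = "z \<odot>\<^bsub>M\<^esub> (x \<odot>\<^bsub>M\<^esub> c)"
  have "x \<odot>\<^bsub>M\<^esub> (m \<ominus>\<^bsub>M\<^esub> z \<odot>\<^bsub>M\<^esub> c) = x \<odot>\<^bsub>M\<^esub> m \<oplus>\<^bsub>M\<^esub> \<ominus>\<^bsub>M\<^esub> ?w"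
    using c by (simp add: a_minus_def smult_r_distr smult_r_minus smult_commute)
  also have "\<dots> = (n \<oplus>\<^bsub>M\<^esub> z \<odot>\<^bsub>M\<^esub> n') \<oplus>\<^bsub>M\<^esub> (?w \<oplus>\<^bsub>M\<^esub> \<ominus>\<^bsub>M\<^esub> ?w)"
    unfolding assms(1) using c by (simp add: smult_r_distr M.a_assoc)
  finally show ?thesis using c by (simp add: M.r_neg)
qed

lemma minus_plus_cancel: "a \<in> carrier M \<Longrightarrow> b \<in> carrier M \<Longrightarrow> (a \<ominus>\<^bsub>M\<^esub> b) \<oplus>\<^bsub>M\<^esub> b = a"
  by (simp add: a_minus_def M.a_assoc M.l_neg)

text \<open>If x m = n + y c, then y c vanishes modulo N + xX, so c = n' + x c' and x (m - y c')
  lies in N. Regularity of x on X/N puts m into N + yX.\<close>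

lemma nonzerodivisor_swap:
  assumes N: "is_submodule N" and X: "is_submodule X" and x: "x \<in> carrier R" and y: "y \<in> carrier R"
    and nx: "nonzerodivisor_mod M X N x" and ny: "nonzerodivisor_mod M X (add_multiples M X N x) y"
  shows "nonzerodivisor_mod M X (add_multiples M X N y) x"
  unfolding nonzerodivisor_mod_def
proof (intro ballI impI)
  note Nc = operator_subgroupD(2)[OF N] and Xc = operator_subgroupD(2)[OF X]
  note Nx = add_multiples_submodule[OF N X x]
  fix m assume m: "m \<in> X" "x \<odot>\<^bsub>M\<^esub> m \<in> add_multiples M X N y"
  then obtain n c where nc: "x \<odot>\<^bsub>M\<^esub> m = n \<oplus>\<^bsub>M\<^esub> y \<odot>\<^bsub>M\<^esub> c" "n \<in> N" "c \<in> X"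
    by (auto simp: add_multiples_def)
  have "y \<odot>\<^bsub>M\<^esub> c \<oplus>\<^bsub>M\<^esub> n \<in> add_multiples M X N x"
    using add_multiples_incl(2)[OF N X x m(1)] nc Nc Xc y by (simp add: M.a_comm)
  from add_cancel_submodule[OF Nx this] have "y \<odot>\<^bsub>M\<^esub> c \<in> add_multiples M X N x"
    using add_multiples_incl(1)[OF N X x] nc Xc y by blast
  hence "c \<in> add_multiples M X N x" using ny nc by (auto simp: nonzerodivisor_mod_def)
  then obtain n' c' where n': "c = n' \<oplus>\<^bsub>M\<^esub> x \<odot>\<^bsub>M\<^esub> c'" "n' \<in> N" "c' \<in> X" by (auto simp: add_multiples_def)
  have "x \<odot>\<^bsub>M\<^esub> (m \<ominus>\<^bsub>M\<^esub> y \<odot>\<^bsub>M\<^esub> c') = n \<oplus>\<^bsub>M\<^esub> y \<odot>\<^bsub>M\<^esub> n'"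
    by (rule move_multiple) (use nc n' m Nc Xc x y in auto)
  also have "\<dots> \<in> N" using operator_subgroupD(5)[OF N nc(2)] operator_subgroupD(7)[OF N y n'(2)] .
  finally have "m \<ominus>\<^bsub>M\<^esub> y \<odot>\<^bsub>M\<^esub> c' \<in> N"
    using nx operator_subgroupD(6)[OF X m(1) operator_subgroupD(7)[OF X y n'(3)]] by (auto simp: nonzerodivisor_mod_def)
  from add_multiplesI[OF this n'(3), of y] show "m \<in> add_multiples M X N y"
    using minus_plus_cancel[of m "y \<odot>\<^bsub>M\<^esub> c'"] m n' Xc y by simp
qed

text \<open>The element z is exchanged with each entry in turn by
  \<open>nonzerodivisor_swap\<close>, which requires z to be regular modulo every initial
  segment.\<close>

lemma weakly_regular_swap:
  assumes "is_submodule N" "is_submodule X" "z \<in> carrier R" "set xs \<subseteq> carrier R" "weakly_regular M X N xs"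
    and "\<And>k. k \<le> length xs \<Longrightarrow> nonzerodivisor_mod M X (extend_by M X N (take k xs)) z"
  shows "weakly_regular M X (add_multiples M X N z) xs"
  using assms
proof (induction xs arbitrary: N)
  case (Cons x xs)
  have Nx: "is_submodule (add_multiples M X N x)" using Cons.prems by (auto intro: add_multiples_submodule)
  have "nonzerodivisor_mod M X (add_multiples M X N z) x"
    by (rule nonzerodivisor_swap[OF Cons.prems(1,2) _ Cons.prems(3)])
      (use Cons.prems(4,5) Cons.prems(6)[of 1] in auto)
  moreover have "weakly_regular M X (add_multiples M X (add_multiples M X N x) z) xs"
    by (rule Cons.IH[OF Nx]) (use Cons.prems(2-5) Cons.prems(6)[of "Suc k" for k] in auto)
  ultimately show ?case using add_multiples_commute[of N X x z] Cons.prems by simp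
qed simp

text \<open>Says that Hom(R/I, M/N) is nonzero.\<close>

definition has_socle :: "'a set \<Rightarrow> 'c set \<Rightarrow> bool" where
  "has_socle I N \<longleftrightarrow> (\<exists>m \<in> carrier M - N. \<forall>r \<in> I. r \<odot>\<^bsub>M\<^esub> m \<in> N)"

text \<open>For m killed by I modulo N + xM, write y m = n + x m'. Then m' is killed by I modulo N +
  yM, and is nonzero there because the relation between m and m' is symmetric. Behind this, Hom(R/I,
  M/(N + xM)) and Hom(R/I, M/(N + yM)) are both Ext^1(R/I, M/N).\<close>

lemma has_socle_exchange_one:
  assumes N: "is_submodule N" and I: "I \<subseteq> carrier R" and x: "x \<in> I" and y: "y \<in> I"
    and nx: "nonzerodivisor_mod M (carrier M) N x" and ny: "nonzerodivisor_mod M (carrier M) N y"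
    and soc: "has_socle I (add_multiples M (carrier M) N x)"
  shows "has_socle I (add_multiples M (carrier M) N y)"
proof -
  let ?X = "carrier M"
  note Nc = operator_subgroupD(2)[OF N]
  have xc: "x \<in> carrier R" and yc: "y \<in> carrier R" using I x y by auto
  from soc obtain m where m: "m \<in> ?X" "m \<notin> add_multiples M ?X N x" "\<And>r. r \<in> I \<Longrightarrow> r \<odot>\<^bsub>M\<^esub> m \<in> add_multiples M ?X N x"
    unfolding has_socle_def by blast
  from m(3)[OF y] obtain n m' where m': "y \<odot>\<^bsub>M\<^esub> m = n \<oplus>\<^bsub>M\<^esub> x \<odot>\<^bsub>M\<^esub> m'" "n \<in> N" "m' \<in> ?X"
    by (auto simp: add_multiples_def)
  have "m' \<notin> add_multiples M ?X N y"
  proof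
    assume "m' \<in> add_multiples M ?X N y"
    then obtain n' c where c: "m' = n' \<oplus>\<^bsub>M\<^esub> y \<odot>\<^bsub>M\<^esub> c" "n' \<in> N" "c \<in> ?X" by (auto simp: add_multiples_def)
    have "y \<odot>\<^bsub>M\<^esub> (m \<ominus>\<^bsub>M\<^esub> x \<odot>\<^bsub>M\<^esub> c) = n \<oplus>\<^bsub>M\<^esub> x \<odot>\<^bsub>M\<^esub> n'"
      by (rule move_multiple) (use m' m c Nc xc yc in auto)
    also have "\<dots> \<in> N" using operator_subgroupD(5)[OF N m'(2)] operator_subgroupD(7)[OF N xc c(2)] .
    finally have "m \<ominus>\<^bsub>M\<^esub> x \<odot>\<^bsub>M\<^esub> c \<in> N" using ny m c xc by (auto simp: nonzerodivisor_mod_def)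
    from add_multiplesI[OF this c(3), of x] show False
      using m minus_plus_cancel[of m "x \<odot>\<^bsub>M\<^esub> c"] c xc by simp
  qed
  moreover have "r \<odot>\<^bsub>M\<^esub> m' \<in> add_multiples M ?X N y" if r: "r \<in> I" for r
  proof -
    have rc: "r \<in> carrier R" using r I by auto
    from m(3)[OF r] obtain n1 c where c: "r \<odot>\<^bsub>M\<^esub> m = n1 \<oplus>\<^bsub>M\<^esub> x \<odot>\<^bsub>M\<^esub> c" "n1 \<in> N" "c \<in> ?X"
      by (auto simp: add_multiples_def)
    have carr: "n \<in> carrier M" "n1 \<in> carrier M" using Nc m' c by auto
    have "r \<odot>\<^bsub>M\<^esub> (y \<odot>\<^bsub>M\<^esub> m) = y \<odot>\<^bsub>M\<^esub> (r \<odot>\<^bsub>M\<^esub> m)" using rc yc m by (simp add: smult_commute)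
    hence "r \<odot>\<^bsub>M\<^esub> n \<oplus>\<^bsub>M\<^esub> x \<odot>\<^bsub>M\<^esub> (r \<odot>\<^bsub>M\<^esub> m') = y \<odot>\<^bsub>M\<^esub> n1 \<oplus>\<^bsub>M\<^esub> x \<odot>\<^bsub>M\<^esub> (y \<odot>\<^bsub>M\<^esub> c)"
      unfolding m'(1) c(1) using carr rc yc xc m' c by (simp add: smult_r_distr smult_commute[of r x] smult_commute[of y x])
    hence e: "x \<odot>\<^bsub>M\<^esub> (r \<odot>\<^bsub>M\<^esub> m') \<oplus>\<^bsub>M\<^esub> r \<odot>\<^bsub>M\<^esub> n = y \<odot>\<^bsub>M\<^esub> n1 \<oplus>\<^bsub>M\<^esub> x \<odot>\<^bsub>M\<^esub> (y \<odot>\<^bsub>M\<^esub> c)"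
      using carr rc xc m' by (simp add: M.a_comm)
    have "x \<odot>\<^bsub>M\<^esub> (r \<odot>\<^bsub>M\<^esub> m') = (y \<odot>\<^bsub>M\<^esub> n1 \<oplus>\<^bsub>M\<^esub> x \<odot>\<^bsub>M\<^esub> (y \<odot>\<^bsub>M\<^esub> c)) \<ominus>\<^bsub>M\<^esub> r \<odot>\<^bsub>M\<^esub> n"
      unfolding e[symmetric] using carr rc xc m' by (simp add: a_minus_def M.a_assoc M.r_neg)
    also have "\<dots> = (y \<odot>\<^bsub>M\<^esub> n1 \<ominus>\<^bsub>M\<^esub> r \<odot>\<^bsub>M\<^esub> n) \<oplus>\<^bsub>M\<^esub> x \<odot>\<^bsub>M\<^esub> (y \<odot>\<^bsub>M\<^esub> c)"
      using carr rc yc xc c by (simp add: a_minus_def M.a_ac)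
    finally have e2: "x \<odot>\<^bsub>M\<^esub> (r \<odot>\<^bsub>M\<^esub> m') = (y \<odot>\<^bsub>M\<^esub> n1 \<ominus>\<^bsub>M\<^esub> r \<odot>\<^bsub>M\<^esub> n) \<oplus>\<^bsub>M\<^esub> x \<odot>\<^bsub>M\<^esub> (y \<odot>\<^bsub>M\<^esub> c)" .
    have "x \<odot>\<^bsub>M\<^esub> (r \<odot>\<^bsub>M\<^esub> m' \<ominus>\<^bsub>M\<^esub> y \<odot>\<^bsub>M\<^esub> c) = x \<odot>\<^bsub>M\<^esub> (r \<odot>\<^bsub>M\<^esub> m') \<ominus>\<^bsub>M\<^esub> x \<odot>\<^bsub>M\<^esub> (y \<odot>\<^bsub>M\<^esub> c)"
      using rc yc xc c m' by (simp add: a_minus_def smult_r_distr smult_r_minus)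
    also have "\<dots> = y \<odot>\<^bsub>M\<^esub> n1 \<ominus>\<^bsub>M\<^esub> r \<odot>\<^bsub>M\<^esub> n"
      unfolding e2 using carr rc yc xc c by (simp add: a_minus_def M.a_assoc M.r_neg)
    also have "\<dots> \<in> N"
      by (intro operator_subgroupD(6,7)[OF N] rc yc c m')
    finally have "r \<odot>\<^bsub>M\<^esub> m' \<ominus>\<^bsub>M\<^esub> y \<odot>\<^bsub>M\<^esub> c \<in> N"
      using nx rc yc m' c by (auto simp: nonzerodivisor_mod_def)
    from add_multiplesI[OF this c(3), of y] show ?thesis
      using minus_plus_cancel[of "r \<odot>\<^bsub>M\<^esub> m'" "y \<odot>\<^bsub>M\<^esub> c"] m' c rc yc by simp
  qed
  ultimately show ?thesis unfolding has_socle_def using m' by blast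
qed

text \<open>The annihilator of the class of m in M/N.\<close>

definition residual :: "'c set \<Rightarrow> 'c \<Rightarrow> 'a set" where
  "residual N m = {r \<in> carrier R. r \<odot>\<^bsub>M\<^esub> m \<in> N}"

lemma residual_ideal:
  assumes N: "is_submodule N" and m: "m \<in> carrier M"
  shows "ideal (residual N m) R"
proof (rule idealI)
  show "ring R" by (rule R.ring_axioms)
  note D = operator_subgroupD[OF N]
  show "subgroup (residual N m) (add_monoid R)"
    by (rule R.add.subgroupI)
      (use m D in \<open>auto simp: residual_def smult_l_minus smult_l_distr intro: exI[of _ \<zero>]\<close>)
  fix a x assume "a \<in> residual N m" "x \<in> carrier R"
  thus "x \<otimes> a \<in> residual N m" "a \<otimes> x \<in> residual N m"
    using m D(7)[of x] by (auto simp: residual_def smult_assoc1 R.m_comm[of a x])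
qed

text \<open>A maximal annihilator of a nonzero class in M/N is prime, and as R is Noetherian every
  zero divisor lies in one of them. That finitely many suffice is what makes prime avoidance
  applicable.\<close>

lemma zero_divisors_covered:
  assumes "noetherian_ring R" and noeth: "noetherian_over M (carrier R) (carrier M)" and N: "is_submodule N"
  shows "\<exists>\<P>. finite \<P> \<and> (\<forall>P \<in> \<P>. primeideal P R \<and> (\<exists>m \<in> carrier M - N. P = residual N m)) \<and>
     {r \<in> carrier R. \<not> nonzerodivisor_mod M (carrier M) N r} \<subseteq> \<Union>\<P>"
proof -
  interpret noetherian_ring R by fact
  define C where "C = residual N ` (carrier M - N)"
  have C_ideal: "ideal P R" if "P \<in> C" for P using that residual_ideal[OF N] by (auto simp: C_def)
  define X where "X = {m \<in> carrier M - N. \<forall>Q \<in> C. residual N m \<subseteq> Q \<longrightarrow> Q = residual N m}"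
  have Xc: "X \<subseteq> carrier M" by (auto simp: X_def)
  have prime: "primeideal (residual N m) R" if m: "m \<in> X" for m
  proof (rule primeidealI)
    have mc: "m \<in> carrier M" "m \<notin> N" using m by (auto simp: X_def)
    show "ideal (residual N m) R" by (rule residual_ideal[OF N mc(1)])
    show "cring R" by (rule R.is_cring)
    have "\<one> \<notin> residual N m" using mc by (auto simp: residual_def)
    thus "carrier R \<noteq> residual N m" by auto
    fix a b assume ab: "a \<in> carrier R" "b \<in> carrier R" "a \<otimes> b \<in> residual N m"
    show "a \<in> residual N m \<or> b \<in> residual N m"
    proof (rule disjCI)
      assume "b \<notin> residual N m"
      hence bm: "b \<odot>\<^bsub>M\<^esub> m \<in> carrier M - N" using ab mc by (auto simp: residual_def)
      have "residual N m \<subseteq> residual N (b \<odot>\<^bsub>M\<^esub> m)"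
        using mc ab operator_subgroupD(7)[OF N] by (auto simp: residual_def smult_commute[of _ b])
      hence "residual N (b \<odot>\<^bsub>M\<^esub> m) = residual N m" using m bm by (auto simp: X_def C_def)
      moreover have "a \<in> residual N (b \<odot>\<^bsub>M\<^esub> m)" using ab mc by (auto simp: residual_def smult_assoc1)
      ultimately show "a \<in> residual N m" by simp
    qed
  qed
  \<comment> \<open>An annihilator contains the intersection of the annihilators of any finite set generating
    the submodule in question, so finitely many maximal ones suffice.\<close>
  have "operator_subgroup M (carrier R) (operator_span M (carrier R) X)"
    by (rule operator_span_subgroup[OF Xc]) simp
  moreover have "operator_span M (carrier R) X \<subseteq> carrier M"
    using operator_span_minimal[OF carrier_submodule Xc] .
  ultimately obtain G where G: "finite G" "G \<subseteq> operator_span M (carrier R) X"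
     "operator_span M (carrier R) X \<subseteq> operator_span M (carrier R) G"
    by (rule noetherian_overE[OF noeth])
  obtain F where F: "finite F" "F \<subseteq> X" "G \<subseteq> operator_span M (carrier R) F"
    using operator_span_finite_support[OF G(1,2)] by blast
  have Fc: "F \<subseteq> carrier M" using F Xc by blast
  have span: "X \<subseteq> operator_span M (carrier R) F"
  proof -
    have "operator_span M (carrier R) G \<subseteq> operator_span M (carrier R) F"
      using operator_span_minimal[OF operator_span_subgroup[OF Fc subset_refl] F(3)] .
    thus ?thesis using G(3) by (auto intro: operator_span.incl)
  qed
  have cover: "\<exists>f \<in> F. residual N m = residual N f" if m: "m \<in> X" for m
  proof (rule ccontr)
    assume no: "\<not> (\<exists>f \<in> F. residual N m = residual N f)"
    have mc: "m \<in> carrier M" using m Xc by auto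
    note P = prime[OF m]
    have notsub: "\<not> residual N f \<subseteq> residual N m" if "f \<in> F" for f
    proof
      assume sub: "residual N f \<subseteq> residual N m"
      have "f \<in> X" using that F(2) by blast
      moreover have "residual N m \<in> C" using m by (auto simp: C_def X_def)
      ultimately have "residual N m = residual N f" using sub by (auto simp: X_def)
      thus False using no that by blast
    qed
    have "\<exists>r \<in> carrier R. r \<notin> residual N m \<and> (\<forall>f \<in> F. r \<in> residual N f)"
      using F(1) Fc notsub
    proof (induction F)
      case empty
      have "\<one> \<notin> residual N m" using m by (auto simp: residual_def X_def)
      thus ?case by auto
    next
      case (insert f F)
      have "\<exists>r \<in> carrier R. r \<notin> residual N m \<and> (\<forall>f \<in> F. r \<in> residual N f)"
      proof (rule insert.IH)
        show "F \<subseteq> carrier M" using insert.prems(1) by simp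
        show "\<not> residual N g \<subseteq> residual N m" if "g \<in> F" for g using insert.prems(2)[of g] that by simp
      qed
      then obtain r where r: "r \<in> carrier R" "r \<notin> residual N m" "\<forall>f \<in> F. r \<in> residual N f" by blast
      obtain q where q: "q \<in> residual N f" "q \<notin> residual N m" using insert.prems(2)[OF insertI1] by blast
      have qc: "q \<in> carrier R" using q by (auto simp: residual_def)
      have "r \<otimes> q \<notin> residual N m" using primeideal.I_prime[OF P r(1) qc] r(2) q(2) by blast
      moreover have "r \<otimes> q \<in> residual N g" if g: "g \<in> insert f F" for g
      proof -
        have id: "ideal (residual N g) R" using g insert.prems(1) by (intro residual_ideal[OF N]) blast
        show ?thesis
          using g r(1,3) q(1) qc ideal.I_r_closed[OF id, of r q] ideal.I_l_closed[OF id, of q r] by auto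
      qed
      ultimately show ?case using r(1) qc by (intro bexI[of _ "r \<otimes> q"]) simp_all
    qed
    then obtain r where r: "r \<in> carrier R" "r \<notin> residual N m" "\<forall>f \<in> F. r \<in> residual N f" by blast
    \<comment> \<open>\<open>r\<close> multiplies F into N, hence also its span and with it m,
      although it was chosen outside the annihilator of m.\<close>
    have "is_submodule {y \<in> carrier M. r \<odot>\<^bsub>M\<^esub> y \<in> N}"
      by (rule operator_subgroupI)
        (use r operator_subgroupD[OF N] in \<open>auto simp: smult_r_minus smult_r_distr smult_commute[of r]\<close>)
    moreover have "F \<subseteq> {y \<in> carrier M. r \<odot>\<^bsub>M\<^esub> y \<in> N}" using r Fc by (auto simp: residual_def)
    ultimately have "operator_span M (carrier R) F \<subseteq> {y \<in> carrier M. r \<odot>\<^bsub>M\<^esub> y \<in> N}"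
      by (rule operator_span_minimal)
    thus False using span m r by (auto simp: residual_def)
  qed
  have "{r \<in> carrier R. \<not> nonzerodivisor_mod M (carrier M) N r} \<subseteq> \<Union> (residual N ` F)"
  proof
    fix r assume "r \<in> {r \<in> carrier R. \<not> nonzerodivisor_mod M (carrier M) N r}"
    then obtain m where m: "r \<in> residual N m" "m \<in> carrier M" "m \<notin> N"
      unfolding nonzerodivisor_mod_def residual_def by blast
    let ?D = "{Q \<in> C. residual N m \<subseteq> Q}"
    have "?D \<noteq> {}" using m by (auto simp: C_def)
    then obtain P where P: "P \<in> ?D" "\<forall>Q \<in> ?D. P \<subseteq> Q \<longrightarrow> Q = P"
      using maximal_ideal_in_family[of ?D] C_ideal by blast
    then obtain m' where m': "P = residual N m'" "m' \<in> carrier M - N" by (auto simp: C_def)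
    have "m' \<in> X" unfolding X_def
    proof (intro CollectI conjI ballI impI)
      fix Q assume Q: "Q \<in> C" "residual N m' \<subseteq> Q"
      hence "Q \<in> ?D" using P(1) m'(1) by blast
      thus "Q = residual N m'" using P(2) Q(2) m'(1) by blast
    qed (rule m'(2))
    then obtain f where "f \<in> F" "residual N m' = residual N f" using cover by blast
    thus "r \<in> \<Union> (residual N ` F)" using m P m' by blast
  qed
  moreover have "\<forall>P \<in> residual N ` F. primeideal P R \<and> (\<exists>m \<in> carrier M - N. P = residual N m)"
    using prime F(2) by (auto simp: X_def subset_eq)
  ultimately show ?thesis using F(1) by blast
qed

text \<open>Each covering prime annihilates a nonzero class of M/N, so it does not contain I when I
  has no socle there. Prime avoidance then treats the finitely many N together.\<close>

lemma common_nonzerodivisor: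
  assumes R: "noetherian_ring R" and noeth: "noetherian_over M (carrier R) (carrier M)" and I: "ideal I R"
    and "finite \<N>" and \<N>: "\<And>N. N \<in> \<N> \<Longrightarrow> is_submodule N \<and> \<not> has_socle I N"
  shows "\<exists>z \<in> I. \<forall>N \<in> \<N>. nonzerodivisor_mod M (carrier M) N z"
proof -
  have Ic: "I \<subseteq> carrier R" using ideal.Icarr[OF I] by blast
  have "\<forall>N \<in> \<N>. \<exists>\<P>. finite \<P> \<and> (\<forall>P \<in> \<P>. primeideal P R \<and> \<not> I \<subseteq> P) \<and>
     {r \<in> carrier R. \<not> nonzerodivisor_mod M (carrier M) N r} \<subseteq> \<Union>\<P>"
  proof
    fix N assume N: "N \<in> \<N>"
    from zero_divisors_covered[OF R noeth conjunct1[OF \<N>[OF N]]]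
    obtain \<P> where \<P>: "finite \<P>" "\<forall>P \<in> \<P>. primeideal P R \<and> (\<exists>m \<in> carrier M - N. P = residual N m)"
      "{r \<in> carrier R. \<not> nonzerodivisor_mod M (carrier M) N r} \<subseteq> \<Union>\<P>"
      by (elim exE conjE) (rule that, assumption+)
    have "\<not> I \<subseteq> P" if "P \<in> \<P>" for P
      using \<P>(2)[rule_format, OF that] \<N>[OF N] by (auto simp: has_socle_def residual_def subset_eq)
    thus "\<exists>\<P>. finite \<P> \<and> (\<forall>P \<in> \<P>. primeideal P R \<and> \<not> I \<subseteq> P) \<and>
     {r \<in> carrier R. \<not> nonzerodivisor_mod M (carrier M) N r} \<subseteq> \<Union>\<P>"
      using \<P> by blast
  qed
  from bchoice[OF this] obtain \<P> where \<P>: "\<forall>N \<in> \<N>. finite (\<P> N) \<and> (\<forall>P \<in> \<P> N. primeideal P R \<and> \<not> I \<subseteq> P) \<and>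
     {r \<in> carrier R. \<not> nonzerodivisor_mod M (carrier M) N r} \<subseteq> \<Union> (\<P> N)"
    by (elim exE)
  have "finite (\<Union>N \<in> \<N>. \<P> N)" using \<P> \<open>finite \<N>\<close> by simp
  moreover have "primeideal P R" "\<not> I \<subseteq> P" if "P \<in> (\<Union>N \<in> \<N>. \<P> N)" for P using that \<P> by auto
  ultimately have "\<exists>z \<in> I. \<forall>P \<in> (\<Union>N \<in> \<N>. \<P> N). z \<notin> P" by (rule R.prime_avoidance[OF _ _ I])
  then obtain z where z: "z \<in> I" "\<And>P. P \<in> (\<Union>N \<in> \<N>. \<P> N) \<Longrightarrow> z \<notin> P" by blast
  have "nonzerodivisor_mod M (carrier M) N z" if N: "N \<in> \<N>" for N
  proof (rule ccontr)
    assume "\<not> nonzerodivisor_mod M (carrier M) N z"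
    hence "z \<in> {r \<in> carrier R. \<not> nonzerodivisor_mod M (carrier M) N r}" using z(1) Ic by auto
    hence "z \<in> \<Union> (\<P> N)" using \<P> N by (meson subsetD)
    thus False using z(2) N by blast
  qed
  thus ?thesis using z(1) by blast
qed

lemma no_socle: "x \<in> I \<Longrightarrow> nonzerodivisor_mod M (carrier M) N x \<Longrightarrow> \<not> has_socle I N"
  unfolding has_socle_def nonzerodivisor_mod_def by blast

text \<open>Choosing \<open>z\<close> regular on all proper quotients by initial segments reduces the exchange of
  \<open>xs\<close> for \<open>ys\<close> to shorter sequences over \<open>N + zM\<close>.\<close>

lemma has_socle_exchange:
  assumes R: "noetherian_ring R" and noeth: "noetherian_over M (carrier R) (carrier M)" and I: "ideal I R"
  shows "is_submodule N \<Longrightarrow> length xs = length ys \<Longrightarrow> set xs \<subseteq> I \<Longrightarrow> set ys \<subseteq> I \<Longrightarrow>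
     weakly_regular M (carrier M) N xs \<Longrightarrow> weakly_regular M (carrier M) N ys \<Longrightarrow>
     has_socle I (extend_by M (carrier M) N xs) \<Longrightarrow> has_socle I (extend_by M (carrier M) N ys)"
proof (induction "length xs" arbitrary: N xs ys)
  case (Suc n)
  let ?X = "carrier M"
  have Ic: "I \<subseteq> carrier R" using ideal.Icarr[OF I] by blast
  obtain xs' x where xs: "xs = xs' @ [x]" "length xs' = n" using Suc.hyps(2) by (metis length_Suc_conv_rev)
  obtain ys' y where ys: "ys = ys' @ [y]" "length ys' = n"
    using Suc.hyps(2) Suc.prems(2) by (metis length_Suc_conv_rev)
  \<comment> \<open>Segments up to length n, that is, up to the lists without their last entries:
    there z has to be regular both for the swaps and for its exchange with the last entry.\<close>
  let ?\<N> = "(\<lambda>k. extend_by M ?X N (take k xs')) ` {..n} \<union> (\<lambda>k. extend_by M ?X N (take k ys')) ` {..n}"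
  have wx: "\<forall>k \<le> n. nonzerodivisor_mod M ?X (extend_by M ?X N (take k xs')) (xs ! k)"
    using Suc.prems(5) unfolding weakly_regular_nth by (auto simp: xs)
  have wy: "\<forall>k \<le> n. nonzerodivisor_mod M ?X (extend_by M ?X N (take k ys')) (ys ! k)"
    using Suc.prems(6) unfolding weakly_regular_nth by (auto simp: ys)
  have sub: "is_submodule (extend_by M ?X N (take k zs))" if "set zs \<subseteq> I" for zs k
    using that Ic set_take_subset[of k zs] Suc.prems(1) by (intro extend_submodule carrier_submodule) auto
  have xsI: "xs ! k \<in> I" "ys ! k \<in> I" if "k \<le> n" for k
    using that Suc.prems(3,4) Suc.hyps(2) Suc.prems(2) by (auto simp: subset_eq)
  have "is_submodule T \<and> \<not> has_socle I T" if T: "T \<in> ?\<N>" for T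
  proof -
    from T consider k where "k \<le> n" "T = extend_by M ?X N (take k xs')" | k where "k \<le> n" "T = extend_by M ?X N (take k ys')"
      by blast
    thus ?thesis
    proof cases
      case 1 thus ?thesis
        using sub[of xs' k] no_socle[OF xsI(1) wx[rule_format]] Suc.prems(3) xs by auto
    next
      case 2 thus ?thesis
        using sub[of ys' k] no_socle[OF xsI(2) wy[rule_format]] Suc.prems(4) ys by auto
    qed
  qed
  hence "\<exists>z \<in> I. \<forall>T \<in> ?\<N>. nonzerodivisor_mod M ?X T z"
    by (intro common_nonzerodivisor[OF R noeth I]) simp_all
  then obtain z where z: "z \<in> I" "\<forall>T \<in> ?\<N>. nonzerodivisor_mod M ?X T z" by blast
  have zc: "z \<in> carrier R" using z Ic by auto
  have nz: "nonzerodivisor_mod M ?X (extend_by M ?X N (take k xs')) z"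
    "nonzerodivisor_mod M ?X (extend_by M ?X N (take k ys')) z" if "k \<le> n" for k
    using z(2) that by blast+
  have xs'c: "set xs' \<subseteq> I" "set ys' \<subseteq> I" "x \<in> I" "y \<in> I" using Suc.prems(3,4) xs ys by auto
  have Nz: "is_submodule (add_multiples M ?X N z)"
    by (rule add_multiples_submodule[OF Suc.prems(1) carrier_submodule zc])
  have ext: "extend_by M ?X (add_multiples M ?X N z) zs = add_multiples M ?X (extend_by M ?X N zs) z" if "set zs \<subseteq> I" for zs
    using that Ic zc Suc.prems(1) by (intro extend_add_multiples carrier_submodule) auto
  have "has_socle I (add_multiples M ?X (extend_by M ?X N xs') x)"
    using Suc.prems(7) by (simp add: xs extend_append)
  hence "has_socle I (add_multiples M ?X (extend_by M ?X N xs') z)"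
    by (rule has_socle_exchange_one[rotated -1])
      (use sub[OF xs'c(1), of n] Ic xs'c z(1) nz(1)[of n] wx[rule_format, of n] xs in \<open>auto simp: nth_append\<close>)
  hence "has_socle I (extend_by M ?X (add_multiples M ?X N z) xs')" by (simp add: ext xs'c)
  moreover have "weakly_regular M ?X (add_multiples M ?X N z) xs'"
    by (rule weakly_regular_swap)
      (use Suc.prems(1,5) carrier_submodule zc xs'c Ic xs nz(1) in \<open>auto simp: weakly_regular_append\<close>)
  moreover have "weakly_regular M ?X (add_multiples M ?X N z) ys'"
    by (rule weakly_regular_swap)
      (use Suc.prems(1,6) carrier_submodule zc xs'c Ic ys nz(2) in \<open>auto simp: weakly_regular_append\<close>)
  ultimately have "has_socle I (extend_by M ?X (add_multiples M ?X N z) ys')"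
    using Suc.hyps(1)[OF _ Nz, of xs' ys'] xs ys xs'c by simp
  hence "has_socle I (add_multiples M ?X (extend_by M ?X N ys') z)" by (simp add: ext xs'c)
  hence "has_socle I (add_multiples M ?X (extend_by M ?X N ys') y)"
    by (rule has_socle_exchange_one[rotated -1])
      (use sub[OF xs'c(2), of n] Ic xs'c z(1) nz(2)[of n] wy[rule_format, of n] ys in \<open>auto simp: nth_append\<close>)
  thus ?case by (simp add: ys extend_append)
qed simp

section \<open>Submodules IM, regular sequences and the grade\<close>

lemma ideal_smult_minimal:
  assumes N: "is_submodule N" and I: "I \<subseteq> carrier R" and "\<And>r x. r \<in> I \<Longrightarrow> x \<in> carrier M \<Longrightarrow> r \<odot>\<^bsub>M\<^esub> x \<in> N"
  shows "ideal_smult R M I \<subseteq> N"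
  unfolding ideal_smult_def submodule_span_def
  using assms submodule_iff_operator_subgroup by blast

lemma ideal_smult_submodule:
  assumes "I \<subseteq> carrier R"
  shows "is_submodule (ideal_smult R M I)"
proof -
  have "{r \<odot>\<^bsub>M\<^esub> x | r x. r \<in> I \<and> x \<in> carrier M} \<subseteq> carrier M" using assms by auto
  thus ?thesis unfolding ideal_smult_def by (simp add: submodule_span_eq operator_span_subgroup)
qed

lemma ideal_smult_incl:
  "r \<in> I \<Longrightarrow> x \<in> carrier M \<Longrightarrow> r \<odot>\<^bsub>M\<^esub> x \<in> ideal_smult R M I"
  unfolding ideal_smult_def submodule_span_def by blast

text \<open>Links the submodules (x_1, ..., x_k)M to the chain built one element at a time: both are
  the smallest submodule containing all multiples by the x_i.\<close>

lemma ideal_smult_Idl_eq_extend: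
  assumes xs: "set xs \<subseteq> carrier R"
  shows "ideal_smult R M (Idl (set xs)) = extend_by M (carrier M) {\<zero>\<^bsub>M\<^esub>} xs"
proof
  let ?e = "extend_by M (carrier M) {\<zero>\<^bsub>M\<^esub>} xs"
  have Id: "Idl (set xs) \<subseteq> carrier R" using ideal.Icarr[OF R.genideal_ideal[OF xs]] by blast
  have sub: "is_submodule ?e" by (intro extend_submodule zero_submodule carrier_submodule xs)
  have gen: "x \<odot>\<^bsub>M\<^esub> m \<in> extend_by M (carrier M) N xs"
    if "x \<in> set xs" "m \<in> carrier M" "is_submodule N" "set xs \<subseteq> carrier R" for x m N xs
    using that
  proof (induction xs arbitrary: N)
    case (Cons y ys)
    have Ny: "is_submodule (add_multiples M (carrier M) N y)"
      using Cons.prems by (intro add_multiples_submodule carrier_submodule) auto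
    have incl: "N' \<subseteq> extend_by M (carrier M) N' ys" if "is_submodule N'" for N'
      using that Cons.prems(4)
    proof (induction ys arbitrary: N')
      case (Cons a ys)
      have "N' \<subseteq> add_multiples M (carrier M) N' a"
        using Cons.prems by (intro add_multiples_incl carrier_submodule) auto
      moreover have "is_submodule (add_multiples M (carrier M) N' a)"
        using Cons.prems by (intro add_multiples_submodule carrier_submodule) auto
      ultimately show ?case using Cons by fastforce
    qed simp
    show ?case
    proof (cases "x = y")
      case True
      have "x \<odot>\<^bsub>M\<^esub> m \<in> add_multiples M (carrier M) N y"
        using add_multiples_incl(2)[OF Cons.prems(3) carrier_submodule, of y m] Cons.prems True by auto
      thus ?thesis using incl[OF Ny] by auto
    next
      case False thus ?thesis using Cons Ny by auto
    qed
  qed simp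
  have "ideal {r \<in> carrier R. \<forall>m \<in> carrier M. r \<odot>\<^bsub>M\<^esub> m \<in> ?e} R"
  proof (rule idealI)
    show "ring R" by (rule R.ring_axioms)
    show "subgroup {r \<in> carrier R. \<forall>m \<in> carrier M. r \<odot>\<^bsub>M\<^esub> m \<in> ?e} (add_monoid R)"
      by (rule R.add.subgroupI)
        (use operator_subgroupD[OF sub] in \<open>auto simp: smult_l_minus smult_l_distr intro!: exI[of _ \<zero>]\<close>)
    fix a x assume "a \<in> {r \<in> carrier R. \<forall>m \<in> carrier M. r \<odot>\<^bsub>M\<^esub> m \<in> ?e}" "x \<in> carrier R"
    thus "x \<otimes> a \<in> {r \<in> carrier R. \<forall>m \<in> carrier M. r \<odot>\<^bsub>M\<^esub> m \<in> ?e}"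
      "a \<otimes> x \<in> {r \<in> carrier R. \<forall>m \<in> carrier M. r \<odot>\<^bsub>M\<^esub> m \<in> ?e}"
      by (auto simp: smult_assoc1)
        (auto simp: smult_commute[of x] R.m_comm[of a x])
  qed
  moreover have "set xs \<subseteq> {r \<in> carrier R. \<forall>m \<in> carrier M. r \<odot>\<^bsub>M\<^esub> m \<in> ?e}"
    using gen[OF _ _ zero_submodule xs] xs by auto
  ultimately have "Idl (set xs) \<subseteq> {r \<in> carrier R. \<forall>m \<in> carrier M. r \<odot>\<^bsub>M\<^esub> m \<in> ?e}"
    by (rule R.genideal_minimal)
  thus "ideal_smult R M (Idl (set xs)) \<subseteq> ?e"
    using ideal_smult_minimal[OF sub Id] by blast
  have "extend_by M (carrier M) N xs' \<subseteq> ideal_smult R M (Idl (set xs))"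
    if "N \<subseteq> ideal_smult R M (Idl (set xs))" "set xs' \<subseteq> set xs" for N xs'
    using that
  proof (induction xs' arbitrary: N)
    case (Cons a xs')
    have "a \<in> Idl (set xs)" using Cons.prems R.genideal_self[OF xs] by auto
    hence "add_multiples M (carrier M) N a \<subseteq> ideal_smult R M (Idl (set xs))"
      using Cons.prems by (intro add_multiples_minimal[OF ideal_smult_submodule[OF Id]] ideal_smult_incl) auto
    thus ?case using Cons by auto
  qed simp
  from this[of "{\<zero>\<^bsub>M\<^esub>}" xs] show "?e \<subseteq> ideal_smult R M (Idl (set xs))"
    using operator_subgroupD(3)[OF ideal_smult_submodule[OF Id]] by simp
qed

lemma regular_sequence_iff:
  "regular_sequence R M xs \<longleftrightarrow> set xs \<subseteq> carrier R \<and> weakly_regular M (carrier M) {\<zero>\<^bsub>M\<^esub>} xs \<and>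
     extend_by M (carrier M) {\<zero>\<^bsub>M\<^esub>} xs \<noteq> carrier M"
proof (cases "set xs \<subseteq> carrier R")
  case True
  hence "set (take k xs) \<subseteq> carrier R" for k using set_take_subset[of k xs] by blast
  thus ?thesis using True
    unfolding regular_sequence_def weakly_regular_nth nonzerodivisor_mod_def
    by (simp add: ideal_smult_Idl_eq_extend)
qed (auto simp: regular_sequence_def)

text \<open>Rees' theorem for an ideal generated by a regular sequence. The nonzero module M/(xs)M
  is killed by the ideal, so \<open>xs\<close> is maximal. By \<open>has_socle_exchange\<close> the
  length at which a socle appears is the same for all weakly regular sequences in the ideal, which
  makes the description in \<open>grade\<close> unique.\<close>

theorem grade_eq_length:
  assumes R: "noetherian_ring R" and noeth: "noetherian_over M (carrier R) (carrier M)"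
    and xs: "regular_sequence R M xs"
  shows "grade R (Idl (set xs)) M = length xs"
proof -
  let ?X = "carrier M" and ?I = "Idl (set xs)" and ?O = "{\<zero>\<^bsub>M\<^esub>}"
  have xsc: "set xs \<subseteq> carrier R" using xs by (simp add: regular_sequence_def)
  have I: "ideal ?I R" using R.genideal_ideal[OF xsc] .
  have Ic: "?I \<subseteq> carrier R" using ideal.Icarr[OF I] by blast
  have xsI: "set xs \<subseteq> ?I" using R.genideal_self[OF xsc] .
  have wx: "weakly_regular M ?X ?O xs" "extend_by M ?X ?O xs \<noteq> ?X" using xs by (auto simp: regular_sequence_iff)
  have sub: "is_submodule (extend_by M ?X ?O zs)" if "set zs \<subseteq> ?I" for zs
    using that Ic by (intro extend_submodule zero_submodule carrier_submodule) auto
  have IM: "extend_by M ?X ?O zs \<subseteq> extend_by M ?X ?O xs" if "set zs \<subseteq> ?I" for zs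
  proof -
    have "set zs \<subseteq> carrier R" using that Ic by blast
    moreover have "ideal_smult R M (Idl (set zs)) \<subseteq> ideal_smult R M ?I"
    proof (rule ideal_smult_minimal)
      show "is_submodule (ideal_smult R M ?I)" by (rule ideal_smult_submodule[OF Ic])
      have "Idl (set zs) \<subseteq> ?I" using R.genideal_minimal[OF I that] .
      thus "Idl (set zs) \<subseteq> carrier R" "\<And>r x. r \<in> Idl (set zs) \<Longrightarrow> x \<in> ?X \<Longrightarrow> r \<odot>\<^bsub>M\<^esub> x \<in> ideal_smult R M ?I"
        using Ic ideal_smult_incl by blast+
    qed
    ultimately show ?thesis by (simp add: ideal_smult_Idl_eq_extend xsc)
  qed
  \<comment> \<open>Supplies the last condition of \<open>regular_sequence\<close> for the sequences
    in the ideal that are constructed below.\<close>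
  have proper: "extend_by M ?X ?O zs \<noteq> ?X" if "set zs \<subseteq> ?I" for zs
    using IM[OF that] wx(2) operator_subgroupD(1)[OF sub[OF xsI]] by blast
  have soc: "has_socle ?I (extend_by M ?X ?O xs)"
  proof -
    obtain m where m: "m \<in> ?X" "m \<notin> extend_by M ?X ?O xs"
      using wx(2) operator_subgroupD(1)[OF sub[OF xsI]] by blast
    have "r \<odot>\<^bsub>M\<^esub> m \<in> extend_by M ?X ?O xs" if "r \<in> ?I" for r
      using ideal_smult_incl[OF that m(1)] by (simp add: ideal_smult_Idl_eq_extend xsc)
    thus ?thesis using m unfolding has_socle_def by blast
  qed
  have max_xs: "maximal_regular_sequence R M ?I xs"
    unfolding maximal_regular_sequence_def
  proof (intro conjI ballI notI)
    fix x assume "x \<in> ?I" "regular_sequence R M (xs @ [x])"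
    thus False using no_socle soc by (auto simp: regular_sequence_iff weakly_regular_append)
  qed (use xs xsI in auto)
  have unique: "length ys = length xs" if ys: "maximal_regular_sequence R M ?I ys" for ys
  proof -
    have ysI: "set ys \<subseteq> ?I" and wy: "weakly_regular M ?X ?O ys"
      using ys by (auto simp: maximal_regular_sequence_def regular_sequence_iff)
    note exch = has_socle_exchange[OF R noeth I zero_submodule]
    consider "length ys < length xs" | "length xs < length ys" | "length xs = length ys" by linarith
    thus ?thesis
    proof cases
      \<comment> \<open>By exchange with an initial segment of \<open>xs\<close>, a shorter
        \<open>ys\<close> has no socle and could be extended, against maximality.\<close>
      case 1
      let ?r = "length ys"
      have take: "set (take ?r xs) \<subseteq> ?I" using xsI set_take_subset[of ?r xs] by blast
      have "weakly_regular M ?X ?O (take ?r xs)" using wx(1) weakly_regular_append[of M ?X ?O "take ?r xs" "drop ?r xs"] by simp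
      moreover have "\<not> has_socle ?I (extend_by M ?X ?O (take ?r xs))"
        using wx(1) 1 xsI no_socle[of "xs ! ?r" ?I] nth_mem[OF 1] by (auto simp: weakly_regular_nth subset_eq)
      ultimately have "\<not> has_socle ?I (extend_by M ?X ?O ys)"
        using exch[of ys "take ?r xs"] 1 ysI take wy by auto
      with common_nonzerodivisor[OF R noeth I, of "{extend_by M ?X ?O ys}"] sub[OF ysI]
      obtain z where z: "z \<in> ?I" "nonzerodivisor_mod M ?X (extend_by M ?X ?O ys) z" by auto
      have "regular_sequence R M (ys @ [z])"
        using z ysI wy Ic proper[of "ys @ [z]"] by (auto simp: regular_sequence_iff weakly_regular_append)
      thus ?thesis using ys z by (auto simp: maximal_regular_sequence_def)
    next
      \<comment> \<open>A longer \<open>ys\<close> would contain a regular element after a segment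
        that, by exchange with \<open>xs\<close>, already has a socle.\<close>
      case 2
      let ?s = "length xs"
      have take: "set (take ?s ys) \<subseteq> ?I" using ysI set_take_subset[of ?s ys] by blast
      have "weakly_regular M ?X ?O (take ?s ys)" using wy weakly_regular_append[of M ?X ?O "take ?s ys" "drop ?s ys"] by simp
      hence "has_socle ?I (extend_by M ?X ?O (take ?s ys))"
        using exch[of xs "take ?s ys"] 2 xsI take wx soc by auto
      moreover have "\<not> has_socle ?I (extend_by M ?X ?O (take ?s ys))"
        using wy 2 ysI no_socle[of "ys ! ?s" ?I] nth_mem[OF 2] by (auto simp: weakly_regular_nth subset_eq)
      ultimately show ?thesis by blast
    qed simp
  qed
  show ?thesis unfolding grade_def
  proof (rule the_equality)
    show "\<exists>ys. maximal_regular_sequence R M ?I ys \<and> length ys = length xs" using max_xs by blast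
    show "t = length xs" if "\<exists>ys. maximal_regular_sequence R M ?I ys \<and> length ys = t" for t
      using that unique by blast
  qed
qed

end

section \<open>Homogeneous ideals and extension of homomorphisms\<close>

lemma (in abelian_group) minus_eq_zeroD:
  assumes x: "x \<in> carrier G" and y: "y \<in> carrier G" and "x \<ominus> y = \<zero>"
  shows "x = y"
proof -
  have "(x \<ominus> y) \<oplus> y = x" using x y by (simp add: a_minus_def a_assoc l_neg)
  thus ?thesis using assms by simp
qed

text \<open>The projections recover the summands of a finite sum, which gives uniqueness; for
  existence, the difference of x and the sum of its projections is killed by all of them.\<close>

lemma direct_sum_decompositionI:
  assumes G: "abelian_group G" and sub: "\<And>i. additive_subgroup (A i) G"
    and closed: "\<And>i x. x \<in> carrier G \<Longrightarrow> p i x \<in> A i"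
    and add: "\<And>i x y. x \<in> carrier G \<Longrightarrow> y \<in> carrier G \<Longrightarrow> p i (x \<oplus>\<^bsub>G\<^esub> y) = p i x \<oplus>\<^bsub>G\<^esub> p i y"
    and same: "\<And>i x. x \<in> A i \<Longrightarrow> p i x = x"
    and other: "\<And>i j x. x \<in> A i \<Longrightarrow> j \<noteq> i \<Longrightarrow> p j x = \<zero>\<^bsub>G\<^esub>"
    and fin: "\<And>x. x \<in> carrier G \<Longrightarrow> finite {i. p i x \<noteq> \<zero>\<^bsub>G\<^esub>}"
    and zero: "\<And>x. x \<in> carrier G \<Longrightarrow> (\<And>i. p i x = \<zero>\<^bsub>G\<^esub>) \<Longrightarrow> x = \<zero>\<^bsub>G\<^esub>"
  shows "direct_sum_decomposition G A"
proof -
  interpret G: abelian_group G by fact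
  have carr: "x \<in> carrier G" if "x \<in> A i" for i x
    using additive_subgroup.a_Hcarr[OF sub that] .
  have pc: "p i x \<in> carrier G" if "x \<in> carrier G" for i x using closed[OF that] carr by blast
  have p0: "p i \<zero>\<^bsub>G\<^esub> = \<zero>\<^bsub>G\<^esub>" for i
    using same[of "\<zero>\<^bsub>G\<^esub>" i] additive_subgroup.zero_closed[OF sub] by simp
  have sum: "p j (finsum G c F) = (if j \<in> F then c j else \<zero>\<^bsub>G\<^esub>)"
    if "finite F" "\<And>i. c i \<in> A i" for c F j
    using that(1)
  proof induction
    case (insert i F)
    have c: "c k \<in> carrier G" for k using that(2) carr by blast
    hence "finsum G c F \<in> carrier G" by (intro G.finsum_closed) auto
    hence "p j (finsum G c (insert i F)) = p j (c i) \<oplus>\<^bsub>G\<^esub> (if j \<in> F then c j else \<zero>\<^bsub>G\<^esub>)"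
      using insert c by (simp add: add)
    thus ?case
      using insert.hyps c same[OF that(2)[of i]] other[OF that(2)[of i], of j] by (cases "j = i") simp_all
  qed (simp add: p0)
  have pneg: "p i (\<ominus>\<^bsub>G\<^esub> x) = \<ominus>\<^bsub>G\<^esub> p i x" if "x \<in> carrier G" for i x
  proof -
    have "p i (\<ominus>\<^bsub>G\<^esub> x) \<oplus>\<^bsub>G\<^esub> p i x = \<zero>\<^bsub>G\<^esub>"
      using add[of "\<ominus>\<^bsub>G\<^esub> x" x i] that p0 by (simp add: G.l_neg)
    thus ?thesis using G.minus_equality[of "p i (\<ominus>\<^bsub>G\<^esub> x)" "p i x"] pc that by simp
  qed
  have "\<exists>!c. (\<forall>i. c i \<in> A i) \<and> finite {i. c i \<noteq> \<zero>\<^bsub>G\<^esub>} \<and> x = (\<Oplus>\<^bsub>G\<^esub> i \<in> {i. c i \<noteq> \<zero>\<^bsub>G\<^esub>}. c i)"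
    if x: "x \<in> carrier G" for x
  proof (rule ex1I)
    let ?S = "{i. p i x \<noteq> \<zero>\<^bsub>G\<^esub>}" and ?c = "\<lambda>i. p i x"
    let ?y = "finsum G ?c ?S"
    have y: "?y \<in> carrier G" using pc[OF x] by (intro G.finsum_closed) auto
    have py: "p i ?y = p i x" for i using sum[OF fin[OF x], of ?c i] closed[OF x] by auto
    have "p i (x \<ominus>\<^bsub>G\<^esub> ?y) = \<zero>\<^bsub>G\<^esub>" for i
      unfolding a_minus_def using x y pc[OF x] py by (simp add: add pneg G.r_neg)
    from zero[OF G.minus_closed[OF x y] this] have "x \<ominus>\<^bsub>G\<^esub> ?y = \<zero>\<^bsub>G\<^esub>" .
    hence xy: "x = ?y" using G.minus_eq_zeroD[OF x y] by blast
    show "(\<forall>i. p i x \<in> A i) \<and> finite ?S \<and> x = (\<Oplus>\<^bsub>G\<^esub> i \<in> ?S. p i x)"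
      using closed[OF x] fin[OF x] by (intro conjI xy) blast+
    fix c assume c: "(\<forall>i. c i \<in> A i) \<and> finite {i. c i \<noteq> \<zero>\<^bsub>G\<^esub>} \<and> x = (\<Oplus>\<^bsub>G\<^esub> i \<in> {i. c i \<noteq> \<zero>\<^bsub>G\<^esub>}. c i)"
    show "c = (\<lambda>i. p i x)"
    proof
      fix i
      have "p i (finsum G c {i. c i \<noteq> \<zero>\<^bsub>G\<^esub>}) = c i" using sum[of "{i. c i \<noteq> \<zero>\<^bsub>G\<^esub>}" c i] c by auto
      thus "c i = p i x" using c by metis
    qed
  qed
  thus ?thesis using sub by (simp add: direct_sum_decomposition_def)
qed

lemma module_homD:
  assumes "f \<in> module_hom R M N"
  shows "x \<in> carrier M \<Longrightarrow> f x \<in> carrier N"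
    "x \<in> carrier M \<Longrightarrow> y \<in> carrier M \<Longrightarrow> f (x \<oplus>\<^bsub>M\<^esub> y) = f x \<oplus>\<^bsub>N\<^esub> f y"
    "r \<in> carrier R \<Longrightarrow> x \<in> carrier M \<Longrightarrow> f (r \<odot>\<^bsub>M\<^esub> x) = r \<odot>\<^bsub>N\<^esub> f x"
  using assms by (auto simp: module_hom_def)

context graded_module
begin

lemma graded_group_gM: "graded_group M gM"
  by (intro graded_group.intro graded_group_axioms.intro gM_decomposition M.abelian_group_axioms)

sublocale gM: graded_group M gM by (rule graded_group_gM)

end

lemma (in cring) ideal_if_closed:
  assumes "W \<subseteq> carrier R" "\<zero> \<in> W" "\<And>r s. r \<in> W \<Longrightarrow> s \<in> W \<Longrightarrow> r \<oplus> s \<in> W"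
    "\<And>r s. r \<in> W \<Longrightarrow> s \<in> carrier R \<Longrightarrow> s \<otimes> r \<in> W"
  shows "ideal W R"
proof (rule idealI)
  have "\<ominus> r \<in> W" if "r \<in> W" for r
    using assms(4)[OF that, of "\<ominus> \<one>"] that assms(1) by (auto simp: l_minus)
  thus "subgroup W (add_monoid R)"
    by (intro add.subgroupI) (use assms in auto)
  show "x \<otimes> a \<in> W" "a \<otimes> x \<in> W" if "a \<in> W" "x \<in> carrier R" for a x
    using assms(4)[OF that] that assms(1) m_comm[of a x] by auto
qed (rule ring_axioms)

context standard_graded_ring
begin

lemma hcomp_smult:
  assumes "graded_module R E gr gE" "r \<in> gr m" "x \<in> carrier E"
  shows "hcomp E gE (int m + k) (r \<odot>\<^bsub>E\<^esub> x) = r \<odot>\<^bsub>E\<^esub> hcomp E gE k x"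
proof -
  interpret E: graded_module R E gr gE by fact
  show ?thesis
    by (rule hcomp_graded_map(1)[OF E.graded_group_gM E.graded_group_gM,
          where s = "\<lambda>k. int m + k" and f = "\<lambda>x. r \<odot>\<^bsub>E\<^esub> x"])
      (use assms gr.piece_carrier[OF assms(2)] in \<open>auto simp: E.smult_r_distr E.gM_smult inj_def\<close>)
qed

lemma hcomp_mult:
  assumes "s \<in> gr m" "r \<in> carrier R"
  shows "hcomp R gr (m + k) (r \<otimes> s) = hcomp R gr k r \<otimes> s"
    and "k < m \<Longrightarrow> hcomp R gr k (r \<otimes> s) = \<zero>"
proof -
  note map = hcomp_graded_map[OF graded_group_gr graded_group_gr,
      where s = "\<lambda>k. m + k" and f = "\<lambda>r. r \<otimes> s"]
  have *: "(\<lambda>r. r \<otimes> s) \<in> carrier R \<rightarrow> carrier R" "\<And>x y. x \<in> carrier R \<Longrightarrow> y \<in> carrier R \<Longrightarrow> (x \<oplus> y) \<otimes> s = x \<otimes> s \<oplus> y \<otimes> s"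
    "\<And>i x. x \<in> gr i \<Longrightarrow> x \<otimes> s \<in> gr (m + i)" "inj (\<lambda>k. m + k)"
    using assms gr.piece_carrier[OF assms(1)] gr_mult[OF _ assms(1)] by (auto simp: l_distr add.commute inj_def)
  show "hcomp R gr (m + k) (r \<otimes> s) = hcomp R gr k r \<otimes> s"
    by (rule map(1)[OF * assms(2)])
  show "hcomp R gr k (r \<otimes> s) = \<zero>" if "k < m"
    by (rule map(2)[OF * assms(2)]) (use that in auto)
qed

text \<open>Homogeneity in the form used below: membership can be tested on components.\<close>

definition hom_ideal :: "'a set \<Rightarrow> bool" where
  "hom_ideal W \<longleftrightarrow> ideal W R \<and> (\<forall>r \<in> W. \<forall>n. hcomp R gr n r \<in> W)"

lemma hom_idealD: "hom_ideal W \<Longrightarrow> ideal W R" "hom_ideal W \<Longrightarrow> r \<in> W \<Longrightarrow> hcomp R gr n r \<in> W"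
  "hom_ideal W \<Longrightarrow> r \<in> W \<Longrightarrow> r \<in> carrier R"
  "hom_ideal W \<Longrightarrow> r \<in> W \<Longrightarrow> s \<in> carrier R \<Longrightarrow> s \<otimes> r \<in> W"
  "hom_ideal W \<Longrightarrow> r \<in> W \<Longrightarrow> s \<in> W \<Longrightarrow> r \<oplus> s \<in> W" "hom_ideal W \<Longrightarrow> \<zero> \<in> W"
  by (auto simp: hom_ideal_def ideal.Icarr ideal.I_l_closed additive_subgroup.a_closed
      additive_subgroup.zero_closed ideal.axioms(1))

text \<open>The elements whose components all lie in the generated ideal form an ideal containing
  \<open>X\<close>; closure under multiplication is checked on homogeneous multipliers.\<close>

lemma hom_ideal_Idl:
  assumes X: "X \<subseteq> (\<Union>n. gr n)"
  shows "hom_ideal (Idl X)"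
proof -
  have Xc: "X \<subseteq> carrier R" using X gr.piece_carrier by blast
  interpret X: ideal "Idl X" R by (rule genideal_ideal[OF Xc])
  let ?K = "{r \<in> carrier R. \<forall>n. hcomp R gr n r \<in> Idl X}"
  have "ideal ?K R"
  proof (rule ideal_if_closed)
    show "r \<oplus> s \<in> ?K" if "r \<in> ?K" "s \<in> ?K" for r s
      using that by (auto simp: gr.hcomp_add X.a_closed)
    show "s \<otimes> r \<in> ?K" if r: "r \<in> ?K" and s: "s \<in> carrier R" for r s
      using s
    proof (induction rule: gr.homogeneous_induct)
      case zero thus ?case using r by simp
    next
      case (piece m a)
      have a: "a \<in> carrier R" using piece gr.piece_carrier by blast
      have "hcomp R gr n (a \<otimes> r) \<in> Idl X" for n
      proof (cases "n < m")
        case True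
        have "hcomp R gr n (r \<otimes> a) = \<zero>" using r hcomp_mult(2)[OF piece _ True] by simp
        thus ?thesis using a r by (simp add: m_comm)
      next
        case False
        have "hcomp R gr (m + (n - m)) (r \<otimes> a) = hcomp R gr (n - m) r \<otimes> a" using r by (intro hcomp_mult(1)[OF piece]) auto
        thus ?thesis using a r False by (simp add: m_comm X.I_l_closed)
      qed
      thus ?case using a r by simp
    next
      case (add x y)
      thus ?case using r by (auto simp: l_distr gr.hcomp_add X.a_closed)
    qed
  qed auto
  moreover have "X \<subseteq> ?K"
  proof
    fix x assume x: "x \<in> X"
    then obtain m where m: "x \<in> gr m" using X by blast
    have "hcomp R gr n x \<in> Idl X" for n
      using gr.hcomp_same[OF m] gr.hcomp_other[OF m, of n] genideal_self[OF Xc] x by (cases "n = m") auto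
    thus "x \<in> ?K" using x Xc by blast
  qed
  ultimately have "Idl X \<subseteq> ?K" by (rule genideal_minimal)
  thus ?thesis unfolding hom_ideal_def using X.is_ideal by blast
qed

lemma homogeneous_ideal_imp: "homogeneous_ideal R gr I \<Longrightarrow> hom_ideal I"
  using hom_ideal_Idl[of "I \<inter> (\<Union>n. gr n)"] unfolding homogeneous_ideal_def by simp

lemma hom_ideal_zero: "hom_ideal {\<zero>}"
  by (auto simp: hom_ideal_def zeroideal)

lemma hom_ideal_carrier: "hom_ideal (carrier R)"
  by (auto simp: hom_ideal_def oneideal)

text \<open>The nonzero components of finitely many generators are finite in number and lie in the
  ideal.\<close>

lemma hom_ideal_finite_generators:
  assumes W: "hom_ideal W"
  shows "\<exists>X. finite X \<and> X \<subseteq> W \<inter> (\<Union>n. gr n) \<and> W = Idl X"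
proof -
  interpret noetherian_ring R by (rule noetherian)
  obtain F where F: "F \<subseteq> carrier R" "finite F" "W = Idl F" using finetely_gen[OF hom_idealD(1)[OF W]] by blast
  let ?X = "\<Union>f \<in> F. (\<lambda>n. hcomp R gr n f) ` {n. hcomp R gr n f \<noteq> \<zero>}"
  have FW: "F \<subseteq> W" using F genideal_self by blast
  have "finite ?X" using F gr.hcomp_finite by blast
  moreover have X: "?X \<subseteq> W \<inter> (\<Union>n. gr n)"
  proof
    fix x assume "x \<in> ?X"
    then obtain f n where f: "f \<in> F" "x = hcomp R gr n f" by blast
    show "x \<in> W \<inter> (\<Union>n. gr n)"
      using hom_idealD(2)[OF W, of f n] gr.hcomp_piece[of f n] f FW F(1) by auto
  qed
  moreover have "W = Idl ?X"
  proof
    show "Idl ?X \<subseteq> W" using genideal_minimal[OF hom_idealD(1)[OF W]] X by blast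
    have Xc: "?X \<subseteq> carrier R" using X gr.piece_carrier by blast
    interpret X: ideal "Idl ?X" R by (rule genideal_ideal[OF Xc])
    have "F \<subseteq> Idl ?X"
    proof
      fix f assume f: "f \<in> F"
      hence fc: "f \<in> carrier R" using F by blast
      have comp: "hcomp R gr n f \<in> Idl ?X" for n
      proof (cases "hcomp R gr n f = \<zero>")
        case False
        hence "hcomp R gr n f \<in> ?X" using f by blast
        thus ?thesis using genideal_self[OF Xc] by blast
      qed (simp add: X.zero_closed)
      show "f \<in> Idl ?X"
        by (rule gr.sum_of_hcomps_induct[where P = "\<lambda>r. r \<in> Idl ?X", OF fc X.zero_closed])
          (rule X.a_closed[OF comp])
    qed
    thus "W \<subseteq> Idl ?X" unfolding F(3) using genideal_minimal[OF X.is_ideal] by blast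
  qed
  ultimately show ?thesis by blast
qed

section \<open>Cyclic extensions of homogeneous ideals\<close>

definition add_generator :: "'a set \<Rightarrow> 'a \<Rightarrow> 'a set" where
  "add_generator W p = {w \<oplus> r \<otimes> p | w r. w \<in> W \<and> r \<in> carrier R}"

text \<open>The factor (W + Rp)/W is R/(W : p) with degrees shifted by the degree of p;
  \<open>add_generator\<close> and \<open>colon\<close> always occur in this pairing.\<close>

definition colon :: "'a set \<Rightarrow> 'a \<Rightarrow> 'a set" where
  "colon W p = {r \<in> carrier R. r \<otimes> p \<in> W}"

lemma hom_ideal_add_generator:
  assumes W: "hom_ideal W" and p: "p \<in> gr m"
  shows "hom_ideal (add_generator W p)" "W \<subseteq> add_generator W p" "p \<in> add_generator W p"
proof -
  note D = hom_idealD[OF W] and pc = gr.piece_carrier[OF p]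
  show incl: "W \<subseteq> add_generator W p"
  proof
    fix w assume w: "w \<in> W"
    hence "w = w \<oplus> \<zero> \<otimes> p" using D(3) pc by simp
    thus "w \<in> add_generator W p" unfolding add_generator_def using w by blast
  qed
  have "p = \<zero> \<oplus> \<one> \<otimes> p" using pc by simp
  thus "p \<in> add_generator W p" unfolding add_generator_def using D(6) by blast
  have "ideal (add_generator W p) R"
  proof (rule ideal_if_closed)
    show "add_generator W p \<subseteq> carrier R" using D(3) pc by (auto simp: add_generator_def)
    show "\<zero> \<in> add_generator W p" using incl D(6) by blast
    fix r assume "r \<in> add_generator W p"
    then obtain w a where r: "r = w \<oplus> a \<otimes> p" "w \<in> W" "a \<in> carrier R" by (auto simp: add_generator_def)
    {
      fix s assume "s \<in> add_generator W p"
      then obtain w' b where s: "s = w' \<oplus> b \<otimes> p" "w' \<in> W" "b \<in> carrier R" by (auto simp: add_generator_def)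
      have "r \<oplus> s = (w \<oplus> w') \<oplus> (a \<oplus> b) \<otimes> p"
        using r s D(3) pc by (simp add: l_distr a_ac)
      thus "r \<oplus> s \<in> add_generator W p" unfolding add_generator_def using r s D(5) by blast
    next
      fix s assume s: "s \<in> carrier R"
      have "s \<otimes> r = s \<otimes> w \<oplus> (s \<otimes> a) \<otimes> p" using r s D(3) pc by (simp add: r_distr m_assoc)
      thus "s \<otimes> r \<in> add_generator W p" unfolding add_generator_def using r s D(4) by blast
    }
  qed
  moreover have "hcomp R gr n r \<in> add_generator W p" if rP: "r \<in> add_generator W p" for r n
  proof -
    obtain w a where r: "r = w \<oplus> a \<otimes> p" "w \<in> W" "a \<in> carrier R" using rP by (auto simp: add_generator_def)
    have e: "hcomp R gr n r = hcomp R gr n w \<oplus> hcomp R gr n (a \<otimes> p)" using r D(3) pc by (simp add: gr.hcomp_add)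
    show ?thesis
    proof (cases "n < m")
      case True
      thus ?thesis using e hcomp_mult(2)[OF p r(3)] D(2)[OF r(2)] D(3) r(2) incl by auto
    next
      case False
      hence "hcomp R gr n (a \<otimes> p) = hcomp R gr (n - m) a \<otimes> p" using hcomp_mult(1)[OF p r(3), of "n - m"] by simp
      moreover have "hcomp R gr (n - m) a \<in> carrier R" using r(3) by simp
      ultimately show ?thesis unfolding add_generator_def using e D(2)[OF r(2)] by auto
    qed
  qed
  ultimately show "hom_ideal (add_generator W p)" unfolding hom_ideal_def by blast
qed

lemma add_generator_minimal:
  assumes "ideal P R" "W \<subseteq> P" "p \<in> P"
  shows "add_generator W p \<subseteq> P"
proof -
  interpret P: ideal P R by fact
  show ?thesis unfolding add_generator_def using assms(2,3) by (auto intro!: P.a_closed P.I_l_closed)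
qed

lemma hom_ideal_colon:
  assumes W: "hom_ideal W" and p: "p \<in> gr m"
  shows "hom_ideal (colon W p)" "W \<subseteq> colon W p"
proof -
  note D = hom_idealD[OF W] and pc = gr.piece_carrier[OF p]
  have "ideal (colon W p) R"
    by (rule ideal_if_closed) (use D(4-6) pc in \<open>auto simp: colon_def l_distr m_assoc\<close>)
  moreover have "hcomp R gr n r \<in> colon W p" if "r \<in> colon W p" for r n
    using that hcomp_mult(1)[OF p, of r n] D(2)[of "r \<otimes> p" "m + n"] by (auto simp: colon_def)
  ultimately show "hom_ideal (colon W p)" unfolding hom_ideal_def by blast
  show "W \<subseteq> colon W p" using D(3,4) pc by (auto simp: colon_def m_comm)
qed

subsection \<open>Shifted copies of homogeneous ideals as test modules\<close>

text \<open>The constant tag \<open>e\<close> places an ideal in the type of the test modules of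
  \<open>graded_injective\<close>.\<close>

definition copy :: "'a set \<Rightarrow> 'e \<Rightarrow> ('a, 'a \<times> 'e) module" where
  "copy K e = \<lparr>carrier = (\<lambda>r. (r, e)) ` K, monoid.mult = undefined, one = undefined,
     ring.zero = (\<zero>, e), add = (\<lambda>x y. (fst x \<oplus> fst y, e)), smult = (\<lambda>r x. (r \<otimes> fst x, e))\<rparr>"

text \<open>Degrees are raised by n, so that the unit of the copy of R sits in degree n; below n
  there is only zero.\<close>

definition copy_grading :: "'a set \<Rightarrow> 'e \<Rightarrow> int \<Rightarrow> int \<Rightarrow> ('a \<times> 'e) set" where
  "copy_grading K e n k = (\<lambda>r. (r, e)) ` (K \<inter> (if n \<le> k then gr (nat (k - n)) else {\<zero>}))"

lemma module_copy:
  assumes "ideal K R"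
  shows "module R (copy K e)"
proof (rule moduleI)
  interpret K: ideal K R by fact
  show "abelian_group (copy K e)"
    by (rule abelian_groupI)
      (auto simp: copy_def K.a_closed K.zero_closed K.a_Hcarr a_ac r_neg l_neg K.a_inv_closed
        intro!: bexI[of _ "\<ominus> x" for x])
qed (use assms in \<open>auto simp: copy_def is_cring ideal.Icarr ideal.I_l_closed l_distr r_distr m_assoc\<close>)

lemma graded_module_copy:
  fixes e :: 'e
  assumes K: "hom_ideal K"
  shows "graded_module R (copy K e) gr (copy_grading K e n)"
proof (intro graded_module.intro graded_module_axioms.intro)
  interpret K: ideal K R by (rule hom_idealD(1)[OF K])
  show M: "module R (copy K e)" by (rule module_copy[OF K.is_ideal])
  interpret M: module R "copy K e" by (rule M)
  have neg: "\<ominus>\<^bsub>copy K e\<^esub> (r, e) = (\<ominus> r, e)" if "r \<in> K" for r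
    using M.M.minus_equality[of "(\<ominus> r, e)" "(r, e)"] that K.a_inv_closed[of r]
    by (auto simp: copy_def K.a_Hcarr l_neg)
  have sub: "additive_subgroup (copy_grading K e n k) (copy K e)" for k
  proof (intro additive_subgroup.intro M.M.add.subgroupI)
    show "copy_grading K e n k \<subseteq> carrier (copy K e)" by (auto simp: copy_grading_def copy_def)
    have "(\<zero>, e) \<in> copy_grading K e n k" using K.zero_closed by (cases "n \<le> k") (auto simp: copy_grading_def)
    thus "copy_grading K e n k \<noteq> {}" by blast
    show "\<ominus>\<^bsub>copy K e\<^esub> x \<in> copy_grading K e n k" if "x \<in> copy_grading K e n k" for x
      using that by (auto simp: copy_grading_def neg K.a_inv_closed gr.piece_neg split: if_splits)
    show "x \<oplus>\<^bsub>copy K e\<^esub> y \<in> copy_grading K e n k" if "x \<in> copy_grading K e n k" "y \<in> copy_grading K e n k" for x y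
      using that by (auto simp: copy_grading_def copy_def K.a_closed gr.piece_add split: if_splits)
  qed
  define p where "p k x = (if n \<le> k then hcomp R gr (nat (k - n)) (fst x) else \<zero>, e)" for k and x :: "'a \<times> 'e"
  show "direct_sum_decomposition (copy K e) (copy_grading K e n)"
  proof (rule direct_sum_decompositionI[where p = p])
    show "abelian_group (copy K e)" by (rule M.M.abelian_group_axioms)
    show "additive_subgroup (copy_grading K e n i) (copy K e)" for i by (rule sub)
    show "p i x \<in> copy_grading K e n i" if "x \<in> carrier (copy K e)" for i x
      using that hom_idealD(2,3)[OF K] gr.hcomp_piece K.zero_closed by (auto simp: p_def copy_grading_def copy_def)
    show "p i (x \<oplus>\<^bsub>copy K e\<^esub> y) = p i x \<oplus>\<^bsub>copy K e\<^esub> p i y"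
      if "x \<in> carrier (copy K e)" "y \<in> carrier (copy K e)" for i x y
      using that by (auto simp: p_def copy_def gr.hcomp_add K.a_Hcarr)
    show "p i x = x" if "x \<in> copy_grading K e n i" for i x
      using that by (auto simp: p_def copy_grading_def gr.hcomp_same split: if_splits)
    show "p j x = \<zero>\<^bsub>copy K e\<^esub>" if "x \<in> copy_grading K e n i" "j \<noteq> i" for i j x
      using that gr.hcomp_other[of "fst x" "nat (i - n)" "nat (j - n)"]
      by (auto simp: p_def copy_grading_def copy_def split: if_splits)
    show "finite {i. p i x \<noteq> \<zero>\<^bsub>copy K e\<^esub>}" if "x \<in> carrier (copy K e)" for x
    proof (rule finite_subset)
      show "{i. p i x \<noteq> \<zero>\<^bsub>copy K e\<^esub>} \<subseteq> (\<lambda>j. int j + n) ` {j. hcomp R gr j (fst x) \<noteq> \<zero>}"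
      proof
        fix i assume "i \<in> {i. p i x \<noteq> \<zero>\<^bsub>copy K e\<^esub>}"
        hence "n \<le> i" "hcomp R gr (nat (i - n)) (fst x) \<noteq> \<zero>" by (auto simp: p_def copy_def split: if_splits)
        thus "i \<in> (\<lambda>j. int j + n) ` {j. hcomp R gr j (fst x) \<noteq> \<zero>}"
          by (intro image_eqI[of _ _ "nat (i - n)"]) auto
      qed
      show "finite ((\<lambda>j. int j + n) ` {j. hcomp R gr j (fst x) \<noteq> \<zero>})"
        using that by (auto simp: copy_def K.a_Hcarr intro!: gr.hcomp_finite)
    qed
    show "x = \<zero>\<^bsub>copy K e\<^esub>" if "x \<in> carrier (copy K e)" "\<And>i. p i x = \<zero>\<^bsub>copy K e\<^esub>" for x
    proof -
      have "hcomp R gr j (fst x) = \<zero>" for j using that(2)[of "int j + n"] by (auto simp: p_def copy_def)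
      moreover have "fst x \<in> carrier R" using that(1) by (auto simp: copy_def K.a_Hcarr)
      ultimately have "fst x = \<zero>" using gr.hcomp_eq_zeroD by blast
      thus ?thesis using that(1) by (auto simp: copy_def)
    qed
  qed
  show "r \<odot>\<^bsub>copy K e\<^esub> x \<in> copy_grading K e n (int m + k)"
    if r: "r \<in> gr m" and x: "x \<in> copy_grading K e n k" for r m x k
  proof -
    have rc: "r \<in> carrier R" using r gr.piece_carrier by blast
    show ?thesis
    proof (cases "n \<le> k")
      case True
      hence "nat (int m + k - n) = m + nat (k - n)" by simp
      thus ?thesis using True x rc gr_mult[OF r] by (auto simp: copy_grading_def copy_def K.I_l_closed)
    next
      case False
      thus ?thesis using x rc K.zero_closed by (auto simp: copy_grading_def copy_def)
    qed
  qed
qed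

text \<open>The element \<open>u\<close> defines a homomorphism \<open>W + Rp \<rightarrow> E\<close> killing \<open>W\<close> and sending \<open>p\<close> to \<open>u\<close>;
  extended to \<open>R\<close> it becomes multiplication with some \<open>y\<close>. No other use of injectivity is made.\<close>

lemma injective_extension_homogeneous:
  fixes E :: "('a, 'e) module"
  assumes E: "graded_module R E gr gE" and inj: "graded_injective R gr E gE"
    and W: "hom_ideal W" and p: "p \<in> gr m" and u: "u \<in> gE (int m + n)"
    and kills: "\<And>r. r \<in> colon W p \<Longrightarrow> r \<odot>\<^bsub>E\<^esub> u = \<zero>\<^bsub>E\<^esub>"
  shows "\<exists>y \<in> gE n. (\<forall>w \<in> W. w \<odot>\<^bsub>E\<^esub> y = \<zero>\<^bsub>E\<^esub>) \<and> p \<odot>\<^bsub>E\<^esub> y = u"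
proof -
  interpret E: graded_module R E gr gE by fact
  let ?e = "undefined :: 'e" and ?P = "add_generator W p"
  note D = hom_idealD[OF W] and pc = gr.piece_carrier[OF p]
  have uc: "u \<in> carrier E" using u E.gM.piece_carrier by blast
  have P: "hom_ideal ?P" "W \<subseteq> ?P" "p \<in> ?P" using hom_ideal_add_generator[OF W p] .
  define A where "A = copy ?P ?e"
  define B where "B = copy (carrier R) ?e"
  \<comment> \<open>A chosen coefficient of p is applied to u. Two possible coefficients differ by
    an element of \<open>colon W p\<close>, which kills u, so \<open>v_eq\<close> can evaluate with
    any of them.\<close>
  define v where "v x = (SOME r. r \<in> carrier R \<and> (\<exists>w \<in> W. fst x = w \<oplus> r \<otimes> p)) \<odot>\<^bsub>E\<^esub> u" for x :: "'a \<times> 'e"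
  have v_eq: "v x = r \<odot>\<^bsub>E\<^esub> u" if "fst x = w \<oplus> r \<otimes> p" "w \<in> W" "r \<in> carrier R" for x w r
  proof -
    define s where "s = (SOME r. r \<in> carrier R \<and> (\<exists>w \<in> W. fst x = w \<oplus> r \<otimes> p))"
    have "r \<in> carrier R \<and> (\<exists>w \<in> W. fst x = w \<oplus> r \<otimes> p)" using that by blast
    from someI[of "\<lambda>r. r \<in> carrier R \<and> (\<exists>w \<in> W. fst x = w \<oplus> r \<otimes> p)", OF this]
    have "s \<in> carrier R \<and> (\<exists>w \<in> W. fst x = w \<oplus> s \<otimes> p)" unfolding s_def .
    then obtain w' where "s \<in> carrier R" "w' \<in> W" "fst x = w' \<oplus> s \<otimes> p" by blast
    note s = this(1,2) this(3)[unfolded that(1)]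
    have wc: "w \<in> carrier R" "w' \<in> carrier R" using D(3) that s by auto
    interpret W: ideal W R by (rule D(1))
    have "s \<otimes> p = \<ominus> w' \<oplus> (w' \<oplus> s \<otimes> p)" using s wc pc by (simp add: a_assoc[symmetric] l_neg)
    also have "\<dots> = \<ominus> w' \<oplus> (w \<oplus> r \<otimes> p)" by (simp only: s(3))
    finally have "(s \<ominus> r) \<otimes> p = (\<ominus> w' \<oplus> (w \<oplus> r \<otimes> p)) \<oplus> \<ominus> (r \<otimes> p)"
      using s(1) that(3) pc by (simp add: a_minus_def l_distr l_minus)
    also have "\<dots> = (\<ominus> w' \<oplus> w) \<oplus> (r \<otimes> p \<oplus> \<ominus> (r \<otimes> p))"
      using that(3) wc pc by (simp add: a_assoc)
    also have "\<dots> = w \<oplus> \<ominus> w'" using that(3) wc pc by (simp add: r_neg a_comm)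
    also have "\<dots> \<in> W" using that s by (intro W.a_closed W.a_inv_closed)
    finally have "s \<ominus> r \<in> colon W p" using s(1) that(3) by (simp add: colon_def)
    hence "(s \<ominus> r) \<odot>\<^bsub>E\<^esub> u = \<zero>\<^bsub>E\<^esub>" by (rule kills)
    moreover have "(s \<ominus> r) \<odot>\<^bsub>E\<^esub> u = s \<odot>\<^bsub>E\<^esub> u \<ominus>\<^bsub>E\<^esub> r \<odot>\<^bsub>E\<^esub> u"
      unfolding a_minus_def
      using E.smult_l_distr[OF s(1) a_inv_closed[OF that(3)] uc] E.smult_l_minus[OF that(3) uc] by (simp only:)
    ultimately have "s \<odot>\<^bsub>E\<^esub> u \<ominus>\<^bsub>E\<^esub> r \<odot>\<^bsub>E\<^esub> u = \<zero>\<^bsub>E\<^esub>" by simp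
    hence "s \<odot>\<^bsub>E\<^esub> u = r \<odot>\<^bsub>E\<^esub> u" using E.M.minus_eq_zeroD[OF E.smult_closed[OF s(1) uc] E.smult_closed[OF that(3) uc]] by blast
    thus ?thesis unfolding v_def s_def .
  qed
  have A_elem: "\<exists>w r. fst x = w \<oplus> r \<otimes> p \<and> w \<in> W \<and> r \<in> carrier R" if "x \<in> carrier A" for x
  proof -
    have "fst x \<in> ?P" using that by (auto simp: A_def copy_def)
    thus ?thesis unfolding add_generator_def by blast
  qed
  have "v \<in> graded_hom R A (copy_grading ?P ?e n) E gE"
    unfolding graded_hom_def module_hom_def
  proof (intro CollectI conjI ballI allI image_subsetI)
    show "v \<in> carrier A \<rightarrow> carrier E"
    proof
      fix x assume "x \<in> carrier A"
      then obtain w r where "fst x = w \<oplus> r \<otimes> p" "w \<in> W" "r \<in> carrier R" using A_elem by blast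
      thus "v x \<in> carrier E" using v_eq uc by auto
    qed
    fix x assume "x \<in> carrier A"
    then obtain w r where x: "fst x = w \<oplus> r \<otimes> p" "w \<in> W" "r \<in> carrier R" using A_elem by blast
    {
      fix y assume "y \<in> carrier A"
      then obtain w' s where y: "fst y = w' \<oplus> s \<otimes> p" "w' \<in> W" "s \<in> carrier R" using A_elem by blast
      have "fst (x \<oplus>\<^bsub>A\<^esub> y) = (w \<oplus> w') \<oplus> (r \<oplus> s) \<otimes> p"
        using x y D(3) pc by (simp add: A_def copy_def l_distr a_ac)
      from v_eq[OF this D(5)] show "v (x \<oplus>\<^bsub>A\<^esub> y) = v x \<oplus>\<^bsub>E\<^esub> v y"
        using x y uc v_eq[OF x] v_eq[OF y] by (simp add: E.smult_l_distr)
    next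
      fix s assume s: "s \<in> carrier R"
      have "fst (s \<odot>\<^bsub>A\<^esub> x) = s \<otimes> w \<oplus> (s \<otimes> r) \<otimes> p"
        using x s D(3) pc by (simp add: A_def copy_def r_distr m_assoc)
      from v_eq[OF this D(4)] show "v (s \<odot>\<^bsub>A\<^esub> x) = s \<odot>\<^bsub>E\<^esub> v x"
        using x s uc v_eq[OF x] by (simp add: E.smult_assoc1)
    }
  next
    fix k x assume x: "x \<in> copy_grading ?P ?e n k"
    then obtain q where q: "x = (q, ?e)" "q \<in> ?P" "q \<in> (if n \<le> k then gr (nat (k - n)) else {\<zero>})"
      by (auto simp: copy_grading_def)
    show "v x \<in> gE k"
    proof (cases "n \<le> k")
      case False
      have "fst x = \<zero> \<oplus> \<zero> \<otimes> p" using q False pc by simp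
      from v_eq[OF this] show ?thesis using D(6) uc by simp
    next
      case True
      let ?j = "nat (k - n)"
      obtain w r where wr: "q = w \<oplus> r \<otimes> p" "w \<in> W" "r \<in> carrier R" using q(2) by (auto simp: add_generator_def)
      have "q = hcomp R gr ?j q" using q True gr.hcomp_same by simp
      also have "\<dots> = hcomp R gr ?j w \<oplus> hcomp R gr ?j (r \<otimes> p)"
        using wr D(3) pc by (simp add: gr.hcomp_add)
      finally have e: "fst x = hcomp R gr ?j w \<oplus> hcomp R gr ?j (r \<otimes> p)" using q by simp
      show ?thesis
      proof (cases "?j < m")
        case True
        hence "fst x = hcomp R gr ?j w \<oplus> \<zero> \<otimes> p" using e hcomp_mult(2)[OF p wr(3)] pc by simp
        from v_eq[OF this D(2)[OF wr(2)]] show ?thesis using uc by simp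
      next
        case False
        hence "fst x = hcomp R gr ?j w \<oplus> hcomp R gr (?j - m) r \<otimes> p"
          using e hcomp_mult(1)[OF p wr(3), of "?j - m"] by simp
        from v_eq[OF this D(2)[OF wr(2)]] have "v x = hcomp R gr (?j - m) r \<odot>\<^bsub>E\<^esub> u" using wr by simp
        moreover have "hcomp R gr (?j - m) r \<odot>\<^bsub>E\<^esub> u \<in> gE (int (?j - m) + (int m + n))"
          using u wr by (intro E.gM_smult gr.hcomp_piece)
        moreover have "int (?j - m) + (int m + n) = k" using False True by simp
        ultimately show ?thesis by simp
      qed
    qed
  qed
  moreover have "(\<lambda>x. x) \<in> graded_hom R A (copy_grading ?P ?e n) B (copy_grading (carrier R) ?e n)"
    using hom_idealD(3)[OF P(1)]
    by (auto simp: graded_hom_def module_hom_def A_def B_def copy_def copy_grading_def)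
  moreover have "graded_module R A gr (copy_grading ?P ?e n)" "graded_module R B gr (copy_grading (carrier R) ?e n)"
    unfolding A_def B_def by (intro graded_module_copy P(1) hom_ideal_carrier)+
  ultimately obtain f where f: "f \<in> graded_hom R B (copy_grading (carrier R) ?e n) E gE" "\<forall>x \<in> carrier A. f x = v x"
    using inj[unfolded graded_injective_def, rule_format, of A "copy_grading ?P ?e n" B
        "copy_grading (carrier R) ?e n" "\<lambda>x. x" v] by auto
  have fh: "f \<in> module_hom R B E" using f by (auto simp: graded_hom_def)
  \<comment> \<open>A homomorphism from R is multiplication with the image of 1, which has degree n
    by the choice of the grading.\<close>
  let ?y = "f (\<one>, ?e)"
  have "(\<one>, ?e) \<in> copy_grading (carrier R) ?e n n" using gr_one by (auto simp: copy_grading_def)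
  hence yn: "?y \<in> gE n" using f(1) by (auto simp: graded_hom_def)
  have mult: "r \<odot>\<^bsub>E\<^esub> ?y = v (r, ?e)" if "r \<in> ?P" for r
  proof -
    have rc: "r \<in> carrier R" using that hom_idealD(3)[OF P(1)] by blast
    have "f (r \<odot>\<^bsub>B\<^esub> (\<one>, ?e)) = r \<odot>\<^bsub>E\<^esub> ?y"
      using rc by (intro module_homD(3)[OF fh]) (auto simp: B_def copy_def)
    moreover have "r \<odot>\<^bsub>B\<^esub> (\<one>, ?e) = (r, ?e)" using rc by (simp add: B_def copy_def)
    moreover have "(r, ?e) \<in> carrier A" using that by (auto simp: A_def copy_def)
    ultimately show ?thesis using f(2) by metis
  qed
  have "w \<odot>\<^bsub>E\<^esub> ?y = \<zero>\<^bsub>E\<^esub>" if w: "w \<in> W" for w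
  proof -
    have "fst (w, ?e) = w \<oplus> \<zero> \<otimes> p" using w D(3) pc by simp
    from v_eq[OF this w] show ?thesis using mult[of w] w P(2) uc by auto
  qed
  moreover have "p \<odot>\<^bsub>E\<^esub> ?y = u"
  proof -
    have "fst (p, ?e) = \<zero> \<oplus> \<one> \<otimes> p" using pc by simp
    from v_eq[OF this] show ?thesis using mult[OF P(3)] D(6) uc by auto
  qed
  ultimately show ?thesis using yn by blast
qed

text \<open>For components r_j of r and x_k of x, the product r_j x_k is a component of r_j x, which
  vanishes because r_j is again in W.\<close>

lemma killed_hcomp:
  assumes E: "graded_module R E gr gE" and W: "hom_ideal W" and x: "x \<in> carrier E"
    and kills: "\<And>r. r \<in> W \<Longrightarrow> r \<odot>\<^bsub>E\<^esub> x = \<zero>\<^bsub>E\<^esub>" and r: "r \<in> W"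
  shows "r \<odot>\<^bsub>E\<^esub> hcomp E gE k x = \<zero>\<^bsub>E\<^esub>"
proof -
  interpret E: graded_module R E gr gE by fact
  have rc: "r \<in> carrier R" using hom_idealD(3)[OF W r] .
  have "hcomp R gr j r \<odot>\<^bsub>E\<^esub> hcomp E gE k x = \<zero>\<^bsub>E\<^esub>" for j
    using hcomp_smult[OF E gr.hcomp_piece[OF rc] x, of j k] kills[OF hom_idealD(2)[OF W r]] by simp
  thus ?thesis
    using x rc
    by (intro gr.sum_of_hcomps_induct[where P = "\<lambda>r. r \<odot>\<^bsub>E\<^esub> hcomp E gE k x = \<zero>\<^bsub>E\<^esub>" and x = r])
      (simp_all add: E.smult_l_distr)
qed

text \<open>The components of u are killed by the homogeneous ideal W : p as well; they are lifted
  one by one and the lifts are added.\<close>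

lemma injective_extension:
  fixes E :: "('a, 'e) module"
  assumes E: "graded_module R E gr gE" and inj: "graded_injective R gr E gE"
    and W: "hom_ideal W" and p: "p \<in> gr m" and u: "u \<in> carrier E"
    and kills: "\<And>r. r \<in> colon W p \<Longrightarrow> r \<odot>\<^bsub>E\<^esub> u = \<zero>\<^bsub>E\<^esub>"
  shows "\<exists>y \<in> carrier E. (\<forall>w \<in> W. w \<odot>\<^bsub>E\<^esub> y = \<zero>\<^bsub>E\<^esub>) \<and> p \<odot>\<^bsub>E\<^esub> y = u"
proof -
  interpret E: graded_module R E gr gE by fact
  have pc: "p \<in> carrier R" using gr.piece_carrier[OF p] .
  note D = hom_idealD[OF W]
  have "\<exists>y \<in> carrier E. (\<forall>w \<in> W. w \<odot>\<^bsub>E\<^esub> y = \<zero>\<^bsub>E\<^esub>) \<and> p \<odot>\<^bsub>E\<^esub> y = hcomp E gE k u" for k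
  proof -
    have "\<exists>y \<in> gE (k - int m). (\<forall>w \<in> W. w \<odot>\<^bsub>E\<^esub> y = \<zero>\<^bsub>E\<^esub>) \<and> p \<odot>\<^bsub>E\<^esub> y = hcomp E gE k u"
      using E.gM.hcomp_piece[OF u, of k] killed_hcomp[OF E hom_ideal_colon(1)[OF W p] u kills]
      by (intro injective_extension_homogeneous[OF E inj W p]) auto
    thus ?thesis using E.gM.piece_carrier by blast
  qed
  note comps = this
  show ?thesis
  proof (rule E.gM.sum_of_hcomps_induct[where x = u and P = "\<lambda>u. \<exists>y \<in> carrier E. (\<forall>w \<in> W. w \<odot>\<^bsub>E\<^esub> y = \<zero>\<^bsub>E\<^esub>) \<and> p \<odot>\<^bsub>E\<^esub> y = u", OF u])
    show "\<exists>y \<in> carrier E. (\<forall>w \<in> W. w \<odot>\<^bsub>E\<^esub> y = \<zero>\<^bsub>E\<^esub>) \<and> p \<odot>\<^bsub>E\<^esub> y = \<zero>\<^bsub>E\<^esub>"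
      using pc D(3) by (intro bexI[of _ "\<zero>\<^bsub>E\<^esub>"]) auto
    fix k z assume "\<exists>y \<in> carrier E. (\<forall>w \<in> W. w \<odot>\<^bsub>E\<^esub> y = \<zero>\<^bsub>E\<^esub>) \<and> p \<odot>\<^bsub>E\<^esub> y = z"
    then obtain y where y: "y \<in> carrier E" "\<forall>w \<in> W. w \<odot>\<^bsub>E\<^esub> y = \<zero>\<^bsub>E\<^esub>" "p \<odot>\<^bsub>E\<^esub> y = z" by blast
    from comps[of k] obtain y' where y': "y' \<in> carrier E" "\<forall>w \<in> W. w \<odot>\<^bsub>E\<^esub> y' = \<zero>\<^bsub>E\<^esub>" "p \<odot>\<^bsub>E\<^esub> y' = hcomp E gE k u"
      by blast
    show "\<exists>y \<in> carrier E. (\<forall>w \<in> W. w \<odot>\<^bsub>E\<^esub> y = \<zero>\<^bsub>E\<^esub>) \<and> p \<odot>\<^bsub>E\<^esub> y = hcomp E gE k u \<oplus>\<^bsub>E\<^esub> z"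
      using y y' pc D(3) by (intro bexI[of _ "y' \<oplus>\<^bsub>E\<^esub> y"]) (auto simp: E.smult_r_distr)
  qed
qed

end

section \<open>Noetherian subquotients\<close>

text \<open>The Noetherian property of Z/B: submodules between B and Z are finitely generated modulo
  B.\<close>

definition noetherian_quotient :: "('r, 'm, 'y) module_scheme \<Rightarrow> 'r set \<Rightarrow> 'm set \<Rightarrow> 'm set \<Rightarrow> bool" where
  "noetherian_quotient M A Z B \<longleftrightarrow>
     (\<forall>S. operator_subgroup M A S \<and> B \<subseteq> S \<and> S \<subseteq> Z \<longrightarrow>
        (\<exists>F. finite F \<and> F \<subseteq> S \<and> S \<subseteq> operator_span M A (F \<union> B)))"

lemma noetherian_quotientE:
  assumes "noetherian_quotient M A Z B" "operator_subgroup M A S" "B \<subseteq> S" "S \<subseteq> Z"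
  obtains F where "finite F" "F \<subseteq> S" "S \<subseteq> operator_span M A (F \<union> B)"
proof -
  have "\<exists>F. finite F \<and> F \<subseteq> S \<and> S \<subseteq> operator_span M A (F \<union> B)"
    using assms(2-) assms(1)[unfolded noetherian_quotient_def, rule_format, of S] by simp
  thus thesis using that by (elim exE conjE)
qed

context module
begin

lemma sum_submodule:
  assumes S: "is_submodule S" and T: "is_submodule T"
  shows "is_submodule {s \<oplus>\<^bsub>M\<^esub> t | s t. s \<in> S \<and> t \<in> T}"
proof -
  have "{s \<oplus>\<^bsub>M\<^esub> t | s t. s \<in> S \<and> t \<in> T} = add_multiples M T S \<one>"
  proof -
    have "\<one> \<odot>\<^bsub>M\<^esub> t = t" if "t \<in> T" for t using operator_subgroupD(2)[OF T that] by simp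
    thus ?thesis unfolding add_multiples_def by (metis (no_types, lifting))
  qed
  thus ?thesis using add_multiples_submodule[OF S T] by simp
qed

lemma operator_span_union:
  assumes F: "F \<subseteq> carrier M" and B: "is_submodule B" and x: "x \<in> operator_span M (carrier R) (F \<union> B)"
  shows "\<exists>f \<in> operator_span M (carrier R) F. \<exists>b \<in> B. x = f \<oplus>\<^bsub>M\<^esub> b"
proof -
  let ?U = "{s \<oplus>\<^bsub>M\<^esub> t | s t. s \<in> operator_span M (carrier R) F \<and> t \<in> B}"
  note FS = operator_span_subgroup[OF F subset_refl]
  have U: "is_submodule ?U" by (rule sum_submodule[OF FS B])
  have "F \<union> B \<subseteq> ?U"
  proof
    fix x assume "x \<in> F \<union> B"
    thus "x \<in> ?U"
    proof
      assume "x \<in> F"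
      hence "x = x \<oplus>\<^bsub>M\<^esub> \<zero>\<^bsub>M\<^esub>" "x \<in> operator_span M (carrier R) F" using F by (auto intro: operator_span.incl)
      thus ?thesis using operator_subgroupD(3)[OF B] by blast
    next
      assume "x \<in> B"
      hence "x = \<zero>\<^bsub>M\<^esub> \<oplus>\<^bsub>M\<^esub> x" using operator_subgroupD(2)[OF B] by simp
      thus ?thesis using \<open>x \<in> B\<close> operator_subgroupD(3)[OF FS] by blast
    qed
  qed
  thus ?thesis using operator_span_minimal[OF U] x by blast
qed

end

lemma operator_span_hom_image:
  assumes "module R M" "module R N" and f: "f \<in> module_hom R M N" and F: "F \<subseteq> carrier M"
    and x: "x \<in> operator_span M (carrier R) F"
  shows "f x \<in> operator_span N (carrier R) (f ` F)"
proof -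
  interpret M: module R M by fact
  interpret N: module R N by fact
  note h = module_homD[OF f]
  have f0: "f \<zero>\<^bsub>M\<^esub> = \<zero>\<^bsub>N\<^esub>"
    using h(3)[of "\<zero>\<^bsub>R\<^esub>" "\<zero>\<^bsub>M\<^esub>"] h(1)[of "\<zero>\<^bsub>M\<^esub>"] by simp
  have neg: "f (\<ominus>\<^bsub>M\<^esub> x) = \<ominus>\<^bsub>N\<^esub> f x" if "x \<in> carrier M" for x
  proof -
    have "f (\<ominus>\<^bsub>M\<^esub> x) \<oplus>\<^bsub>N\<^esub> f x = \<zero>\<^bsub>N\<^esub>" using h(2)[of "\<ominus>\<^bsub>M\<^esub> x" x] that f0 by (simp add: M.M.l_neg)
    thus ?thesis using N.M.minus_equality h(1) that by (metis M.M.a_inv_closed)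
  qed
  have "x \<in> carrier M \<and> f x \<in> operator_span N (carrier R) (f ` F)"
    using x
  proof induction
    case zero thus ?case by (simp add: f0 operator_span.zero)
  next
    case (incl x) thus ?case using F by (auto intro: operator_span.incl)
  next
    case (neg x) thus ?case using \<open>\<And>x. x \<in> carrier M \<Longrightarrow> f (\<ominus>\<^bsub>M\<^esub> x) = _\<close> by (simp add: operator_span.neg)
  next
    case (add x y) thus ?case using h(2) by (simp add: operator_span.add)
  next
    case (smult a x) thus ?case using h(3) by (simp add: operator_span.smult)
  qed
  thus ?thesis by blast
qed

text \<open>By \<open>fB\<close>, f embeds Z/B into Z'/B'. Generators of the image of S modulo B'
  can be taken in that image, and their lifts generate S modulo B.\<close>

lemma noetherian_quotient_reflect:
  assumes M: "module R M" and N: "module R N" and f: "f \<in> module_hom R M N"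
    and Z: "Z \<subseteq> carrier M" and Z': "operator_subgroup N (carrier R) Z'" and B: "B \<subseteq> carrier M"
    and B': "operator_subgroup N (carrier R) B'" "B' \<subseteq> Z'"
    and noeth: "noetherian_quotient N (carrier R) Z' B'"
    and fZ: "\<And>z. z \<in> Z \<Longrightarrow> f z \<in> Z'" and fB: "\<And>z. z \<in> Z \<Longrightarrow> f z \<in> B' \<Longrightarrow> z \<in> B"
  shows "noetherian_quotient M (carrier R) Z B"
  unfolding noetherian_quotient_def
proof (intro allI impI, elim conjE)
  interpret M: module R M by fact
  interpret N: module R N by fact
  note h = module_homD[OF f]
  fix S assume S: "operator_subgroup M (carrier R) S" "B \<subseteq> S" "S \<subseteq> Z"
  note Sc = M.operator_subgroupD[OF S(1)]
  have fS: "f ` S \<subseteq> carrier N" using h(1) Sc(2) by blast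
  let ?S' = "operator_span N (carrier R) (f ` S \<union> B')"
  have carr: "f ` S \<union> B' \<subseteq> carrier N" using fS N.operator_subgroupD(1)[OF B'(1)] by blast
  have "f ` S \<union> B' \<subseteq> Z'" using fZ S(3) B'(2) by blast
  hence S'Z: "?S' \<subseteq> Z'" by (rule N.operator_span_minimal[OF Z'])
  have "B' \<subseteq> ?S'" by (auto intro: operator_span.incl)
  then obtain G where G: "finite G" "G \<subseteq> ?S'" "?S' \<subseteq> operator_span N (carrier R) (G \<union> B')"
    using S'Z by (rule noetherian_quotientE[OF noeth N.operator_span_subgroup[OF carr subset_refl]])
  obtain H where H: "finite H" "H \<subseteq> f ` S \<union> B'" "G \<subseteq> operator_span N (carrier R) H"
    using operator_span_finite_support[OF G(1,2)] by blast
  obtain F where F: "finite F" "F \<subseteq> S" "H \<subseteq> f ` F \<union> B'"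
  proof -
    have "finite (H \<inter> f ` S)" "H \<inter> f ` S \<subseteq> f ` S" using H by auto
    then obtain F where F: "F \<subseteq> S" "finite F" "H \<inter> f ` S = f ` F" by (meson finite_subset_image)
    have "H \<subseteq> f ` F \<union> B'" using H(2) F(3) by blast
    thus thesis using that F(1,2) by blast
  qed
  have Fc: "F \<subseteq> carrier M" using F(2) Sc(1) by blast
  have fFc: "f ` F \<subseteq> carrier N" using h(1) Fc by blast
  have fFB: "f ` F \<union> B' \<subseteq> carrier N" using fFc N.operator_subgroupD(1)[OF B'(1)] by blast
  have "H \<subseteq> operator_span N (carrier R) (f ` F \<union> B')" using F(3) by (auto intro: operator_span.incl)
  hence "operator_span N (carrier R) H \<subseteq> operator_span N (carrier R) (f ` F \<union> B')"
    by (rule N.operator_span_minimal[OF N.operator_span_subgroup[OF fFB subset_refl]])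
  hence "G \<union> B' \<subseteq> operator_span N (carrier R) (f ` F \<union> B')" using G(3) H(3) by (auto intro: operator_span.incl)
  hence span: "?S' \<subseteq> operator_span N (carrier R) (f ` F \<union> B')"
    using N.operator_span_minimal[OF N.operator_span_subgroup[OF fFB subset_refl]] G(3) by blast
  have "S \<subseteq> operator_span M (carrier R) (F \<union> B)"
  proof
    fix s assume s: "s \<in> S"
    have "f s \<in> ?S'" using s by (auto intro: operator_span.incl)
    then obtain g b where g: "g \<in> operator_span N (carrier R) (f ` F)" "b \<in> B'" "f s = g \<oplus>\<^bsub>N\<^esub> b"
      using span N.operator_span_union[OF fFc B'(1)] by blast
    have "operator_span N (carrier R) (f ` F) \<subseteq> f ` operator_span M (carrier R) F"
    proof (rule N.operator_span_minimal)
      let ?U = "operator_span M (carrier R) F"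
      note U = M.operator_subgroupD[OF M.operator_span_subgroup[OF Fc subset_refl]]
      show "f ` F \<subseteq> f ` ?U" by (auto intro: operator_span.incl)
      have sm: "a \<odot>\<^bsub>N\<^esub> x \<in> f ` ?U" if "a \<in> carrier R" "x \<in> f ` ?U" for a x
        using that h(3) U(2,7) by (auto simp flip: h(3))
      show "operator_subgroup N (carrier R) (f ` ?U)"
      proof (rule N.operator_subgroupI)
        show "f ` ?U \<subseteq> carrier N" using h(1) U(2) by blast
        show "\<zero>\<^bsub>N\<^esub> \<in> f ` ?U"
          using sm[of "\<zero>\<^bsub>R\<^esub>" "f \<zero>\<^bsub>M\<^esub>"] U(3) h(1)[OF U(2)[OF U(3)]] by simp
        show "\<ominus>\<^bsub>N\<^esub> x \<in> f ` ?U" if "x \<in> f ` ?U" for x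
          using sm[of "\<ominus>\<^bsub>R\<^esub> \<one>\<^bsub>R\<^esub>" x] that h(1) U(2) by (auto simp: N.smult_l_minus)
        show "x \<oplus>\<^bsub>N\<^esub> y \<in> f ` ?U" if "x \<in> f ` ?U" "y \<in> f ` ?U" for x y
          using that U(2,5) by (auto simp flip: h(2))
      qed (rule sm)
    qed
    then obtain t where t: "t \<in> operator_span M (carrier R) F" "g = f t" using g(1) by blast
    have tS: "t \<in> S" using M.operator_span_minimal[OF S(1) F(2)] t(1) by blast
    have tc: "t \<in> carrier M" and sc: "s \<in> carrier M" using Sc(2) s tS by auto
    have st: "s \<ominus>\<^bsub>M\<^esub> t \<in> S" using Sc(6)[OF s tS] .
    have "f ((s \<ominus>\<^bsub>M\<^esub> t) \<oplus>\<^bsub>M\<^esub> t) = f (s \<ominus>\<^bsub>M\<^esub> t) \<oplus>\<^bsub>N\<^esub> f t" using h(2)[of "s \<ominus>\<^bsub>M\<^esub> t" t] sc tc by simp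
    hence "f (s \<ominus>\<^bsub>M\<^esub> t) \<oplus>\<^bsub>N\<^esub> g = b \<oplus>\<^bsub>N\<^esub> g"
      using g(3) t(2) sc tc h(1)[OF tc] N.operator_subgroupD(2)[OF B'(1) g(2)]
      by (simp add: M.minus_plus_cancel N.M.a_comm)
    hence "f (s \<ominus>\<^bsub>M\<^esub> t) = b"
      using h(1) sc tc t(2) N.operator_subgroupD(2)[OF B'(1) g(2)] by simp
    hence "s \<ominus>\<^bsub>M\<^esub> t \<in> B" using fB[of "s \<ominus>\<^bsub>M\<^esub> t"] st S(3) g(2) by auto
    hence "(s \<ominus>\<^bsub>M\<^esub> t) \<oplus>\<^bsub>M\<^esub> t \<in> operator_span M (carrier R) (F \<union> B)"
      using t(1) operator_span_mono[of F "F \<union> B" "carrier R" "carrier R" M]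
      by (intro operator_span.add) (auto intro: operator_span.incl)
    thus "s \<in> operator_span M (carrier R) (F \<union> B)" using sc tc by (simp add: M.minus_plus_cancel)
  qed
  thus "\<exists>F. finite F \<and> F \<subseteq> S \<and> S \<subseteq> operator_span M (carrier R) (F \<union> B)" using F by blast
qed

text \<open>Z'/B' is covered by the image of Z/B: generators of the preimage of S are pushed
  forward.\<close>

lemma noetherian_quotient_image:
  assumes M: "module R M" and N: "module R N" and f: "f \<in> module_hom R M N"
    and Z: "operator_subgroup M (carrier R) Z" and B: "B \<subseteq> Z" and B': "B' \<subseteq> carrier N"
    and noeth: "noetherian_quotient M (carrier R) Z B"
    and fZ: "Z' \<subseteq> f ` Z" and fB: "f ` B \<subseteq> B'"
  shows "noetherian_quotient N (carrier R) Z' B'"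
  unfolding noetherian_quotient_def
proof (intro allI impI, elim conjE)
  interpret M: module R M by fact
  interpret N: module R N by fact
  note h = module_homD[OF f] and Zc = M.operator_subgroupD[OF Z]
  fix S assume S: "operator_subgroup N (carrier R) S" "B' \<subseteq> S" "S \<subseteq> Z'"
  note Sc = N.operator_subgroupD[OF S(1)]
  let ?T = "{z \<in> Z. f z \<in> S}"
  have sm: "a \<odot>\<^bsub>M\<^esub> x \<in> ?T" if "a \<in> carrier R" "x \<in> ?T" for a x
    using that Zc(2,7) Sc(7) by (auto simp: h(3))
  have "operator_subgroup M (carrier R) ?T"
  proof (rule M.operator_subgroupI)
    show "?T \<subseteq> carrier M" using Zc(2) by blast
    have "f (\<zero>\<^bsub>R\<^esub> \<odot>\<^bsub>M\<^esub> \<zero>\<^bsub>M\<^esub>) = \<zero>\<^bsub>N\<^esub>" using h(1)[of "\<zero>\<^bsub>M\<^esub>"] by (subst h(3)) auto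
    thus "\<zero>\<^bsub>M\<^esub> \<in> ?T" using Zc(3) Sc(3) by simp
    show "\<ominus>\<^bsub>M\<^esub> x \<in> ?T" if "x \<in> ?T" for x
      using sm[of "\<ominus>\<^bsub>R\<^esub> \<one>\<^bsub>R\<^esub>" x] that Zc(2) by (simp add: M.smult_l_minus)
    show "x \<oplus>\<^bsub>M\<^esub> y \<in> ?T" if "x \<in> ?T" "y \<in> ?T" for x y
      using that Zc(2,5) Sc(5) by (auto simp: h(2))
  qed (rule sm)
  moreover have "B \<subseteq> ?T" using B fB S(2) by blast
  moreover have "?T \<subseteq> Z" by blast
  ultimately obtain F where F: "finite F" "F \<subseteq> ?T" "?T \<subseteq> operator_span M (carrier R) (F \<union> B)"
    by (rule noetherian_quotientE[OF noeth])
  have FB: "F \<union> B \<subseteq> carrier M" using F(2) B Zc(1) by blast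
  have "S \<subseteq> operator_span N (carrier R) (f ` F \<union> B')"
  proof
    fix s assume s: "s \<in> S"
    then obtain z where z: "z \<in> Z" "s = f z" using S(3) fZ by blast
    hence "z \<in> operator_span M (carrier R) (F \<union> B)" using s F(3) by blast
    from operator_span_hom_image[OF M N f FB this] have "s \<in> operator_span N (carrier R) (f ` (F \<union> B))"
      using z by simp
    moreover have "f ` (F \<union> B) \<subseteq> f ` F \<union> B'" using fB by blast
    ultimately show "s \<in> operator_span N (carrier R) (f ` F \<union> B')" using operator_span_mono by blast
  qed
  moreover have "f ` F \<subseteq> S" using F(2) by blast
  ultimately show "\<exists>F. finite F \<and> F \<subseteq> S \<and> S \<subseteq> operator_span N (carrier R) (F \<union> B')"
    using F(1) by blast
qed

section \<open>Elementwise Ext modules in a graded injective resolution\<close>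

text \<open>The resolution with indices raised by one: \<open>E 0\<close> is zero and
  \<open>E (Suc i)\<close> is the i-th injective term. The kernel in \<open>E (Suc 0)\<close> stands
  for M, hence \<open>exact\<close> begins at the next index. Injectivity enters in the form
  \<open>extension\<close>.\<close>

locale injective_complex = standard_graded_ring R gr for R (structure) and gr +
  fixes E :: "nat \<Rightarrow> ('a, 'e) module" and gE :: "nat \<Rightarrow> int \<Rightarrow> 'e set" and d :: "nat \<Rightarrow> 'e \<Rightarrow> 'e"
  assumes E_graded: "graded_module R (E i) gr (gE i)"
    and d_graded_hom: "d i \<in> graded_hom R (E i) (gE i) (E (Suc i)) (gE (Suc i))"
    and E_0: "carrier (E 0) = {\<zero>\<^bsub>E 0\<^esub>}"
    and d_d: "x \<in> carrier (E i) \<Longrightarrow> d (Suc i) (d i x) = \<zero>\<^bsub>E (Suc (Suc i))\<^esub>"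
    and exact: "x \<in> carrier (E (Suc (Suc i))) \<Longrightarrow> d (Suc (Suc i)) x = \<zero>\<^bsub>E (Suc (Suc (Suc i)))\<^esub> \<Longrightarrow>
      \<exists>y \<in> carrier (E (Suc i)). d (Suc i) y = x"
    and extension: "hom_ideal W \<Longrightarrow> p \<in> gr m \<Longrightarrow> u \<in> carrier (E i) \<Longrightarrow>
      (\<And>r. r \<in> colon W p \<Longrightarrow> r \<odot>\<^bsub>E i\<^esub> u = \<zero>\<^bsub>E i\<^esub>) \<Longrightarrow>
      \<exists>y \<in> carrier (E i). (\<forall>w \<in> W. w \<odot>\<^bsub>E i\<^esub> y = \<zero>\<^bsub>E i\<^esub>) \<and> p \<odot>\<^bsub>E i\<^esub> y = u"
    and noetherian_kernel: "noetherian_over (E (Suc 0)) (carrier R)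
      {x \<in> carrier (E (Suc 0)). d (Suc 0) x = \<zero>\<^bsub>E (Suc (Suc 0))\<^esub>}"
begin

sublocale E: graded_module R "E i" gr "gE i" for i
  by (rule E_graded)

lemma d_hom: "d i \<in> module_hom R (E i) (E (Suc i))"
  using d_graded_hom by (simp add: graded_hom_def)

lemma d_closed [simp]: "x \<in> carrier (E i) \<Longrightarrow> d i x \<in> carrier (E (Suc i))"
  and d_add: "x \<in> carrier (E i) \<Longrightarrow> y \<in> carrier (E i) \<Longrightarrow> d i (x \<oplus>\<^bsub>E i\<^esub> y) = d i x \<oplus>\<^bsub>E (Suc i)\<^esub> d i y"
  and d_smult: "r \<in> carrier R \<Longrightarrow> x \<in> carrier (E i) \<Longrightarrow> d i (r \<odot>\<^bsub>E i\<^esub> x) = r \<odot>\<^bsub>E (Suc i)\<^esub> d i x"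
  using module_homD[OF d_hom] by auto

lemma d_zero [simp]: "d i \<zero>\<^bsub>E i\<^esub> = \<zero>\<^bsub>E (Suc i)\<^esub>"
  using d_smult[of \<zero> "\<zero>\<^bsub>E i\<^esub>" i] d_closed[of "\<zero>\<^bsub>E i\<^esub>" i] by simp

lemma d_neg: "x \<in> carrier (E i) \<Longrightarrow> d i (\<ominus>\<^bsub>E i\<^esub> x) = \<ominus>\<^bsub>E (Suc i)\<^esub> d i x"
  using d_smult[of "\<ominus> \<one>" x i] by (simp add: E.smult_l_minus)

lemma d_minus: "x \<in> carrier (E i) \<Longrightarrow> y \<in> carrier (E i) \<Longrightarrow> d i (x \<ominus>\<^bsub>E i\<^esub> y) = d i x \<ominus>\<^bsub>E (Suc i)\<^esub> d i y"
  by (simp add: a_minus_def d_add d_neg)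

text \<open>Homomorphisms from R/W to \<open>E i\<close>, given by the image of 1.\<close>

definition killed :: "'a set \<Rightarrow> nat \<Rightarrow> 'e set" where
  "killed W i = {z \<in> carrier (E i). \<forall>w \<in> W. w \<odot>\<^bsub>E i\<^esub> z = \<zero>\<^bsub>E i\<^esub>}"

text \<open>Up to the index shift, \<open>rel_cocycles j P W / rel_coboundaries j P W\<close> is \<open>Ext\<^sup>j(P/W, M)\<close> for
  homogeneous ideals \<open>W \<subseteq> P\<close>: by injectivity a homomorphism \<open>P/W \<rightarrow> E\<close> is multiplication with an element
  killed by \<open>W\<close>, unique up to elements killed by \<open>P\<close>.\<close>

definition rel_cocycles :: "nat \<Rightarrow> 'a set \<Rightarrow> 'a set \<Rightarrow> 'e set" where
  "rel_cocycles j P W = {z \<in> killed W (Suc j). d (Suc j) z \<in> killed P (Suc (Suc j))}"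

definition rel_coboundaries :: "nat \<Rightarrow> 'a set \<Rightarrow> 'a set \<Rightarrow> 'e set" where
  "rel_coboundaries j P W = {d j y \<oplus>\<^bsub>E (Suc j)\<^esub> v | y v. y \<in> killed W j \<and> v \<in> killed P (Suc j)}"

section \<open>Relative cocycles and coboundaries\<close>

lemma killed_carrier: "z \<in> killed W i \<Longrightarrow> z \<in> carrier (E i)"
  by (simp add: killed_def)

lemma killed_submodule:
  assumes "W \<subseteq> carrier R" shows "E.is_submodule i (killed W i)"
  by (rule E.operator_subgroupI)
    (use assms in \<open>auto simp: killed_def E.smult_r_minus E.smult_r_distr E.smult_commute[of _ _ _ i] subset_eq\<close>)

lemma killed_anti: "W \<subseteq> P \<Longrightarrow> z \<in> killed P i \<Longrightarrow> z \<in> killed W i"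
  by (auto simp: killed_def)

lemma d_killed: "W \<subseteq> carrier R \<Longrightarrow> z \<in> killed W i \<Longrightarrow> d i z \<in> killed W (Suc i)"
  by (auto simp: killed_def d_smult[symmetric] subset_eq)

lemma killed_all: "z \<in> killed (carrier R) i \<Longrightarrow> z = \<zero>\<^bsub>E i\<^esub>"
  unfolding killed_def using E.smult_one[of z i] one_closed by fastforce

lemma zero_killed: "W \<subseteq> carrier R \<Longrightarrow> \<zero>\<^bsub>E i\<^esub> \<in> killed W i"
  by (auto simp: killed_def)

lemma rel_cocycles_submodule:
  assumes "P \<subseteq> carrier R" "W \<subseteq> carrier R"
  shows "E.is_submodule (Suc j) (rel_cocycles j P W)"
  by (rule E.operator_subgroupI)
    (use E.operator_subgroupD[OF killed_submodule[OF assms(1)]] E.operator_subgroupD[OF killed_submodule[OF assms(2)]]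
      in \<open>auto simp: rel_cocycles_def d_neg d_add d_smult\<close>)

lemma rel_coboundariesI:
  "y \<in> killed W j \<Longrightarrow> v \<in> killed P (Suc j) \<Longrightarrow> d j y \<oplus>\<^bsub>E (Suc j)\<^esub> v \<in> rel_coboundaries j P W"
  unfolding rel_coboundaries_def by blast

lemma rel_coboundariesE:
  assumes "z \<in> rel_coboundaries j P W"
  obtains y v where "z = d j y \<oplus>\<^bsub>E (Suc j)\<^esub> v" "y \<in> killed W j" "v \<in> killed P (Suc j)"
  using assms unfolding rel_coboundaries_def by blast

lemma d_in_rel_coboundaries:
  assumes "y \<in> killed W j" "P \<subseteq> carrier R"
  shows "d j y \<in> rel_coboundaries j P W"
  using rel_coboundariesI[OF assms(1) zero_killed[OF assms(2)]] killed_carrier[OF assms(1)] by simp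

lemma killed_in_rel_coboundaries:
  assumes "v \<in> killed P (Suc j)" "W \<subseteq> carrier R"
  shows "v \<in> rel_coboundaries j P W"
  using rel_coboundariesI[OF zero_killed[OF assms(2)] assms(1)] killed_carrier[OF assms(1)] by simp

lemma rel_coboundaries_submodule:
  assumes "P \<subseteq> carrier R" "W \<subseteq> carrier R"
  shows "E.is_submodule (Suc j) (rel_coboundaries j P W)"
proof -
  note W = E.operator_subgroupD[OF killed_submodule[OF assms(2), of j]]
  have "E.is_submodule (Suc j) (d j ` killed W j)"
  proof (rule E.operator_subgroupI)
    show "d j ` killed W j \<subseteq> carrier (E (Suc j))" using W(2) by auto
    show "\<zero>\<^bsub>E (Suc j)\<^esub> \<in> d j ` killed W j" using W(3) d_zero by (metis imageI)
    show "\<ominus>\<^bsub>E (Suc j)\<^esub> x \<in> d j ` killed W j" if "x \<in> d j ` killed W j" for x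
      using that W(2,4) by (auto simp: d_neg[symmetric])
    show "x \<oplus>\<^bsub>E (Suc j)\<^esub> y \<in> d j ` killed W j" if "x \<in> d j ` killed W j" "y \<in> d j ` killed W j" for x y
      using that W(2,5) by (auto simp: d_add[symmetric])
    show "a \<odot>\<^bsub>E (Suc j)\<^esub> x \<in> d j ` killed W j" if "a \<in> carrier R" "x \<in> d j ` killed W j" for a x
      using that W(2,7) by (auto simp: d_smult[symmetric])
  qed
  from E.sum_submodule[OF this killed_submodule[OF assms(1), of "Suc j"]]
  show ?thesis unfolding rel_coboundaries_def by (rule back_subst) blast
qed

lemma rel_coboundaries_subset:
  assumes "P \<subseteq> carrier R" "W \<subseteq> P"
  shows "rel_coboundaries j P W \<subseteq> rel_cocycles j P W"
proof
  fix z assume "z \<in> rel_coboundaries j P W"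
  then obtain y v where z: "z = d j y \<oplus>\<^bsub>E (Suc j)\<^esub> v" "y \<in> killed W j" "v \<in> killed P (Suc j)"
    by (rule rel_coboundariesE)
  have W: "W \<subseteq> carrier R" using assms by blast
  have c: "y \<in> carrier (E j)" "v \<in> carrier (E (Suc j))" using z killed_carrier by blast+
  have "z \<in> killed W (Suc j)"
    unfolding z(1) using d_killed[OF W z(2)] killed_anti[OF assms(2) z(3)]
    by (rule E.operator_subgroupD(5)[OF killed_submodule[OF W]])
  moreover have "d (Suc j) z = d (Suc j) v" unfolding z(1) using c by (simp add: d_add d_d)
  ultimately show "z \<in> rel_cocycles j P W"
    unfolding rel_cocycles_def using d_killed[OF assms(1) z(3)] by simp
qed

text \<open>Exactness of Ext^j(P/V) \<rightarrow> Ext^j(P/W) \<rightarrow> Ext^j(V/W) in the middle: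
  a class that dies on the right is represented by v, which is killed by V.\<close>

lemma rel_connecting:
  assumes "V \<subseteq> carrier R" "W \<subseteq> V" and z: "z \<in> rel_cocycles j P W" "z = d j y \<oplus>\<^bsub>E (Suc j)\<^esub> v"
    "y \<in> killed W j" "v \<in> killed V (Suc j)"
  shows "v \<in> rel_cocycles j P V"
proof -
  have c: "y \<in> carrier (E j)" "v \<in> carrier (E (Suc j))" using z killed_carrier by blast+
  have "d (Suc j) z = d (Suc j) v" unfolding z(2) using c by (simp add: d_add d_d)
  thus ?thesis using z by (simp add: rel_cocycles_def)
qed

text \<open>Multiplication by p identifies Ext^j((W + Rp)/W, M) with Ext^j(R/(W : p), M) up to a
  shift of degrees; this is its effect on cocycles.\<close>

lemma rel_cocycles_colon:
  assumes W: "hom_ideal W" and p: "p \<in> gr m" and z: "z \<in> rel_cocycles j (add_generator W p) W"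
  shows "p \<odot>\<^bsub>E (Suc j)\<^esub> z \<in> rel_cocycles j (carrier R) (colon W p)"
proof -
  have pc: "p \<in> carrier R" using gr.piece_carrier[OF p] .
  have zc: "z \<in> carrier (E (Suc j))" using z killed_carrier by (auto simp: rel_cocycles_def)
  have "p \<odot>\<^bsub>E (Suc j)\<^esub> z \<in> killed (colon W p) (Suc j)"
    using z zc pc by (auto simp: rel_cocycles_def killed_def colon_def E.smult_assoc1[symmetric])
  moreover have "d (Suc j) (p \<odot>\<^bsub>E (Suc j)\<^esub> z) = \<zero>\<^bsub>E (Suc (Suc j))\<^esub>"
    using z zc pc hom_ideal_add_generator(3)[OF W p] by (simp add: d_smult rel_cocycles_def killed_def)
  ultimately show ?thesis using zero_killed[of "carrier R"] by (simp add: rel_cocycles_def)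
qed

text \<open>Multiplication by p is injective on classes: if p z = d u, then \<open>extension\<close>
  gives y killed by W with p y = u, and z - d y is killed by W and by p.\<close>

lemma rel_coboundaries_colon:
  assumes W: "hom_ideal W" and p: "p \<in> gr m" and z: "z \<in> rel_cocycles j (add_generator W p) W"
    and pz: "p \<odot>\<^bsub>E (Suc j)\<^esub> z \<in> rel_coboundaries j (carrier R) (colon W p)"
  shows "z \<in> rel_coboundaries j (add_generator W p) W"
proof -
  have pc: "p \<in> carrier R" using gr.piece_carrier[OF p] .
  have Wc: "W \<subseteq> carrier R" using hom_idealD(3)[OF W] by blast
  have zk: "z \<in> killed W (Suc j)" using z by (simp add: rel_cocycles_def)
  have zc: "z \<in> carrier (E (Suc j))" using zk killed_carrier by blast
  obtain u v where u: "p \<odot>\<^bsub>E (Suc j)\<^esub> z = d j u \<oplus>\<^bsub>E (Suc j)\<^esub> v" "u \<in> killed (colon W p) j" "v \<in> killed (carrier R) (Suc j)"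
    using pz by (rule rel_coboundariesE)
  have uc: "u \<in> carrier (E j)" using u killed_carrier by blast
  have pz': "p \<odot>\<^bsub>E (Suc j)\<^esub> z = d j u" using u(1) killed_all[OF u(3)] uc by simp
  obtain y where y: "y \<in> carrier (E j)" "\<forall>w \<in> W. w \<odot>\<^bsub>E j\<^esub> y = \<zero>\<^bsub>E j\<^esub>" "p \<odot>\<^bsub>E j\<^esub> y = u"
    using extension[OF W p uc] u(2) by (auto simp: killed_def)
  have yk: "y \<in> killed W j" using y by (simp add: killed_def)
  let ?v = "z \<ominus>\<^bsub>E (Suc j)\<^esub> d j y"
  have vW: "?v \<in> killed W (Suc j)"
    by (rule E.operator_subgroupD(6)[OF killed_submodule[OF Wc] zk d_killed[OF Wc yk]])
  have pv: "p \<odot>\<^bsub>E (Suc j)\<^esub> ?v = \<zero>\<^bsub>E (Suc j)\<^esub>"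
  proof -
    have "p \<odot>\<^bsub>E (Suc j)\<^esub> ?v = p \<odot>\<^bsub>E (Suc j)\<^esub> z \<oplus>\<^bsub>E (Suc j)\<^esub> \<ominus>\<^bsub>E (Suc j)\<^esub> d j (p \<odot>\<^bsub>E j\<^esub> y)"
      using pc zc y(1) by (simp add: a_minus_def E.smult_r_distr E.smult_r_minus d_smult)
    thus ?thesis using pz' y(3) uc by (simp add: E.M.r_neg)
  qed
  have "?v \<in> killed (add_generator W p) (Suc j)"
    unfolding killed_def
  proof (intro CollectI conjI ballI)
    show vc: "?v \<in> carrier (E (Suc j))" using vW killed_carrier by blast
    fix q assume "q \<in> add_generator W p"
    then obtain w r where q: "q = w \<oplus> r \<otimes> p" "w \<in> W" "r \<in> carrier R" by (auto simp: add_generator_def)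
    have "w \<odot>\<^bsub>E (Suc j)\<^esub> ?v = \<zero>\<^bsub>E (Suc j)\<^esub>" using vW q(2) by (simp add: killed_def)
    thus "q \<odot>\<^bsub>E (Suc j)\<^esub> ?v = \<zero>\<^bsub>E (Suc j)\<^esub>"
      using q pc vc pv subsetD[OF Wc q(2)] by (simp add: E.smult_l_distr E.smult_assoc1)
  qed
  from rel_coboundariesI[OF yk this] have "d j y \<oplus>\<^bsub>E (Suc j)\<^esub> ?v \<in> rel_coboundaries j (add_generator W p) W" .
  moreover have "d j y \<oplus>\<^bsub>E (Suc j)\<^esub> ?v = z"
    using E.minus_plus_cancel[of z "Suc j" "d j y"] zc y(1) by (simp add: E.M.a_comm)
  ultimately show ?thesis by simp
qed

text \<open>Dimension shift: Ext^(j+1)(R/W, M) is an image of Ext^j(W, M), with W regarded as W/0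
  and the differential as connecting map. A closed element killed by W is some d y by exactness, and
  such a y is a cocycle for W/0.\<close>

lemma rel_cocycles_shift:
  assumes W: "W \<subseteq> carrier R"
  shows "rel_cocycles (Suc j) (carrier R) W \<subseteq> d (Suc j) ` rel_cocycles j W {\<zero>}"
    and "d (Suc j) ` rel_coboundaries j W {\<zero>} \<subseteq> rel_coboundaries (Suc j) (carrier R) W"
proof -
  show "rel_cocycles (Suc j) (carrier R) W \<subseteq> d (Suc j) ` rel_cocycles j W {\<zero>}"
  proof
    fix z assume z: "z \<in> rel_cocycles (Suc j) (carrier R) W"
    hence "z \<in> carrier (E (Suc (Suc j)))" "d (Suc (Suc j)) z = \<zero>\<^bsub>E (Suc (Suc (Suc j)))\<^esub>"
      using killed_carrier killed_all by (auto simp: rel_cocycles_def)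
    then obtain y where y: "y \<in> carrier (E (Suc j))" "d (Suc j) y = z" using exact by blast
    hence "y \<in> rel_cocycles j W {\<zero>}" using z by (auto simp: rel_cocycles_def killed_def)
    thus "z \<in> d (Suc j) ` rel_cocycles j W {\<zero>}" using y by blast
  qed
  show "d (Suc j) ` rel_coboundaries j W {\<zero>} \<subseteq> rel_coboundaries (Suc j) (carrier R) W"
  proof
    fix z assume "z \<in> d (Suc j) ` rel_coboundaries j W {\<zero>}"
    then obtain b where b: "z = d (Suc j) b" "b \<in> rel_coboundaries j W {\<zero>}" by blast
    from b(2) obtain y v where y: "b = d j y \<oplus>\<^bsub>E (Suc j)\<^esub> v" "y \<in> killed {\<zero>} j" "v \<in> killed W (Suc j)"
      by (rule rel_coboundariesE)
    have "z = d (Suc j) v"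
      unfolding b(1) y(1) using killed_carrier[OF y(2)] killed_carrier[OF y(3)] by (simp add: d_add d_d)
    thus "z \<in> rel_coboundaries (Suc j) (carrier R) W" using d_in_rel_coboundaries[OF y(3)] by simp
  qed
qed

text \<open>Noetherian induction: among the V between W and P with \<open>Q V W\<close>, a maximal
  one equals P, as otherwise one more generator could be added.\<close>

lemma devissage:
  assumes W: "hom_ideal W" and P: "hom_ideal P" and WP: "W \<subseteq> P" and refl: "Q W W"
    and trans: "\<And>V U. hom_ideal V \<Longrightarrow> hom_ideal U \<Longrightarrow> W \<subseteq> V \<Longrightarrow> V \<subseteq> U \<Longrightarrow> U \<subseteq> P \<Longrightarrow> Q U V \<Longrightarrow> Q V W \<Longrightarrow> Q U W"
    and step: "\<And>V. hom_ideal V \<Longrightarrow> W \<subseteq> V \<Longrightarrow> V \<subseteq> P \<Longrightarrow> V \<noteq> P \<Longrightarrow>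
      \<exists>p m. p \<in> gr m \<and> p \<in> P \<and> p \<notin> V \<and> Q (add_generator V p) V"
  shows "Q P W"
proof -
  interpret noetherian_ring R by (rule noetherian)
  let ?C = "{V. hom_ideal V \<and> W \<subseteq> V \<and> V \<subseteq> P \<and> Q V W}"
  have "?C \<noteq> {}" using W WP refl by blast
  moreover have "ideal V R" if "V \<in> ?C" for V using that hom_idealD(1) by blast
  ultimately obtain V where V: "V \<in> ?C" "\<forall>U \<in> ?C. V \<subseteq> U \<longrightarrow> U = V" using maximal_ideal_in_family[of ?C] by blast
  have "V = P"
  proof (rule ccontr)
    assume "V \<noteq> P"
    then obtain p m where p: "p \<in> gr m" "p \<in> P" "p \<notin> V" "Q (add_generator V p) V" using step V(1) by blast
    have hV: "hom_ideal V" "W \<subseteq> V" "V \<subseteq> P" "Q V W" using V(1) by auto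
    note g = hom_ideal_add_generator[OF hV(1) p(1)]
    have gP: "add_generator V p \<subseteq> P" by (rule add_generator_minimal[OF hom_idealD(1)[OF P] hV(3) p(2)])
    have "Q (add_generator V p) W" by (rule trans[OF hV(1) g(1) hV(2) g(2) gP p(4) hV(4)])
    hence "add_generator V p \<in> ?C" using g gP hV by blast
    thus False using V(2) g(2,3) p(3) by blast
  qed
  thus ?thesis using V(1) by blast
qed

lemma homogeneous_outside:
  assumes V: "hom_ideal V" and P: "hom_ideal P" and VP: "V \<subseteq> P" "V \<noteq> P"
  shows "\<exists>p m. p \<in> gr m \<and> p \<in> P \<and> p \<notin> V"
proof -
  obtain r where r: "r \<in> P" "r \<notin> V" using VP by blast
  have rc: "r \<in> carrier R" using hom_idealD(3)[OF P r(1)] .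
  have "\<exists>n. hcomp R gr n r \<notin> V"
  proof (rule ccontr)
    assume all: "\<not> (\<exists>n. hcomp R gr n r \<notin> V)"
    have "r \<in> V"
      by (rule gr.sum_of_hcomps_induct[where P = "\<lambda>r. r \<in> V", OF rc hom_idealD(6)[OF V]])
        (use all in \<open>auto intro: hom_idealD(5)[OF V]\<close>)
    thus False using r by blast
  qed
  then obtain n where n: "hcomp R gr n r \<notin> V" by blast
  show ?thesis
    by (rule exI[of _ "hcomp R gr n r"], rule exI[of _ n])
      (use gr.hcomp_piece[OF rc] hom_idealD(2)[OF P r(1)] n in simp)
qed

text \<open>Filtrations with cyclic factors reduce P/W to R/W for the same j, and the dimension
  shift reduces R/W at j + 1 to W/0 at j. What remains is Ext^0(R/W, M). Serves both finite
  generation and annihilation by powers.\<close>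

lemma ext_induct:
  assumes refl: "\<And>j W. hom_ideal W \<Longrightarrow> Q j W W"
    and trans: "\<And>j P V W. hom_ideal P \<Longrightarrow> hom_ideal V \<Longrightarrow> hom_ideal W \<Longrightarrow> W \<subseteq> V \<Longrightarrow> V \<subseteq> P \<Longrightarrow>
      Q j P V \<Longrightarrow> Q j V W \<Longrightarrow> Q j P W"
    and cyclic: "\<And>j W p m. hom_ideal W \<Longrightarrow> p \<in> gr m \<Longrightarrow> Q j (carrier R) (colon W p) \<Longrightarrow> Q j (add_generator W p) W"
    and shift: "\<And>j W. hom_ideal W \<Longrightarrow> Q j W {\<zero>} \<Longrightarrow> Q (Suc j) (carrier R) W"
    and base: "\<And>W. hom_ideal W \<Longrightarrow> Q 0 (carrier R) W"
    and P: "hom_ideal P" and W: "hom_ideal W" and WP: "W \<subseteq> P"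
  shows "Q j P W"
proof -
  have all: "Q j P W" if cyc: "\<And>W. hom_ideal W \<Longrightarrow> Q j (carrier R) W"
    and P: "hom_ideal P" and W: "hom_ideal W" and WP: "W \<subseteq> P" for j P W
  proof (rule devissage[where Q = "Q j", OF W P WP refl[OF W]])
    fix V U
    show "Q j U W" if "hom_ideal V" "hom_ideal U" "W \<subseteq> V" "V \<subseteq> U" "Q j U V" "Q j V W"
      using trans[OF that(2,1) W that(3,4,5,6)] .
    assume V: "hom_ideal V" "V \<subseteq> P" "V \<noteq> P"
    obtain p m where p: "p \<in> gr m" "p \<in> P" "p \<notin> V" using homogeneous_outside[OF V(1) P V(2,3)] by blast
    have "Q j (add_generator V p) V" by (rule cyclic[OF V(1) p(1) cyc[OF hom_ideal_colon(1)[OF V(1) p(1)]]])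
    thus "\<exists>p m. p \<in> gr m \<and> p \<in> P \<and> p \<notin> V \<and> Q j (add_generator V p) V" using p by blast
  qed
  have "Q j (carrier R) W" if "hom_ideal W" for W
    using that
  proof (induction j arbitrary: W)
    case (Suc j)
    have "Q j W {\<zero>}"
      by (rule all[OF Suc.IH Suc.prems hom_ideal_zero]) (use hom_idealD(6)[OF Suc.prems] in auto)
    thus ?case by (rule shift[OF Suc.prems])
  qed (rule base)
  from all[OF this P W WP] show ?thesis .
qed

lemma hom_ideal_carrier_subset: "hom_ideal W \<Longrightarrow> W \<subseteq> carrier R"
  using hom_idealD(3) by blast

text \<open>The Noetherian property passes to extensions, along the injection given by
  multiplication by p, and along the surjection given by d. Ext^0(R/W, M) lies in the kernel at
  \<open>E (Suc 0)\<close>.\<close>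

lemma ext_noetherian:
  assumes "hom_ideal P" "hom_ideal W" "W \<subseteq> P"
  shows "noetherian_quotient (E (Suc j)) (carrier R) (rel_cocycles j P W) (rel_coboundaries j P W)"
proof (rule ext_induct[where Q = "\<lambda>j P W. noetherian_quotient (E (Suc j)) (carrier R) (rel_cocycles j P W) (rel_coboundaries j P W)",
      OF _ _ _ _ _ assms])
  note sub = hom_ideal_carrier_subset
  {
    fix j W assume W: "hom_ideal W"
    have "rel_cocycles j W W \<subseteq> rel_coboundaries j W W"
      using killed_in_rel_coboundaries[OF _ sub[OF W]] by (auto simp: rel_cocycles_def)
    thus "noetherian_quotient (E (Suc j)) (carrier R) (rel_cocycles j W W) (rel_coboundaries j W W)"
      unfolding noetherian_quotient_def by (auto intro!: exI[of _ "{}"] operator_span.incl)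
  next
    fix j P V W assume h: "hom_ideal P" "hom_ideal V" "hom_ideal W" "W \<subseteq> V" "V \<subseteq> P"
    note c = sub[OF h(1)] sub[OF h(2)] sub[OF h(3)]
    let ?E = "E (Suc j)"
    assume PV: "noetherian_quotient ?E (carrier R) (rel_cocycles j P V) (rel_coboundaries j P V)"
    assume VW: "noetherian_quotient ?E (carrier R) (rel_cocycles j V W) (rel_coboundaries j V W)"
    note B_PV = rel_coboundaries_submodule[OF c(1,2), of j] and B_VW = rel_coboundaries_submodule[OF c(2,3), of j]
      and B_PW = rel_coboundaries_submodule[OF c(1,3), of j]
    have Z_sub: "rel_cocycles j P W \<subseteq> rel_cocycles j V W"
      using killed_anti[OF h(5)] by (auto simp: rel_cocycles_def)
    have B_sub: "rel_coboundaries j P V \<subseteq> rel_coboundaries j P W"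
      using killed_anti[OF h(4)] unfolding rel_coboundaries_def by blast
    show "noetherian_quotient ?E (carrier R) (rel_cocycles j P W) (rel_coboundaries j P W)"
      unfolding noetherian_quotient_def
    proof (intro allI impI, elim conjE)
      fix S assume S: "E.is_submodule (Suc j) S" "rel_coboundaries j P W \<subseteq> S" "S \<subseteq> rel_cocycles j P W"
      note Sc = E.operator_subgroupD[OF S(1)]
      let ?X = "S \<union> rel_coboundaries j V W"
      let ?S1 = "operator_span ?E (carrier R) ?X"
      have "?X \<subseteq> rel_cocycles j V W" using S(3) Z_sub rel_coboundaries_subset[OF c(2) h(4)] by blast
      hence S1Z: "?S1 \<subseteq> rel_cocycles j V W" by (rule E.operator_span_minimal[OF rel_cocycles_submodule[OF c(2,3)]])
      have Xc: "?X \<subseteq> carrier ?E" using Sc(1) E.operator_subgroupD(1)[OF B_VW] by blast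
      have "rel_coboundaries j V W \<subseteq> ?S1" by (auto intro: operator_span.incl)
      then obtain F1 where F1: "finite F1" "F1 \<subseteq> ?S1" "?S1 \<subseteq> operator_span ?E (carrier R) (F1 \<union> rel_coboundaries j V W)"
        using S1Z by (rule noetherian_quotientE[OF VW E.operator_span_subgroup[OF Xc subset_refl]])
      obtain X0 where X0: "finite X0" "X0 \<subseteq> ?X" "F1 \<subseteq> operator_span ?E (carrier R) X0"
        using operator_span_finite_support[OF F1(1,2)] by blast
      \<comment> \<open>S is generated by \<open>F\<close> modulo the coboundaries for V/W, but
        those may lie outside S; the part of them inside S is handled by \<open>G\<close>
        below.\<close>
      define F where "F = X0 \<inter> S"
      have F: "finite F" "F \<subseteq> S" using X0 by (auto simp: F_def)
      have Fc: "F \<subseteq> carrier ?E" using F(2) Sc(1) by blast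
      have FBc: "F \<union> rel_coboundaries j V W \<subseteq> carrier ?E" using Fc E.operator_subgroupD(1)[OF B_VW] by blast
      note FB = E.operator_span_subgroup[OF FBc subset_refl]
      have "X0 \<subseteq> F \<union> rel_coboundaries j V W" using X0(2) by (auto simp: F_def)
      hence "F1 \<subseteq> operator_span ?E (carrier R) (F \<union> rel_coboundaries j V W)"
        using X0(3) operator_span_mono[OF _ subset_refl] by blast
      hence "F1 \<union> rel_coboundaries j V W \<subseteq> operator_span ?E (carrier R) (F \<union> rel_coboundaries j V W)"
        by (auto intro: operator_span.incl)
      from E.operator_span_minimal[OF FB this]
      have S_FB: "S \<subseteq> operator_span ?E (carrier R) (F \<union> rel_coboundaries j V W)"
        using F1(3) by (auto intro: operator_span.incl)
      let ?S2 = "S \<inter> rel_cocycles j P V"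
      have "rel_coboundaries j P V \<subseteq> ?S2"
        using B_sub S(2) rel_coboundaries_subset[OF c(1) h(5)] by blast
      then obtain G where G: "finite G" "G \<subseteq> ?S2" "?S2 \<subseteq> operator_span ?E (carrier R) (G \<union> rel_coboundaries j P V)"
        using inf_le2[of S "rel_cocycles j P V"]
        by (rule noetherian_quotientE[OF PV E.operator_subgroup_inter[OF S(1) rel_cocycles_submodule[OF c(1,2)]]])
      let ?T = "operator_span ?E (carrier R) ((F \<union> G) \<union> rel_coboundaries j P W)"
      have "S \<subseteq> ?T"
      proof
        fix s assume s: "s \<in> S"
        then obtain f b where f: "f \<in> operator_span ?E (carrier R) F" "b \<in> rel_coboundaries j V W" "s = f \<oplus>\<^bsub>?E\<^esub> b"
          using S_FB E.operator_span_union[OF Fc B_VW] by blast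
        have fS: "f \<in> S" using E.operator_span_minimal[OF S(1) F(2)] f(1) by blast
        have fc: "f \<in> carrier ?E" "b \<in> carrier ?E" using fS Sc(2) f(2) E.operator_subgroupD(2)[OF B_VW] by auto
        \<comment> \<open>The remainder b is a coboundary for V/W that lies in S; its summand v is a
          cocycle for P/V, where \<open>G\<close> provides generators.\<close>
        have bS: "b \<in> S"
          using E.add_cancel_submodule[OF S(1), of b f] fS fc s f(3) by (simp add: E.M.a_comm)
        obtain y v where y: "b = d j y \<oplus>\<^bsub>?E\<^esub> v" "y \<in> killed W j" "v \<in> killed V (Suc j)"
          using f(2) by (rule rel_coboundariesE)
        have dy: "d j y \<in> rel_coboundaries j P W" by (rule d_in_rel_coboundaries[OF y(2) c(1)])
        have vc: "v \<in> carrier ?E" "d j y \<in> carrier ?E" using y(2,3) killed_carrier d_closed by blast+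
        have vS: "v \<in> S"
          using E.add_cancel_submodule[OF S(1), of v "d j y"] dy S(2) bS y(1) vc by (auto simp: E.M.a_comm)
        have "v \<in> rel_cocycles j P V"
          by (rule rel_connecting[OF c(2) h(4) _ y]) (use bS S(3) in blast)
        hence "v \<in> operator_span ?E (carrier R) (G \<union> rel_coboundaries j P V)" using vS G(3) by blast
        hence "v \<in> ?T" using operator_span_mono[of "G \<union> rel_coboundaries j P V" "(F \<union> G) \<union> rel_coboundaries j P W"] B_sub
          by blast
        moreover have "f \<in> ?T" using f(1) operator_span_mono[of F "(F \<union> G) \<union> rel_coboundaries j P W"] by blast
        ultimately show "s \<in> ?T"
          unfolding f(3) y(1) using dy by (intro operator_span.add) (auto intro: operator_span.incl)
      qed
      thus "\<exists>F. finite F \<and> F \<subseteq> S \<and> S \<subseteq> operator_span ?E (carrier R) (F \<union> rel_coboundaries j P W)"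
        using F G by (intro exI[of _ "F \<union> G"]) auto
    qed
  next
    fix j W p m assume W: "hom_ideal W" and p: "p \<in> gr m"
    let ?E = "E (Suc j)"
    assume N: "noetherian_quotient ?E (carrier R) (rel_cocycles j (carrier R) (colon W p)) (rel_coboundaries j (carrier R) (colon W p))"
    have pc: "p \<in> carrier R" using gr.piece_carrier[OF p] .
    have hom: "(\<lambda>z. p \<odot>\<^bsub>?E\<^esub> z) \<in> module_hom R ?E ?E"
      using pc by (auto simp: module_hom_def E.smult_r_distr E.smult_commute)
    note g = sub[OF hom_ideal_add_generator(1)[OF W p]] and cl = sub[OF hom_ideal_colon(1)[OF W p]]
    show "noetherian_quotient ?E (carrier R) (rel_cocycles j (add_generator W p) W) (rel_coboundaries j (add_generator W p) W)"
    proof (rule noetherian_quotient_reflect[OF E.module_axioms E.module_axioms hom])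
      show "rel_cocycles j (add_generator W p) W \<subseteq> carrier ?E"
        by (rule E.operator_subgroupD(1)[OF rel_cocycles_submodule[OF g sub[OF W]]])
      show "E.is_submodule (Suc j) (rel_cocycles j (carrier R) (colon W p))"
        by (rule rel_cocycles_submodule[OF subset_refl cl])
      show "rel_coboundaries j (add_generator W p) W \<subseteq> carrier ?E"
        by (rule E.operator_subgroupD(1)[OF rel_coboundaries_submodule[OF g sub[OF W]]])
      show "E.is_submodule (Suc j) (rel_coboundaries j (carrier R) (colon W p))"
        by (rule rel_coboundaries_submodule[OF subset_refl cl])
      show "rel_coboundaries j (carrier R) (colon W p) \<subseteq> rel_cocycles j (carrier R) (colon W p)"
        by (rule rel_coboundaries_subset[OF subset_refl cl])
    qed (use N rel_cocycles_colon[OF W p] rel_coboundaries_colon[OF W p] in auto)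
  next
    fix j W assume W: "hom_ideal W"
    assume N: "noetherian_quotient (E (Suc j)) (carrier R) (rel_cocycles j W {\<zero>}) (rel_coboundaries j W {\<zero>})"
    have z: "{\<zero>} \<subseteq> carrier R" "{\<zero>} \<subseteq> W" using hom_idealD(6)[OF W] by auto
    show "noetherian_quotient (E (Suc (Suc j))) (carrier R) (rel_cocycles (Suc j) (carrier R) W) (rel_coboundaries (Suc j) (carrier R) W)"
    proof (rule noetherian_quotient_image[OF E.module_axioms E.module_axioms d_hom _ _ _ N])
      show "E.is_submodule (Suc j) (rel_cocycles j W {\<zero>})" by (rule rel_cocycles_submodule[OF sub[OF W] z(1)])
      show "rel_coboundaries j W {\<zero>} \<subseteq> rel_cocycles j W {\<zero>}" by (rule rel_coboundaries_subset[OF sub[OF W] z(2)])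
      show "rel_coboundaries (Suc j) (carrier R) W \<subseteq> carrier (E (Suc (Suc j)))"
        by (rule E.operator_subgroupD(1)[OF rel_coboundaries_submodule[OF subset_refl sub[OF W]]])
    qed (rule rel_cocycles_shift[OF sub[OF W]])+
  next
    fix W assume W: "hom_ideal W"
    have "rel_cocycles 0 (carrier R) W \<subseteq> {x \<in> carrier (E (Suc 0)). d (Suc 0) x = \<zero>\<^bsub>E (Suc (Suc 0))\<^esub>}"
      using killed_carrier killed_all by (auto simp: rel_cocycles_def)
    thus "noetherian_quotient (E (Suc 0)) (carrier R) (rel_cocycles 0 (carrier R) W) (rel_coboundaries 0 (carrier R) W)"
      unfolding noetherian_quotient_def
    proof (intro allI impI, elim conjE)
      fix S assume S: "E.is_submodule (Suc 0) S" "S \<subseteq> rel_cocycles 0 (carrier R) W"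
      assume "rel_cocycles 0 (carrier R) W \<subseteq> {x \<in> carrier (E (Suc 0)). d (Suc 0) x = \<zero>\<^bsub>E (Suc (Suc 0))\<^esub>}"
      with S(2) have "S \<subseteq> {x \<in> carrier (E (Suc 0)). d (Suc 0) x = \<zero>\<^bsub>E (Suc (Suc 0))\<^esub>}" by (rule subset_trans)
      then obtain F where "finite F" "F \<subseteq> S" "S \<subseteq> operator_span (E (Suc 0)) (carrier R) F"
        by (rule noetherian_overE[OF noetherian_kernel S(1)])
      thus "\<exists>F. finite F \<and> F \<subseteq> S \<and> S \<subseteq> operator_span (E (Suc 0)) (carrier R) (F \<union> rel_coboundaries 0 (carrier R) W)"
        using operator_span_mono[of F "F \<union> rel_coboundaries 0 (carrier R) W" "carrier R" "carrier R" "E (Suc 0)"] by blast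
    qed
  }
qed

text \<open>The exponent is 1 on Ext^0(R/W, M), adds up along filtrations, and is kept by cyclic
  factors and by the dimension shift.\<close>

lemma ext_annihilator:
  assumes h: "h \<in> carrier R"
    and kills: "\<And>x. x \<in> carrier (E (Suc 0)) \<Longrightarrow> d (Suc 0) x = \<zero>\<^bsub>E (Suc (Suc 0))\<^esub> \<Longrightarrow> h \<odot>\<^bsub>E (Suc 0)\<^esub> x = \<zero>\<^bsub>E (Suc 0)\<^esub>"
    and "hom_ideal P" "hom_ideal W" "W \<subseteq> P"
  shows "\<exists>k::nat. \<forall>z \<in> rel_cocycles j P W. (h [^] k) \<odot>\<^bsub>E (Suc j)\<^esub> z \<in> rel_coboundaries j P W"
proof (rule ext_induct[where Q = "\<lambda>j P W. \<exists>k::nat. \<forall>z \<in> rel_cocycles j P W. (h [^] k) \<odot>\<^bsub>E (Suc j)\<^esub> z \<in> rel_coboundaries j P W",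
      OF _ _ _ _ _ assms(3-5)])
  note sub = hom_ideal_carrier_subset
  have hk [simp]: "h [^] k \<in> carrier R" for k :: nat using h by simp
  {
    fix j W assume W: "hom_ideal W"
    show "\<exists>k::nat. \<forall>z \<in> rel_cocycles j W W. (h [^] k) \<odot>\<^bsub>E (Suc j)\<^esub> z \<in> rel_coboundaries j W W"
      using killed_in_rel_coboundaries[OF _ sub[OF W]] killed_carrier
      by (intro exI[of _ "0 :: nat"]) (auto simp: rel_cocycles_def)
  next
    fix j P V W assume hi: "hom_ideal P" "hom_ideal V" "hom_ideal W" "W \<subseteq> V" "V \<subseteq> P"
    note c = sub[OF hi(1)] sub[OF hi(2)] sub[OF hi(3)]
    let ?E = "E (Suc j)"
    assume "\<exists>k::nat. \<forall>z \<in> rel_cocycles j P V. (h [^] k) \<odot>\<^bsub>?E\<^esub> z \<in> rel_coboundaries j P V"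
    then obtain l :: nat where l: "\<And>z. z \<in> rel_cocycles j P V \<Longrightarrow> (h [^] l) \<odot>\<^bsub>?E\<^esub> z \<in> rel_coboundaries j P V" by blast
    assume "\<exists>k::nat. \<forall>z \<in> rel_cocycles j V W. (h [^] k) \<odot>\<^bsub>?E\<^esub> z \<in> rel_coboundaries j V W"
    then obtain k :: nat where k: "\<And>z. z \<in> rel_cocycles j V W \<Longrightarrow> (h [^] k) \<odot>\<^bsub>?E\<^esub> z \<in> rel_coboundaries j V W" by blast
    have "(h [^] (l + k)) \<odot>\<^bsub>?E\<^esub> z \<in> rel_coboundaries j P W" if z: "z \<in> rel_cocycles j P W" for z
    proof -
      note Z = E.operator_subgroupD[OF rel_cocycles_submodule[OF c(1,3)]]
      note B = E.operator_subgroupD[OF rel_coboundaries_submodule[OF c(1,3)]]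
      have zc: "z \<in> carrier ?E" using Z(2)[OF z] .
      have "z \<in> rel_cocycles j V W" using z killed_anti[OF hi(5)] by (auto simp: rel_cocycles_def)
      from k[OF this] obtain y v where y: "(h [^] k) \<odot>\<^bsub>?E\<^esub> z = d j y \<oplus>\<^bsub>?E\<^esub> v" "y \<in> killed W j" "v \<in> killed V (Suc j)"
        by (rule rel_coboundariesE)
      have yc: "y \<in> carrier (E j)" "v \<in> carrier ?E" using y killed_carrier by blast+
      have "v \<in> rel_cocycles j P V" by (rule rel_connecting[OF c(2) hi(4) Z(7)[OF hk z] y])
      from l[OF this] have "(h [^] l) \<odot>\<^bsub>?E\<^esub> v \<in> rel_coboundaries j P W"
        using killed_anti[OF hi(4)] unfolding rel_coboundaries_def by blast
      moreover have "(h [^] l) \<odot>\<^bsub>?E\<^esub> d j y \<in> rel_coboundaries j P W"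
        by (rule B(7)[OF hk d_in_rel_coboundaries[OF y(2) c(1)]])
      ultimately have "(h [^] l) \<odot>\<^bsub>?E\<^esub> d j y \<oplus>\<^bsub>?E\<^esub> (h [^] l) \<odot>\<^bsub>?E\<^esub> v \<in> rel_coboundaries j P W"
        by (intro B(5))
      moreover have "(h [^] (l + k)) \<odot>\<^bsub>?E\<^esub> z = (h [^] l) \<odot>\<^bsub>?E\<^esub> d j y \<oplus>\<^bsub>?E\<^esub> (h [^] l) \<odot>\<^bsub>?E\<^esub> v"
        using y(1) yc zc h by (simp add: nat_pow_mult[symmetric] E.smult_assoc1 E.smult_r_distr)
      ultimately show ?thesis by simp
    qed
    thus "\<exists>k::nat. \<forall>z \<in> rel_cocycles j P W. (h [^] k) \<odot>\<^bsub>?E\<^esub> z \<in> rel_coboundaries j P W" by blast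
  next
    fix j W p m assume W: "hom_ideal W" and p: "p \<in> gr m"
    let ?E = "E (Suc j)"
    note g = sub[OF hom_ideal_add_generator(1)[OF W p]] and pc = gr.piece_carrier[OF p]
    note Z = E.operator_subgroupD[OF rel_cocycles_submodule[OF g sub[OF W]]]
    assume "\<exists>k::nat. \<forall>z \<in> rel_cocycles j (carrier R) (colon W p). (h [^] k) \<odot>\<^bsub>?E\<^esub> z \<in> rel_coboundaries j (carrier R) (colon W p)"
    then obtain k :: nat where k: "\<And>z. z \<in> rel_cocycles j (carrier R) (colon W p) \<Longrightarrow>
       (h [^] k) \<odot>\<^bsub>?E\<^esub> z \<in> rel_coboundaries j (carrier R) (colon W p)" by blast
    have "(h [^] k) \<odot>\<^bsub>?E\<^esub> z \<in> rel_coboundaries j (add_generator W p) W"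
      if z: "z \<in> rel_cocycles j (add_generator W p) W" for z
      using k[OF rel_cocycles_colon[OF W p z]] Z(2)[OF z] pc
      by (intro rel_coboundaries_colon[OF W p Z(7)[OF hk z]]) (simp add: E.smult_commute[OF hk pc])
    thus "\<exists>k::nat. \<forall>z \<in> rel_cocycles j (add_generator W p) W. (h [^] k) \<odot>\<^bsub>?E\<^esub> z \<in> rel_coboundaries j (add_generator W p) W"
      by blast
  next
    fix j W assume W: "hom_ideal W"
    note shift = rel_cocycles_shift[OF sub[OF W], of j]
    have z0: "{\<zero>} \<subseteq> carrier R" by simp
    assume "\<exists>k::nat. \<forall>z \<in> rel_cocycles j W {\<zero>}. (h [^] k) \<odot>\<^bsub>E (Suc j)\<^esub> z \<in> rel_coboundaries j W {\<zero>}"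
    then obtain k :: nat where k: "\<And>z. z \<in> rel_cocycles j W {\<zero>} \<Longrightarrow> (h [^] k) \<odot>\<^bsub>E (Suc j)\<^esub> z \<in> rel_coboundaries j W {\<zero>}" by blast
    have "(h [^] k) \<odot>\<^bsub>E (Suc (Suc j))\<^esub> z \<in> rel_coboundaries (Suc j) (carrier R) W"
      if z: "z \<in> rel_cocycles (Suc j) (carrier R) W" for z
    proof -
      obtain y where y: "y \<in> rel_cocycles j W {\<zero>}" "z = d (Suc j) y" using z shift(1) by blast
      have yc: "y \<in> carrier (E (Suc j))" using E.operator_subgroupD(2)[OF rel_cocycles_submodule[OF sub[OF W] z0] y(1)] .
      have "d (Suc j) ((h [^] k) \<odot>\<^bsub>E (Suc j)\<^esub> y) \<in> rel_coboundaries (Suc j) (carrier R) W"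
        using k[OF y(1)] shift(2) by blast
      thus ?thesis using y(2) yc by (simp add: d_smult)
    qed
    thus "\<exists>k::nat. \<forall>z \<in> rel_cocycles (Suc j) (carrier R) W. (h [^] k) \<odot>\<^bsub>E (Suc (Suc j))\<^esub> z \<in> rel_coboundaries (Suc j) (carrier R) W"
      by blast
  next
    fix W assume W: "hom_ideal W"
    have "h [^] (1::nat) \<odot>\<^bsub>E (Suc 0)\<^esub> z \<in> rel_coboundaries 0 (carrier R) W"
      if z: "z \<in> rel_cocycles 0 (carrier R) W" for z
    proof -
      have "z \<in> carrier (E (Suc 0))" "d (Suc 0) z = \<zero>\<^bsub>E (Suc (Suc 0))\<^esub>"
        using z killed_carrier killed_all by (auto simp: rel_cocycles_def)
      hence "h [^] (1::nat) \<odot>\<^bsub>E (Suc 0)\<^esub> z = \<zero>\<^bsub>E (Suc 0)\<^esub>" using kills h by simp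
      thus ?thesis using E.operator_subgroupD(3)[OF rel_coboundaries_submodule[OF subset_refl sub[OF W]]] by simp
    qed
    thus "\<exists>k::nat. \<forall>z \<in> rel_cocycles 0 (carrier R) W. (h [^] k) \<odot>\<^bsub>E (Suc 0)\<^esub> z \<in> rel_coboundaries 0 (carrier R) W"
      by blast
  }
qed

end

section \<open>Vanishing in large degrees\<close>

text \<open>Induction on the sum of the exponents: applying some f y lowers the exponent of y and,
  by commutativity, keeps the others valid, so every f y r lies in D and \<open>descent\<close>
  applies. This takes the place of multinomial expansions.\<close>

lemma commuting_powers_descent:
  fixes f :: "'x \<Rightarrow> 'c \<Rightarrow> 'c"
  assumes "finite Y" and C: "\<And>y r. y \<in> Y \<Longrightarrow> r \<in> C \<Longrightarrow> f y r \<in> C"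
    and comm: "\<And>y y' r. y \<in> Y \<Longrightarrow> y' \<in> Y \<Longrightarrow> r \<in> C \<Longrightarrow> f y (f y' r) = f y' (f y r)"
    and D: "\<And>y r. y \<in> Y \<Longrightarrow> r \<in> C \<Longrightarrow> r \<in> D \<Longrightarrow> f y r \<in> D"
    and descent: "\<And>r. r \<in> C \<Longrightarrow> (\<And>y. y \<in> Y \<Longrightarrow> f y r \<in> D) \<Longrightarrow> r \<in> D"
    and r: "r \<in> C" and powers: "\<And>y. y \<in> Y \<Longrightarrow> \<exists>k. (f y ^^ k) r \<in> D"
  shows "r \<in> D"
proof -
  obtain e where "\<forall>y \<in> Y. (f y ^^ e y) r \<in> D" using powers by metis
  thus ?thesis
    using r
  proof (induction "sum e Y" arbitrary: e r rule: less_induct)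
    case less
    show ?case
    proof (rule descent[OF less.prems(2)])
      fix y assume y: "y \<in> Y"
      show "f y r \<in> D"
      proof (cases "e y")
        case 0
        hence "r \<in> D" using less.prems(1) y by auto
        thus ?thesis using D y less.prems(2) by blast
      next
        case (Suc k)
        let ?e = "e(y := k)"
        have swap: "(f y' ^^ l) r' \<in> C \<and> (f y' ^^ l) (f y r') = f y ((f y' ^^ l) r')" if "y' \<in> Y" "r' \<in> C" for y' l r'
          using that by (induction l) (auto simp: C comm y)
        have "sum ?e Y < sum e Y"
          using y \<open>finite Y\<close> Suc by (intro sum_strict_mono_ex1) auto
        moreover have "\<forall>y' \<in> Y. (f y' ^^ ?e y') (f y r) \<in> D"
        proof
          fix y' assume y': "y' \<in> Y"
          show "(f y' ^^ ?e y') (f y r) \<in> D"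
          proof (cases "y' = y")
            case True
            thus ?thesis using less.prems(1) y Suc by (auto simp: funpow_swap1)
          next
            case False
            have "f y ((f y' ^^ e y') r) \<in> D"
              using swap[OF y' less.prems(2)] less.prems(1) y' by (intro D[OF y]) auto
            thus ?thesis using False swap[OF y' less.prems(2)] by simp
          qed
        qed
        moreover have "f y r \<in> C" using C y less.prems(2) .
        ultimately show ?thesis by (rule less.hyps)
      qed
    qed
  qed
qed

lemma (in module) plus_minus_cancel:
  assumes "a \<in> carrier M" "b \<in> carrier M"
  shows "(a \<oplus>\<^bsub>M\<^esub> b) \<ominus>\<^bsub>M\<^esub> a = b"
proof -
  have "(a \<oplus>\<^bsub>M\<^esub> b) \<ominus>\<^bsub>M\<^esub> a = b \<oplus>\<^bsub>M\<^esub> (a \<oplus>\<^bsub>M\<^esub> \<ominus>\<^bsub>M\<^esub> a)"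
    unfolding a_minus_def using assms by (simp add: M.a_comm[of a b] M.a_assoc)
  thus ?thesis using assms by (simp add: M.r_neg)
qed

lemma (in module) funpow_smult:
  "x \<in> carrier R \<Longrightarrow> z \<in> carrier M \<Longrightarrow> ((\<lambda>z. x \<odot>\<^bsub>M\<^esub> z) ^^ k) z = (x [^] k) \<odot>\<^bsub>M\<^esub> z"
  by (induction k) (auto simp: smult_assoc1[symmetric] R.m_comm)

lemma (in cring) funpow_mult:
  "x \<in> carrier R \<Longrightarrow> z \<in> carrier R \<Longrightarrow> ((\<lambda>z. x \<otimes> z) ^^ k) z = (x [^] k) \<otimes> z"
  by (induction k) (auto simp: m_assoc[symmetric] m_comm)

context standard_graded_ring
begin

section \<open>The irrelevant ideal and powers of elements\<close>

lemma irrelevant_ideal_iff: "r \<in> irrelevant_ideal R gr \<longleftrightarrow> r \<in> carrier R \<and> hcomp R gr 0 r = \<zero>"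
proof
  assume "r \<in> irrelevant_ideal R gr"
  then obtain c F where r: "r = (\<Oplus> n \<in> F. c n)" "finite F" "F \<subseteq> {1..}" "\<forall>n \<in> F. c n \<in> gr n"
    by (auto simp: irrelevant_ideal_def)
  have "(\<Oplus> n \<in> F. c n) \<in> carrier R \<and> hcomp R gr 0 (\<Oplus> n \<in> F. c n) = \<zero>"
    using r(2-4)
  proof induction
    case (insert n F)
    have c: "c n \<in> carrier R" "c \<in> F \<rightarrow> carrier R" using insert.prems gr.piece_carrier by auto
    have "hcomp R gr 0 (c n) = \<zero>" using insert.prems by (intro gr.hcomp_other[of _ n]) auto
    thus ?case using insert c by (simp add: gr.hcomp_add)
  qed simp
  thus "r \<in> carrier R \<and> hcomp R gr 0 r = \<zero>" by (simp add: r(1))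
next
  assume r: "r \<in> carrier R \<and> hcomp R gr 0 r = \<zero>"
  let ?F = "{n. hcomp R gr n r \<noteq> \<zero>}"
  have "0 \<notin> ?F" using r by simp
  hence "?F \<subseteq> {1..}" by (auto simp: Suc_le_eq intro: gr0I)
  moreover have "r = (\<Oplus> n \<in> ?F. hcomp R gr n r)" "finite ?F" using gr.hcomp_spec r by blast+
  moreover have "\<forall>n \<in> ?F. hcomp R gr n r \<in> gr n" using gr.hcomp_piece r by blast
  ultimately show "r \<in> irrelevant_ideal R gr" unfolding irrelevant_ideal_def by blast
qed

lemma hom_ideal_irrelevant: "hom_ideal (irrelevant_ideal R gr)"
proof -
  have "s \<otimes> r \<in> irrelevant_ideal R gr" if r: "r \<in> irrelevant_ideal R gr" and s: "s \<in> carrier R" for r s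
    using s
  proof (induction rule: gr.homogeneous_induct)
    case zero thus ?case using r by (auto simp: irrelevant_ideal_iff)
  next
    case (piece m a)
    have a: "a \<in> carrier R" using piece gr.piece_carrier by blast
    have "hcomp R gr 0 (r \<otimes> a) = \<zero>"
      using hcomp_mult[OF piece, of r 0] r a by (cases "m = 0") (auto simp: irrelevant_ideal_iff)
    thus ?case using r a by (simp add: irrelevant_ideal_iff m_comm)
  next
    case (add x y)
    thus ?case using r by (auto simp: irrelevant_ideal_iff l_distr gr.hcomp_add)
  qed
  hence "ideal (irrelevant_ideal R gr) R"
    by (intro ideal_if_closed) (auto simp: irrelevant_ideal_iff gr.hcomp_add)
  moreover have "hcomp R gr n r \<in> irrelevant_ideal R gr" if "r \<in> irrelevant_ideal R gr" for r n
    using that gr.hcomp_other[OF gr.hcomp_piece, of r 0 n]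
    by (cases "n = 0") (auto simp: irrelevant_ideal_iff)
  ultimately show ?thesis unfolding hom_ideal_def by blast
qed

lemma nonneg_part:
  assumes r: "r \<in> carrier R" shows "r \<ominus> hcomp R gr 0 r \<in> irrelevant_ideal R gr"
proof -
  have "hcomp R gr 0 (r \<ominus> hcomp R gr 0 r) = hcomp R gr 0 r \<ominus> hcomp R gr 0 r"
    using r gr.hcomp_same[OF gr.hcomp_piece[OF r], of 0] by (simp add: gr.hcomp_minus)
  also have "\<dots> = \<zero>" using r by (simp add: a_minus_def r_neg)
  finally show ?thesis using r by (simp add: irrelevant_ideal_iff)
qed

lemma gr_power: "x \<in> gr m \<Longrightarrow> x [^] (k::nat) \<in> gr (k * m)"
proof (induction k)
  case (Suc k)
  thus ?case using gr_mult[of "x [^] k" "k * m" x m] by (simp add: add.commute)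
qed (simp add: gr_one)

text \<open>Let D consist of the r with c^K r \<in> W for some K; the claim is 1 \<in> D. If y r
  \<in> D for all y in Y, then c r \<in> D since c lies in the ideal of Y, hence r \<in> D. So
  \<open>commuting_powers_descent\<close> applies.\<close>

lemma power_in_Idl_of_powers:
  assumes Y: "finite Y" "Y \<subseteq> carrier R" and c: "c \<in> Idl Y" and W: "ideal W R"
    and pow: "\<And>y. y \<in> Y \<Longrightarrow> \<exists>l::nat. y [^] l \<in> W"
  shows "\<exists>K::nat. c [^] K \<in> W"
proof -
  interpret W: ideal W R by fact
  have cc: "c \<in> carrier R" using ideal.Icarr[OF genideal_ideal[OF Y(2)] c] .
  define D where "D = {r \<in> carrier R. \<exists>K::nat. c [^] K \<otimes> r \<in> W}"
  have up: "c [^] (L + K) \<otimes> r \<in> W" if "c [^] K \<otimes> r \<in> W" "r \<in> carrier R" for K L :: nat and r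
    using W.I_l_closed[OF that(1), of "c [^] L"] that(2) cc by (simp add: nat_pow_mult[symmetric] m_assoc)
  have D: "ideal D R"
  proof (rule ideal_if_closed)
    show "D \<subseteq> carrier R" by (auto simp: D_def)
    show "\<zero> \<in> D" using cc W.zero_closed by (simp add: D_def)
    fix r assume r: "r \<in> D"
    then obtain K :: nat where K: "r \<in> carrier R" "c [^] K \<otimes> r \<in> W" unfolding D_def by blast
    {
      fix s assume "s \<in> D"
      then obtain L :: nat where L: "s \<in> carrier R" "c [^] L \<otimes> s \<in> W" unfolding D_def by blast
      have "c [^] (L + K) \<otimes> r \<oplus> c [^] (L + K) \<otimes> s \<in> W"
        using up[OF K(2,1), of L] up[OF L(2,1), of K] by (intro W.a_closed) (simp_all add: add.commute)
      hence "c [^] (L + K) \<otimes> (r \<oplus> s) \<in> W" using K L cc by (simp add: r_distr)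
      thus "r \<oplus> s \<in> D" using K L unfolding D_def by blast
    next
      fix s assume s: "s \<in> carrier R"
      have "c [^] K \<otimes> (s \<otimes> r) = s \<otimes> (c [^] K \<otimes> r)" using s K cc by (simp add: m_lcomm)
      hence "c [^] K \<otimes> (s \<otimes> r) \<in> W" using W.I_l_closed[OF K(2) s] by simp
      thus "s \<otimes> r \<in> D" using s K unfolding D_def by blast
    }
  qed
  interpret D: ideal D R by (rule D)
  have "\<one> \<in> D"
  proof (rule commuting_powers_descent[where f = "\<lambda>y r. y \<otimes> r" and C = "carrier R", OF Y(1)])
    show "y \<otimes> r \<in> carrier R" if "y \<in> Y" "r \<in> carrier R" for y r
      using m_closed[OF subsetD[OF Y(2) that(1)] that(2)] .
    show "y \<otimes> (y' \<otimes> r) = y' \<otimes> (y \<otimes> r)" if "y \<in> Y" "y' \<in> Y" "r \<in> carrier R" for y y' r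
      using m_lcomm[OF subsetD[OF Y(2) that(1)] subsetD[OF Y(2) that(2)] that(3)] .
    show "y \<otimes> r \<in> D" if "y \<in> Y" "r \<in> carrier R" "r \<in> D" for y r
      using D.I_l_closed[OF that(3) subsetD[OF Y(2) that(1)]] .
    show "r \<in> D" if r: "r \<in> carrier R" "\<And>y. y \<in> Y \<Longrightarrow> y \<otimes> r \<in> D" for r
    proof -
      have "ideal {s \<in> carrier R. s \<otimes> r \<in> D} R"
      proof (rule ideal_if_closed)
        show "a \<oplus> b \<in> {s \<in> carrier R. s \<otimes> r \<in> D}" if "a \<in> {s \<in> carrier R. s \<otimes> r \<in> D}" "b \<in> {s \<in> carrier R. s \<otimes> r \<in> D}" for a b
          using that D.a_closed[of "a \<otimes> r" "b \<otimes> r"] r(1) by (simp add: l_distr)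
        show "b \<otimes> a \<in> {s \<in> carrier R. s \<otimes> r \<in> D}" if "a \<in> {s \<in> carrier R. s \<otimes> r \<in> D}" "b \<in> carrier R" for a b
          using that D.I_l_closed[of "a \<otimes> r" b] r(1) by (simp add: m_assoc)
      qed (use D.zero_closed r(1) in auto)
      moreover have "Y \<subseteq> {s \<in> carrier R. s \<otimes> r \<in> D}"
      proof
        fix y assume y: "y \<in> Y"
        show "y \<in> {s \<in> carrier R. s \<otimes> r \<in> D}" using r(2)[OF y] subsetD[OF Y(2) y] by blast
      qed
      ultimately have "Idl Y \<subseteq> {s \<in> carrier R. s \<otimes> r \<in> D}" by (rule genideal_minimal)
      hence "c \<otimes> r \<in> D" using c by blast
      then obtain K :: nat where "c [^] K \<otimes> (c \<otimes> r) \<in> W" unfolding D_def by blast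
      hence "c [^] Suc K \<otimes> r \<in> W" using r(1) cc by (simp add: m_assoc)
      thus ?thesis using r(1) unfolding D_def by blast
    qed
    fix y assume y: "y \<in> Y"
    then obtain l :: nat where l: "y [^] l \<in> W" using pow by blast
    have "(((\<otimes>) y) ^^ l) \<one> = y [^] l" using funpow_mult[of y \<one> l] y Y(2) by auto
    moreover have "y [^] l \<in> D"
      unfolding D_def using l W.a_Hcarr[OF l] by (intro CollectI conjI exI[of _ "0::nat"]) simp_all
    ultimately show "\<exists>k. (((\<otimes>) y) ^^ k) \<one> \<in> D" by metis
  qed simp
  thus ?thesis using cc unfolding D_def by auto
qed

end

context injective_complex
begin

section \<open>Graded pieces of the Ext modules\<close>

abbreviation Rplus :: "'a set" where "Rplus \<equiv> irrelevant_ideal R gr"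

lemma d_piece: "x \<in> gE i n \<Longrightarrow> d i x \<in> gE (Suc i) n"
  using d_graded_hom[of i] by (auto simp: graded_hom_def)

lemma d_hcomp:
  assumes "x \<in> carrier (E i)"
  shows "hcomp (E (Suc i)) (gE (Suc i)) n (d i x) = d i (hcomp (E i) (gE i) n x)"
  by (rule hcomp_graded_map(1)[OF E.graded_group_gM E.graded_group_gM, where s = "\<lambda>n. n" and f = "d i"])
    (use assms in \<open>auto simp: d_add d_piece\<close>)

lemma killed_hcomp_closed:
  assumes "hom_ideal W" "z \<in> killed W i"
  shows "hcomp (E i) (gE i) n z \<in> killed W i"
  using killed_hcomp[OF E_graded assms(1), of z i] assms(2) by (auto simp: killed_def)

text \<open>The differential preserves degrees and both ideals are homogeneous, so y and v can be
  replaced by their components of degree n.\<close>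

lemma homogeneous_rel_coboundary:
  assumes P: "hom_ideal P" and W: "hom_ideal W" and z: "z \<in> rel_coboundaries j P W" "z \<in> gE (Suc j) n"
  obtains y v where "z = d j y \<oplus>\<^bsub>E (Suc j)\<^esub> v" "y \<in> killed W j" "y \<in> gE j n"
    "v \<in> killed P (Suc j)" "v \<in> gE (Suc j) n"
proof -
  obtain y v where y: "z = d j y \<oplus>\<^bsub>E (Suc j)\<^esub> v" "y \<in> killed W j" "v \<in> killed P (Suc j)"
    using z(1) by (rule rel_coboundariesE)
  have c: "y \<in> carrier (E j)" "v \<in> carrier (E (Suc j))" using y killed_carrier by blast+
  let ?y = "hcomp (E j) (gE j) n y" and ?v = "hcomp (E (Suc j)) (gE (Suc j)) n v"
  have "z = hcomp (E (Suc j)) (gE (Suc j)) n z" using E.gM.hcomp_same[OF z(2)] by simp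
  also have "\<dots> = d j ?y \<oplus>\<^bsub>E (Suc j)\<^esub> ?v" unfolding y(1) using c by (simp add: E.gM.hcomp_add d_hcomp)
  finally show thesis
    using that killed_hcomp_closed[OF W y(2)] killed_hcomp_closed[OF P y(3)] E.gM.hcomp_piece[OF c(1)]
      E.gM.hcomp_piece[OF c(2)] by blast
qed

text \<open>Says that Ext^j(P/W, M)_n = 0, the degree being that of representing cocycles.\<close>

definition vanishes :: "nat \<Rightarrow> int \<Rightarrow> 'a set \<Rightarrow> 'a set \<Rightarrow> bool" where
  "vanishes j n P W \<longleftrightarrow> rel_cocycles j P W \<inter> gE (Suc j) n \<subseteq> rel_coboundaries j P W"

lemma vanishes_refl: "hom_ideal W \<Longrightarrow> vanishes j n W W"
  unfolding vanishes_def rel_cocycles_def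
  using killed_in_rel_coboundaries[OF _ hom_ideal_carrier_subset] by blast

lemma vanishes_trans:
  assumes h: "hom_ideal P" "hom_ideal V" "hom_ideal W" "W \<subseteq> V" "V \<subseteq> P"
    and PV: "vanishes j n P V" and VW: "vanishes j n V W"
  shows "vanishes j n P W"
  unfolding vanishes_def
proof
  fix z assume z: "z \<in> rel_cocycles j P W \<inter> gE (Suc j) n"
  note c = hom_ideal_carrier_subset[OF h(1)] hom_ideal_carrier_subset[OF h(2)] hom_ideal_carrier_subset[OF h(3)]
  have "z \<in> rel_cocycles j V W" using z killed_anti[OF h(5)] by (auto simp: rel_cocycles_def)
  hence "z \<in> rel_coboundaries j V W" using VW z by (auto simp: vanishes_def)
  then obtain y v where y: "z = d j y \<oplus>\<^bsub>E (Suc j)\<^esub> v" "y \<in> killed W j" "v \<in> killed V (Suc j)" "v \<in> gE (Suc j) n"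
    using homogeneous_rel_coboundary[OF h(2,3)] z by blast
  have "v \<in> rel_cocycles j P V" using rel_connecting[OF c(2) h(4) _ y(1-3)] z by blast
  hence "v \<in> rel_coboundaries j P V" using PV y(4) by (auto simp: vanishes_def)
  hence "v \<in> rel_coboundaries j P W" using killed_anti[OF h(4)] unfolding rel_coboundaries_def by blast
  with d_in_rel_coboundaries[OF y(2) c(1)] show "z \<in> rel_coboundaries j P W"
    unfolding y(1) by (rule E.operator_subgroupD(5)[OF rel_coboundaries_submodule[OF c(1,3)]])
qed

text \<open>Multiplication by p raises the degree of a cocycle by m, hence the degree m + n in the
  hypothesis.\<close>

lemma vanishes_cyclic:
  assumes W: "hom_ideal W" and p: "p \<in> gr m" and van: "vanishes j (int m + n) (carrier R) (colon W p)"
  shows "vanishes j n (add_generator W p) W"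
  unfolding vanishes_def
proof
  fix z assume z: "z \<in> rel_cocycles j (add_generator W p) W \<inter> gE (Suc j) n"
  have "p \<odot>\<^bsub>E (Suc j)\<^esub> z \<in> rel_coboundaries j (carrier R) (colon W p)"
    using van rel_cocycles_colon[OF W p, of z j] E.gM_smult[OF p, of z "Suc j" n] z
    unfolding vanishes_def by blast
  thus "z \<in> rel_coboundaries j (add_generator W p) W" using rel_coboundaries_colon[OF W p] z by blast
qed

text \<open>The module \<open>Ext\<^sup>j(R/R\<^sub>+, M)\<close> is finitely generated and killed by \<open>R\<^sub>+\<close>, hence bounded above.\<close>

lemma eventually_vanishes_Rplus: "\<exists>N. \<forall>n \<ge> N. vanishes j n (carrier R) Rplus"
proof -
  note H = hom_ideal_irrelevant
  have Rc: "Rplus \<subseteq> carrier R" by (rule hom_ideal_carrier_subset[OF H])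
  let ?E = "E (Suc j)" and ?Z = "rel_cocycles j (carrier R) Rplus" and ?B = "rel_coboundaries j (carrier R) Rplus"
  let ?hc = "hcomp (E (Suc j)) (gE (Suc j))"
  note Z = rel_cocycles_submodule[OF subset_refl Rc, of j] and B = rel_coboundaries_submodule[OF subset_refl Rc, of j]
  obtain F where F: "finite F" "F \<subseteq> ?Z" "?Z \<subseteq> operator_span ?E (carrier R) (F \<union> ?B)"
    using Z rel_coboundaries_subset[OF subset_refl Rc] subset_refl
    by (rule noetherian_quotientE[OF ext_noetherian[OF hom_ideal_carrier H Rc]])
  have Fc: "F \<subseteq> carrier ?E" using F(2) E.operator_subgroupD(1)[OF Z] by blast
  have "finite (\<Union>f \<in> F. {k. ?hc k f \<noteq> \<zero>\<^bsub>?E\<^esub>})" using F(1) Fc E.gM.hcomp_finite by blast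
  \<comment> \<open>One more than the largest degree of a component of a generator. For an empty set
    \<open>Max\<close> has no specified value, but then the bound concerns no k.\<close>
  hence N: "k < Max (\<Union>f \<in> F. {k. ?hc k f \<noteq> \<zero>\<^bsub>?E\<^esub>}) + 1" (is "k < ?N")
    if "k \<in> (\<Union>f \<in> F. {k. ?hc k f \<noteq> \<zero>\<^bsub>?E\<^esub>})" for k
    using Max_ge that by fastforce
  define N where "N = ?N"
  let ?T = "{x \<in> killed Rplus (Suc j). \<forall>n \<ge> N. ?hc n x = \<zero>\<^bsub>?E\<^esub>}"
  note K = E.operator_subgroupD[OF killed_submodule[OF Rc, of "Suc j"]]
  \<comment> \<open>On elements killed by R_+ a scalar acts through its degree-zero component, so
    multiplication does not raise degrees and \<open>?T\<close> is a submodule.\<close>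
  have T: "E.is_submodule (Suc j) ?T"
  proof (rule E.operator_subgroupI)
    show "?T \<subseteq> carrier ?E" using K(2) by blast
    show "\<zero>\<^bsub>?E\<^esub> \<in> ?T" using K(3) by simp
    show "\<ominus>\<^bsub>?E\<^esub> x \<in> ?T" if "x \<in> ?T" for x using that K(2,4) by (simp add: E.gM.hcomp_neg)
    show "x \<oplus>\<^bsub>?E\<^esub> y \<in> ?T" if "x \<in> ?T" "y \<in> ?T" for x y using that K(2,5) by (simp add: E.gM.hcomp_add)
    show "a \<odot>\<^bsub>?E\<^esub> x \<in> ?T" if a: "a \<in> carrier R" and x: "x \<in> ?T" for a x
    proof -
      have xc: "x \<in> carrier ?E" using x K(2) by blast
      let ?a = "hcomp R gr 0 a"
      have "(a \<ominus> ?a) \<odot>\<^bsub>?E\<^esub> x = \<zero>\<^bsub>?E\<^esub>" using nonneg_part[OF a] x by (auto simp: killed_def)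
      moreover have "(a \<ominus> ?a) \<odot>\<^bsub>?E\<^esub> x = a \<odot>\<^bsub>?E\<^esub> x \<ominus>\<^bsub>?E\<^esub> ?a \<odot>\<^bsub>?E\<^esub> x"
        unfolding a_minus_def using E.smult_l_distr[of a "\<ominus> ?a" x "Suc j"] E.smult_l_minus[of ?a x "Suc j"] a xc by simp
      ultimately have "a \<odot>\<^bsub>?E\<^esub> x \<ominus>\<^bsub>?E\<^esub> ?a \<odot>\<^bsub>?E\<^esub> x = \<zero>\<^bsub>?E\<^esub>" by (simp only:)
      hence eq: "a \<odot>\<^bsub>?E\<^esub> x = ?a \<odot>\<^bsub>?E\<^esub> x"
        by (rule E.M.minus_eq_zeroD[OF E.smult_closed[OF a xc] E.smult_closed[OF gr.hcomp_closed[OF a] xc]])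
      have "?hc n (a \<odot>\<^bsub>?E\<^esub> x) = \<zero>\<^bsub>?E\<^esub>" if "n \<ge> N" for n
        using hcomp_smult[OF E_graded gr.hcomp_piece[OF a, of 0] xc, of n] x that a by (simp add: eq)
      thus ?thesis using K(7)[OF a] x by blast
    qed
  qed
  have "F \<subseteq> ?T"
  proof
    fix f assume f: "f \<in> F"
    have "?hc n f = \<zero>\<^bsub>?E\<^esub>" if "n \<ge> N" for n
    proof (rule ccontr)
      assume "?hc n f \<noteq> \<zero>\<^bsub>?E\<^esub>"
      hence "n < N" unfolding N_def using f by (intro N) blast
      thus False using that by simp
    qed
    thus "f \<in> ?T" using f F(2) by (auto simp: rel_cocycles_def)
  qed
  from E.operator_span_minimal[OF T this] have span: "operator_span ?E (carrier R) F \<subseteq> ?T" .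
  have "vanishes j n (carrier R) Rplus" if n: "n \<ge> N" for n
    unfolding vanishes_def
  proof
    fix z assume z: "z \<in> ?Z \<inter> gE (Suc j) n"
    then obtain f b where f: "f \<in> operator_span ?E (carrier R) F" "b \<in> ?B" "z = f \<oplus>\<^bsub>?E\<^esub> b"
      using F(3) E.operator_span_union[OF Fc B] by blast
    from f(2) obtain y v where y: "b = d j y \<oplus>\<^bsub>?E\<^esub> v" "y \<in> killed Rplus j" "v \<in> killed (carrier R) (Suc j)"
      by (rule rel_coboundariesE)
    have yc: "y \<in> carrier (E j)" using y(2) killed_carrier by blast
    have b: "b = d j y" using y(1) killed_all[OF y(3)] yc by simp
    have fc: "f \<in> carrier ?E" using f(1) span K(2) by blast
    have "z = ?hc n z" using E.gM.hcomp_same z by auto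
    also have "\<dots> = ?hc n f \<oplus>\<^bsub>?E\<^esub> d j (hcomp (E j) (gE j) n y)"
      unfolding f(3) b using fc yc by (simp add: E.gM.hcomp_add d_hcomp)
    also have "?hc n f = \<zero>\<^bsub>?E\<^esub>" using f(1) span n by blast
    finally have "z = d j (hcomp (E j) (gE j) n y)" using yc by simp
    thus "z \<in> ?B" using d_in_rel_coboundaries[OF killed_hcomp_closed[OF H y(2)] subset_refl] by simp
  qed
  thus ?thesis by blast
qed

text \<open>Induction on i along Ext^i(W/R_+) \<rightarrow> Ext^(i+1)(R/W) \<rightarrow>
  Ext^(i+1)(R/R_+). The left module is filtered with factors R/(V : p) where V : p again contains
  R_+, in degrees m + n \<ge> N.\<close>

lemma vanishes_above_Rplus:
  assumes N: "\<And>i n. i \<le> j \<Longrightarrow> n \<ge> N \<Longrightarrow> vanishes i n (carrier R) Rplus"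
    and "i \<le> j" "n \<ge> N" "hom_ideal W" "Rplus \<subseteq> W"
  shows "vanishes i n (carrier R) W"
  using assms(2-5)
proof (induction i arbitrary: n W)
  case 0
  show ?case
    unfolding vanishes_def
  proof
    fix z assume z: "z \<in> rel_cocycles 0 (carrier R) W \<inter> gE (Suc 0) n"
    have "z \<in> rel_cocycles 0 (carrier R) Rplus" using z killed_anti[OF 0(4)] by (auto simp: rel_cocycles_def)
    hence "z \<in> rel_coboundaries 0 (carrier R) Rplus" using N[OF 0(1,2)] z by (auto simp: vanishes_def)
    then obtain y v where y: "z = d 0 y \<oplus>\<^bsub>E (Suc 0)\<^esub> v" "y \<in> killed Rplus 0" "v \<in> killed (carrier R) (Suc 0)"
      by (rule rel_coboundariesE)
    have "y = \<zero>\<^bsub>E 0\<^esub>" using killed_carrier[OF y(2)] E_0 by simp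
    hence "y \<in> killed W 0" using zero_killed[OF hom_ideal_carrier_subset[OF 0(3)]] by simp
    thus "z \<in> rel_coboundaries 0 (carrier R) W" unfolding y(1) using y(3) by (rule rel_coboundariesI)
  qed
next
  case (Suc i)
  note H = hom_ideal_irrelevant and c = hom_ideal_carrier_subset[OF Suc.prems(3)]
  show ?case
    unfolding vanishes_def
  proof
    fix z assume z: "z \<in> rel_cocycles (Suc i) (carrier R) W \<inter> gE (Suc (Suc i)) n"
    have "z \<in> rel_cocycles (Suc i) (carrier R) Rplus" using z killed_anti[OF Suc.prems(4)] by (auto simp: rel_cocycles_def)
    hence "z \<in> rel_coboundaries (Suc i) (carrier R) Rplus" using N[OF Suc.prems(1,2)] z by (auto simp: vanishes_def)
    then obtain y v where y: "z = d (Suc i) y \<oplus>\<^bsub>E (Suc (Suc i))\<^esub> v" "y \<in> killed Rplus (Suc i)" "y \<in> gE (Suc i) n"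
      "v \<in> killed (carrier R) (Suc (Suc i))"
      using homogeneous_rel_coboundary[OF hom_ideal_carrier H] z by blast
    have zy: "z = d (Suc i) y" using y(1) killed_all[OF y(4)] killed_carrier[OF y(2)] by simp
    \<comment> \<open>So far y is killed by R_+ only. As d y is killed by W, y is a cocycle for
      W/R_+; vanishing there yields w killed by W with the same differential.\<close>
    have "d (Suc i) y \<in> killed W (Suc (Suc i))" using z zy by (auto simp: rel_cocycles_def)
    hence yZ: "y \<in> rel_cocycles i W Rplus" using y(2) by (simp add: rel_cocycles_def)
    have "vanishes i n W Rplus"
    proof (rule devissage[where Q = "vanishes i n", OF H Suc.prems(3,4) vanishes_refl[OF H]])
      fix V U
      show "vanishes i n U Rplus" if "hom_ideal V" "hom_ideal U" "Rplus \<subseteq> V" "V \<subseteq> U" "vanishes i n U V" "vanishes i n V Rplus"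
        using vanishes_trans[OF that(2,1) H that(3-6)] .
      assume V: "hom_ideal V" "Rplus \<subseteq> V" "V \<subseteq> W" "V \<noteq> W"
      obtain p m where p: "p \<in> gr m" "p \<in> W" "p \<notin> V" using homogeneous_outside[OF V(1) Suc.prems(3) V(3,4)] by blast
      have "vanishes i (int m + n) (carrier R) (colon V p)"
        using hom_ideal_colon[OF V(1) p(1)] V(2) Suc.prems(1,2) by (intro Suc.IH) auto
      from vanishes_cyclic[OF V(1) p(1) this]
      show "\<exists>p m. p \<in> gr m \<and> p \<in> W \<and> p \<notin> V \<and> vanishes i n (add_generator V p) V" using p by blast
    qed
    hence "y \<in> rel_coboundaries i W Rplus" using yZ y(3) by (auto simp: vanishes_def)
    then obtain y' w where w: "y = d i y' \<oplus>\<^bsub>E (Suc i)\<^esub> w" "y' \<in> killed Rplus i" "w \<in> killed W (Suc i)"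
      by (rule rel_coboundariesE)
    have "z = d (Suc i) w" unfolding zy w(1) using killed_carrier[OF w(2)] killed_carrier[OF w(3)] by (simp add: d_add d_d)
    thus "z \<in> rel_coboundaries (Suc i) (carrier R) W" using d_in_rel_coboundaries[OF w(3) subset_refl] by simp
  qed
qed

text \<open>While V \<noteq> P, some nonzero homogeneous class in P/V is killed by R_+, by
  \<open>commuting_powers_descent\<close>. The ideal V : p then contains R_+, so
  \<open>vanishes_above_Rplus\<close> settles the next factor.\<close>

lemma vanishes_Rplus_torsion:
  assumes N: "\<And>i n. i \<le> j \<Longrightarrow> n \<ge> N \<Longrightarrow> vanishes i n (carrier R) Rplus"
    and i: "i \<le> j" and n: "n \<ge> N" and P: "hom_ideal P" and W: "hom_ideal W" and WP: "W \<subseteq> P"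
    and U: "finite U" "U \<subseteq> (\<Union>m. gr m)" "Rplus = Idl U"
    and tors: "\<And>u p. u \<in> U \<Longrightarrow> p \<in> P \<Longrightarrow> \<exists>q::nat. u [^] q \<otimes> p \<in> W"
  shows "vanishes i n P W"
proof (rule devissage[where Q = "vanishes i n", OF W P WP vanishes_refl[OF W]])
  fix V U'
  show "vanishes i n U' W" if "hom_ideal V" "hom_ideal U'" "W \<subseteq> V" "V \<subseteq> U'" "vanishes i n U' V" "vanishes i n V W"
    using vanishes_trans[OF that(2,1) W that(3-6)] .
  assume V: "hom_ideal V" "W \<subseteq> V" "V \<subseteq> P" "V \<noteq> P"
  have Uc: "U \<subseteq> carrier R" using U(2) gr.piece_carrier by blast
  let ?C = "P \<inter> (\<Union>m. gr m)"
  have Cc: "?C \<subseteq> carrier R" using gr.piece_carrier by blast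
  have "\<exists>p \<in> ?C - V. \<forall>u \<in> U. u \<otimes> p \<in> V"
  proof (rule ccontr)
    assume none: "\<not> (\<exists>p \<in> ?C - V. \<forall>u \<in> U. u \<otimes> p \<in> V)"
    obtain r m where r: "r \<in> gr m" "r \<in> P" "r \<notin> V" using homogeneous_outside[OF V(1) P V(3,4)] by blast
    have "r \<in> V"
    proof (rule commuting_powers_descent[where f = "\<lambda>u r. u \<otimes> r" and C = ?C, OF U(1)])
      show "u \<otimes> p \<in> ?C" if u: "u \<in> U" and p: "p \<in> ?C" for u p
      proof -
        obtain a b where "u \<in> gr a" "p \<in> gr b" using u p U(2) by blast
        hence "u \<otimes> p \<in> gr (a + b)" by (rule gr_mult)
        moreover have "u \<otimes> p \<in> P" using hom_idealD(4)[OF P, of p u] u p Uc by blast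
        ultimately show ?thesis by blast
      qed
      show "u \<otimes> (u' \<otimes> p) = u' \<otimes> (u \<otimes> p)" if "u \<in> U" "u' \<in> U" "p \<in> ?C" for u u' p
        using m_lcomm[OF subsetD[OF Uc that(1)] subsetD[OF Uc that(2)] subsetD[OF Cc that(3)]] .
      show "u \<otimes> p \<in> V" if "u \<in> U" "p \<in> ?C" "p \<in> V" for u p
        using hom_idealD(4)[OF V(1) that(3), of u] that(1) Uc by blast
      show "p \<in> V" if "p \<in> ?C" "\<And>u. u \<in> U \<Longrightarrow> u \<otimes> p \<in> V" for p using that none by blast
      show "r \<in> ?C" using r by blast
      fix u assume u: "u \<in> U"
      then obtain q :: nat where "u [^] q \<otimes> r \<in> W" using tors r(2) by blast
      moreover have "u \<in> carrier R" "r \<in> carrier R" using u Uc r(1) gr.piece_carrier by blast+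
      ultimately have "(((\<otimes>) u) ^^ q) r \<in> V" using funpow_mult[of u r q] V(2) by auto
      thus "\<exists>q. (((\<otimes>) u) ^^ q) r \<in> V" by blast
    qed
    thus False using r by blast
  qed
  then obtain p where pp: "p \<in> ?C" "p \<notin> V" "\<forall>u \<in> U. u \<otimes> p \<in> V" by blast
  then obtain m where p: "p \<in> gr m" by blast
  note colon = hom_ideal_colon[OF V(1) p]
  have "U \<subseteq> colon V p" using pp(3) Uc by (auto simp: colon_def)
  hence "Rplus \<subseteq> colon V p" unfolding U(3) using genideal_minimal[OF hom_idealD(1)[OF colon(1)]] by blast
  hence "vanishes i (int m + n) (carrier R) (colon V p)"
    using n by (intro vanishes_above_Rplus[OF N i _ colon(1)]) auto
  from vanishes_cyclic[OF V(1) p this]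
  show "\<exists>p m. p \<in> gr m \<and> p \<in> P \<and> p \<notin> V \<and> vanishes i n (add_generator V p) V" using p pp by blast
qed

section \<open>Torsion subcomplexes\<close>

text \<open>Torsion through powers of single elements; for finite X it is torsion with respect to
  the ideal generated by X, see \<open>torsion_iff\<close>.\<close>

definition tors :: "'a set \<Rightarrow> nat \<Rightarrow> 'e set" where
  "tors X i = {z \<in> carrier (E i). \<forall>x \<in> X. \<exists>k::nat. (x [^] k) \<odot>\<^bsub>E i\<^esub> z = \<zero>\<^bsub>E i\<^esub>}"

text \<open>\<open>qexact S T j n\<close>: the quotient complex \<open>S/T\<close> is exact at the position of \<open>E (Suc j)\<close> in degree \<open>n\<close>.\<close>

definition qexact :: "(nat \<Rightarrow> 'e set) \<Rightarrow> (nat \<Rightarrow> 'e set) \<Rightarrow> nat \<Rightarrow> int \<Rightarrow> bool" where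
  "qexact S T j n \<longleftrightarrow> (\<forall>z \<in> S (Suc j) \<inter> gE (Suc j) n. d (Suc j) z \<in> T (Suc (Suc j)) \<longrightarrow>
     (\<exists>y \<in> S j \<inter> gE j n. \<exists>v \<in> T (Suc j). z = d j y \<oplus>\<^bsub>E (Suc j)\<^esub> v))"

text \<open>For finite X these ideals are cofinal with the powers of the ideal of X, and their
  generators are explicit.\<close>

definition powers_ideal :: "'a set \<Rightarrow> nat \<Rightarrow> 'a set" where
  "powers_ideal X k = Idl ((\<lambda>x. x [^] k) ` X)"

lemma smult_power_zero_mono:
  assumes "x \<in> carrier R" "z \<in> carrier (E i)" "(x [^] k) \<odot>\<^bsub>E i\<^esub> z = \<zero>\<^bsub>E i\<^esub>" "k \<le> (l::nat)"
  shows "(x [^] l) \<odot>\<^bsub>E i\<^esub> z = \<zero>\<^bsub>E i\<^esub>"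
proof -
  have "x [^] l = x [^] (l - k) \<otimes> x [^] k" using assms by (simp add: nat_pow_mult)
  thus ?thesis using assms by (simp add: E.smult_assoc1)
qed

lemma powers_homogeneous:
  assumes "X \<subseteq> (\<Union>m. gr m)" shows "(\<lambda>x. x [^] (k::nat)) ` X \<subseteq> (\<Union>m. gr m)"
proof
  fix r assume "r \<in> (\<lambda>x. x [^] k) ` X"
  then obtain x m where "r = x [^] k" "x \<in> gr m" using assms by blast
  thus "r \<in> (\<Union>m. gr m)" using gr_power[of x m k] by blast
qed

lemma powers_ideal_hom:
  assumes "X \<subseteq> (\<Union>m. gr m)" shows "hom_ideal (powers_ideal X k)"
  unfolding powers_ideal_def by (rule hom_ideal_Idl[OF powers_homogeneous[OF assms]])

lemma killed_Idl:
  assumes "X \<subseteq> carrier R" shows "killed (Idl X) i = killed X i"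
proof
  show "killed (Idl X) i \<subseteq> killed X i" using killed_anti[OF genideal_self[OF assms]] by blast
  show "killed X i \<subseteq> killed (Idl X) i"
  proof
    fix z assume z: "z \<in> killed X i"
    have zc: "z \<in> carrier (E i)" using z killed_carrier by blast
    have "ideal {r \<in> carrier R. r \<odot>\<^bsub>E i\<^esub> z = \<zero>\<^bsub>E i\<^esub>} R"
      by (rule ideal_if_closed) (use zc in \<open>auto simp: E.smult_l_distr E.smult_assoc1\<close>)
    moreover have "X \<subseteq> {r \<in> carrier R. r \<odot>\<^bsub>E i\<^esub> z = \<zero>\<^bsub>E i\<^esub>}" using z assms by (auto simp: killed_def)
    ultimately have "Idl X \<subseteq> {r \<in> carrier R. r \<odot>\<^bsub>E i\<^esub> z = \<zero>\<^bsub>E i\<^esub>}" by (rule genideal_minimal)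
    thus "z \<in> killed (Idl X) i" using zc by (auto simp: killed_def)
  qed
qed

text \<open>Finitely many exponents can be replaced by their maximum. Torsion thereby becomes a
  union of sets \<open>killed W i\<close>, to which the Ext computations apply.\<close>

lemma tors_iff_killed:
  assumes X: "finite X" "X \<subseteq> carrier R"
  shows "z \<in> tors X i \<longleftrightarrow> (\<exists>k. z \<in> killed (powers_ideal X k) i)"
proof -
  have pc: "(\<lambda>x. x [^] k) ` X \<subseteq> carrier R" for k :: nat using X(2) by auto
  have k: "z \<in> killed (powers_ideal X k) i \<longleftrightarrow> z \<in> carrier (E i) \<and> (\<forall>x \<in> X. (x [^] k) \<odot>\<^bsub>E i\<^esub> z = \<zero>\<^bsub>E i\<^esub>)" for k
    unfolding powers_ideal_def killed_Idl[OF pc] by (auto simp: killed_def)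
  show ?thesis
  proof
    assume z: "z \<in> tors X i"
    have "\<exists>k::nat. \<forall>x \<in> X. (x [^] k) \<odot>\<^bsub>E i\<^esub> z = \<zero>\<^bsub>E i\<^esub>" if "X \<subseteq> carrier R" "\<forall>x \<in> X. \<exists>k::nat. (x [^] k) \<odot>\<^bsub>E i\<^esub> z = \<zero>\<^bsub>E i\<^esub>"
      using X(1) that
    proof induction
      case (insert x X)
      have "\<exists>k::nat. \<forall>x \<in> X. (x [^] k) \<odot>\<^bsub>E i\<^esub> z = \<zero>\<^bsub>E i\<^esub>" by (rule insert.IH) (use insert.prems in auto)
      then obtain k :: nat where k: "\<forall>x \<in> X. (x [^] k) \<odot>\<^bsub>E i\<^esub> z = \<zero>\<^bsub>E i\<^esub>" by blast
      obtain l :: nat where l: "(x [^] l) \<odot>\<^bsub>E i\<^esub> z = \<zero>\<^bsub>E i\<^esub>" using insert.prems by auto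
      have "\<forall>x' \<in> insert x X. (x' [^] (max k l)) \<odot>\<^bsub>E i\<^esub> z = \<zero>\<^bsub>E i\<^esub>"
        using k l z insert.prems(1) smult_power_zero_mono[of _ z i k "max k l"] smult_power_zero_mono[of x z i l "max k l"]
        by (auto simp: tors_def)
      thus ?case by blast
    qed simp
    thus "\<exists>k. z \<in> killed (powers_ideal X k) i" using z X(2) unfolding k by (simp add: tors_def)
  next
    assume "\<exists>k. z \<in> killed (powers_ideal X k) i"
    thus "z \<in> tors X i" unfolding k tors_def by blast
  qed
qed

lemma tors_carrier: "z \<in> tors X i \<Longrightarrow> z \<in> carrier (E i)"
  by (simp add: tors_def)

lemma powers_ideal_mono:
  assumes X: "X \<subseteq> carrier R" and "k \<le> l"
  shows "powers_ideal X l \<subseteq> powers_ideal X k"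
proof -
  have c: "(\<lambda>x. x [^] k) ` X \<subseteq> carrier R" for k :: nat using X by auto
  interpret K: ideal "powers_ideal X k" R unfolding powers_ideal_def by (rule genideal_ideal[OF c])
  have "(\<lambda>x. x [^] l) ` X \<subseteq> powers_ideal X k"
  proof
    fix r assume "r \<in> (\<lambda>x. x [^] l) ` X"
    then obtain x where x: "x \<in> X" "r = x [^] (l - k) \<otimes> x [^] k" using \<open>k \<le> l\<close> X by (auto simp: nat_pow_mult)
    have "x [^] k \<in> powers_ideal X k" using genideal_self[OF c] x(1) unfolding powers_ideal_def by blast
    thus "r \<in> powers_ideal X k" unfolding x(2) using x(1) X by (intro K.I_l_closed) auto
  qed
  thus ?thesis unfolding powers_ideal_def[of X l] by (rule genideal_minimal[OF K.is_ideal])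
qed

lemma tors_submodule:
  assumes X: "finite X" "X \<subseteq> carrier R"
  shows "E.is_submodule i (tors X i)"
proof (rule E.operator_subgroupI)
  have c: "powers_ideal X k \<subseteq> carrier R" for k
  proof -
    have "(\<lambda>x. x [^] k) ` X \<subseteq> carrier R" using X(2) by auto
    from ideal.Icarr[OF genideal_ideal[OF this]] show ?thesis unfolding powers_ideal_def by blast
  qed
  note K = E.operator_subgroupD[OF killed_submodule[OF c]]
  note iff = tors_iff_killed[OF X]
  show "tors X i \<subseteq> carrier (E i)" using tors_carrier by blast
  show "\<zero>\<^bsub>E i\<^esub> \<in> tors X i" using K(3) unfolding iff by blast
  show "\<ominus>\<^bsub>E i\<^esub> x \<in> tors X i" if "x \<in> tors X i" for x using that K(4) unfolding iff by blast
  show "a \<odot>\<^bsub>E i\<^esub> x \<in> tors X i" if "a \<in> carrier R" "x \<in> tors X i" for a x using that K(7) unfolding iff by blast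
  fix x y assume "x \<in> tors X i" "y \<in> tors X i"
  then obtain k l where "x \<in> killed (powers_ideal X k) i" "y \<in> killed (powers_ideal X l) i" unfolding iff by blast
  hence "x \<in> killed (powers_ideal X (max k l)) i" "y \<in> killed (powers_ideal X (max k l)) i"
    using killed_anti[OF powers_ideal_mono[OF X(2)]] by (meson max.cobounded1 max.cobounded2)+
  from K(5)[OF this] show "x \<oplus>\<^bsub>E i\<^esub> y \<in> tors X i" unfolding iff by blast
qed

lemma d_tors: "X \<subseteq> carrier R \<Longrightarrow> z \<in> tors X i \<Longrightarrow> d i z \<in> tors X (Suc i)"
  unfolding tors_def by (simp add: d_smult[symmetric] subset_eq) (metis d_zero)

lemma tors_hcomp:
  assumes X: "finite X" "X \<subseteq> (\<Union>m. gr m)" and z: "z \<in> tors X i"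
  shows "hcomp (E i) (gE i) n z \<in> tors X i"
proof -
  have "X \<subseteq> carrier R" using X(2) gr.piece_carrier by blast
  note iff = tors_iff_killed[OF X(1) this]
  show ?thesis using z killed_hcomp_closed[OF powers_ideal_hom[OF X(2)]] unfolding iff by blast
qed

lemma tors_anti: "X \<subseteq> Y \<Longrightarrow> tors Y i \<subseteq> tors X i"
  by (auto simp: tors_def)

text \<open>Some power of y lies in the ideal of X; a further power lies in the annihilator of z, by
  \<open>power_in_Idl_of_powers\<close>.\<close>

lemma tors_Idl:
  assumes X: "finite X" "X \<subseteq> carrier R" and Y: "Y \<subseteq> carrier R"
    and pow: "\<And>y. y \<in> Y \<Longrightarrow> \<exists>k::nat. y [^] k \<in> Idl X"
  shows "tors X i \<subseteq> tors Y i"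
proof
  fix z assume z: "z \<in> tors X i"
  have zc: "z \<in> carrier (E i)" using z tors_carrier by blast
  have A: "ideal {r \<in> carrier R. r \<odot>\<^bsub>E i\<^esub> z = \<zero>\<^bsub>E i\<^esub>} R"
    by (rule ideal_if_closed) (use zc in \<open>auto simp: E.smult_l_distr E.smult_assoc1\<close>)
  have "\<exists>k::nat. (y [^] k) \<odot>\<^bsub>E i\<^esub> z = \<zero>\<^bsub>E i\<^esub>" if y: "y \<in> Y" for y
  proof -
    obtain k :: nat where k: "y [^] k \<in> Idl X" using pow[OF y] by blast
    have "\<exists>K::nat. (y [^] k) [^] K \<in> {r \<in> carrier R. r \<odot>\<^bsub>E i\<^esub> z = \<zero>\<^bsub>E i\<^esub>}"
      by (rule power_in_Idl_of_powers[OF X k A]) (use z X(2) in \<open>auto simp: tors_def\<close>)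
    then obtain K :: nat where "((y [^] k) [^] K) \<odot>\<^bsub>E i\<^esub> z = \<zero>\<^bsub>E i\<^esub>" by blast
    moreover have "(y [^] k) [^] K = y [^] (k * K)" using subsetD[OF Y y] by (rule nat_pow_pow)
    ultimately show ?thesis by auto
  qed
  thus "z \<in> tors Y i" using zc by (simp add: tors_def)
qed

text \<open>Let W = (y^l) kill z and let P = W + (x^k) kill d z. Then z is a cocycle for P/W, a
  module torsion for R_+ by the hypothesis on products. Writing z as a coboundary splits it into d y
  with y torsion for Y and v torsion for X. The bound is independent of z, l and k.\<close>

lemma qexact_torsion:
  assumes X: "finite X" "X \<subseteq> (\<Union>m. gr m)" and Y: "finite Y" "Y \<subseteq> (\<Union>m. gr m)"
    and U: "finite U" "U \<subseteq> (\<Union>m. gr m)" "Rplus = Idl U"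
    and sub: "\<And>x u. x \<in> X \<Longrightarrow> u \<in> U \<Longrightarrow> \<exists>N::nat. x [^] N \<otimes> u [^] N \<in> Idl Y"
  shows "\<exists>n0. \<forall>n \<ge> n0. qexact (tors Y) (tors X) j n"
proof -
  have Xc: "X \<subseteq> carrier R" and Yc: "Y \<subseteq> carrier R" and Uc: "U \<subseteq> carrier R"
    using X Y U gr.piece_carrier by blast+
  obtain N0 where N0: "\<And>i n. n \<ge> N0 i \<Longrightarrow> vanishes i n (carrier R) Rplus"
    using eventually_vanishes_Rplus by metis
  \<comment> \<open>The bounds for all i \<le> j are needed because of the induction on i in
    \<open>vanishes_above_Rplus\<close>.\<close>
  define n0 where "n0 = Max (N0 ` {..j})"
  have N: "vanishes i n (carrier R) Rplus" if "i \<le> j" "n \<ge> n0" for i n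
    using that Max_ge[of "N0 ` {..j}" "N0 i"] by (intro N0) (auto simp: n0_def)
  have "qexact (tors Y) (tors X) j n" if n: "n \<ge> n0" for n
    unfolding qexact_def
  proof (intro ballI impI)
    fix z assume z: "z \<in> tors Y (Suc j) \<inter> gE (Suc j) n" and dz: "d (Suc j) z \<in> tors X (Suc (Suc j))"
    obtain l where l: "z \<in> killed (powers_ideal Y l) (Suc j)" using z tors_iff_killed[OF Y(1) Yc] by blast
    obtain k0 where k0: "d (Suc j) z \<in> killed (powers_ideal X k0) (Suc (Suc j))" using dz tors_iff_killed[OF X(1) Xc] by blast
    let ?W = "powers_ideal Y l"
    have W: "hom_ideal ?W" by (rule powers_ideal_hom[OF Y(2)])
    have Wid: "ideal ?W R" by (rule hom_idealD(1)[OF W])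
    have yl: "(\<lambda>y. y [^] l) ` Y \<subseteq> ?W" unfolding powers_ideal_def using Yc by (intro genideal_self) auto
    have exq: "\<exists>K. \<forall>k \<ge> K. \<exists>q::nat. u [^] q \<otimes> x [^] (k::nat) \<in> ?W" if x: "x \<in> X" and u: "u \<in> U" for x u
    proof -
      have c: "x \<in> carrier R" "u \<in> carrier R" using x u Xc Uc by auto
      obtain N :: nat where "x [^] N \<otimes> u [^] N \<in> Idl Y" using sub[OF x u] by blast
      then obtain K :: nat where "(x [^] N \<otimes> u [^] N) [^] K \<in> ?W"
        using power_in_Idl_of_powers[OF Y(1) Yc _ Wid] yl by blast
      hence xu: "u [^] (N * K) \<otimes> x [^] (N * K) \<in> ?W" using c by (simp add: nat_pow_distrib nat_pow_pow m_comm)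
      have "u [^] (N * K) \<otimes> x [^] k \<in> ?W" if "k \<ge> N * K" for k
      proof -
        have "x [^] (k - N * K) \<otimes> (u [^] (N * K) \<otimes> x [^] (N * K)) = u [^] (N * K) \<otimes> (x [^] (k - N * K) \<otimes> x [^] (N * K))"
          using c by (simp add: m_lcomm)
        also have "x [^] (k - N * K) \<otimes> x [^] (N * K) = x [^] k" using c that by (simp add: nat_pow_mult)
        finally show ?thesis using ideal.I_l_closed[OF Wid xu, of "x [^] (k - N * K)"] c by simp
      qed
      thus ?thesis by blast
    qed
    then obtain K where K: "\<And>x u k. x \<in> X \<Longrightarrow> u \<in> U \<Longrightarrow> k \<ge> K x u \<Longrightarrow> \<exists>q::nat. u [^] q \<otimes> x [^] (k::nat) \<in> ?W"
      by metis
    \<comment> \<open>Large enough for the x^k to kill d z, through \<open>k0\<close>, and for each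
      x^k to be multiplied into \<open>?W\<close> by a power of each u; the sum bounds all
      \<open>K x u\<close> at once.\<close>
    define k where "k = k0 + (\<Sum>(x, u) \<in> X \<times> U. K x u)"
    have kK: "k \<ge> K x u" if "x \<in> X" "u \<in> U" for x u
      using member_le_sum[of "(x, u)" "X \<times> U" "\<lambda>(x, u). K x u"] that X(1) U(1) by (auto simp: k_def)
    let ?G = "(\<lambda>y. y [^] l) ` Y \<union> (\<lambda>x. x [^] k) ` X"
    let ?P = "Idl ?G"
    have Ghom: "?G \<subseteq> (\<Union>m. gr m)" using powers_homogeneous[OF X(2)] powers_homogeneous[OF Y(2)] by (rule Un_least[rotated])
    have Gc: "?G \<subseteq> carrier R" using Xc Yc by auto
    have P: "hom_ideal ?P" by (rule hom_ideal_Idl[OF Ghom])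
    have GP: "?G \<subseteq> ?P" by (rule genideal_self[OF Gc])
    have WP: "?W \<subseteq> ?P"
      unfolding powers_ideal_def by (rule genideal_minimal[OF hom_idealD(1)[OF P]]) (use GP in blast)
    have van: "vanishes j n ?P ?W"
    proof (rule vanishes_Rplus_torsion[OF N le_refl n P W WP U])
      fix u p assume u: "u \<in> U" and p: "p \<in> ?P"
      have uc: "u \<in> carrier R" using u Uc by blast
      let ?Q = "{p \<in> carrier R. \<exists>q::nat. u [^] q \<otimes> p \<in> ?W}"
      have up: "u [^] (q' + q) \<otimes> p \<in> ?W" if "u [^] q \<otimes> p \<in> ?W" "p \<in> carrier R" for q q' :: nat and p
        using ideal.I_l_closed[OF Wid that(1), of "u [^] q'"] that(2) uc by (simp add: nat_pow_mult[symmetric] m_assoc)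
      have "ideal ?Q R"
      proof (rule ideal_if_closed)
        show "\<zero> \<in> ?Q" using uc hom_idealD(6)[OF W] by simp
        fix r assume "r \<in> ?Q"
        then obtain q :: nat where q: "r \<in> carrier R" "u [^] q \<otimes> r \<in> ?W" by blast
        {
          fix s assume "s \<in> ?Q"
          then obtain q' :: nat where q': "s \<in> carrier R" "u [^] q' \<otimes> s \<in> ?W" by blast
          have "u [^] (q' + q) \<otimes> r \<oplus> u [^] (q' + q) \<otimes> s \<in> ?W"
            using up[OF q(2,1), of q'] up[OF q'(2,1), of q] by (intro hom_idealD(5)[OF W]) (simp_all add: add.commute)
          hence "u [^] (q' + q) \<otimes> (r \<oplus> s) \<in> ?W" using q(1) q'(1) uc by (simp add: r_distr)
          thus "r \<oplus> s \<in> ?Q" using q(1) q'(1) by blast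
        next
          fix s assume s: "s \<in> carrier R"
          have "s \<otimes> (u [^] q \<otimes> r) = u [^] q \<otimes> (s \<otimes> r)" using s q(1) uc by (simp add: m_lcomm)
          hence "u [^] q \<otimes> (s \<otimes> r) \<in> ?W" using ideal.I_l_closed[OF Wid q(2) s] by simp
          thus "s \<otimes> r \<in> ?Q" using s q(1) by blast
        }
      qed auto
      moreover have "?G \<subseteq> ?Q"
      proof
        fix r assume r: "r \<in> ?G"
        show "r \<in> ?Q"
        proof (cases "r \<in> (\<lambda>y. y [^] l) ` Y")
          case True
          hence "r \<in> ?W" "r \<in> carrier R" using yl r Gc by blast+
          hence "u [^] (0::nat) \<otimes> r \<in> ?W" "r \<in> carrier R" by simp_all
          thus ?thesis by blast
        next
          case False
          then obtain x where x: "x \<in> X" "r = x [^] k" using r by blast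
          thus ?thesis using K[OF x(1) u kK[OF x(1) u]] Xc by auto
        qed
      qed
      ultimately have "?P \<subseteq> ?Q" by (rule genideal_minimal)
      thus "\<exists>q::nat. u [^] q \<otimes> p \<in> ?W" using p by blast
    qed
    have dzP: "d (Suc j) z \<in> killed ?P (Suc (Suc j))"
      unfolding killed_Idl[OF Gc]
    proof -
      have "d (Suc j) z \<in> killed ((\<lambda>y. y [^] l) ` Y) (Suc (Suc j))"
        using killed_anti[OF yl d_killed[OF hom_ideal_carrier_subset[OF W] l]] .
      moreover have "d (Suc j) z \<in> killed ((\<lambda>x. x [^] k) ` X) (Suc (Suc j))"
      proof (rule killed_anti[OF _ k0])
        have "(\<lambda>x. x [^] k) ` X \<subseteq> powers_ideal X k" unfolding powers_ideal_def using Xc by (intro genideal_self) auto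
        thus "(\<lambda>x. x [^] k) ` X \<subseteq> powers_ideal X k0" using powers_ideal_mono[OF Xc, of k0 k] by (auto simp: k_def)
      qed
      ultimately show "d (Suc j) z \<in> killed ?G (Suc (Suc j))" by (auto simp: killed_def)
    qed
    have "z \<in> rel_coboundaries j ?P ?W" using van l dzP z by (auto simp: vanishes_def rel_cocycles_def)
    then obtain y v where y: "z = d j y \<oplus>\<^bsub>E (Suc j)\<^esub> v" "y \<in> killed ?W j" "y \<in> gE j n" "v \<in> killed ?P (Suc j)"
      using homogeneous_rel_coboundary[OF P W] z by blast
    have "y \<in> tors Y j" using y(2) tors_iff_killed[OF Y(1) Yc] by blast
    moreover have "v \<in> tors X (Suc j)"
    proof -
      have "v \<in> killed ?G (Suc j)" using killed_anti[OF GP y(4)] .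
      thus ?thesis unfolding tors_def killed_def by blast
    qed
    ultimately show "\<exists>y \<in> tors Y j \<inter> gE j n. \<exists>v \<in> tors X (Suc j). z = d j y \<oplus>\<^bsub>E (Suc j)\<^esub> v" using y by blast
  qed
  thus ?thesis by blast
qed

text \<open>The map from \<open>killed W i\<close> to its localization at \<open>h\<close> is surjective.\<close>

lemma divide_by_power:
  assumes W: "hom_ideal W" and h: "h \<in> gr m"
  shows "\<exists>N::nat. \<forall>i. \<forall>y \<in> killed W i. \<forall>k::nat. \<exists>y' \<in> killed W i.
    (h [^] (N + k)) \<odot>\<^bsub>E i\<^esub> y' = (h [^] N) \<odot>\<^bsub>E i\<^esub> y"
proof -
  interpret noetherian_ring R by (rule noetherian)
  have hc: "h \<in> carrier R" using gr.piece_carrier[OF h] .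
  \<comment> \<open>The chain of ideals W : h^N becomes constant. From then on W : h^(N+k) kills h^N
    y, so \<open>extension\<close> divides h^N y by h^(N+k).\<close>
  let ?C = "range (\<lambda>N::nat. colon W (h [^] N))"
  have "?C \<noteq> {}" by blast
  moreover have "ideal V R" if "V \<in> ?C" for V
    using that hom_idealD(1)[OF hom_ideal_colon(1)[OF W gr_power[OF h]]] by blast
  ultimately obtain V where V: "V \<in> ?C" "\<forall>U \<in> ?C. V \<subseteq> U \<longrightarrow> U = V" using maximal_ideal_in_family[of ?C] by blast
  then obtain N :: nat where N: "V = colon W (h [^] N)" by blast
  have up: "colon W (h [^] N) \<subseteq> colon W (h [^] (N + k))" for k :: nat
  proof
    fix r assume "r \<in> colon W (h [^] N)"
    hence r: "r \<in> carrier R" "r \<otimes> h [^] N \<in> W" by (auto simp: colon_def)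
    have "h [^] k \<otimes> (r \<otimes> h [^] N) = r \<otimes> h [^] (N + k)" using r(1) hc by (simp add: nat_pow_mult[symmetric] m_ac)
    thus "r \<in> colon W (h [^] (N + k))" using hom_idealD(4)[OF W r(2), of "h [^] k"] r(1) hc by (simp add: colon_def)
  qed
  have stable: "colon W (h [^] (N + k)) = colon W (h [^] N)" for k :: nat using V(2) up[of k] unfolding N by blast
  have "\<exists>y' \<in> killed W i. (h [^] (N + k)) \<odot>\<^bsub>E i\<^esub> y' = (h [^] N) \<odot>\<^bsub>E i\<^esub> y" if y: "y \<in> killed W i" for i y and k :: nat
  proof -
    have yc: "y \<in> carrier (E i)" using killed_carrier[OF y] .
    have "r \<odot>\<^bsub>E i\<^esub> ((h [^] N) \<odot>\<^bsub>E i\<^esub> y) = \<zero>\<^bsub>E i\<^esub>" if "r \<in> colon W (h [^] (N + k))" for r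
    proof -
      have "r \<in> carrier R" "r \<otimes> h [^] N \<in> W" using that unfolding stable by (auto simp: colon_def)
      thus ?thesis using y yc hc by (simp add: killed_def E.smult_assoc1[symmetric])
    qed
    from extension[OF W gr_power[OF h] _ this] obtain y' where "y' \<in> carrier (E i)" "\<forall>w \<in> W. w \<odot>\<^bsub>E i\<^esub> y' = \<zero>\<^bsub>E i\<^esub>"
      "(h [^] (N + k)) \<odot>\<^bsub>E i\<^esub> y' = (h [^] N) \<odot>\<^bsub>E i\<^esub> y"
      using yc hc by auto
    thus ?thesis by (auto simp: killed_def)
  qed
  thus ?thesis by blast
qed

text \<open>The quotient of the X-torsion by its h-torsion is the localization at h, by
  \<open>divide_by_power\<close>. Its cohomology vanishes since powers of h kill the Ext modules, so
  it is exact in every degree n.\<close>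

lemma qexact_annihilator:
  assumes X: "finite X" "X \<subseteq> (\<Union>m. gr m)" and h: "h \<in> gr m"
    and kills: "\<And>x. x \<in> carrier (E (Suc 0)) \<Longrightarrow> d (Suc 0) x = \<zero>\<^bsub>E (Suc (Suc 0))\<^esub> \<Longrightarrow> h \<odot>\<^bsub>E (Suc 0)\<^esub> x = \<zero>\<^bsub>E (Suc 0)\<^esub>"
  shows "qexact (tors X) (tors (insert h X)) j n"
  unfolding qexact_def
proof (intro ballI impI)
  fix z assume z: "z \<in> tors X (Suc j) \<inter> gE (Suc j) n" and dz: "d (Suc j) z \<in> tors (insert h X) (Suc (Suc j))"
  have Xc: "X \<subseteq> carrier R" and hc: "h \<in> carrier R" using X h gr.piece_carrier by blast+
  have hk [simp]: "h [^] k \<in> carrier R" for k :: nat using hc by simp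
  obtain l where l: "z \<in> killed (powers_ideal X l) (Suc j)" using z tors_iff_killed[OF X(1) Xc] by blast
  let ?W = "powers_ideal X l" and ?E = "E (Suc j)"
  have W: "hom_ideal ?W" by (rule powers_ideal_hom[OF X(2)])
  note Wc = hom_ideal_carrier_subset[OF W]
  have zc: "z \<in> carrier ?E" using killed_carrier[OF l] .
  obtain k :: nat where k: "(h [^] k) \<odot>\<^bsub>E (Suc (Suc j))\<^esub> d (Suc j) z = \<zero>\<^bsub>E (Suc (Suc j))\<^esub>"
    using dz by (auto simp: tors_def)
  \<comment> \<open>h^k z is closed since h^k kills d z; a further power of h makes it a
    coboundary.\<close>
  have "(h [^] k) \<odot>\<^bsub>?E\<^esub> z \<in> rel_cocycles j (carrier R) ?W"
    using E.operator_subgroupD(7)[OF killed_submodule[OF Wc] hk l] k zc zero_killed[OF subset_refl]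
    by (simp add: rel_cocycles_def d_smult)
  then obtain K :: nat where "(h [^] K) \<odot>\<^bsub>?E\<^esub> ((h [^] k) \<odot>\<^bsub>?E\<^esub> z) \<in> rel_coboundaries j (carrier R) ?W"
    using ext_annihilator[OF hc kills hom_ideal_carrier W Wc] by blast
  then obtain y v where y: "(h [^] K) \<odot>\<^bsub>?E\<^esub> ((h [^] k) \<odot>\<^bsub>?E\<^esub> z) = d j y \<oplus>\<^bsub>?E\<^esub> v" "y \<in> killed ?W j" "v \<in> killed (carrier R) (Suc j)"
    by (rule rel_coboundariesE)
  have yc: "y \<in> carrier (E j)" using killed_carrier[OF y(2)] .
  have y1: "(h [^] (K + k)) \<odot>\<^bsub>?E\<^esub> z = d j y"
    using y(1) killed_all[OF y(3)] yc zc hc by (simp add: nat_pow_mult[symmetric] E.smult_assoc1)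
  \<comment> \<open>y is divided by h^(K+k) up to a common factor h^N; therefore h^(N+K+k) kills z -
    d y'.\<close>
  obtain N :: nat and y' where y': "y' \<in> killed ?W j" "(h [^] (N + (K + k))) \<odot>\<^bsub>E j\<^esub> y' = (h [^] N) \<odot>\<^bsub>E j\<^esub> y"
    using divide_by_power[OF W h] y(2) by metis
  have y'c: "y' \<in> carrier (E j)" using killed_carrier[OF y'(1)] .
  let ?v = "z \<ominus>\<^bsub>?E\<^esub> d j y'" and ?M = "N + (K + k)"
  have vW: "?v \<in> killed ?W (Suc j)"
    by (rule E.operator_subgroupD(6)[OF killed_submodule[OF Wc] l d_killed[OF Wc y'(1)]])
  have "(h [^] ?M) \<odot>\<^bsub>?E\<^esub> z = (h [^] N) \<odot>\<^bsub>?E\<^esub> d j y"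
    using y1 zc hc by (simp add: nat_pow_mult[symmetric] E.smult_assoc1)
  also have "\<dots> = (h [^] ?M) \<odot>\<^bsub>?E\<^esub> d j y'" using y'(2) yc y'c by (simp add: d_smult[symmetric])
  finally have "(h [^] ?M) \<odot>\<^bsub>?E\<^esub> ?v = \<zero>\<^bsub>?E\<^esub>"
    using zc y'c by (simp add: a_minus_def E.smult_r_distr E.smult_r_minus E.M.r_neg)
  hence vh: "?v \<in> tors (insert h X) (Suc j)"
    using vW tors_iff_killed[OF X(1) Xc, of ?v "Suc j"] by (auto simp: tors_def)
  have vc: "?v \<in> carrier ?E" using killed_carrier[OF vW] .
  \<comment> \<open>y' may be inhomogeneous; since z has degree n, the degree n components of the
    equation give a homogeneous solution.\<close>
  let ?y = "hcomp (E j) (gE j) n y'"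
  have "z = d j y' \<oplus>\<^bsub>?E\<^esub> ?v" using E.minus_plus_cancel[of z "Suc j" "d j y'"] zc y'c by (simp add: E.M.a_comm)
  hence "hcomp ?E (gE (Suc j)) n z = hcomp ?E (gE (Suc j)) n (d j y') \<oplus>\<^bsub>?E\<^esub> hcomp ?E (gE (Suc j)) n ?v"
    using E.gM.hcomp_add[of "d j y'" "Suc j" ?v n] y'c vc by simp
  hence "z = d j ?y \<oplus>\<^bsub>?E\<^esub> hcomp ?E (gE (Suc j)) n ?v"
    using E.gM.hcomp_same[of z "Suc j" n] z y'c by (simp add: d_hcomp)
  moreover have "?y \<in> tors X j"
    using killed_hcomp_closed[OF W y'(1)] tors_iff_killed[OF X(1) Xc] by blast
  moreover have "?y \<in> gE j n" using E.gM.hcomp_piece[OF y'c] .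
  moreover have "hcomp ?E (gE (Suc j)) n ?v \<in> tors (insert h X) (Suc j)"
    using X h by (intro tors_hcomp[OF _ _ vh]) auto
  ultimately show "\<exists>y \<in> tors X j \<inter> gE j n. \<exists>v \<in> tors (insert h X) (Suc j). z = d j y \<oplus>\<^bsub>?E\<^esub> v" by blast
qed

text \<open>Exactness of H(U/T) \<rightarrow> H(S/T) \<rightarrow> H(S/U) in the middle.\<close>

lemma qexact_trans:
  assumes SU: "qexact S U j n" and UT: "qexact U T j n"
    and S: "\<And>i. E.is_submodule i (S i)" and T: "\<And>i. E.is_submodule i (T i)" and U: "\<And>i. E.is_submodule i (U i)"
    and sub: "\<And>i. T i \<subseteq> U i" "\<And>i. U i \<subseteq> S i"
    and Uh: "\<And>i z. z \<in> U i \<Longrightarrow> hcomp (E i) (gE i) n z \<in> U i"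
    and Th: "\<And>i z. z \<in> T i \<Longrightarrow> hcomp (E i) (gE i) n z \<in> T i"
  shows "qexact S T j n"
  unfolding qexact_def
proof (intro ballI impI)
  fix z assume z: "z \<in> S (Suc j) \<inter> gE (Suc j) n" and dz: "d (Suc j) z \<in> T (Suc (Suc j))"
  let ?E = "E (Suc j)"
  obtain y v where y: "y \<in> S j" "y \<in> gE j n" "v \<in> U (Suc j)" "z = d j y \<oplus>\<^bsub>?E\<^esub> v"
    using SU z dz sub(1) unfolding qexact_def by blast
  have c: "y \<in> carrier (E j)" "v \<in> carrier ?E"
    using y E.operator_subgroupD(2)[OF S] E.operator_subgroupD(2)[OF U] by blast+
  have vn: "v \<in> gE (Suc j) n"
  proof -
    have "v = z \<ominus>\<^bsub>?E\<^esub> d j y" unfolding y(4) using c by (simp add: E.plus_minus_cancel)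
    thus ?thesis using z d_piece[OF y(2)] E.gM.piece_add E.gM.piece_neg by (simp add: a_minus_def)
  qed
  have "d (Suc j) v = d (Suc j) z" unfolding y(4) using c by (simp add: d_add d_d)
  hence "d (Suc j) v \<in> T (Suc (Suc j))" using dz by simp
  then obtain y' v' where y': "y' \<in> U j" "y' \<in> gE j n" "v' \<in> T (Suc j)" "v = d j y' \<oplus>\<^bsub>?E\<^esub> v'"
    using UT y(3) vn unfolding qexact_def by blast
  have c': "y' \<in> carrier (E j)" "v' \<in> carrier ?E"
    using y' E.operator_subgroupD(2)[OF U] E.operator_subgroupD(2)[OF T] by blast+
  have "z = d j (y \<oplus>\<^bsub>E j\<^esub> y') \<oplus>\<^bsub>?E\<^esub> v'"
    unfolding y(4) y'(4) using c c' by (simp add: d_add E.M.a_assoc)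
  moreover have "y \<oplus>\<^bsub>E j\<^esub> y' \<in> S j" using E.operator_subgroupD(5)[OF S y(1)] y'(1) sub(2) by blast
  moreover have "y \<oplus>\<^bsub>E j\<^esub> y' \<in> gE j n" using y y' E.gM.piece_add by blast
  ultimately show "\<exists>y \<in> S j \<inter> gE j n. \<exists>v \<in> T (Suc j). z = d j y \<oplus>\<^bsub>?E\<^esub> v" using y'(3) by blast
qed

text \<open>Exactness of H^j(S/T) \<rightarrow> H^j(S/U) \<rightarrow> H^(j+1)(U/T) in the middle,
  whence the index \<open>Suc j\<close> for U/T.\<close>

lemma qexact_cancel:
  assumes ST: "qexact S T j n" and UT: "qexact U T (Suc j) n"
    and S: "\<And>i. E.is_submodule i (S i)" and U: "\<And>i. E.is_submodule i (U i)" and T: "\<And>i. E.is_submodule i (T i)"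
    and sub: "\<And>i. T i \<subseteq> U i" "\<And>i. U i \<subseteq> S i"
  shows "qexact S U j n"
  unfolding qexact_def
proof (intro ballI impI)
  fix z assume z: "z \<in> S (Suc j) \<inter> gE (Suc j) n" and dz: "d (Suc j) z \<in> U (Suc (Suc j))"
  let ?E = "E (Suc j)" and ?E' = "E (Suc (Suc j))"
  have zc: "z \<in> carrier ?E" using z E.gM.piece_carrier by blast
  have "d (Suc (Suc j)) (d (Suc j) z) \<in> T (Suc (Suc (Suc j)))"
    using d_d[OF zc] E.operator_subgroupD(3)[OF T] by simp
  then obtain y v where y: "y \<in> U (Suc j)" "y \<in> gE (Suc j) n" "v \<in> T (Suc (Suc j))" "d (Suc j) z = d (Suc j) y \<oplus>\<^bsub>?E'\<^esub> v"
    using UT dz d_piece[of z "Suc j" n] z unfolding qexact_def by blast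
  have yc: "y \<in> carrier ?E" using y(2) E.gM.piece_carrier by blast
  have vc: "v \<in> carrier ?E'" using y(3) E.operator_subgroupD(2)[OF T] by blast
  let ?z = "z \<ominus>\<^bsub>?E\<^esub> y"
  have "d (Suc j) ?z = v"
  proof -
    have "d (Suc j) ?z = (d (Suc j) y \<oplus>\<^bsub>?E'\<^esub> v) \<ominus>\<^bsub>?E'\<^esub> d (Suc j) y"
      using zc yc y(4) by (simp add: d_minus)
    thus ?thesis using yc vc by (simp add: E.plus_minus_cancel)
  qed
  moreover have "?z \<in> S (Suc j)"
    using z y(1) sub(2) by (intro E.operator_subgroupD(6)[OF S]) auto
  moreover have "?z \<in> gE (Suc j) n" using z y(2) E.gM.piece_add E.gM.piece_neg by (simp add: a_minus_def)
  ultimately obtain y' v' where y': "y' \<in> S j" "y' \<in> gE j n" "v' \<in> T (Suc j)" "?z = d j y' \<oplus>\<^bsub>?E\<^esub> v'"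
    using ST y(3) unfolding qexact_def by blast
  have c': "y' \<in> carrier (E j)" "v' \<in> carrier ?E"
    using y' E.gM.piece_carrier E.operator_subgroupD(2)[OF T] by blast+
  have "z = d j y' \<oplus>\<^bsub>?E\<^esub> (v' \<oplus>\<^bsub>?E\<^esub> y)"
    using E.minus_plus_cancel[OF zc yc] c' yc unfolding y'(4) by (simp add: E.M.a_assoc)
  moreover have "v' \<oplus>\<^bsub>?E\<^esub> y \<in> U (Suc j)" using E.operator_subgroupD(5)[OF U _ y(1)] y'(3) sub(1) by blast
  ultimately show "\<exists>y \<in> S j \<inter> gE j n. \<exists>v \<in> U (Suc j). z = d j y \<oplus>\<^bsub>?E\<^esub> v" using y' by blast
qed

end

section \<open>Cohomology with support in a regular sequence\<close>

context module
begin

section \<open>Powers of the first element of a regular sequence\<close>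

lemma nonzerodivisor_power:
  assumes X: "is_submodule X" and x: "x \<in> carrier R" and nz: "nonzerodivisor_mod M X N x"
  shows "nonzerodivisor_mod M X N (x [^] (j::nat))"
proof (induction j)
  case 0
  show ?case using operator_subgroupD(2)[OF X] by (auto simp: nonzerodivisor_mod_def)
next
  case (Suc j)
  show ?case
    unfolding nonzerodivisor_mod_def
  proof (intro ballI impI)
    fix m assume m: "m \<in> X" "(x [^] Suc j) \<odot>\<^bsub>M\<^esub> m \<in> N"
    have "(x [^] j) \<odot>\<^bsub>M\<^esub> (x \<odot>\<^bsub>M\<^esub> m) \<in> N"
      using m x operator_subgroupD(2)[OF X] by (simp add: smult_assoc1)
    hence "x \<odot>\<^bsub>M\<^esub> m \<in> N" using Suc operator_subgroupD(7)[OF X x m(1)] by (simp add: nonzerodivisor_mod_def)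
    thus "m \<in> N" using nz m(1) by (simp add: nonzerodivisor_mod_def)
  qed
qed

text \<open>If y m lies in N + x^(j+1)X, then m = n' + x^j c' by induction. Cancelling the regular
  element x^j puts y c', hence c', into N + xX, and so m into N + x^(j+1)X.\<close>

lemma nonzerodivisor_mod_power:
  assumes N: "is_submodule N" and X: "is_submodule X" and x: "x \<in> carrier R" and y: "y \<in> carrier R"
    and nx: "nonzerodivisor_mod M X N x" and ny: "nonzerodivisor_mod M X (add_multiples M X N x) y"
  shows "nonzerodivisor_mod M X (add_multiples M X N (x [^] (j::nat))) y"
proof (induction j)
  case 0
  show ?case
    unfolding nonzerodivisor_mod_def
    using add_multiples_incl(2)[OF N X R.one_closed] operator_subgroupD(2)[OF X] by auto
next
  case (Suc j)
  note Nc = operator_subgroupD[OF N] and Xc = operator_subgroupD[OF X]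
  have xj: "x [^] j \<in> carrier R" using x by simp
  show ?case
    unfolding nonzerodivisor_mod_def
  proof (intro ballI impI)
    fix m assume m: "m \<in> X" "y \<odot>\<^bsub>M\<^esub> m \<in> add_multiples M X N (x [^] Suc j)"
    then obtain n c where nc: "y \<odot>\<^bsub>M\<^esub> m = n \<oplus>\<^bsub>M\<^esub> (x [^] Suc j) \<odot>\<^bsub>M\<^esub> c" "n \<in> N" "c \<in> X"
      by (auto simp: add_multiples_def)
    have nc': "y \<odot>\<^bsub>M\<^esub> m = n \<oplus>\<^bsub>M\<^esub> (x [^] j) \<odot>\<^bsub>M\<^esub> (x \<odot>\<^bsub>M\<^esub> c)"
      using nc x Xc(2) by (simp add: smult_assoc1)
    have "y \<odot>\<^bsub>M\<^esub> m \<in> add_multiples M X N (x [^] j)"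
      unfolding nc' using nc(2) Xc(7)[OF x nc(3)] by (rule add_multiplesI)
    hence "m \<in> add_multiples M X N (x [^] j)" using Suc m(1) by (simp add: nonzerodivisor_mod_def)
    then obtain n' c' where n': "m = n' \<oplus>\<^bsub>M\<^esub> (x [^] j) \<odot>\<^bsub>M\<^esub> c'" "n' \<in> N" "c' \<in> X"
      by (auto simp: add_multiples_def)
    have c: "n \<in> carrier M" "n' \<in> carrier M" "c \<in> carrier M" "c' \<in> carrier M" "m \<in> carrier M"
      using nc n' m Nc(2) Xc(2) by auto
    let ?a = "y \<odot>\<^bsub>M\<^esub> c'" and ?b = "x \<odot>\<^bsub>M\<^esub> c"
    have "(x [^] j) \<odot>\<^bsub>M\<^esub> ?a \<oplus>\<^bsub>M\<^esub> y \<odot>\<^bsub>M\<^esub> n' = y \<odot>\<^bsub>M\<^esub> m"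
      unfolding n'(1) using c y xj by (simp add: smult_r_distr smult_commute[of y] M.a_comm)
    hence e: "(x [^] j) \<odot>\<^bsub>M\<^esub> ?a \<oplus>\<^bsub>M\<^esub> y \<odot>\<^bsub>M\<^esub> n' = n \<oplus>\<^bsub>M\<^esub> (x [^] j) \<odot>\<^bsub>M\<^esub> ?b" using nc' by simp
    have "(x [^] j) \<odot>\<^bsub>M\<^esub> (?a \<ominus>\<^bsub>M\<^esub> ?b) \<oplus>\<^bsub>M\<^esub> y \<odot>\<^bsub>M\<^esub> n' = ((x [^] j) \<odot>\<^bsub>M\<^esub> ?a \<oplus>\<^bsub>M\<^esub> y \<odot>\<^bsub>M\<^esub> n') \<ominus>\<^bsub>M\<^esub> (x [^] j) \<odot>\<^bsub>M\<^esub> ?b"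
      using c x y xj by (simp add: a_minus_def smult_r_distr smult_r_minus M.a_ac)
    also have "\<dots> = n" unfolding e using c x xj by (simp add: a_minus_def M.a_assoc M.r_neg)
    finally have "(x [^] j) \<odot>\<^bsub>M\<^esub> (?a \<ominus>\<^bsub>M\<^esub> ?b) \<in> N"
      using add_cancel_submodule[OF N, of "(x [^] j) \<odot>\<^bsub>M\<^esub> (?a \<ominus>\<^bsub>M\<^esub> ?b)" "y \<odot>\<^bsub>M\<^esub> n'"] nc(2) Nc(7)[OF y n'(2)] c x y xj
      by simp
    moreover have "?a \<ominus>\<^bsub>M\<^esub> ?b \<in> X" using Xc(6)[OF Xc(7)[OF y n'(3)] Xc(7)[OF x nc(3)]] .
    ultimately have "?a \<ominus>\<^bsub>M\<^esub> ?b \<in> N" using nonzerodivisor_power[OF X x nx, of j] by (simp add: nonzerodivisor_mod_def)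
    from add_multiplesI[OF this nc(3), of x] have "?a \<in> add_multiples M X N x"
      using minus_plus_cancel[of ?a ?b] c x y by simp
    hence "c' \<in> add_multiples M X N x" using ny n'(3) by (simp add: nonzerodivisor_mod_def)
    then obtain n'' c'' where n'': "c' = n'' \<oplus>\<^bsub>M\<^esub> x \<odot>\<^bsub>M\<^esub> c''" "n'' \<in> N" "c'' \<in> X"
      by (auto simp: add_multiples_def)
    have "m = (n' \<oplus>\<^bsub>M\<^esub> (x [^] j) \<odot>\<^bsub>M\<^esub> n'') \<oplus>\<^bsub>M\<^esub> (x [^] Suc j) \<odot>\<^bsub>M\<^esub> c''"
      unfolding n'(1) n''(1) using c n'' Nc(2) Xc(2) x xj by (simp add: smult_r_distr smult_assoc1 M.a_assoc)
    thus "m \<in> add_multiples M X N (x [^] Suc j)"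
      using add_multiplesI[OF Nc(5)[OF n'(2) Nc(7)[OF xj n''(2)]] n''(3)] by simp
  qed
qed

text \<open>Each later y is regular modulo the power by \<open>nonzerodivisor_mod_power\<close>; x
  stays regular after y is divided out, by \<open>nonzerodivisor_swap\<close>, so the induction
  continues.\<close>

lemma weakly_regular_power:
  assumes "is_submodule N" and X: "is_submodule X" and x: "x \<in> carrier R" and "set ys \<subseteq> carrier R"
    and "nonzerodivisor_mod M X N x" and "weakly_regular M X (add_multiples M X N x) ys"
  shows "weakly_regular M X (add_multiples M X N (x [^] (j::nat))) ys"
  using assms(1,4-)
proof (induction ys arbitrary: N)
  case (Cons y ys)
  have xj: "x [^] j \<in> carrier R" and y: "y \<in> carrier R" using x Cons.prems by auto
  have ny: "nonzerodivisor_mod M X (add_multiples M X N x) y" using Cons.prems by simp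
  have "weakly_regular M X (add_multiples M X (add_multiples M X N y) (x [^] j)) ys"
  proof (rule Cons.IH)
    show "is_submodule (add_multiples M X N y)" by (rule add_multiples_submodule[OF Cons.prems(1) X y])
    show "nonzerodivisor_mod M X (add_multiples M X N y) x"
      by (rule nonzerodivisor_swap[OF Cons.prems(1) X x y Cons.prems(3) ny])
    show "weakly_regular M X (add_multiples M X (add_multiples M X N y) x) ys"
      using Cons.prems by (simp add: add_multiples_commute[OF Cons.prems(1) X y x])
  qed (use Cons.prems in simp)
  thus ?case
    using nonzerodivisor_mod_power[OF Cons.prems(1) X x y Cons.prems(3) ny, of j]
    by (simp add: add_multiples_commute[OF Cons.prems(1) X y xj])
qed simp

end

context injective_complex
begin

text \<open>The index is the cohomological degree: \<open>cocycles X k\<close> modulo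
  \<open>coboundaries X k\<close> is H^k with support in X, inside \<open>E (Suc k)\<close>.\<close>

definition cocycles :: "'a set \<Rightarrow> nat \<Rightarrow> 'e set" where
  "cocycles X k = {z \<in> tors X (Suc k). d (Suc k) z = \<zero>\<^bsub>E (Suc (Suc k))\<^esub>}"

definition coboundaries :: "'a set \<Rightarrow> nat \<Rightarrow> 'e set" where
  "coboundaries X k = d k ` tors X k"

text \<open>H^j with support in X vanishes for j \<noteq> k, and \<open>xs\<close> is weakly regular
  on H^k. This is the invariant while elements move from \<open>xs\<close> into
  \<open>X\<close>.\<close>

definition concentrated :: "'a set \<Rightarrow> nat \<Rightarrow> 'a list \<Rightarrow> bool" where
  "concentrated X k xs \<longleftrightarrow> (\<forall>j. j \<noteq> k \<longrightarrow> cocycles X j \<subseteq> coboundaries X j) \<and>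
     weakly_regular (E (Suc k)) (cocycles X k) (coboundaries X k) xs"

lemma cocycles_submodule:
  assumes X: "finite X" "X \<subseteq> carrier R" shows "E.is_submodule (Suc k) (cocycles X k)"
  by (rule E.operator_subgroupI)
    (use E.operator_subgroupD[OF tors_submodule[OF X]] in \<open>auto simp: cocycles_def d_neg d_add d_smult\<close>)

lemma coboundaries_submodule:
  assumes X: "finite X" "X \<subseteq> carrier R" shows "E.is_submodule (Suc k) (coboundaries X k)"
proof (rule E.operator_subgroupI)
  note T = E.operator_subgroupD[OF tors_submodule[OF X, of k]]
  show "coboundaries X k \<subseteq> carrier (E (Suc k))" using T(2) by (auto simp: coboundaries_def)
  show "\<zero>\<^bsub>E (Suc k)\<^esub> \<in> coboundaries X k" unfolding coboundaries_def using T(3) d_zero by (metis imageI)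
  show "\<ominus>\<^bsub>E (Suc k)\<^esub> x \<in> coboundaries X k" if "x \<in> coboundaries X k" for x
    using that T(2,4) by (auto simp: coboundaries_def d_neg[symmetric])
  show "x \<oplus>\<^bsub>E (Suc k)\<^esub> y \<in> coboundaries X k" if "x \<in> coboundaries X k" "y \<in> coboundaries X k" for x y
    using that T(2,5) by (auto simp: coboundaries_def d_add[symmetric])
  show "a \<odot>\<^bsub>E (Suc k)\<^esub> x \<in> coboundaries X k" if "a \<in> carrier R" "x \<in> coboundaries X k" for a x
    using that T(2,7) by (auto simp: coboundaries_def d_smult[symmetric])
qed

lemma coboundaries_subset_cocycles: "X \<subseteq> carrier R \<Longrightarrow> coboundaries X k \<subseteq> cocycles X k"
  using d_tors d_d tors_carrier by (auto simp: coboundaries_def cocycles_def)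

lemma tors_divide:
  assumes X: "finite X" "X \<subseteq> (\<Union>m. gr m)" and h: "h \<in> gr m" and y: "y \<in> tors X i"
  obtains N :: nat and y' where "y' \<in> tors X i" "(h [^] (N + k)) \<odot>\<^bsub>E i\<^esub> y' = (h [^] N) \<odot>\<^bsub>E i\<^esub> y"
proof -
  have Xc: "X \<subseteq> carrier R" using X(2) gr.piece_carrier by blast
  obtain l where l: "y \<in> killed (powers_ideal X l) i" using y tors_iff_killed[OF X(1) Xc] by blast
  obtain N :: nat where "\<forall>i. \<forall>y \<in> killed (powers_ideal X l) i. \<forall>k::nat. \<exists>y' \<in> killed (powers_ideal X l) i.
      (h [^] (N + k)) \<odot>\<^bsub>E i\<^esub> y' = (h [^] N) \<odot>\<^bsub>E i\<^esub> y"
    using divide_by_power[OF powers_ideal_hom[OF X(2), of l] h] by blast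
  then obtain y' where "y' \<in> killed (powers_ideal X l) i" "(h [^] (N + k)) \<odot>\<^bsub>E i\<^esub> y' = (h [^] N) \<odot>\<^bsub>E i\<^esub> y"
    using l by blast
  thus thesis using that tors_iff_killed[OF X(1) Xc] by blast
qed

lemma tors_insert_iff:
  "z \<in> tors (insert x X) i \<longleftrightarrow> z \<in> tors X i \<and> (\<exists>k::nat. (x [^] k) \<odot>\<^bsub>E i\<^esub> z = \<zero>\<^bsub>E i\<^esub>)"
  by (auto simp: tors_def)

text \<open>Division of b by x^l up to a common factor gives b' such that y - d b' is x-torsion; its
  differential is that of y.\<close>

lemma correct_to_torsion:
  assumes X: "finite X" "X \<subseteq> (\<Union>m. gr m)" and x: "x \<in> gr m" and y: "y \<in> tors X (Suc i)"
    and b: "b \<in> tors X i" "(x [^] (l::nat)) \<odot>\<^bsub>E (Suc i)\<^esub> y = d i b"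
  shows "\<exists>y' \<in> tors (insert x X) (Suc i). d (Suc i) y' = d (Suc i) y"
proof -
  have Xc: "X \<subseteq> carrier R" and xc: "x \<in> carrier R" using X(2) x gr.piece_carrier by blast+
  have xk [simp]: "x [^] k \<in> carrier R" for k :: nat using xc by simp
  obtain N :: nat and b' where b': "b' \<in> tors X i" "(x [^] (N + l)) \<odot>\<^bsub>E i\<^esub> b' = (x [^] N) \<odot>\<^bsub>E i\<^esub> b"
    by (rule tors_divide[OF X x b(1), of l])
  have c: "y \<in> carrier (E (Suc i))" "b \<in> carrier (E i)" "b' \<in> carrier (E i)" using y b b' tors_carrier by blast+
  let ?v = "y \<ominus>\<^bsub>E (Suc i)\<^esub> d i b'"
  have "(x [^] (N + l)) \<odot>\<^bsub>E (Suc i)\<^esub> y = (x [^] N) \<odot>\<^bsub>E (Suc i)\<^esub> d i b"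
    using b(2) c xc by (simp add: nat_pow_mult[symmetric] E.smult_assoc1)
  also have "\<dots> = (x [^] (N + l)) \<odot>\<^bsub>E (Suc i)\<^esub> d i b'" using b'(2) c by (simp add: d_smult[symmetric])
  finally have "(x [^] (N + l)) \<odot>\<^bsub>E (Suc i)\<^esub> ?v = \<zero>\<^bsub>E (Suc i)\<^esub>"
    using c by (simp add: a_minus_def E.smult_r_distr E.smult_r_minus E.M.r_neg)
  moreover have "?v \<in> tors X (Suc i)"
    using E.operator_subgroupD(6)[OF tors_submodule[OF X(1) Xc] y d_tors[OF Xc b'(1)]] .
  ultimately have "?v \<in> tors (insert x X) (Suc i)" unfolding tors_insert_iff by blast
  moreover have "d (Suc i) ?v = d (Suc i) y \<ominus>\<^bsub>E (Suc (Suc i))\<^esub> d (Suc i) (d i b')"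
    by (rule d_minus) (use c in simp_all)
  hence "d (Suc i) ?v = d (Suc i) y" using c by (simp add: d_d a_minus_def)
  ultimately show ?thesis by blast
qed

text \<open>H^j with x added to the support sits between the localization of H^(j-1) at x and H^j.
  The former vanishes for j \<noteq> k + 1. Classes from the larger support are x-torsion in H^j,
  hence zero there, also for j = k because x is regular on H^k.\<close>

lemma concentrated_step_acyclic:
  assumes X: "finite X" "X \<subseteq> (\<Union>m. gr m)" and x: "x \<in> gr m"
    and acyclic: "\<And>j. j \<noteq> k \<Longrightarrow> cocycles X j \<subseteq> coboundaries X j"
    and nz: "nonzerodivisor_mod (E (Suc k)) (cocycles X k) (coboundaries X k) x" and j: "j \<noteq> Suc k"
  shows "cocycles (insert x X) j \<subseteq> coboundaries (insert x X) j"
proof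
  have Xc: "X \<subseteq> carrier R" and xc: "x \<in> carrier R" using X(2) x gr.piece_carrier by blast+
  have xk [simp]: "x [^] k \<in> carrier R" for k :: nat using xc by simp
  fix z assume z: "z \<in> cocycles (insert x X) j"
  hence zX: "z \<in> cocycles X j" unfolding cocycles_def using tors_insert_iff by blast
  obtain l :: nat where l: "(x [^] l) \<odot>\<^bsub>E (Suc j)\<^esub> z = \<zero>\<^bsub>E (Suc j)\<^esub>" using z unfolding cocycles_def tors_insert_iff by blast
  have "z \<in> coboundaries X j"
  proof (cases "j = k")
    case True
    have "\<zero>\<^bsub>E (Suc k)\<^esub> \<in> coboundaries X k" by (rule E.operator_subgroupD(3)[OF coboundaries_submodule[OF X(1) Xc]])
    thus ?thesis using E.nonzerodivisor_power[OF cocycles_submodule[OF X(1) Xc] xc nz, of l] zX l True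
      by (simp add: nonzerodivisor_mod_def)
  qed (use acyclic zX in blast)
  then obtain y where y: "y \<in> tors X j" "z = d j y" by (auto simp: coboundaries_def)
  have yc: "y \<in> carrier (E j)" using y(1) tors_carrier by blast
  show "z \<in> coboundaries (insert x X) j"
  proof (cases j)
    case 0
    have "y = \<zero>\<^bsub>E 0\<^esub>" using yc E_0 0 by simp
    moreover have "\<zero>\<^bsub>E 0\<^esub> \<in> tors (insert x X) 0" using X(1) Xc xc by (intro E.operator_subgroupD(3)[OF tors_submodule]) auto
    ultimately show ?thesis using y 0 unfolding coboundaries_def by blast
  next
    case (Suc i)
    have "(x [^] l) \<odot>\<^bsub>E j\<^esub> y \<in> cocycles X i"
      using E.operator_subgroupD(7)[OF tors_submodule[OF X(1) Xc] xk y(1)] l y(2) yc Suc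
      by (simp add: cocycles_def d_smult)
    moreover have "i \<noteq> k" using j Suc by simp
    ultimately have "(x [^] l) \<odot>\<^bsub>E j\<^esub> y \<in> coboundaries X i" using acyclic by blast
    then obtain b where b: "b \<in> tors X i" "(x [^] l) \<odot>\<^bsub>E j\<^esub> y = d i b" by (auto simp: coboundaries_def)
    have "\<exists>y' \<in> tors (insert x X) (Suc i). d (Suc i) y' = d (Suc i) y"
      by (rule correct_to_torsion[OF X x _ b(1)]) (use y b Suc in auto)
    then obtain y' where "y' \<in> tors (insert x X) j" "d j y' = z" using Suc y(2) by auto
    thus ?thesis unfolding coboundaries_def by blast
  qed
qed

text \<open>A class in \<open>H\<^bsup>k+1\<^esup>\<close> of the \<open>x\<close>-torsion subcomplex is \<open>d y\<close> with \<open>x\<^sup>j y\<close> a cocycle of the full complex,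
  i.e. a fraction with denominator \<open>x\<^sup>j\<close>; the set below transports a submodule of \<open>k\<close>-cocycles.\<close>

definition fractions :: "'a \<Rightarrow> 'a set \<Rightarrow> nat \<Rightarrow> 'e set \<Rightarrow> 'e set" where
  "fractions x X k N = {d (Suc k) y | y. y \<in> tors X (Suc k) \<and> (\<exists>j::nat. (x [^] j) \<odot>\<^bsub>E (Suc k)\<^esub> y \<in> N)}"

text \<open>H^(k+1) with x added to the support is the direct limit of the quotients H^k/x^j H^k,
  the class of d y corresponding to x^j y. By \<open>weakly_regular_power\<close>, \<open>xs\<close>
  is weakly regular on all of these quotients.\<close>

lemma concentrated_step_regular:
  assumes X: "finite X" "X \<subseteq> (\<Union>m. gr m)" and x: "x \<in> gr m"
    and acyclic: "cocycles X (Suc k) \<subseteq> coboundaries X (Suc k)"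
    and reg: "weakly_regular (E (Suc k)) (cocycles X k) (coboundaries X k) (x # xs)" and xs: "set xs \<subseteq> carrier R"
  shows "weakly_regular (E (Suc (Suc k))) (cocycles (insert x X) (Suc k)) (coboundaries (insert x X) (Suc k)) xs"
proof -
  have Xc: "X \<subseteq> carrier R" and xc: "x \<in> carrier R" using X(2) x gr.piece_carrier by blast+
  have xk [simp]: "x [^] k \<in> carrier R" for k :: nat using xc by simp
  let ?E = "E (Suc k)" and ?E' = "E (Suc (Suc k))" and ?Z = "cocycles X k" and ?Z' = "cocycles (insert x X) (Suc k)"
  let ?\<Phi> = "fractions x X k"
  note T = E.operator_subgroupD[OF tors_submodule[OF X(1) Xc]]
  have Z: "E.is_submodule (Suc k) ?Z" by (rule cocycles_submodule[OF X(1) Xc])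
  note Zc = E.operator_subgroupD[OF Z]
  have Zt: "z \<in> tors X (Suc k)" "d (Suc k) z = \<zero>\<^bsub>?E'\<^esub>" if "z \<in> ?Z" for z using that by (auto simp: cocycles_def)
  have Z': "E.is_submodule (Suc (Suc k)) ?Z'" using X(1) Xc xc by (intro cocycles_submodule) auto
  have lift: "\<exists>y \<in> tors X (Suc k). z = d (Suc k) y \<and> (\<exists>l::nat. (x [^] l) \<odot>\<^bsub>?E\<^esub> y \<in> ?Z)" if z: "z \<in> ?Z'" for z
  proof -
    have "z \<in> cocycles X (Suc k)" using z unfolding cocycles_def using tors_insert_iff by blast
    then obtain y where y: "y \<in> tors X (Suc k)" "z = d (Suc k) y" using acyclic by (auto simp: coboundaries_def)
    obtain l :: nat where l: "(x [^] l) \<odot>\<^bsub>?E'\<^esub> z = \<zero>\<^bsub>?E'\<^esub>" using z unfolding cocycles_def tors_insert_iff by blast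
    have "(x [^] l) \<odot>\<^bsub>?E\<^esub> y \<in> ?Z"
      using T(7)[OF xk y(1)] l y tors_carrier[OF y(1)] by (simp add: cocycles_def d_smult)
    thus ?thesis using y by blast
  qed
  have base: "?\<Phi> (coboundaries X k) = coboundaries (insert x X) (Suc k)"
  proof
    show "?\<Phi> (coboundaries X k) \<subseteq> coboundaries (insert x X) (Suc k)"
    proof
      fix z assume "z \<in> ?\<Phi> (coboundaries X k)"
      then obtain y b and j :: nat where y: "z = d (Suc k) y" "y \<in> tors X (Suc k)" "b \<in> tors X k" "(x [^] j) \<odot>\<^bsub>?E\<^esub> y = d k b"
        unfolding fractions_def coboundaries_def by blast
      from correct_to_torsion[OF X x y(2-4)] show "z \<in> coboundaries (insert x X) (Suc k)"
        unfolding y(1) coboundaries_def by (metis imageI)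
    qed
    show "coboundaries (insert x X) (Suc k) \<subseteq> ?\<Phi> (coboundaries X k)"
    proof
      fix z assume "z \<in> coboundaries (insert x X) (Suc k)"
      then obtain y0 where "z = d (Suc k) y0" "y0 \<in> tors (insert x X) (Suc k)" unfolding coboundaries_def by blast
      then obtain y and l :: nat where y: "z = d (Suc k) y" "y \<in> tors X (Suc k)" "(x [^] l) \<odot>\<^bsub>?E\<^esub> y = \<zero>\<^bsub>?E\<^esub>"
        unfolding tors_insert_iff by blast
      have "(x [^] l) \<odot>\<^bsub>?E\<^esub> y \<in> coboundaries X k"
        unfolding y(3) by (rule E.operator_subgroupD(3)[OF coboundaries_submodule[OF X(1) Xc]])
      thus "z \<in> ?\<Phi> (coboundaries X k)" unfolding fractions_def using y(1,2) by blast
    qed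
  qed
  \<comment> \<open>Hence the chain of submodules formed from \<open>xs\<close> in H^k is carried to
    the chain in H^(k+1).\<close>
  have add: "?\<Phi> (add_multiples ?E ?Z N p) = add_multiples ?E' ?Z' (?\<Phi> N) p"
    if N: "E.is_submodule (Suc k) N" "N \<subseteq> ?Z" and p: "p \<in> carrier R" for N p
  proof
    show "?\<Phi> (add_multiples ?E ?Z N p) \<subseteq> add_multiples ?E' ?Z' (?\<Phi> N) p"
    proof
      fix z assume "z \<in> ?\<Phi> (add_multiples ?E ?Z N p)"
      then obtain y n c and j :: nat where y: "z = d (Suc k) y" "y \<in> tors X (Suc k)"
        "(x [^] j) \<odot>\<^bsub>?E\<^esub> y = n \<oplus>\<^bsub>?E\<^esub> p \<odot>\<^bsub>?E\<^esub> c" "n \<in> N" "c \<in> ?Z"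
        unfolding fractions_def add_multiples_def by blast
      obtain K :: nat and c' where c': "c' \<in> tors X (Suc k)" "(x [^] (K + j)) \<odot>\<^bsub>?E\<^esub> c' = (x [^] K) \<odot>\<^bsub>?E\<^esub> c"
        by (rule tors_divide[OF X x Zt(1)[OF y(5)], of j])
      have carr: "y \<in> carrier ?E" "n \<in> carrier ?E" "c \<in> carrier ?E" "c' \<in> carrier ?E"
        using y c' tors_carrier Zc(2) N(2) by blast+
      let ?y = "y \<ominus>\<^bsub>?E\<^esub> p \<odot>\<^bsub>?E\<^esub> c'"
      have yT: "?y \<in> tors X (Suc k)" using T(6)[OF y(2) T(7)[OF p c'(1)]] .
      have "(x [^] (K + j)) \<odot>\<^bsub>?E\<^esub> y = (x [^] K) \<odot>\<^bsub>?E\<^esub> ((x [^] j) \<odot>\<^bsub>?E\<^esub> y)"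
        using carr xc by (simp add: nat_pow_mult[symmetric] E.smult_assoc1)
      also have "\<dots> = (x [^] K) \<odot>\<^bsub>?E\<^esub> n \<oplus>\<^bsub>?E\<^esub> p \<odot>\<^bsub>?E\<^esub> ((x [^] K) \<odot>\<^bsub>?E\<^esub> c)"
        unfolding y(3) using carr p by (simp add: E.smult_r_distr E.smult_commute[of _ p])
      finally have "(x [^] (K + j)) \<odot>\<^bsub>?E\<^esub> ?y = ((x [^] K) \<odot>\<^bsub>?E\<^esub> n \<oplus>\<^bsub>?E\<^esub> p \<odot>\<^bsub>?E\<^esub> ((x [^] K) \<odot>\<^bsub>?E\<^esub> c)) \<ominus>\<^bsub>?E\<^esub> p \<odot>\<^bsub>?E\<^esub> ((x [^] (K + j)) \<odot>\<^bsub>?E\<^esub> c')"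
        using carr p by (simp add: a_minus_def E.smult_r_distr E.smult_r_minus E.smult_commute[of _ p])
      also have "\<dots> = (x [^] K) \<odot>\<^bsub>?E\<^esub> n"
        unfolding c'(2) using carr p by (simp add: a_minus_def E.M.a_assoc E.M.r_neg)
      also have "\<dots> \<in> N" using E.operator_subgroupD(7)[OF N(1) xk y(4)] .
      finally have "d (Suc k) ?y \<in> ?\<Phi> N" unfolding fractions_def using yT by blast
      moreover have "d (Suc k) c' \<in> ?Z'"
      proof -
        have "(x [^] (K + j)) \<odot>\<^bsub>?E'\<^esub> d (Suc k) c' = d (Suc k) ((x [^] K) \<odot>\<^bsub>?E\<^esub> c)"
          using c'(2) carr by (simp add: d_smult[symmetric])
        also have "\<dots> = \<zero>\<^bsub>?E'\<^esub>" using Zt(2)[OF y(5)] carr by (simp add: d_smult)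
        finally show ?thesis using d_tors[OF Xc c'(1)] d_d[OF carr(4)] unfolding cocycles_def tors_insert_iff by blast
      qed
      ultimately have "d (Suc k) ?y \<oplus>\<^bsub>?E'\<^esub> p \<odot>\<^bsub>?E'\<^esub> d (Suc k) c' \<in> add_multiples ?E' ?Z' (?\<Phi> N) p"
        by (rule E.add_multiplesI)
      moreover have "d (Suc k) ?y \<oplus>\<^bsub>?E'\<^esub> p \<odot>\<^bsub>?E'\<^esub> d (Suc k) c' = z"
      proof -
        have "d (Suc k) ?y \<oplus>\<^bsub>?E'\<^esub> p \<odot>\<^bsub>?E'\<^esub> d (Suc k) c' = d (Suc k) (?y \<oplus>\<^bsub>?E\<^esub> p \<odot>\<^bsub>?E\<^esub> c')"
          using carr p by (simp add: d_add d_smult)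
        thus ?thesis using carr p y(1) by (simp add: E.minus_plus_cancel)
      qed
      ultimately show "z \<in> add_multiples ?E' ?Z' (?\<Phi> N) p" by simp
    qed
    show "add_multiples ?E' ?Z' (?\<Phi> N) p \<subseteq> ?\<Phi> (add_multiples ?E ?Z N p)"
    proof
      fix z assume "z \<in> add_multiples ?E' ?Z' (?\<Phi> N) p"
      then obtain y z' and j :: nat where y: "z = d (Suc k) y \<oplus>\<^bsub>?E'\<^esub> p \<odot>\<^bsub>?E'\<^esub> z'" "y \<in> tors X (Suc k)"
        "(x [^] j) \<odot>\<^bsub>?E\<^esub> y \<in> N" "z' \<in> ?Z'"
        unfolding fractions_def add_multiples_def by blast
      obtain y' and l :: nat where y': "y' \<in> tors X (Suc k)" "z' = d (Suc k) y'" "(x [^] l) \<odot>\<^bsub>?E\<^esub> y' \<in> ?Z"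
        using lift[OF y(4)] by blast
      have carr: "y \<in> carrier ?E" "y' \<in> carrier ?E" using y y' tors_carrier by blast+
      have "(x [^] (j + l)) \<odot>\<^bsub>?E\<^esub> (y \<oplus>\<^bsub>?E\<^esub> p \<odot>\<^bsub>?E\<^esub> y') =
          (x [^] (j + l)) \<odot>\<^bsub>?E\<^esub> y \<oplus>\<^bsub>?E\<^esub> p \<odot>\<^bsub>?E\<^esub> ((x [^] (j + l)) \<odot>\<^bsub>?E\<^esub> y')"
        using carr p by (simp add: E.smult_r_distr E.smult_commute[of _ p])
      also have "(x [^] (j + l)) \<odot>\<^bsub>?E\<^esub> y = (x [^] l) \<odot>\<^bsub>?E\<^esub> ((x [^] j) \<odot>\<^bsub>?E\<^esub> y)"
        using carr xc by (simp add: add.commute[of j l] nat_pow_mult[symmetric] E.smult_assoc1)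
      also have "(x [^] (j + l)) \<odot>\<^bsub>?E\<^esub> y' = (x [^] j) \<odot>\<^bsub>?E\<^esub> ((x [^] l) \<odot>\<^bsub>?E\<^esub> y')"
        using carr xc by (simp add: nat_pow_mult[symmetric] E.smult_assoc1)
      also have "(x [^] l) \<odot>\<^bsub>?E\<^esub> ((x [^] j) \<odot>\<^bsub>?E\<^esub> y) \<oplus>\<^bsub>?E\<^esub> p \<odot>\<^bsub>?E\<^esub> ((x [^] j) \<odot>\<^bsub>?E\<^esub> ((x [^] l) \<odot>\<^bsub>?E\<^esub> y')) \<in> add_multiples ?E ?Z N p"
        by (rule E.add_multiplesI[OF E.operator_subgroupD(7)[OF N(1) xk y(3)] Zc(7)[OF xk y'(3)]])
      finally have "d (Suc k) (y \<oplus>\<^bsub>?E\<^esub> p \<odot>\<^bsub>?E\<^esub> y') \<in> ?\<Phi> (add_multiples ?E ?Z N p)"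
        unfolding fractions_def using T(5)[OF y(2) T(7)[OF p y'(1)]] by blast
      thus "z \<in> ?\<Phi> (add_multiples ?E ?Z N p)" using y(1) y'(2) carr p by (simp add: d_add d_smult)
    qed
  qed
  \<comment> \<open>z and p z are written with the common denominator x^(j+l); regularity of p on
    fractions then becomes regularity on numerators modulo N + x^(j+l) \<open>?Z\<close>.\<close>
  have nzd: "nonzerodivisor_mod ?E' ?Z' (?\<Phi> N) p"
    if N: "E.is_submodule (Suc k) N" "N \<subseteq> ?Z" and p: "p \<in> carrier R"
      and np: "\<And>j::nat. nonzerodivisor_mod ?E ?Z (add_multiples ?E ?Z N (x [^] j)) p" for N p
    unfolding nonzerodivisor_mod_def
  proof (intro ballI impI)
    fix z assume z: "z \<in> ?Z'" "p \<odot>\<^bsub>?E'\<^esub> z \<in> ?\<Phi> N"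
    obtain y and l :: nat where y: "y \<in> tors X (Suc k)" "z = d (Suc k) y" "(x [^] l) \<odot>\<^bsub>?E\<^esub> y \<in> ?Z"
      using lift[OF z(1)] by blast
    obtain y2 and j :: nat where y2: "y2 \<in> tors X (Suc k)" "p \<odot>\<^bsub>?E'\<^esub> z = d (Suc k) y2" "(x [^] j) \<odot>\<^bsub>?E\<^esub> y2 \<in> N"
      using z(2) unfolding fractions_def by blast
    have carr: "y \<in> carrier ?E" "y2 \<in> carrier ?E" using y y2 tors_carrier by blast+
    let ?J = "j + l" and ?c = "p \<odot>\<^bsub>?E\<^esub> y \<ominus>\<^bsub>?E\<^esub> y2"
    have yJ: "(x [^] ?J) \<odot>\<^bsub>?E\<^esub> y \<in> ?Z"
      using Zc(7)[OF xk y(3), of j] carr xc by (simp add: nat_pow_mult[symmetric] E.smult_assoc1)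
    have y2J: "(x [^] ?J) \<odot>\<^bsub>?E\<^esub> y2 \<in> N"
      using E.operator_subgroupD(7)[OF N(1) xk y2(3), of l] carr xc
      by (simp add: add.commute[of j l] nat_pow_mult[symmetric] E.smult_assoc1)
    have "d (Suc k) ?c = p \<odot>\<^bsub>?E'\<^esub> z \<ominus>\<^bsub>?E'\<^esub> d (Suc k) y2" using carr p y(2) by (simp add: d_minus d_smult)
    also have "\<dots> = \<zero>\<^bsub>?E'\<^esub>" unfolding y2(2) using carr by (simp add: a_minus_def E.M.r_neg)
    finally have cZ: "?c \<in> ?Z" using T(6)[OF T(7)[OF p y(1)] y2(1)] by (simp add: cocycles_def)
    have "(x [^] ?J) \<odot>\<^bsub>?E\<^esub> y2 \<oplus>\<^bsub>?E\<^esub> (x [^] ?J) \<odot>\<^bsub>?E\<^esub> ?c = (x [^] ?J) \<odot>\<^bsub>?E\<^esub> (?c \<oplus>\<^bsub>?E\<^esub> y2)"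
      using carr p by (simp add: E.smult_r_distr E.M.a_comm)
    also have "\<dots> = p \<odot>\<^bsub>?E\<^esub> ((x [^] ?J) \<odot>\<^bsub>?E\<^esub> y)"
      using carr p by (simp add: E.minus_plus_cancel E.smult_commute[of p])
    finally have "p \<odot>\<^bsub>?E\<^esub> ((x [^] ?J) \<odot>\<^bsub>?E\<^esub> y) \<in> add_multiples ?E ?Z N (x [^] ?J)"
      using E.add_multiplesI[OF y2J cZ, where x = "x [^] ?J" and i = "Suc k"] by (simp only:)
    hence "(x [^] ?J) \<odot>\<^bsub>?E\<^esub> y \<in> add_multiples ?E ?Z N (x [^] ?J)"
      using np[of ?J] yJ by (simp add: nonzerodivisor_mod_def)
    then obtain n c' where c': "(x [^] ?J) \<odot>\<^bsub>?E\<^esub> y = n \<oplus>\<^bsub>?E\<^esub> (x [^] ?J) \<odot>\<^bsub>?E\<^esub> c'" "n \<in> N" "c' \<in> ?Z"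
      by (auto simp: add_multiples_def)
    have carr': "n \<in> carrier ?E" "c' \<in> carrier ?E" using c' Zc(2) N(2) by blast+
    let ?y = "y \<ominus>\<^bsub>?E\<^esub> c'"
    have "(x [^] ?J) \<odot>\<^bsub>?E\<^esub> ?y = (x [^] ?J) \<odot>\<^bsub>?E\<^esub> y \<ominus>\<^bsub>?E\<^esub> (x [^] ?J) \<odot>\<^bsub>?E\<^esub> c'"
      using carr carr' by (simp add: a_minus_def E.smult_r_distr E.smult_r_minus)
    also have "\<dots> = n" unfolding c'(1) using carr' by (simp add: a_minus_def E.M.a_assoc E.M.r_neg)
    finally have "(x [^] ?J) \<odot>\<^bsub>?E\<^esub> ?y \<in> N" using c'(2) by simp
    moreover have "?y \<in> tors X (Suc k)" using T(6)[OF y(1) Zt(1)[OF c'(3)]] .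
    ultimately have "d (Suc k) ?y \<in> ?\<Phi> N" unfolding fractions_def by blast
    moreover have "d (Suc k) ?y = z"
    proof -
      have "d (Suc k) ?y = d (Suc k) y \<ominus>\<^bsub>?E'\<^esub> \<zero>\<^bsub>?E'\<^esub>"
        using d_minus[OF carr(1) carr'(2)] Zt(2)[OF c'(3)] by simp
      thus ?thesis using carr y(2) by (simp add: a_minus_def)
    qed
    ultimately show "z \<in> ?\<Phi> N" by simp
  qed
  \<comment> \<open>All powers of x appear in the hypothesis because all denominators occur.\<close>
  have transport: "weakly_regular ?E' ?Z' (?\<Phi> N) ps"
    if "E.is_submodule (Suc k) N" "N \<subseteq> ?Z" "set ps \<subseteq> carrier R"
      "\<And>j::nat. weakly_regular ?E ?Z (add_multiples ?E ?Z N (x [^] j)) ps" for N ps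
    using that
  proof (induction ps arbitrary: N)
    case (Cons p ps)
    have p: "p \<in> carrier R" using Cons.prems by simp
    have Np: "E.is_submodule (Suc k) (add_multiples ?E ?Z N p)" by (rule E.add_multiples_submodule[OF Cons.prems(1) Z p])
    have "weakly_regular ?E' ?Z' (?\<Phi> (add_multiples ?E ?Z N p)) ps"
    proof (rule Cons.IH[OF Np])
      show "add_multiples ?E ?Z N p \<subseteq> ?Z"
        by (rule E.add_multiples_minimal[OF Z Cons.prems(2)]) (rule Zc(7)[OF p])
      show "weakly_regular ?E ?Z (add_multiples ?E ?Z (add_multiples ?E ?Z N p) (x [^] j)) ps" for j :: nat
        using Cons.prems(4)[of j] by (simp add: E.add_multiples_commute[OF Cons.prems(1) Z p xk])
    qed (use Cons.prems in simp)
    moreover have "nonzerodivisor_mod ?E' ?Z' (?\<Phi> N) p"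
      by (rule nzd[OF Cons.prems(1,2) p]) (use Cons.prems(4) in simp)
    ultimately show ?case by (simp add: add[OF Cons.prems(1,2) p])
  qed simp
  note B = coboundaries_submodule[OF X(1) Xc, of k]
  have "weakly_regular ?E ?Z (add_multiples ?E ?Z (coboundaries X k) (x [^] j)) xs" for j :: nat
    by (rule E.weakly_regular_power[OF B Z xc xs]) (use reg in auto)
  from transport[OF B coboundaries_subset_cocycles[OF Xc] xs this] show ?thesis by (simp add: base)
qed

lemma concentrated_all:
  assumes "finite X" "X \<subseteq> (\<Union>m. gr m)" "set xs \<subseteq> (\<Union>m. gr m)" "concentrated X k xs"
  shows "concentrated (set xs \<union> X) (k + length xs) []"
  using assms
proof (induction xs arbitrary: X k)
  case (Cons x xs)
  obtain m where m: "x \<in> gr m" using Cons.prems(3) by auto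
  have xs: "set xs \<subseteq> carrier R" using Cons.prems(3) gr.piece_carrier by auto
  have conc: "\<And>j. j \<noteq> k \<Longrightarrow> cocycles X j \<subseteq> coboundaries X j"
    "weakly_regular (E (Suc k)) (cocycles X k) (coboundaries X k) (x # xs)"
    using Cons.prems(4) unfolding concentrated_def by blast+
  have "concentrated (insert x X) (Suc k) xs"
    unfolding concentrated_def
  proof (intro conjI allI impI)
    show "cocycles (insert x X) j \<subseteq> coboundaries (insert x X) j" if "j \<noteq> Suc k" for j
      using concentrated_step_acyclic[OF Cons.prems(1,2) m conc(1) _ that] conc(2) by simp
    show "weakly_regular (E (Suc (Suc k))) (cocycles (insert x X) (Suc k)) (coboundaries (insert x X) (Suc k)) xs"
      using concentrated_step_regular[OF Cons.prems(1,2) m conc(1) conc(2) xs] by simp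
  qed
  with Cons.IH[of "insert x X" "Suc k"] Cons.prems m show ?case by auto
qed simp

text \<open>With empty support all elements are torsion, and the only cohomology is the kernel at
  \<open>E (Suc 0)\<close>, in degree 0. So the invariant holds for the empty set and k = 0; after
  the whole sequence has moved into the support the degree is \<open>length xs\<close>.\<close>

lemma regular_sequence_acyclic:
  assumes xs: "set xs \<subseteq> (\<Union>m. gr m)"
    and reg: "weakly_regular (E (Suc 0)) {z \<in> carrier (E (Suc 0)). d (Suc 0) z = \<zero>\<^bsub>E (Suc (Suc 0))\<^esub>} {\<zero>\<^bsub>E (Suc 0)\<^esub>} xs"
    and j: "j \<noteq> length xs"
  shows "cocycles (set xs) j \<subseteq> coboundaries (set xs) j"
proof -
  have t: "tors {} i = carrier (E i)" for i by (simp add: tors_def)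
  have "concentrated {} 0 xs"
    unfolding concentrated_def
  proof (intro conjI allI impI)
    show "cocycles {} j \<subseteq> coboundaries {} j" if "j \<noteq> 0" for j
    proof -
      obtain i where i: "j = Suc i" using \<open>j \<noteq> 0\<close> by (cases j) auto
      show ?thesis using exact[of _ i] by (force simp: cocycles_def coboundaries_def t i)
    qed
    have "coboundaries {} 0 = {\<zero>\<^bsub>E (Suc 0)\<^esub>}" by (simp add: coboundaries_def t E_0)
    thus "weakly_regular (E (Suc 0)) (cocycles {} 0) (coboundaries {} 0) xs" using reg by (simp add: cocycles_def t)
  qed
  from concentrated_all[OF _ _ xs this] have "concentrated (set xs) (length xs) []" by simp
  thus ?thesis using j unfolding concentrated_def by blast
qed

end

section \<open>Radicals of annihilators\<close>

text \<open>One coefficient in I per entry of the list, so that relations among the generators can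
  be reduced by recursion on the list.\<close>

primrec ideal_combinations :: "('r, 'm, 'y) module_scheme \<Rightarrow> 'r set \<Rightarrow> 'm list \<Rightarrow> 'm set" where
  "ideal_combinations M I [] = {\<zero>\<^bsub>M\<^esub>}"
| "ideal_combinations M I (m # ms) = {a \<odot>\<^bsub>M\<^esub> m \<oplus>\<^bsub>M\<^esub> y | a y. a \<in> I \<and> y \<in> ideal_combinations M I ms}"

context module
begin

section \<open>Combinations of generators with coefficients in an ideal\<close>

lemma ideal_multiples_submodule:
  assumes I: "ideal I R" and m: "m \<in> carrier M"
  shows "is_submodule {a \<odot>\<^bsub>M\<^esub> m | a. a \<in> I}"
proof -
  interpret I: ideal I R by fact
  show ?thesis
  proof (rule operator_subgroupI)
    show "{a \<odot>\<^bsub>M\<^esub> m | a. a \<in> I} \<subseteq> carrier M" using m I.a_Hcarr by auto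
    have "\<zero>\<^bsub>M\<^esub> = \<zero> \<odot>\<^bsub>M\<^esub> m" using m by simp
    thus "\<zero>\<^bsub>M\<^esub> \<in> {a \<odot>\<^bsub>M\<^esub> m | a. a \<in> I}" using I.zero_closed by blast
    fix x assume "x \<in> {a \<odot>\<^bsub>M\<^esub> m | a. a \<in> I}"
    then obtain a where a: "a \<in> I" "x = a \<odot>\<^bsub>M\<^esub> m" by blast
    have ac: "a \<in> carrier R" using a(1) I.a_Hcarr by blast
    have "\<ominus>\<^bsub>M\<^esub> x = (\<ominus> a) \<odot>\<^bsub>M\<^esub> m" using a(2) ac m by (simp add: smult_l_minus)
    thus "\<ominus>\<^bsub>M\<^esub> x \<in> {a \<odot>\<^bsub>M\<^esub> m | a. a \<in> I}" using I.a_inv_closed[OF a(1)] by blast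
    fix y assume "y \<in> {a \<odot>\<^bsub>M\<^esub> m | a. a \<in> I}"
    then obtain b where b: "b \<in> I" "y = b \<odot>\<^bsub>M\<^esub> m" by blast
    have "x \<oplus>\<^bsub>M\<^esub> y = (a \<oplus> b) \<odot>\<^bsub>M\<^esub> m" using a(2) b ac I.a_Hcarr[OF b(1)] m by (simp add: smult_l_distr)
    thus "x \<oplus>\<^bsub>M\<^esub> y \<in> {a \<odot>\<^bsub>M\<^esub> m | a. a \<in> I}" using I.a_closed[OF a(1) b(1)] by blast
  next
    fix r x assume r: "r \<in> carrier R" and "x \<in> {a \<odot>\<^bsub>M\<^esub> m | a. a \<in> I}"
    then obtain a where a: "a \<in> I" "x = a \<odot>\<^bsub>M\<^esub> m" by blast
    have "r \<odot>\<^bsub>M\<^esub> x = (r \<otimes> a) \<odot>\<^bsub>M\<^esub> m" using a(2) I.a_Hcarr[OF a(1)] r m by (simp add: smult_assoc1)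
    thus "r \<odot>\<^bsub>M\<^esub> x \<in> {a \<odot>\<^bsub>M\<^esub> m | a. a \<in> I}" using I.I_l_closed[OF a(1) r] by blast
  qed
qed

lemma ideal_combinations_submodule:
  assumes I: "ideal I R" and "set ms \<subseteq> carrier M"
  shows "is_submodule (ideal_combinations M I ms)"
  using assms(2)
proof (induction ms)
  case Nil show ?case by (simp add: zero_submodule)
next
  case (Cons m ms)
  have "ideal_combinations M I (m # ms) =
      {x \<oplus>\<^bsub>M\<^esub> y | x y. x \<in> {a \<odot>\<^bsub>M\<^esub> m | a. a \<in> I} \<and> y \<in> ideal_combinations M I ms}" by auto
  moreover have "is_submodule \<dots>"
    by (rule sum_submodule) (use Cons ideal_multiples_submodule[OF I, of m] in auto)
  ultimately show ?case by simp
qed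

lemma ideal_combinations_incl:
  assumes I: "ideal I R" and "set ms \<subseteq> carrier M" "m \<in> set ms" and a: "a \<in> I"
  shows "a \<odot>\<^bsub>M\<^esub> m \<in> ideal_combinations M I ms"
  using assms(2,3)
proof (induction ms)
  case (Cons m' ms)
  have ac: "a \<in> carrier R" using ideal.Icarr[OF I a] .
  have sub: "is_submodule (ideal_combinations M I ms)" using ideal_combinations_submodule[OF I] Cons.prems by simp
  show ?case
  proof (cases "m = m'")
    case True
    have "a \<odot>\<^bsub>M\<^esub> m = a \<odot>\<^bsub>M\<^esub> m' \<oplus>\<^bsub>M\<^esub> \<zero>\<^bsub>M\<^esub>" using True ac Cons.prems by simp
    thus ?thesis using operator_subgroupD(3)[OF sub] a by auto
  next
    case False
    hence m: "a \<odot>\<^bsub>M\<^esub> m \<in> ideal_combinations M I ms" using Cons by simp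
    have "a \<odot>\<^bsub>M\<^esub> m = \<zero> \<odot>\<^bsub>M\<^esub> m' \<oplus>\<^bsub>M\<^esub> a \<odot>\<^bsub>M\<^esub> m" using Cons.prems operator_subgroupD(2)[OF sub m] by simp
    thus ?thesis using m additive_subgroup.zero_closed[OF ideal.axioms(1)[OF I]] by auto
  qed
qed simp

lemma ideal_smult_combinations:
  assumes I: "ideal I R" and ms: "set ms \<subseteq> carrier M" and gen: "submodule_span R M (set ms) = carrier M"
  shows "ideal_smult R M I \<subseteq> ideal_combinations M I ms"
proof (rule ideal_smult_minimal)
  note sub = ideal_combinations_submodule[OF I ms]
  note D = operator_subgroupD[OF sub]
  show "is_submodule (ideal_combinations M I ms)" by (rule sub)
  show Ic: "I \<subseteq> carrier R" using ideal.Icarr[OF I] by blast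
  fix r x assume r: "r \<in> I" and x: "x \<in> carrier M"
  have rc: "r \<in> carrier R" using r Ic by blast
  have "is_submodule {x \<in> carrier M. r \<odot>\<^bsub>M\<^esub> x \<in> ideal_combinations M I ms}"
    by (rule operator_subgroupI)
      (use rc D in \<open>auto simp: smult_r_minus smult_r_distr smult_commute[OF rc]\<close>)
  moreover have "set ms \<subseteq> {x \<in> carrier M. r \<odot>\<^bsub>M\<^esub> x \<in> ideal_combinations M I ms}"
    using ideal_combinations_incl[OF I ms _ r] ms by auto
  ultimately have "operator_span M (carrier R) (set ms) \<subseteq> {x \<in> carrier M. r \<odot>\<^bsub>M\<^esub> x \<in> ideal_combinations M I ms}"
    by (rule operator_span_minimal)
  thus "r \<odot>\<^bsub>M\<^esub> x \<in> ideal_combinations M I ms" using gen x by (auto simp: submodule_span_eq[OF ms])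
qed

end

text \<open>Being a power of r modulo I is multiplicative; this follows the annihilating element
  through the elimination.\<close>

lemma (in cring) congruent_power_mult:
  assumes I: "ideal I R" and r: "r \<in> carrier R" and "a \<in> I" "b \<in> I" "x = r [^] (K::nat) \<oplus> a" "y = r [^] (L::nat) \<oplus> b"
  shows "\<exists>c \<in> I. x \<otimes> y = r [^] (K + L) \<oplus> c"
proof -
  interpret I: ideal I R by fact
  have c: "a \<in> carrier R" "b \<in> carrier R" using assms I.a_Hcarr by auto
  have "x \<otimes> y = r [^] (K + L) \<oplus> (r [^] K \<otimes> b \<oplus> (r [^] L \<otimes> a \<oplus> a \<otimes> b))"
    unfolding assms(5,6) using c r by (simp add: nat_pow_mult[symmetric] l_distr r_distr a_ac m_comm)
  moreover have "r [^] K \<otimes> b \<oplus> (r [^] L \<otimes> a \<oplus> a \<otimes> b) \<in> I"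
    using assms(3,4) r c by (intro I.a_closed I.I_l_closed) auto
  ultimately show ?thesis by blast
qed

lemma (in cring) congruent_power_pow:
  assumes I: "ideal I R" and r: "r \<in> carrier R" and "a \<in> I" "x = r [^] (K::nat) \<oplus> a"
  shows "\<exists>c \<in> I. x [^] (N::nat) = r [^] (N * K) \<oplus> c"
proof (induction N)
  case 0 thus ?case using additive_subgroup.zero_closed[OF ideal.axioms(1)[OF I]] by (intro bexI[of _ \<zero>]) auto
next
  case (Suc N)
  then obtain c where "c \<in> I" "x [^] N = r [^] (N * K) \<oplus> c" by blast
  from congruent_power_mult[OF I r this(1) assms(3) this(2) assms(4)]
  show ?case by (simp add: add.commute)
qed

context module
begin

text \<open>Gaussian elimination replaces the usual determinant in the Cayley-Hamilton argument.\<close>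

lemma elimination:
  assumes I: "ideal I R"
  shows "set ms \<subseteq> carrier M \<Longrightarrow> r \<in> carrier R \<Longrightarrow> (\<And>m. m \<in> set ms \<Longrightarrow> r \<odot>\<^bsub>M\<^esub> m \<in> ideal_combinations M I ms) \<Longrightarrow>
    \<exists>N::nat. \<exists>c \<in> I. \<forall>m \<in> set ms. (r [^] N \<oplus> c) \<odot>\<^bsub>M\<^esub> m = \<zero>\<^bsub>M\<^esub>"
proof (induction ms arbitrary: r)
  case Nil
  thus ?case using additive_subgroup.zero_closed[OF ideal.axioms(1)[OF I]] by auto
next
  case (Cons m ms)
  interpret I: ideal I R by fact
  have mc: "m \<in> carrier M" "set ms \<subseteq> carrier M" and rc: "r \<in> carrier R" using Cons.prems by auto
  note C = operator_subgroupD[OF ideal_combinations_submodule[OF I mc(2)]]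
  obtain a y0 where a: "r \<odot>\<^bsub>M\<^esub> m = a \<odot>\<^bsub>M\<^esub> m \<oplus>\<^bsub>M\<^esub> y0" "a \<in> I" "y0 \<in> ideal_combinations M I ms"
    using Cons.prems(3)[of m] by auto
  have ac: "a \<in> carrier R" using a(2) I.a_Hcarr by blast
  \<comment> \<open>The relation \<open>?b\<close> m = \<open>y0\<close> is free of m on the right.
    Multiplying the other relations by \<open>?b\<close> removes m from them too, at the price of
    replacing r by r times \<open>?b\<close>, which is r^2 modulo I.\<close>
  let ?b = "r \<oplus> \<ominus> a"
  have bc: "?b \<in> carrier R" using rc ac by simp
  have bm: "?b \<odot>\<^bsub>M\<^esub> m = y0"
  proof -
    have "?b \<odot>\<^bsub>M\<^esub> m = (a \<odot>\<^bsub>M\<^esub> m \<oplus>\<^bsub>M\<^esub> y0) \<ominus>\<^bsub>M\<^esub> a \<odot>\<^bsub>M\<^esub> m"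
      using rc ac mc a(1) by (simp add: smult_l_distr smult_l_minus a_minus_def)
    thus ?thesis using plus_minus_cancel[of "a \<odot>\<^bsub>M\<^esub> m" y0] ac mc C(2)[OF a(3)] by simp
  qed
  have "(r \<otimes> ?b) \<odot>\<^bsub>M\<^esub> m' \<in> ideal_combinations M I ms" if m': "m' \<in> set ms" for m'
  proof -
    have m'c: "m' \<in> carrier M" using m' mc by blast
    obtain a' y' where a': "r \<odot>\<^bsub>M\<^esub> m' = a' \<odot>\<^bsub>M\<^esub> m \<oplus>\<^bsub>M\<^esub> y'" "a' \<in> I" "y' \<in> ideal_combinations M I ms"
      using Cons.prems(3)[of m'] m' by auto
    have a'c: "a' \<in> carrier R" using a'(2) I.a_Hcarr by blast
    have "(r \<otimes> ?b) \<odot>\<^bsub>M\<^esub> m' = ?b \<odot>\<^bsub>M\<^esub> (r \<odot>\<^bsub>M\<^esub> m')"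
      using smult_assoc1[OF bc rc m'c] R.m_comm[OF rc bc] by simp
    also have "\<dots> = a' \<odot>\<^bsub>M\<^esub> (?b \<odot>\<^bsub>M\<^esub> m) \<oplus>\<^bsub>M\<^esub> ?b \<odot>\<^bsub>M\<^esub> y'"
      unfolding a'(1) using smult_r_distr[OF bc smult_closed[OF a'c mc(1)] C(2)[OF a'(3)]] smult_commute[OF bc a'c mc(1)] by simp
    also have "\<dots> \<in> ideal_combinations M I ms"
      unfolding bm using C(5)[OF C(7)[OF a'c a(3)] C(7)[OF bc a'(3)]] .
    finally show ?thesis .
  qed
  from Cons.IH[OF mc(2) R.m_closed[OF rc bc] this] obtain N :: nat and c where
    N: "c \<in> I" "\<forall>m \<in> set ms. ((r \<otimes> ?b) [^] N \<oplus> c) \<odot>\<^bsub>M\<^esub> m = \<zero>\<^bsub>M\<^esub>" by blast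
  let ?s = "(r \<otimes> ?b) [^] N \<oplus> c"
  have cc: "c \<in> carrier R" using N(1) I.a_Hcarr by blast
  have sc: "?s \<in> carrier R" using rc bc cc by simp
  have kill: "is_submodule {x \<in> carrier M. ?s \<odot>\<^bsub>M\<^esub> x = \<zero>\<^bsub>M\<^esub>}"
    by (rule operator_subgroupI) (use sc in \<open>auto simp: smult_r_minus smult_r_distr smult_commute[OF sc]\<close>)
  have "ideal_combinations M I ms' \<subseteq> {x \<in> carrier M. ?s \<odot>\<^bsub>M\<^esub> x = \<zero>\<^bsub>M\<^esub>}" if "set ms' \<subseteq> set ms" for ms'
    using that
  proof (induction ms')
    case Nil show ?case using operator_subgroupD(3)[OF kill] by simp
  next
    case (Cons m' ms')
    note K = operator_subgroupD[OF kill]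
    have "m' \<in> {x \<in> carrier M. ?s \<odot>\<^bsub>M\<^esub> x = \<zero>\<^bsub>M\<^esub>}" using Cons.prems N(2) mc(2) by auto
    hence "e \<odot>\<^bsub>M\<^esub> m' \<in> {x \<in> carrier M. ?s \<odot>\<^bsub>M\<^esub> x = \<zero>\<^bsub>M\<^esub>}" if "e \<in> I" for e
      using K(7)[OF I.a_Hcarr[OF that]] by blast
    moreover have "ideal_combinations M I ms' \<subseteq> {x \<in> carrier M. ?s \<odot>\<^bsub>M\<^esub> x = \<zero>\<^bsub>M\<^esub>}" using Cons by simp
    ultimately show ?case using K(5) by (fastforce simp del: mem_Collect_eq)
  qed
  hence sy0: "?s \<odot>\<^bsub>M\<^esub> y0 = \<zero>\<^bsub>M\<^esub>" using a(3) by blast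
  have b1: "?b = r [^] (1::nat) \<oplus> \<ominus> a" using rc by simp
  have r1: "r = r [^] (1::nat) \<oplus> \<zero>" using rc by simp
  obtain c1 where c1: "c1 \<in> I" "r \<otimes> ?b = r [^] (1 + 1 :: nat) \<oplus> c1"
    using congruent_power_mult[OF I rc I.zero_closed I.a_inv_closed[OF a(2)] r1 b1] by blast
  obtain c2 where c2: "c2 \<in> I" "(r \<otimes> ?b) [^] N = r [^] (N * (1 + 1)) \<oplus> c2"
    using congruent_power_pow[OF I rc c1, of N] by blast
  have s2: "?s = r [^] (N * (1 + 1)) \<oplus> (c2 \<oplus> c)"
    unfolding c2(2) using rc cc I.a_Hcarr[OF c2(1)] by (simp add: R.a_assoc)
  \<comment> \<open>\<open>?s\<close> kills the tail of the list and \<open>y0\<close>, so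
    \<open>?s\<close> times \<open>?b\<close> kills m as well; modulo I this product is
    r^(2N+1).\<close>
  obtain c3 where c3: "c3 \<in> I" "?s \<otimes> ?b = r [^] (N * (1 + 1) + 1) \<oplus> c3"
    using congruent_power_mult[OF I rc I.a_closed[OF c2(1) N(1)] I.a_inv_closed[OF a(2)] s2 b1] by blast
  have "(?s \<otimes> ?b) \<odot>\<^bsub>M\<^esub> m' = \<zero>\<^bsub>M\<^esub>" if "m' \<in> set (m # ms)" for m'
  proof (cases "m' = m")
    case True
    thus ?thesis using smult_assoc1[OF sc bc mc(1)] bm sy0 by simp
  next
    case False
    hence m': "m' \<in> set ms" "m' \<in> carrier M" using that mc by auto
    have "(?s \<otimes> ?b) \<odot>\<^bsub>M\<^esub> m' = ?b \<odot>\<^bsub>M\<^esub> (?s \<odot>\<^bsub>M\<^esub> m')"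
      using smult_assoc1[OF sc bc m'(2)] smult_commute[OF sc bc m'(2)] by simp
    thus ?thesis using N(2) m'(1) bc by simp
  qed
  thus ?case using c3 by (metis (no_types, lifting))
qed

text \<open>Elimination on a finite generating list gives r^N + c with c in I killing the
  generators, hence killing M. The two summands of r^N are -c and this element.\<close>

lemma power_in_ideal_plus_annihilator:
  assumes fg: "finitely_generated_module R M" and I: "ideal I R" and r: "r \<in> carrier R"
    and rM: "\<And>m. m \<in> carrier M \<Longrightarrow> r \<odot>\<^bsub>M\<^esub> m \<in> ideal_smult R M I"
  shows "\<exists>N::nat. \<exists>a \<in> I. \<exists>h \<in> annihilator R M. r [^] N = a \<oplus> h"
proof -
  interpret I: ideal I R by fact
  obtain X where X: "finite X" "X \<subseteq> carrier M" "submodule_span R M X = carrier M"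
    using fg unfolding finitely_generated_module_def by blast
  obtain ms where ms: "set ms = X" using finite_list[OF X(1)] by blast
  obtain N :: nat and c where N: "c \<in> I" "\<forall>m \<in> X. (r [^] N \<oplus> c) \<odot>\<^bsub>M\<^esub> m = \<zero>\<^bsub>M\<^esub>"
    using elimination[OF I, of ms r] rM ideal_smult_combinations[OF I, of ms] X r unfolding ms by blast
  have cc: "c \<in> carrier R" using N(1) I.a_Hcarr by blast
  let ?s = "r [^] N \<oplus> c"
  have sc: "?s \<in> carrier R" using r cc by simp
  have "is_submodule {x \<in> carrier M. ?s \<odot>\<^bsub>M\<^esub> x = \<zero>\<^bsub>M\<^esub>}"
    by (rule operator_subgroupI) (use sc in \<open>auto simp: smult_r_minus smult_r_distr smult_commute[OF sc]\<close>)
  moreover have "X \<subseteq> {x \<in> carrier M. ?s \<odot>\<^bsub>M\<^esub> x = \<zero>\<^bsub>M\<^esub>}" using N(2) X(2) by blast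
  ultimately have "carrier M \<subseteq> {x \<in> carrier M. ?s \<odot>\<^bsub>M\<^esub> x = \<zero>\<^bsub>M\<^esub>}"
    using operator_span_minimal X(3) submodule_span_eq[OF X(2)] by metis
  hence "?s \<in> annihilator R M" using sc by (auto simp: annihilator_def)
  moreover have "r [^] N = \<ominus> c \<oplus> ?s" using r cc by (simp add: R.a_comm R.a_assoc[symmetric] R.r_neg R.a_lcomm R.r_neg2 R.r_neg1)
  ultimately show ?thesis using I.a_inv_closed[OF N(1)] by blast
qed

section \<open>Cosets and torsion\<close>

lemma coset_eq: "a_r_coset M B x = {b \<oplus>\<^bsub>M\<^esub> x | b. b \<in> B}"
  by (auto simp: a_r_coset_def r_coset_def)

lemma set_add_eq: "set_add M S T = {s \<oplus>\<^bsub>M\<^esub> t | s t. s \<in> S \<and> t \<in> T}"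
  by (auto simp: set_add_def set_mult_def)

text \<open>Adding B' to a coset of B gives the coset of B', so the map between quotients is C
  \<mapsto> B' + C, without choice of representatives.\<close>

lemma set_add_coset:
  assumes B: "is_submodule B" and B': "is_submodule B'" and "B \<subseteq> B'" and x: "x \<in> carrier M"
  shows "set_add M B' (a_r_coset M B x) = a_r_coset M B' x"
proof -
  note D = operator_subgroupD[OF B] and D' = operator_subgroupD[OF B']
  show ?thesis
  proof (intro equalityI subsetI)
    fix w assume "w \<in> set_add M B' (a_r_coset M B x)"
    then obtain b' b where w: "w = b' \<oplus>\<^bsub>M\<^esub> (b \<oplus>\<^bsub>M\<^esub> x)" "b' \<in> B'" "b \<in> B" unfolding set_add_eq coset_eq by blast
    hence "w = (b' \<oplus>\<^bsub>M\<^esub> b) \<oplus>\<^bsub>M\<^esub> x" using D(2) D'(2) x by (simp add: M.a_assoc)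
    moreover have "b' \<oplus>\<^bsub>M\<^esub> b \<in> B'" using w D'(5) \<open>B \<subseteq> B'\<close> by blast
    ultimately show "w \<in> a_r_coset M B' x" unfolding coset_eq by blast
  next
    fix w assume "w \<in> a_r_coset M B' x"
    then obtain b' where w: "w = b' \<oplus>\<^bsub>M\<^esub> x" "b' \<in> B'" unfolding coset_eq by blast
    hence "w = b' \<oplus>\<^bsub>M\<^esub> (\<zero>\<^bsub>M\<^esub> \<oplus>\<^bsub>M\<^esub> x)" using x by simp
    thus "w \<in> set_add M B' (a_r_coset M B x)" unfolding set_add_eq coset_eq using w(2) D(3) by blast
  qed
qed

lemma coset_add:
  assumes B: "is_submodule B" and x: "x \<in> carrier M" and y: "y \<in> carrier M"
  shows "set_add M (a_r_coset M B x) (a_r_coset M B y) = a_r_coset M B (x \<oplus>\<^bsub>M\<^esub> y)"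
proof -
  note D = operator_subgroupD[OF B]
  show ?thesis
  proof (intro equalityI subsetI)
    fix w assume "w \<in> set_add M (a_r_coset M B x) (a_r_coset M B y)"
    then obtain b b' where w: "w = (b \<oplus>\<^bsub>M\<^esub> x) \<oplus>\<^bsub>M\<^esub> (b' \<oplus>\<^bsub>M\<^esub> y)" "b \<in> B" "b' \<in> B" unfolding set_add_eq coset_eq by blast
    hence "w = (b \<oplus>\<^bsub>M\<^esub> b') \<oplus>\<^bsub>M\<^esub> (x \<oplus>\<^bsub>M\<^esub> y)" using interchange[of b b' x y] D(2) x y by simp
    moreover have "b \<oplus>\<^bsub>M\<^esub> b' \<in> B" using w D(5) by blast
    ultimately show "w \<in> a_r_coset M B (x \<oplus>\<^bsub>M\<^esub> y)" unfolding coset_eq by blast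
  next
    fix w assume "w \<in> a_r_coset M B (x \<oplus>\<^bsub>M\<^esub> y)"
    then obtain b where w: "w = b \<oplus>\<^bsub>M\<^esub> (x \<oplus>\<^bsub>M\<^esub> y)" "b \<in> B" unfolding coset_eq by blast
    hence "w = (b \<oplus>\<^bsub>M\<^esub> x) \<oplus>\<^bsub>M\<^esub> (\<zero>\<^bsub>M\<^esub> \<oplus>\<^bsub>M\<^esub> y)" using D(2) x y by (simp add: M.a_assoc)
    thus "w \<in> set_add M (a_r_coset M B x) (a_r_coset M B y)" unfolding set_add_eq coset_eq using w(2) D(3) by blast
  qed
qed

lemma coset_smult:
  assumes B: "is_submodule B" and x: "x \<in> carrier M" and r: "r \<in> carrier R"
  shows "set_add M B ((\<lambda>x. r \<odot>\<^bsub>M\<^esub> x) ` a_r_coset M B x) = a_r_coset M B (r \<odot>\<^bsub>M\<^esub> x)"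
proof -
  note D = operator_subgroupD[OF B]
  show ?thesis
  proof (intro equalityI subsetI)
    fix w assume "w \<in> set_add M B ((\<lambda>x. r \<odot>\<^bsub>M\<^esub> x) ` a_r_coset M B x)"
    then obtain b b' where w: "w = b \<oplus>\<^bsub>M\<^esub> r \<odot>\<^bsub>M\<^esub> (b' \<oplus>\<^bsub>M\<^esub> x)" "b \<in> B" "b' \<in> B" unfolding set_add_eq coset_eq by blast
    hence "w = (b \<oplus>\<^bsub>M\<^esub> r \<odot>\<^bsub>M\<^esub> b') \<oplus>\<^bsub>M\<^esub> r \<odot>\<^bsub>M\<^esub> x" using D(2) x r by (simp add: smult_r_distr M.a_assoc)
    moreover have "b \<oplus>\<^bsub>M\<^esub> r \<odot>\<^bsub>M\<^esub> b' \<in> B" using D(5)[OF w(2) D(7)[OF r w(3)]] .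
    ultimately show "w \<in> a_r_coset M B (r \<odot>\<^bsub>M\<^esub> x)" unfolding coset_eq by blast
  next
    fix w assume "w \<in> a_r_coset M B (r \<odot>\<^bsub>M\<^esub> x)"
    then obtain b where w: "w = b \<oplus>\<^bsub>M\<^esub> r \<odot>\<^bsub>M\<^esub> x" "b \<in> B" unfolding coset_eq by blast
    hence "w = b \<oplus>\<^bsub>M\<^esub> r \<odot>\<^bsub>M\<^esub> (\<zero>\<^bsub>M\<^esub> \<oplus>\<^bsub>M\<^esub> x)" using x by simp
    thus "w \<in> set_add M B ((\<lambda>x. r \<odot>\<^bsub>M\<^esub> x) ` a_r_coset M B x)" unfolding set_add_eq coset_eq using w(2) D(3) by blast
  qed
qed

lemma coset_eq_iff:
  assumes B: "is_submodule B" and x: "x \<in> carrier M" and y: "y \<in> carrier M"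
  shows "a_r_coset M B x = a_r_coset M B y \<longleftrightarrow> x \<ominus>\<^bsub>M\<^esub> y \<in> B"
proof
  note D = operator_subgroupD[OF B]
  assume eq: "a_r_coset M B x = a_r_coset M B y"
  have "\<zero>\<^bsub>M\<^esub> \<oplus>\<^bsub>M\<^esub> x \<in> a_r_coset M B x" using D(3) unfolding coset_eq by blast
  then obtain b where b: "b \<in> B" "x = b \<oplus>\<^bsub>M\<^esub> y" using x unfolding eq unfolding coset_eq by auto
  have "x \<ominus>\<^bsub>M\<^esub> y = b" unfolding b(2) using D(2)[OF b(1)] y by (simp add: a_minus_def M.a_assoc M.r_neg)
  thus "x \<ominus>\<^bsub>M\<^esub> y \<in> B" using b(1) by simp
next
  note D = operator_subgroupD[OF B]
  have sub: "a_r_coset M B u \<subseteq> a_r_coset M B v" if uv: "u \<ominus>\<^bsub>M\<^esub> v \<in> B" "u \<in> carrier M" "v \<in> carrier M" for u v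
  proof
    fix w assume "w \<in> a_r_coset M B u"
    then obtain b where b: "b \<in> B" "w = b \<oplus>\<^bsub>M\<^esub> u" unfolding coset_eq by blast
    have "w = (b \<oplus>\<^bsub>M\<^esub> (u \<ominus>\<^bsub>M\<^esub> v)) \<oplus>\<^bsub>M\<^esub> v"
      unfolding b(2) using D(2)[OF b(1)] uv(2,3) by (simp add: a_minus_def M.a_assoc M.l_neg)
    thus "w \<in> a_r_coset M B v" unfolding coset_eq using D(5)[OF b(1) uv(1)] by blast
  qed
  assume xy: "x \<ominus>\<^bsub>M\<^esub> y \<in> B"
  have "\<ominus>\<^bsub>M\<^esub> (x \<ominus>\<^bsub>M\<^esub> y) = y \<ominus>\<^bsub>M\<^esub> x" using x y by (simp add: a_minus_def M.minus_add M.a_comm)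
  hence "y \<ominus>\<^bsub>M\<^esub> x \<in> B" using D(4)[OF xy] by simp
  thus "a_r_coset M B x = a_r_coset M B y" using sub[OF xy x y] sub[OF _ y x] by blast
qed

lemma ideal_power_simps:
  "\<aa> [^]\<^bsub>ideals_set R\<^esub> (0::nat) = carrier R"
  "\<aa> [^]\<^bsub>ideals_set R\<^esub> (Suc k) = ideal_prod R (\<aa> [^]\<^bsub>ideals_set R\<^esub> k) \<aa>"
  by (simp_all add: nat_pow_def ideals_set_def)

lemma ideal_power_ideal:
  assumes "ideal \<aa> R" shows "ideal (\<aa> [^]\<^bsub>ideals_set R\<^esub> (k::nat)) R"
proof (induction k)
  case 0 show ?case unfolding ideal_power_simps by (rule R.oneideal)
next
  case (Suc k) thus ?case unfolding ideal_power_simps using assms by (rule R.ideal_prod_is_ideal)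
qed

text \<open>The backward direction is a descent: if all x u are torsion, one power of the ideal
  kills all x u, hence all s u with s in the ideal, and the next power kills u.\<close>

lemma torsion_iff:
  assumes X: "finite X" "X \<subseteq> carrier R"
  shows "z \<in> torsion R (Idl X) M \<longleftrightarrow> z \<in> carrier M \<and> (\<forall>x \<in> X. \<exists>k::nat. (x [^] k) \<odot>\<^bsub>M\<^esub> z = \<zero>\<^bsub>M\<^esub>)"
proof
  let ?a = "Idl X"
  have a: "ideal ?a R" by (rule R.genideal_ideal[OF X(2)])
  have Xa: "X \<subseteq> ?a" by (rule R.genideal_self[OF X(2)])
  let ?pow = "\<lambda>k::nat. ?a [^]\<^bsub>ideals_set R\<^esub> k"
  have pow: "ideal (?pow k) R" for k by (rule ideal_power_ideal[OF a])
  have xpow: "x [^] k \<in> ?pow k" if "x \<in> X" for x and k :: nat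
  proof (induction k)
    case 0 show ?case unfolding ideal_power_simps by simp
  next
    case (Suc k)
    have "x [^] k \<otimes> x \<in> ideal_prod R (?pow k) ?a" using Suc subsetD[OF Xa that] by (rule ideal_prod.prod)
    thus ?case unfolding ideal_power_simps by simp
  qed
  {
    assume "z \<in> torsion R ?a M"
    thus "z \<in> carrier M \<and> (\<forall>x \<in> X. \<exists>k::nat. (x [^] k) \<odot>\<^bsub>M\<^esub> z = \<zero>\<^bsub>M\<^esub>)"
      using xpow unfolding torsion_def by blast
  }
  assume z: "z \<in> carrier M \<and> (\<forall>x \<in> X. \<exists>k::nat. (x [^] k) \<odot>\<^bsub>M\<^esub> z = \<zero>\<^bsub>M\<^esub>)"
  have "z \<in> torsion R ?a M"
  proof (rule commuting_powers_descent[where f = "\<lambda>x z. x \<odot>\<^bsub>M\<^esub> z" and C = "carrier M", OF X(1)])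
    show "x \<odot>\<^bsub>M\<^esub> u \<in> carrier M" if "x \<in> X" "u \<in> carrier M" for x u using that X(2) by (simp add: subset_eq)
    show "x \<odot>\<^bsub>M\<^esub> (y \<odot>\<^bsub>M\<^esub> u) = y \<odot>\<^bsub>M\<^esub> (x \<odot>\<^bsub>M\<^esub> u)" if "x \<in> X" "y \<in> X" "u \<in> carrier M" for x y u
      by (rule smult_commute[OF subsetD[OF X(2) that(1)] subsetD[OF X(2) that(2)] that(3)])
    show "x \<odot>\<^bsub>M\<^esub> u \<in> torsion R ?a M" if x: "x \<in> X" and u: "u \<in> carrier M" "u \<in> torsion R ?a M" for x u
    proof -
      have xc: "x \<in> carrier R" using x X(2) by blast
      obtain k where k: "\<forall>r \<in> ?pow k. r \<odot>\<^bsub>M\<^esub> u = \<zero>\<^bsub>M\<^esub>" using u(2) unfolding torsion_def by blast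
      have "r \<odot>\<^bsub>M\<^esub> (x \<odot>\<^bsub>M\<^esub> u) = \<zero>\<^bsub>M\<^esub>" if "r \<in> ?pow k" for r
        using smult_commute[OF ideal.Icarr[OF pow that] xc u(1)] k that xc by simp
      thus ?thesis unfolding torsion_def using u(1) xc by blast
    qed
    fix u assume u: "u \<in> carrier M" and tors: "\<And>x. x \<in> X \<Longrightarrow> x \<odot>\<^bsub>M\<^esub> u \<in> torsion R ?a M"
    have "\<forall>x \<in> X. \<exists>k. \<forall>r \<in> ?pow k. r \<odot>\<^bsub>M\<^esub> (x \<odot>\<^bsub>M\<^esub> u) = \<zero>\<^bsub>M\<^esub>" using tors unfolding torsion_def by blast
    from bchoice[OF this] obtain k where k: "\<forall>x \<in> X. \<forall>r \<in> ?pow (k x). r \<odot>\<^bsub>M\<^esub> (x \<odot>\<^bsub>M\<^esub> u) = \<zero>\<^bsub>M\<^esub>" by blast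
    have anti: "?pow (i + j) \<subseteq> ?pow i" for i j
    proof (induction j)
      case (Suc j)
      have "?pow (Suc (i + j)) \<subseteq> ?pow (i + j) \<inter> ?a"
        unfolding ideal_power_simps by (rule R.ideal_prod_inter[OF pow a])
      thus ?case using Suc by auto
    qed simp
    let ?K = "sum k X"
    have "?pow ?K \<subseteq> ?pow (k x)" if "x \<in> X" for x
      using anti[of "k x" "?K - k x"] member_le_sum[OF that, of k] X(1) by simp
    hence kK: "r \<odot>\<^bsub>M\<^esub> (x \<odot>\<^bsub>M\<^esub> u) = \<zero>\<^bsub>M\<^esub>" if "x \<in> X" "r \<in> ?pow ?K" for x r using k that by blast
    let ?L = "{s \<in> carrier R. \<forall>r \<in> ?pow ?K. r \<odot>\<^bsub>M\<^esub> (s \<odot>\<^bsub>M\<^esub> u) = \<zero>\<^bsub>M\<^esub>}"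
    have rc: "r \<in> carrier R" if "r \<in> ?pow ?K" for r using ideal.Icarr[OF pow that] .
    have "ideal ?L R"
    proof (rule R.ideal_if_closed)
      show "?L \<subseteq> carrier R" by blast
      show "\<zero> \<in> ?L" using u rc by auto
      show "s \<oplus> t \<in> ?L" if "s \<in> ?L" "t \<in> ?L" for s t
        using that u rc by (auto simp: smult_l_distr smult_r_distr)
      show "t \<otimes> s \<in> ?L" if "s \<in> ?L" "t \<in> carrier R" for s t
        using that u rc by (auto simp: smult_assoc1 smult_commute[of _ t])
    qed
    moreover have "X \<subseteq> ?L" using kK X(2) by blast
    ultimately have aL: "?a \<subseteq> ?L" by (rule R.genideal_minimal)
    have "q \<odot>\<^bsub>M\<^esub> u = \<zero>\<^bsub>M\<^esub>" if "q \<in> ?pow (Suc ?K)" for q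
    proof -
      have "q \<in> carrier R \<and> q \<odot>\<^bsub>M\<^esub> u = \<zero>\<^bsub>M\<^esub>"
        using that unfolding ideal_power_simps
      proof (induction q rule: ideal_prod.induct)
        case (prod r s)
        hence "r \<odot>\<^bsub>M\<^esub> (s \<odot>\<^bsub>M\<^esub> u) = \<zero>\<^bsub>M\<^esub>" "s \<in> carrier R" "r \<in> carrier R" using aL rc by blast+
        thus ?case using u by (simp add: smult_assoc1)
      next
        case (sum s t)
        thus ?case using u by (simp add: smult_l_distr)
      qed
      thus ?thesis by blast
    qed
    thus "u \<in> torsion R ?a M" unfolding torsion_def using u by blast
  next
    fix x assume x: "x \<in> X"
    then obtain k :: nat where k: "(x [^] k) \<odot>\<^bsub>M\<^esub> z = \<zero>\<^bsub>M\<^esub>" using z by blast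
    have "((\<lambda>z. x \<odot>\<^bsub>M\<^esub> z) ^^ k) z = \<zero>\<^bsub>M\<^esub>" using funpow_smult[of x z k] k x X(2) z by auto
    moreover have "\<zero>\<^bsub>M\<^esub> \<in> torsion R ?a M"
    proof -
      have "r \<odot>\<^bsub>M\<^esub> \<zero>\<^bsub>M\<^esub> = \<zero>\<^bsub>M\<^esub>" if "r \<in> ?pow 0" for r using ideal.Icarr[OF pow that] by (rule smult_r_null)
      thus ?thesis unfolding torsion_def by blast
    qed
    ultimately show "\<exists>k. ((\<lambda>z. x \<odot>\<^bsub>M\<^esub> z) ^^ k) z \<in> torsion R ?a M" by metis
  qed (use z in blast)
  thus "z \<in> torsion R ?a M" .
qed

end

section \<open>Comparison of the local cohomology modules\<close>

text \<open>A zero module is put in front of the resolution, so that coboundaries need no separate treatment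
  in degree \<open>0\<close>.\<close>

definition shift_module :: "(nat \<Rightarrow> ('r, 'e) module) \<Rightarrow> nat \<Rightarrow> ('r, 'e) module" where
  "shift_module E i = (case i of 0 \<Rightarrow> (E 0)\<lparr>carrier := {\<zero>\<^bsub>E 0\<^esub>}\<rparr> | Suc j \<Rightarrow> E j)"

definition shift_grading :: "(nat \<Rightarrow> ('r, 'e) module) \<Rightarrow> (nat \<Rightarrow> int \<Rightarrow> 'e set) \<Rightarrow> nat \<Rightarrow> int \<Rightarrow> 'e set" where
  "shift_grading E gE i = (case i of 0 \<Rightarrow> (\<lambda>n. {\<zero>\<^bsub>E 0\<^esub>}) | Suc j \<Rightarrow> gE j)"

definition shift_differential :: "(nat \<Rightarrow> ('r, 'e) module) \<Rightarrow> (nat \<Rightarrow> 'e \<Rightarrow> 'e) \<Rightarrow> nat \<Rightarrow> 'e \<Rightarrow> 'e" where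
  "shift_differential E d i = (case i of 0 \<Rightarrow> (\<lambda>x. \<zero>\<^bsub>E 0\<^esub>) | Suc j \<Rightarrow> d j)"

lemma shift_simps [simp]:
  "shift_module E 0 = (E 0)\<lparr>carrier := {\<zero>\<^bsub>E 0\<^esub>}\<rparr>" "shift_module E (Suc j) = E j"
  "shift_grading E gE 0 = (\<lambda>n. {\<zero>\<^bsub>E 0\<^esub>})" "shift_grading E gE (Suc j) = gE j"
  "shift_differential E d 0 = (\<lambda>x. \<zero>\<^bsub>E 0\<^esub>)" "shift_differential E d (Suc j) = d j"
  by (simp_all add: shift_module_def shift_grading_def shift_differential_def)

lemma module_hom_zero:
  assumes "module R M" "module R N" "f \<in> module_hom R M N"
  shows "f \<zero>\<^bsub>M\<^esub> = \<zero>\<^bsub>N\<^esub>"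
proof -
  interpret M: module R M by fact
  interpret N: module R N by fact
  note h = module_homD[OF assms(3)]
  show ?thesis using h(3)[of "\<zero>\<^bsub>R\<^esub>" "\<zero>\<^bsub>M\<^esub>"] h(1)[of "\<zero>\<^bsub>M\<^esub>"] by simp
qed

text \<open>Carries regularity from M to its image in the first injective module, where the complex
  sees it as a kernel.\<close>

lemma weakly_regular_image:
  assumes "module R M" "module R N" and f: "f \<in> module_hom R M N" and inj: "inj_on f (carrier M)"
  shows "set xs \<subseteq> carrier R \<Longrightarrow> operator_subgroup M (carrier R) T \<Longrightarrow> weakly_regular M (carrier M) T xs \<Longrightarrow>
    weakly_regular N (f ` carrier M) (f ` T) xs"
proof (induction xs arbitrary: T)
  interpret M: module R M by fact
  interpret N: module R N by fact
  note h = module_homD[OF f]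
  case (Cons x xs)
  have x: "x \<in> carrier R" using Cons.prems by simp
  note T = M.operator_subgroupD[OF Cons.prems(2)]
  have "nonzerodivisor_mod N (f ` carrier M) (f ` T) x"
    unfolding nonzerodivisor_mod_def
  proof (intro ballI impI)
    fix m' assume "m' \<in> f ` carrier M" "x \<odot>\<^bsub>N\<^esub> m' \<in> f ` T"
    then obtain m t where m: "m' = f m" "m \<in> carrier M" "x \<odot>\<^bsub>N\<^esub> f m = f t" "t \<in> T" by blast
    have "f (x \<odot>\<^bsub>M\<^esub> m) = f t" using h(3)[OF x m(2)] m(3) by simp
    hence "x \<odot>\<^bsub>M\<^esub> m = t" using inj_onD[OF inj] m(2) x T(2)[OF m(4)] by blast
    thus "m' \<in> f ` T" using Cons.prems(3) m by (auto simp: nonzerodivisor_mod_def)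
  qed
  moreover have "add_multiples N (f ` carrier M) (f ` T) x = f ` add_multiples M (carrier M) T x"
  proof -
    have "f (t \<oplus>\<^bsub>M\<^esub> x \<odot>\<^bsub>M\<^esub> m) = f t \<oplus>\<^bsub>N\<^esub> x \<odot>\<^bsub>N\<^esub> f m" if "t \<in> T" "m \<in> carrier M" for t m
      using h(2)[OF T(2)[OF that(1)] M.smult_closed[OF x that(2)]] h(3)[OF x that(2)] by simp
    hence eq: "f t \<oplus>\<^bsub>N\<^esub> x \<odot>\<^bsub>N\<^esub> f m = f (t \<oplus>\<^bsub>M\<^esub> x \<odot>\<^bsub>M\<^esub> m)" if "t \<in> T" "m \<in> carrier M" for t m
      using that by simp
    show ?thesis
    proof (intro equalityI subsetI)
      fix w assume "w \<in> add_multiples N (f ` carrier M) (f ` T) x"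
      then obtain t m where "w = f t \<oplus>\<^bsub>N\<^esub> x \<odot>\<^bsub>N\<^esub> f m" "t \<in> T" "m \<in> carrier M" unfolding add_multiples_def by blast
      thus "w \<in> f ` add_multiples M (carrier M) T x" using eq unfolding add_multiples_def by blast
    next
      fix w assume "w \<in> f ` add_multiples M (carrier M) T x"
      then obtain t m where "w = f (t \<oplus>\<^bsub>M\<^esub> x \<odot>\<^bsub>M\<^esub> m)" "t \<in> T" "m \<in> carrier M" unfolding add_multiples_def by blast
      thus "w \<in> add_multiples N (f ` carrier M) (f ` T) x" using eq[symmetric] unfolding add_multiples_def by blast
    qed
  qed
  moreover have "weakly_regular N (f ` carrier M) (f ` add_multiples M (carrier M) T x) xs"
    by (rule Cons.IH)
      (use Cons.prems M.add_multiples_submodule[OF Cons.prems(2) M.carrier_submodule x] in auto)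
  ultimately show ?case by simp
qed simp

context standard_graded_ring
begin

lemma graded_module_trivial:
  assumes "graded_module R E gr gE"
  shows "graded_module R (E\<lparr>carrier := {\<zero>\<^bsub>E\<^esub>}\<rparr>) gr (\<lambda>n. {\<zero>\<^bsub>E\<^esub>})"
proof -
  interpret E: graded_module R E gr gE by fact
  let ?T = "E\<lparr>carrier := {\<zero>\<^bsub>E\<^esub>}\<rparr>"
  have T: "module R ?T"
    using submodule.submodule_is_module[of "{\<zero>\<^bsub>E\<^esub>}" R E] E.zero_submodule E.module_axioms
    by (simp add: E.submodule_iff_operator_subgroup)
  interpret T: module R ?T by (rule T)
  have sub: "additive_subgroup {\<zero>\<^bsub>E\<^esub>} ?T"
    using T.zero_submodule unfolding operator_subgroup_def by simp
  show ?thesis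
  proof (intro graded_module.intro graded_module_axioms.intro T)
    show "direct_sum_decomposition ?T (\<lambda>n. {\<zero>\<^bsub>E\<^esub>})"
      by (rule direct_sum_decompositionI[where p = "\<lambda>i x. \<zero>\<^bsub>E\<^esub>"])
        (use sub T.M.abelian_group_axioms in auto)
    show "r \<odot>\<^bsub>?T\<^esub> x \<in> {\<zero>\<^bsub>E\<^esub>}" if "r \<in> gr m" "x \<in> {\<zero>\<^bsub>E\<^esub>}" for r m x
      using that gr.piece_carrier[OF that(1)] by simp
  qed
qed

text \<open>The kernel of \<open>d 0\<close> is the image of M and so Noetherian;
  \<open>extension\<close> is \<open>injective_extension\<close>, with the zero module in front
  treated separately.\<close>

lemma injective_complex_resolution:
  fixes E :: "nat \<Rightarrow> ('a, 'e) module"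
  assumes M: "graded_module R M gr gM" and noeth: "noetherian_over M (carrier R) (carrier M)"
    and res: "graded_injective_resolution R gr M gM E gE \<epsilon> d"
  shows "injective_complex R gr (shift_module E) (shift_grading E gE) (shift_differential E d)"
proof (intro injective_complex.intro injective_complex_axioms.intro)
  have Eg: "graded_module R (E i) gr (gE i)" and inj: "graded_injective R gr (E i) (gE i)"
    and dh: "d i \<in> graded_hom R (E i) (gE i) (E (Suc i)) (gE (Suc i))"
    and \<epsilon>: "\<epsilon> \<in> graded_hom R M gM (E 0) (gE 0)"
    and ker0: "\<epsilon> ` carrier M = {x \<in> carrier (E 0). d 0 x = \<zero>\<^bsub>E (Suc 0)\<^esub>}"
    and ker: "d i ` carrier (E i) = {x \<in> carrier (E (Suc i)). d (Suc i) x = \<zero>\<^bsub>E (Suc (Suc i))\<^esub>}" for i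
    using res unfolding graded_injective_resolution_def by auto
  interpret M: graded_module R M gr gM by (rule M)
  have Em: "module R (E i)" for i using Eg by (rule graded_module.axioms(1))
  note triv = graded_module_trivial[OF Eg[of 0]]
  interpret E0: graded_module R "E 0" gr "gE 0" by (rule Eg)
  interpret T: graded_module R "(E 0)\<lparr>carrier := {\<zero>\<^bsub>E 0\<^esub>}\<rparr>" gr "\<lambda>n. {\<zero>\<^bsub>E 0\<^esub>}" by (rule triv)
  show "standard_graded_ring R gr" by (rule standard_graded_ring_axioms)
  show "graded_module R (shift_module E i) gr (shift_grading E gE i)" for i
    using Eg triv by (cases i) simp_all
  show "shift_differential E d i \<in> graded_hom R (shift_module E i) (shift_grading E gE i)
      (shift_module E (Suc i)) (shift_grading E gE (Suc i))" for i
    using dh by (cases i) (auto simp: graded_hom_def module_hom_def)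
  show "carrier (shift_module E 0) = {\<zero>\<^bsub>shift_module E 0\<^esub>}" by simp
  show "shift_differential E d (Suc i) (shift_differential E d i x) = \<zero>\<^bsub>shift_module E (Suc (Suc i))\<^esub>"
    if "x \<in> carrier (shift_module E i)" for x i
  proof (cases i)
    case 0
    thus ?thesis using module_hom_zero[OF Em Em, of "d 0" 0 "Suc 0"] dh by (simp add: graded_hom_def)
  next
    case (Suc j)
    thus ?thesis using ker[of j] that by auto
  qed
  show "\<exists>y \<in> carrier (shift_module E (Suc i)). shift_differential E d (Suc i) y = x"
    if "x \<in> carrier (shift_module E (Suc (Suc i)))"
      "shift_differential E d (Suc (Suc i)) x = \<zero>\<^bsub>shift_module E (Suc (Suc (Suc i)))\<^esub>" for x i
    using that ker[of i] by force
  show "\<exists>y \<in> carrier (shift_module E i). (\<forall>w \<in> W. w \<odot>\<^bsub>shift_module E i\<^esub> y = \<zero>\<^bsub>shift_module E i\<^esub>) \<and>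
      p \<odot>\<^bsub>shift_module E i\<^esub> y = u"
    if "hom_ideal W" "p \<in> gr m" "u \<in> carrier (shift_module E i)"
      "\<And>r. r \<in> colon W p \<Longrightarrow> r \<odot>\<^bsub>shift_module E i\<^esub> u = \<zero>\<^bsub>shift_module E i\<^esub>" for W p m u i
  proof (cases i)
    case 0
    thus ?thesis using that hom_idealD(3)[OF that(1)] gr.piece_carrier[OF that(2)] by simp
  next
    case (Suc j)
    thus ?thesis using injective_extension[OF Eg inj that(1,2), of u j] that(3,4) by simp
  qed
  have "noetherian_quotient (E 0) (carrier R) (\<epsilon> ` carrier M) {}"
  proof (rule noetherian_quotient_image[OF M.module_axioms Em])
    show "\<epsilon> \<in> module_hom R M (E 0)" using \<epsilon> by (simp add: graded_hom_def)
    show "M.is_submodule (carrier M)" by (rule M.carrier_submodule)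
    show "noetherian_quotient M (carrier R) (carrier M) {}"
      using noeth by (simp add: noetherian_over_def noetherian_quotient_def)
  qed auto
  thus "noetherian_over (shift_module E (Suc 0)) (carrier R)
      {x \<in> carrier (shift_module E (Suc 0)). shift_differential E d (Suc 0) x = \<zero>\<^bsub>shift_module E (Suc (Suc 0))\<^esub>}"
    unfolding ker0 by (simp add: noetherian_over_def noetherian_quotient_def)
qed

text \<open>For x of degree n, the k-th component of h times x is the component of h x = 0 in degree
  k + n.\<close>

lemma hcomp_annihilator:
  assumes M: "graded_module R M gr gM" and h: "h \<in> annihilator R M"
  shows "hcomp R gr k h \<in> annihilator R M"
proof -
  interpret M: graded_module R M gr gM by (rule M)
  have hc: "h \<in> carrier R" using h by (simp add: annihilator_def)
  have kc: "hcomp R gr k h \<in> carrier R" using hc by simp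
  have "hcomp R gr k h \<odot>\<^bsub>M\<^esub> x = \<zero>\<^bsub>M\<^esub>" if "x \<in> carrier M" for x
    using that
  proof (induction rule: M.gM.homogeneous_induct)
    case (piece n x)
    have x: "x \<in> carrier M" using piece M.gM.piece_carrier by blast
    have "hcomp M gM (int k + n) (h \<odot>\<^bsub>M\<^esub> x) = hcomp R gr k h \<odot>\<^bsub>M\<^esub> x"
      by (rule hcomp_graded_map(1)[OF graded_group_gr M.graded_group_gM,
            where s = "\<lambda>k. int k + n" and f = "\<lambda>h. h \<odot>\<^bsub>M\<^esub> x"])
        (use x hc piece in \<open>auto simp: M.smult_l_distr M.gM_smult inj_def\<close>)
    moreover have "h \<odot>\<^bsub>M\<^esub> x = \<zero>\<^bsub>M\<^esub>" using h x by (simp add: annihilator_def)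
    ultimately show ?case by simp
  qed (use kc in \<open>simp_all add: M.smult_r_distr\<close>)
  thus ?thesis using kc by (simp add: annihilator_def)
qed

text \<open>The linkage hypotheses enter only here: a power of \<open>u\<close> lies in \<open>J + Ann M\<close>, hence in
  \<open>\<bb> + Ann M\<close>, and \<open>\<aa>\<bb>M \<subseteq> IM\<close>.\<close>

lemma linkage_product:
  assumes M: "graded_module R M gr gM" and fg: "finitely_generated_module R M"
    and IJ: "homogeneous_ideal R gr I" "homogeneous_ideal R gr J"
    and ab: "h_linked R gr M I \<aa> \<bb>" and bR: "h_linked R gr M J \<bb> (irrelevant_ideal R gr)"
    and rad: "radical R (irrelevant_ideal R gr <+>\<^bsub>R\<^esub> annihilator R M) = radical R (J <+>\<^bsub>R\<^esub> annihilator R M)"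
    and x: "x \<in> \<aa>" "x \<in> gr m" and u: "u \<in> irrelevant_ideal R gr" "u \<in> gr l"
  shows "\<exists>N::nat. \<exists>a \<in> I. \<exists>h \<in> annihilator R M. \<exists>k. h \<in> gr k \<and> x [^] N \<otimes> u [^] N = a \<oplus> h"
proof -
  interpret M: graded_module R M gr gM by (rule M)
  have I: "hom_ideal I" and J: "hom_ideal J" using IJ by (auto intro: homogeneous_ideal_imp)
  interpret I: ideal I R by (rule hom_idealD(1)[OF I])
  have Jb: "J \<subseteq> \<bb>" and a: "ideal \<aa> R" and b: "ideal \<bb> R"
    using ab bR unfolding h_linked_def homogeneous_ideal_def by auto
  have bM: "ideal_smult R M \<bb> = module_colon M (ideal_smult R M I) \<aa>" using ab unfolding h_linked_def by blast
  have xc: "x \<in> carrier R" and uc: "u \<in> carrier R" using x u gr.piece_carrier by blast+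
  have "\<zero> \<in> annihilator R M" by (auto simp: annihilator_def)
  hence "u \<oplus> \<zero> \<in> irrelevant_ideal R gr <+> annihilator R M" using u(1) unfolding set_add_def set_mult_def by force
  hence "u [^] (1::nat) \<in> irrelevant_ideal R gr <+> annihilator R M" using uc by simp
  hence "u \<in> radical R (irrelevant_ideal R gr <+> annihilator R M)" unfolding radical_def using uc by blast
  hence "u \<in> radical R (J <+> annihilator R M)" unfolding rad .
  then obtain k :: nat where "u [^] k \<in> J <+> annihilator R M" unfolding radical_def by blast
  then obtain \<beta> h where \<beta>: "\<beta> \<in> J" "h \<in> annihilator R M" "u [^] k = \<beta> \<oplus> h" by (auto simp: set_add_def set_mult_def)
  have \<beta>c: "\<beta> \<in> carrier R" and hc: "h \<in> carrier R" using \<beta> hom_idealD(3)[OF J] by (auto simp: annihilator_def)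
  \<comment> \<open>On M the factor u^k acts as \<beta> \<in> J \<subseteq> \<bb>, and x maps \<bb>M
    into IM by the colon relation for \<bb>M.\<close>
  let ?r = "x \<otimes> u [^] k"
  have "?r \<odot>\<^bsub>M\<^esub> y \<in> ideal_smult R M I" if y: "y \<in> carrier M" for y
  proof -
    have "(u [^] k) \<odot>\<^bsub>M\<^esub> y = \<beta> \<odot>\<^bsub>M\<^esub> y"
      using \<beta>(2) y \<beta>c hc unfolding \<beta>(3) by (simp add: M.smult_l_distr annihilator_def)
    hence "?r \<odot>\<^bsub>M\<^esub> y = x \<odot>\<^bsub>M\<^esub> (\<beta> \<odot>\<^bsub>M\<^esub> y)" using xc uc y by (simp add: M.smult_assoc1)
    moreover have "\<beta> \<odot>\<^bsub>M\<^esub> y \<in> ideal_smult R M \<bb>" using \<beta>(1) Jb y by (intro M.ideal_smult_incl) auto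
    ultimately show ?thesis using x(1) unfolding bM module_colon_def by simp
  qed
  from M.power_in_ideal_plus_annihilator[OF fg I.is_ideal _ this]
  obtain N :: nat and a' h' where N: "a' \<in> I" "h' \<in> annihilator R M" "?r [^] N = a' \<oplus> h'"
    using xc uc by auto
  have h'c: "h' \<in> carrier R" using N(2) by (simp add: annihilator_def)
  \<comment> \<open>The exponents of x and u are to be equal: (x u^k)^N = x^N u^(kN) divides x^K u^K
    for K = N + kN.\<close>
  let ?K = "N + k * N"
  have "x [^] ?K \<otimes> u [^] ?K = (x [^] (k * N) \<otimes> u [^] N) \<otimes> (?r [^] N)"
    using xc uc by (simp add: nat_pow_mult[symmetric] nat_pow_distrib nat_pow_pow m_ac)
  also have "\<dots> = (x [^] (k * N) \<otimes> u [^] N) \<otimes> a' \<oplus> (x [^] (k * N) \<otimes> u [^] N) \<otimes> h'"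
    unfolding N(3) using xc uc h'c I.a_Hcarr[OF N(1)] by (simp add: r_distr)
  finally obtain a'' h'' where e: "x [^] ?K \<otimes> u [^] ?K = a'' \<oplus> h''" "a'' \<in> I" "h'' \<in> annihilator R M"
    using I.I_l_closed[OF N(1), of "x [^] (k * N) \<otimes> u [^] N"] N(2) xc uc h'c
    by (auto simp: annihilator_def M.smult_assoc1)
  have h''c: "h'' \<in> carrier R" using e(3) by (simp add: annihilator_def)
  \<comment> \<open>The product is homogeneous of degree \<open>?D\<close>; taking that component of
    both summands makes the annihilator part homogeneous.\<close>
  let ?D = "?K * m + ?K * l"
  have "x [^] ?K \<otimes> u [^] ?K \<in> gr ?D" by (rule gr_mult[OF gr_power[OF x(2)] gr_power[OF u(2)]])
  hence "x [^] ?K \<otimes> u [^] ?K = hcomp R gr ?D (a'' \<oplus> h'')" using gr.hcomp_same e(1) by metis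
  also have "\<dots> = hcomp R gr ?D a'' \<oplus> hcomp R gr ?D h''" using I.a_Hcarr[OF e(2)] h''c by (rule gr.hcomp_add)
  finally show ?thesis
    using hom_idealD(2)[OF I e(2)] hcomp_annihilator[OF M e(3)] gr.hcomp_piece[OF h''c] by blast
qed

end

context injective_complex
begin

text \<open>The elements of H join the support one at a time, and the comparisons are composed by
  \<open>qexact_trans\<close>.\<close>

lemma qexact_annihilators:
  assumes X: "finite X" "X \<subseteq> (\<Union>m. gr m)" and H: "finite H" "H \<subseteq> (\<Union>m. gr m)"
    and kills: "\<And>h x. h \<in> H \<Longrightarrow> x \<in> carrier (E (Suc 0)) \<Longrightarrow> d (Suc 0) x = \<zero>\<^bsub>E (Suc (Suc 0))\<^esub> \<Longrightarrow>
      h \<odot>\<^bsub>E (Suc 0)\<^esub> x = \<zero>\<^bsub>E (Suc 0)\<^esub>"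
  shows "qexact (tors X) (tors (X \<union> H)) j n"
  using H kills
proof (induction H)
  case empty
  have Xc: "X \<subseteq> carrier R" using X(2) gr.piece_carrier by blast
  show ?case
    unfolding qexact_def
  proof (intro ballI impI)
    fix z assume z: "z \<in> tors X (Suc j) \<inter> gE (Suc j) n"
    have "z = d j \<zero>\<^bsub>E j\<^esub> \<oplus>\<^bsub>E (Suc j)\<^esub> z" using z tors_carrier by auto
    moreover have "\<zero>\<^bsub>E j\<^esub> \<in> tors X j \<inter> gE j n" using E.operator_subgroupD(3)[OF tors_submodule[OF X(1) Xc]] by simp
    ultimately show "\<exists>y \<in> tors X j \<inter> gE j n. \<exists>v \<in> tors (X \<union> {}) (Suc j). z = d j y \<oplus>\<^bsub>E (Suc j)\<^esub> v"
      using z by (intro bexI[of _ "\<zero>\<^bsub>E j\<^esub>"] bexI[of _ z]) simp_all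
  qed
next
  case (insert h H)
  obtain m where m: "h \<in> gr m" using insert.prems(1) by auto
  have XH: "finite (X \<union> H)" "X \<union> H \<subseteq> (\<Union>m. gr m)" using X insert by auto
  have c: "X \<subseteq> carrier R" "X \<union> H \<subseteq> carrier R" "insert h (X \<union> H) \<subseteq> carrier R"
    using X(2) XH(2) m gr.piece_carrier by blast+
  have hom: "insert h (X \<union> H) \<subseteq> (\<Union>m. gr m)" using XH m by auto
  have fin: "finite (insert h (X \<union> H))" using XH by simp
  have "qexact (tors X) (tors (insert h (X \<union> H))) j n"
  proof (rule qexact_trans[where U = "tors (X \<union> H)"])
    show "qexact (tors X) (tors (X \<union> H)) j n" using insert.IH insert.prems by simp
    show "qexact (tors (X \<union> H)) (tors (insert h (X \<union> H))) j n"
      by (rule qexact_annihilator[OF XH m]) (use insert.prems(2) in simp)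
    show "E.is_submodule i (tors X i)" "E.is_submodule i (tors (X \<union> H) i)"
      "E.is_submodule i (tors (insert h (X \<union> H)) i)" for i
      by (rule tors_submodule[OF X(1) c(1)] tors_submodule[OF XH(1) c(2)] tors_submodule[OF fin c(3)])+
    show "tors (insert h (X \<union> H)) i \<subseteq> tors (X \<union> H) i" "tors (X \<union> H) i \<subseteq> tors X i" for i
      by (rule tors_anti; blast)+
    show "hcomp (E i) (gE i) n z \<in> tors (X \<union> H) i" if "z \<in> tors (X \<union> H) i" for i z
      by (rule tors_hcomp[OF XH that])
    show "hcomp (E i) (gE i) n z \<in> tors (insert h (X \<union> H)) i" if "z \<in> tors (insert h (X \<union> H)) i" for i z
      by (rule tors_hcomp[OF fin hom that])
  qed
  thus ?case by simp
qed

text \<open>Y is compared with X \<union> H by way of Y \<union> H, where the second step needs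
  large n, and X with X \<union> H in all degrees; \<open>qexact_cancel\<close> then removes
  H.\<close>

lemma qexact_comparison:
  assumes X: "finite X" "X \<subseteq> (\<Union>m. gr m)" and Y: "finite Y" "Y \<subseteq> (\<Union>m. gr m)" and YX: "Y \<subseteq> Idl X"
    and H: "finite H" "H \<subseteq> (\<Union>m. gr m)"
    and kills: "\<And>h x. h \<in> H \<Longrightarrow> x \<in> carrier (E (Suc 0)) \<Longrightarrow> d (Suc 0) x = \<zero>\<^bsub>E (Suc (Suc 0))\<^esub> \<Longrightarrow>
      h \<odot>\<^bsub>E (Suc 0)\<^esub> x = \<zero>\<^bsub>E (Suc 0)\<^esub>"
    and U: "finite U" "U \<subseteq> (\<Union>m. gr m)" "Rplus = Idl U"
    and prod: "\<And>x u. x \<in> X \<Longrightarrow> u \<in> U \<Longrightarrow> \<exists>N::nat. x [^] N \<otimes> u [^] N \<in> Idl (Y \<union> H)"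
  shows "\<exists>n0. \<forall>n \<ge> n0. qexact (tors Y) (tors X) j n"
proof -
  have c: "X \<subseteq> carrier R" "Y \<subseteq> carrier R" "H \<subseteq> carrier R" "U \<subseteq> carrier R"
    using X(2) Y(2) H(2) U(2) gr.piece_carrier by blast+
  have XH: "finite (X \<union> H)" "X \<union> H \<subseteq> (\<Union>m. gr m)" "X \<union> H \<subseteq> carrier R" using X H c by auto
  have YH: "finite (Y \<union> H)" "Y \<union> H \<subseteq> (\<Union>m. gr m)" "Y \<union> H \<subseteq> carrier R" using Y H c by auto
  note sub = tors_submodule[OF X(1) c(1)] tors_submodule[OF Y(1) c(2)] tors_submodule[OF XH(1,3)] tors_submodule[OF YH(1,3)]
  have XY: "tors X i \<subseteq> tors Y i" for i
  proof (rule tors_Idl[OF X(1) c(1,2)])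
    fix y assume y: "y \<in> Y"
    hence "y [^] (1::nat) \<in> Idl X" using subsetD[OF YX y] subsetD[OF c(2) y] by simp
    thus "\<exists>k::nat. y [^] k \<in> Idl X" by blast
  qed
  have XHYH: "tors (X \<union> H) i \<subseteq> tors (Y \<union> H) i" for i
    using XY unfolding tors_def by blast
  have "\<exists>n0. \<forall>n \<ge> n0. qexact (tors (Y \<union> H)) (tors (X \<union> H)) j n"
  proof (rule qexact_torsion[OF XH(1,2) YH(1,2) U])
    fix x u assume x: "x \<in> X \<union> H" and u: "u \<in> U"
    show "\<exists>N::nat. x [^] N \<otimes> u [^] N \<in> Idl (Y \<union> H)"
    proof (cases "x \<in> X")
      case True thus ?thesis using prod u by blast
    next
      case False
      hence "x \<in> Idl (Y \<union> H)" using x genideal_self[OF YH(3)] by blast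
      hence "u \<otimes> x \<in> Idl (Y \<union> H)" using u c(4) by (intro ideal.I_l_closed[OF genideal_ideal[OF YH(3)]]) auto
      hence "x [^] (1::nat) \<otimes> u [^] (1::nat) \<in> Idl (Y \<union> H)" using x u XH(3) c(4) by (simp add: m_comm subset_eq)
      thus ?thesis by blast
    qed
  qed
  then obtain n0 where n0: "\<And>n. n \<ge> n0 \<Longrightarrow> qexact (tors (Y \<union> H)) (tors (X \<union> H)) j n" by blast
  have "qexact (tors Y) (tors X) j n" if n: "n \<ge> n0" for n
  proof (rule qexact_cancel)
    show "qexact (tors Y) (tors (X \<union> H)) j n"
    proof (rule qexact_trans[OF qexact_annihilators[OF Y H kills] n0[OF n]])
      show "tors (X \<union> H) i \<subseteq> tors (Y \<union> H) i" "tors (Y \<union> H) i \<subseteq> tors Y i" for i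
        by (rule XHYH) (rule tors_anti; blast)
      show "hcomp (E i) (gE i) n z \<in> tors (Y \<union> H) i" if "z \<in> tors (Y \<union> H) i" for i z
        by (rule tors_hcomp[OF YH(1,2) that])
      show "hcomp (E i) (gE i) n z \<in> tors (X \<union> H) i" if "z \<in> tors (X \<union> H) i" for i z
        by (rule tors_hcomp[OF XH(1,2) that])
    qed (use sub in auto)
    show "qexact (tors X) (tors (X \<union> H)) (Suc j) n" by (rule qexact_annihilators[OF X H kills])
    show "tors (X \<union> H) i \<subseteq> tors X i" for i by (rule tors_anti) blast
  qed (use sub XY in auto)
  thus ?thesis by blast
qed

text \<open>Exactness at position j splits z as d y + v, and v is a cocycle for X in the class of
  z.\<close>

lemma cohomology_surjective:
  assumes X: "X \<subseteq> carrier R" and q: "qexact (tors Y) (tors X) j n"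
    and X': "finite X" and Y: "finite Y" "Y \<subseteq> carrier R"
    and z: "z \<in> cocycles Y j \<inter> gE (Suc j) n"
  shows "\<exists>z' \<in> cocycles X j \<inter> gE (Suc j) n. z \<ominus>\<^bsub>E (Suc j)\<^esub> z' \<in> coboundaries Y j"
proof -
  have "d (Suc j) z \<in> tors X (Suc (Suc j))"
    using z E.operator_subgroupD(3)[OF tors_submodule[OF X' X]] by (simp add: cocycles_def)
  then obtain y v where y: "y \<in> tors Y j" "y \<in> gE j n" "v \<in> tors X (Suc j)" "z = d j y \<oplus>\<^bsub>E (Suc j)\<^esub> v"
    using q z unfolding qexact_def cocycles_def by blast
  have c: "y \<in> carrier (E j)" "v \<in> carrier (E (Suc j))" using y tors_carrier by blast+
  have vz: "v = z \<ominus>\<^bsub>E (Suc j)\<^esub> d j y" unfolding y(4) using c by (simp add: E.plus_minus_cancel)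
  have "v \<in> gE (Suc j) n" unfolding vz using z d_piece[OF y(2)] E.gM.piece_add E.gM.piece_neg by (simp add: a_minus_def)
  moreover have "d (Suc j) v = d (Suc j) z" unfolding y(4) using c by (simp add: d_add d_d)
  hence "v \<in> cocycles X j" using y(3) z by (simp add: cocycles_def)
  moreover have "z \<ominus>\<^bsub>E (Suc j)\<^esub> v = d j y"
    using E.plus_minus_cancel[of v "Suc j" "d j y"] c unfolding y(4) by (simp add: E.M.a_comm)
  ultimately show ?thesis using y(1) unfolding coboundaries_def by auto
qed

text \<open>If z = d y with y torsion for Y, exactness one position earlier splits y as d w + v, so
  that z = d v with v torsion for X. For j = 0 the element y is zero.\<close>

lemma cohomology_injective:
  assumes q: "\<And>i. j = Suc i \<Longrightarrow> qexact (tors Y) (tors X) i n"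
    and X: "finite X" "X \<subseteq> (\<Union>m. gr m)" and Y: "finite Y" "Y \<subseteq> (\<Union>m. gr m)"
    and z: "z \<in> cocycles X j \<inter> gE (Suc j) n" "z \<in> coboundaries Y j"
  shows "z \<in> coboundaries X j"
proof -
  have Xc: "X \<subseteq> carrier R" using X gr.piece_carrier by blast
  obtain y0 where y0: "y0 \<in> tors Y j" "z = d j y0" using z(2) by (auto simp: coboundaries_def)
  have y0c: "y0 \<in> carrier (E j)" using y0 tors_carrier by blast
  let ?y = "hcomp (E j) (gE j) n y0"
  have y: "?y \<in> tors Y j" "?y \<in> gE j n" using tors_hcomp[OF Y y0(1)] E.gM.hcomp_piece[OF y0c] by auto
  have zy: "z = d j ?y" using d_hcomp[OF y0c, of n] E.gM.hcomp_same[of z "Suc j" n] z(1) y0(2) by simp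
  show ?thesis
  proof (cases j)
    case 0
    hence "?y = \<zero>\<^bsub>E j\<^esub>" using E_0 E.gM.piece_carrier[OF y(2)] by simp
    hence "?y \<in> tors X j" using E.operator_subgroupD(3)[OF tors_submodule[OF X(1) Xc], of j] by simp
    thus ?thesis using zy unfolding coboundaries_def by blast
  next
    case (Suc i)
    have "d (Suc i) ?y \<in> tors X (Suc (Suc i))" using zy z(1) Suc by (simp add: cocycles_def)
    then obtain w v where w: "w \<in> tors Y i" "v \<in> tors X (Suc i)" "?y = d i w \<oplus>\<^bsub>E (Suc i)\<^esub> v"
      using q[OF Suc] y Suc unfolding qexact_def by blast
    have "d j ?y = d j v" using w tors_carrier[OF w(1)] tors_carrier[OF w(2)] Suc by (simp add: d_add d_d)
    thus ?thesis using zy w(2) Suc unfolding coboundaries_def by auto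
  qed
qed

end

text \<open>Q and Q' will be the cocycles of one fixed degree, so linearity is stated over a subset
  A of the scalars, later R_0. The isomorphism is C \<mapsto> B' + C.\<close>

lemma (in module) quotient_isomorphism:
  fixes K L :: "('a, 'c set) module"
  assumes A: "A \<subseteq> carrier R" and B: "is_submodule B" and B': "is_submodule B'" and BB': "B \<subseteq> B'"
    and Q: "Q \<subseteq> carrier M" and Q': "Q' \<subseteq> carrier M" and QQ': "Q \<subseteq> Q'"
    and Q_minus: "\<And>x y. x \<in> Q \<Longrightarrow> y \<in> Q \<Longrightarrow> x \<ominus>\<^bsub>M\<^esub> y \<in> Q"
    and inj: "\<And>x. x \<in> Q \<Longrightarrow> x \<in> B' \<Longrightarrow> x \<in> B"
    and surj: "\<And>x. x \<in> Q' \<Longrightarrow> \<exists>y \<in> Q. x \<ominus>\<^bsub>M\<^esub> y \<in> B'"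
    and K: "carrier K = {a_r_coset M B x | x. x \<in> Q}" "add K = set_add M"
      "\<And>r C. r \<odot>\<^bsub>K\<^esub> C = set_add M B ((\<lambda>x. r \<odot>\<^bsub>M\<^esub> x) ` C)"
    and L: "carrier L = {a_r_coset M B' x | x. x \<in> Q'}" "add L = set_add M"
      "\<And>r C. r \<odot>\<^bsub>L\<^esub> C = set_add M B' ((\<lambda>x. r \<odot>\<^bsub>M\<^esub> x) ` C)"
  shows "modules_isomorphic (R\<lparr>carrier := A\<rparr>) K L"
proof -
  let ?f = "set_add M B'"
  have f: "?f (a_r_coset M B x) = a_r_coset M B' x" if "x \<in> carrier M" for x
    by (rule set_add_coset[OF B B' BB' that])
  have into: "?f C \<in> carrier L" if "C \<in> carrier K" for C
  proof -
    obtain x where x: "C = a_r_coset M B x" "x \<in> Q" using \<open>C \<in> carrier K\<close> unfolding K(1) by blast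
    have "x \<in> carrier M" "x \<in> Q'" using x(2) Q QQ' by auto
    thus ?thesis unfolding x(1) L(1) by (auto simp: f)
  qed
  have "?f \<in> module_hom (R\<lparr>carrier := A\<rparr>) K L"
    unfolding module_hom_def
  proof (intro CollectI conjI ballI)
    show "?f \<in> carrier K \<rightarrow> carrier L" using into by blast
    fix C assume "C \<in> carrier K"
    then obtain x where x: "C = a_r_coset M B x" "x \<in> carrier M" unfolding K(1) using Q by blast
    {
      fix D assume "D \<in> carrier K"
      then obtain y where y: "D = a_r_coset M B y" "y \<in> carrier M" unfolding K(1) using Q by blast
      show "?f (C \<oplus>\<^bsub>K\<^esub> D) = ?f C \<oplus>\<^bsub>L\<^esub> ?f D"
        unfolding x(1) y(1) K(2) L(2) using x y by (simp add: coset_add[OF B] coset_add[OF B'] f)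
    next
      fix r assume "r \<in> carrier (R\<lparr>carrier := A\<rparr>)"
      hence r: "r \<in> carrier R" using A by auto
      show "?f (r \<odot>\<^bsub>K\<^esub> C) = r \<odot>\<^bsub>L\<^esub> ?f C"
        unfolding x(1) K(3) L(3) using x r by (simp add: coset_smult[OF B] coset_smult[OF B'] f)
    }
  qed
  moreover have "bij_betw ?f (carrier K) (carrier L)"
    unfolding bij_betw_def
  proof
    show "inj_on ?f (carrier K)"
    proof (rule inj_onI)
      fix C D assume "C \<in> carrier K" "D \<in> carrier K" and eq: "?f C = ?f D"
      then obtain x y where x: "C = a_r_coset M B x" "x \<in> Q" and y: "D = a_r_coset M B y" "y \<in> Q"
        unfolding K(1) by blast
      have c: "x \<in> carrier M" "y \<in> carrier M" using x y Q by auto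
      have "x \<ominus>\<^bsub>M\<^esub> y \<in> B'" using eq unfolding x(1) y(1) by (simp add: f c coset_eq_iff[OF B'])
      hence "x \<ominus>\<^bsub>M\<^esub> y \<in> B" using inj Q_minus x(2) y(2) by blast
      thus "C = D" unfolding x(1) y(1) by (simp add: coset_eq_iff[OF B] c)
    qed
    show "?f ` carrier K = carrier L"
    proof
      show "?f ` carrier K \<subseteq> carrier L" using into by blast
      show "carrier L \<subseteq> ?f ` carrier K"
      proof
        fix D assume "D \<in> carrier L"
        then obtain x where x: "D = a_r_coset M B' x" "x \<in> Q'" unfolding L(1) by blast
        obtain y where y: "y \<in> Q" "x \<ominus>\<^bsub>M\<^esub> y \<in> B'" using surj[OF x(2)] by blast
        have c: "x \<in> carrier M" "y \<in> carrier M" using x y Q Q' by auto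
        have "D = ?f (a_r_coset M B y)" unfolding x(1) f[OF c(2)] using coset_eq_iff[OF B' c] y(2) by blast
        thus "D \<in> ?f ` carrier K" unfolding K(1) using y(1) by blast
      qed
    qed
  qed
  ultimately show ?thesis unfolding modules_isomorphic_def by blast
qed

lemma set_add_carrier_update [simp]: "set_add (M\<lparr>carrier := Z\<rparr>) = set_add M"
  by (intro ext) (simp add: set_add_def set_mult_def)

lemma local_cohomology_component_simps:
  "carrier (local_cohomology_component R E gE d \<aa> i n) =
     {a_r_coset (E i) (torsion_coboundaries R E d \<aa> i) x | x. x \<in> torsion_cocycles R E d \<aa> i \<inter> gE i n}"
  "\<zero>\<^bsub>local_cohomology_component R E gE d \<aa> i n\<^esub> = torsion_coboundaries R E d \<aa> i"
  "add (local_cohomology_component R E gE d \<aa> i n) = set_add (E i)"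
  "r \<odot>\<^bsub>local_cohomology_component R E gE d \<aa> i n\<^esub> C =
     set_add (E i) (torsion_coboundaries R E d \<aa> i) ((\<lambda>x. r \<odot>\<^bsub>E i\<^esub> x) ` C)"
  by (simp_all add: local_cohomology_component_def local_cohomology_def quotient_module_def)

theorem corollary3p8:
  fixes R :: "('r, 'x) ring_scheme"
    and gr :: "nat \<Rightarrow> 'r set"
    and M :: "('r, 'm, 'y) module_scheme"
    and gM :: "int \<Rightarrow> 'm set"
    and E :: "nat \<Rightarrow> ('r, 'e) module"
    and gE :: "nat \<Rightarrow> int \<Rightarrow> 'e set"
    and \<epsilon> :: "'m \<Rightarrow> 'e"
    and d :: "nat \<Rightarrow> 'e \<Rightarrow> 'e"
    and \<aa> \<bb> I J :: "'r set"
    and t :: nat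
  assumes "standard_graded_ring R gr"
    and "graded_module R M gr gM"
    and "finitely_generated_module R M"
    and "graded_injective_resolution R gr M gM E gE \<epsilon> d"
    and "homogeneous_ideal R gr \<aa>" and "homogeneous_ideal R gr \<bb>"
    and "homogeneous_ideal R gr I" and "homogeneous_ideal R gr J"
    and "h_linked R gr M I \<aa> \<bb>"
    and "h_linked R gr M J \<bb> (irrelevant_ideal R gr)"
    and "radical R (irrelevant_ideal R gr <+>\<^bsub>R\<^esub> annihilator R M) =
         radical R (J <+>\<^bsub>R\<^esub> annihilator R M)"
    and "t = grade R I M"
  shows "\<forall>i. \<forall>\<^sub>F n in at_top.
           (i \<noteq> t \<longrightarrow> carrier (local_cohomology_component R E gE d \<aa> i n) =
                     {\<zero>\<^bsub>local_cohomology_component R E gE d \<aa> i n\<^esub>}) \<and>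
           (i = t \<longrightarrow> modules_isomorphic (R\<lparr>carrier := gr 0\<rparr>)
                     (local_cohomology_component R E gE d \<aa> i n)
                     (local_cohomology_component R E gE d I t n))"
proof -
  interpret standard_graded_ring R gr by fact
  interpret M: graded_module R M gr gM by fact
  note noethM = finitely_generated_imp_noetherian[OF M.module_axioms assms(3)]
  interpret C: injective_complex R gr "shift_module E" "shift_grading E gE" "shift_differential E d"
    by (rule injective_complex_resolution[OF assms(2) noethM assms(4)])
  have E: "graded_module R (E i) gr (gE i)" for i using C.E_graded[of "Suc i"] by simp
  have Em: "module R (E i)" for i using E by (rule graded_module.axioms(1))
  have \<epsilon>: "\<epsilon> \<in> module_hom R M (E 0)" and \<epsilon>_inj: "inj_on \<epsilon> (carrier M)"
    and ker: "{x \<in> carrier (E 0). d 0 x = \<zero>\<^bsub>E (Suc 0)\<^esub>} = \<epsilon> ` carrier M"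
    using assms(4) unfolding graded_injective_resolution_def graded_hom_def by auto
  obtain xs where xs: "set xs \<subseteq> (\<Union>n. gr n)" "regular_sequence R M xs" "I = Idl\<^bsub>R\<^esub> (set xs)"
    using assms(9) unfolding h_linked_def by blast
  have xsc: "set xs \<subseteq> carrier R" using xs(2) by (simp add: regular_sequence_def)
  have t: "t = length xs" unfolding assms(12) xs(3) by (rule M.grade_eq_length[OF noetherian noethM xs(2)])
  obtain X where X: "finite X" "X \<subseteq> \<aa> \<inter> (\<Union>n. gr n)" "\<aa> = Idl\<^bsub>R\<^esub> X"
    using hom_ideal_finite_generators[OF homogeneous_ideal_imp[OF assms(5)]] by blast
  obtain U where U: "finite U" "U \<subseteq> irrelevant_ideal R gr \<inter> (\<Union>n. gr n)" "irrelevant_ideal R gr = Idl\<^bsub>R\<^esub> U"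
    using hom_ideal_finite_generators[OF hom_ideal_irrelevant] by blast
  have Xg: "X \<subseteq> (\<Union>n. gr n)" and Xc: "X \<subseteq> carrier R" using X(2) gr.piece_carrier by blast+
  \<comment> \<open>One homogeneous element of Ann M is chosen per pair of generators of \<aa> and
    R_+; finitely many pairs give the finite set \<open>H\<close>.\<close>
  have "\<forall>p \<in> X \<times> U. \<exists>h. h \<in> annihilator R M \<and> h \<in> (\<Union>n. gr n) \<and>
      (\<exists>N::nat. \<exists>a \<in> I. fst p [^]\<^bsub>R\<^esub> N \<otimes>\<^bsub>R\<^esub> snd p [^]\<^bsub>R\<^esub> N = a \<oplus>\<^bsub>R\<^esub> h)"
  proof
    fix p assume "p \<in> X \<times> U"
    hence p: "fst p \<in> X" "snd p \<in> U" by auto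
    have pa: "fst p \<in> \<aa>" "snd p \<in> irrelevant_ideal R gr" using p X(2) U(2) by blast+
    obtain m where m: "fst p \<in> gr m" using p(1) X(2) by blast
    obtain l where l: "snd p \<in> gr l" using p(2) U(2) by blast
    from linkage_product[OF assms(2,3,7-11) pa(1) m pa(2) l] show "\<exists>h. h \<in> annihilator R M \<and> h \<in> (\<Union>n. gr n) \<and>
      (\<exists>N::nat. \<exists>a \<in> I. fst p [^]\<^bsub>R\<^esub> N \<otimes>\<^bsub>R\<^esub> snd p [^]\<^bsub>R\<^esub> N = a \<oplus>\<^bsub>R\<^esub> h)" by blast
  qed
  from bchoice[OF this] obtain g where g: "\<forall>p \<in> X \<times> U. g p \<in> annihilator R M \<and> g p \<in> (\<Union>n. gr n) \<and>
      (\<exists>N::nat. \<exists>a \<in> I. fst p [^]\<^bsub>R\<^esub> N \<otimes>\<^bsub>R\<^esub> snd p [^]\<^bsub>R\<^esub> N = a \<oplus>\<^bsub>R\<^esub> g p)" by (elim exE)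
  define H where "H = g ` (X \<times> U)"
  have H: "finite H" "H \<subseteq> (\<Union>n. gr n)" "H \<subseteq> annihilator R M" using X(1) U(1) g by (auto simp: H_def)
  have Hc: "H \<subseteq> carrier R" using H(3) by (auto simp: annihilator_def)
  have kills: "h \<odot>\<^bsub>E 0\<^esub> x = \<zero>\<^bsub>E 0\<^esub>" if h: "h \<in> H" and x: "x \<in> carrier (E 0)" "d 0 x = \<zero>\<^bsub>E (Suc 0)\<^esub>" for h x
  proof -
    obtain m where m: "x = \<epsilon> m" "m \<in> carrier M" using ker x by blast
    have "h \<odot>\<^bsub>M\<^esub> m = \<zero>\<^bsub>M\<^esub>" "h \<in> carrier R" using h H(3) m(2) by (auto simp: annihilator_def)
    thus ?thesis using module_homD(3)[OF \<epsilon>, of h m] m module_hom_zero[OF M.module_axioms Em \<epsilon>] by simp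
  qed
  have XI: "set xs \<subseteq> Idl\<^bsub>R\<^esub> X"
    using assms(9) genideal_self[OF xsc] xs(3) X(3) unfolding h_linked_def by blast
  have qex: "\<exists>n0. \<forall>n \<ge> n0. C.qexact (C.tors (set xs)) (C.tors X) j n" for j
  proof (rule C.qexact_comparison[OF X(1) Xg finite_set xs(1) XI H(1,2) _ U(1) _ U(3)])
    show "U \<subseteq> (\<Union>n. gr n)" using U(2) by blast
    show "h \<odot>\<^bsub>shift_module E (Suc 0)\<^esub> x = \<zero>\<^bsub>shift_module E (Suc 0)\<^esub>"
      if "h \<in> H" "x \<in> carrier (shift_module E (Suc 0))"
        "shift_differential E d (Suc 0) x = \<zero>\<^bsub>shift_module E (Suc (Suc 0))\<^esub>" for h x
      using kills that by simp
    fix x u assume xu: "x \<in> X" "u \<in> U"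
    then obtain N :: nat and a where N: "a \<in> I" "x [^]\<^bsub>R\<^esub> N \<otimes>\<^bsub>R\<^esub> u [^]\<^bsub>R\<^esub> N = a \<oplus>\<^bsub>R\<^esub> g (x, u)" using g by fastforce
    have c: "set xs \<union> H \<subseteq> carrier R" using xsc Hc by blast
    have "g (x, u) \<in> Idl\<^bsub>R\<^esub> (set xs \<union> H)" using genideal_self[OF c] xu by (auto simp: H_def)
    moreover have "a \<in> Idl\<^bsub>R\<^esub> (set xs \<union> H)"
      using N(1) subset_Idl_subset[OF c, of "set xs"] xs(3) by blast
    ultimately have "a \<oplus>\<^bsub>R\<^esub> g (x, u) \<in> Idl\<^bsub>R\<^esub> (set xs \<union> H)"
      by (intro additive_subgroup.a_closed[OF ideal.axioms(1)[OF genideal_ideal[OF c]]])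
    thus "\<exists>N::nat. x [^]\<^bsub>R\<^esub> N \<otimes>\<^bsub>R\<^esub> u [^]\<^bsub>R\<^esub> N \<in> Idl\<^bsub>R\<^esub> (set xs \<union> H)" using N(2) by metis
  qed
  have acyclic: "C.cocycles (set xs) j \<subseteq> C.coboundaries (set xs) j" if "j \<noteq> t" for j
  proof (rule C.regular_sequence_acyclic[OF xs(1)])
    have "weakly_regular (E 0) (\<epsilon> ` carrier M) (\<epsilon> ` {\<zero>\<^bsub>M\<^esub>}) xs"
      by (rule weakly_regular_image[OF M.module_axioms Em \<epsilon> \<epsilon>_inj xsc M.zero_submodule])
        (use xs(2) in \<open>simp add: M.regular_sequence_iff\<close>)
    thus "weakly_regular (shift_module E (Suc 0)) {z \<in> carrier (shift_module E (Suc 0)).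
        shift_differential E d (Suc 0) z = \<zero>\<^bsub>shift_module E (Suc (Suc 0))\<^esub>} {\<zero>\<^bsub>shift_module E (Suc 0)\<^esub>} xs"
      by (simp add: ker module_hom_zero[OF M.module_axioms Em \<epsilon>])
  qed (use that t in simp)
  \<comment> \<open>\<open>C\<close> has a zero module in front, so \<open>E i\<close> is its term
    with index \<open>Suc i\<close>, while cohomological degrees agree.\<close>
  have tors: "torsion R (Idl\<^bsub>R\<^esub> Y) (E i) = C.tors Y (Suc i)" if "finite Y" "Y \<subseteq> carrier R" for Y i
    using module.torsion_iff[OF Em that] by (auto simp: C.tors_def)
  have cocyc: "torsion_cocycles R E d (Idl\<^bsub>R\<^esub> Y) i = C.cocycles Y i" if "finite Y" "Y \<subseteq> carrier R" for Y i
    by (simp add: torsion_cocycles_def C.cocycles_def tors[OF that])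
  have cobd: "torsion_coboundaries R E d (Idl\<^bsub>R\<^esub> Y) i = C.coboundaries Y i" if Y: "finite Y" "Y \<subseteq> carrier R" for Y i
  proof (cases i)
    case 0
    have "\<zero>\<^bsub>E 0\<^esub> \<in> C.tors Y 0" using C.E.operator_subgroupD(3)[OF C.tors_submodule[OF Y], of 0] by simp
    thus ?thesis using 0 by (auto simp: torsion_coboundaries_def C.coboundaries_def)
  qed (simp add: torsion_coboundaries_def C.coboundaries_def tors[OF Y])
  note Xs = cocyc[OF X(1) Xc, folded X(3)] cobd[OF X(1) Xc, folded X(3)]
  note Is = cocyc[OF finite_set xsc, folded xs(3)] cobd[OF finite_set xsc, folded xs(3)]
  have sub: "C.tors X i \<subseteq> C.tors (set xs) i" for i
  proof (rule C.tors_Idl[OF X(1) Xc xsc])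
    fix y assume y: "y \<in> set xs"
    hence "y [^]\<^bsub>R\<^esub> (1::nat) \<in> Idl\<^bsub>R\<^esub> X" using subsetD[OF XI y] subsetD[OF xsc y] by simp
    thus "\<exists>k::nat. y [^]\<^bsub>R\<^esub> k \<in> Idl\<^bsub>R\<^esub> X" by blast
  qed
  show ?thesis
  proof
    fix i
    obtain n1 where n1: "\<And>n. n \<ge> n1 \<Longrightarrow> C.qexact (C.tors (set xs)) (C.tors X) i n" using qex by blast
    \<comment> \<open>Injectivity in degree i uses position i - 1. For i = 0 the truncated
      difference is 0, and exactness there is never called upon since 0 is not a successor.\<close>
    obtain n2 where n2: "\<And>n. n \<ge> n2 \<Longrightarrow> C.qexact (C.tors (set xs)) (C.tors X) (i - 1) n" using qex by blast
    let ?B = "C.coboundaries X i" and ?Z = "C.cocycles X i" and ?B' = "C.coboundaries (set xs) i" and ?Z' = "C.cocycles (set xs) i"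
    interpret Ei: graded_module R "E i" gr "gE i" by (rule E)
    have B: "Ei.is_submodule ?B" and Z: "Ei.is_submodule ?Z" and B': "Ei.is_submodule ?B'" and Z': "Ei.is_submodule ?Z'"
      using C.coboundaries_submodule[OF X(1) Xc, of i] C.cocycles_submodule[OF X(1) Xc, of i]
        C.coboundaries_submodule[OF finite_set xsc, of i] C.cocycles_submodule[OF finite_set xsc, of i] by simp_all
    have ZZ': "?Z \<subseteq> ?Z'" using sub unfolding C.cocycles_def by blast
    have BB': "?B \<subseteq> ?B'" using sub unfolding C.coboundaries_def by blast
    have main: "(i \<noteq> t \<longrightarrow> carrier (local_cohomology_component R E gE d \<aa> i n) =
                     {\<zero>\<^bsub>local_cohomology_component R E gE d \<aa> i n\<^esub>}) \<and>
           (i = t \<longrightarrow> modules_isomorphic (R\<lparr>carrier := gr 0\<rparr>)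
                     (local_cohomology_component R E gE d \<aa> i n)
                     (local_cohomology_component R E gE d I t n))"
      if n: "n \<ge> max n1 n2" for n
    proof -
      have inj: "z \<in> ?B" if "z \<in> ?Z \<inter> gE i n" "z \<in> ?B'" for z
        by (rule C.cohomology_injective[OF _ X(1) Xg finite_set xs(1)]) (use n2[of n] n that in auto)
      have surj: "\<exists>y \<in> ?Z \<inter> gE i n. z \<ominus>\<^bsub>E i\<^esub> y \<in> ?B'" if "z \<in> ?Z' \<inter> gE i n" for z
        using C.cohomology_surjective[OF Xc n1 X(1) finite_set xsc, of n z] n that by simp
      have pc: "x \<in> carrier (E i)" if "x \<in> gE i n" for x using that by (rule Ei.gM.piece_carrier)
      show ?thesis
      proof (intro conjI impI)
        assume it: "i \<noteq> t"
        \<comment> \<open>A degree n cocycle for \<aa> is one for I, hence a coboundary for I as i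
          \<noteq> t, and by injectivity a coboundary for \<aa>.\<close>
        have coset: "a_r_coset (E i) ?B x = ?B" if x: "x \<in> ?Z \<inter> gE i n" for x
        proof -
          have "x \<in> ?B" using inj[OF x] acyclic[OF it] ZZ' x by blast
          moreover have "x \<ominus>\<^bsub>E i\<^esub> \<zero>\<^bsub>E i\<^esub> = x" using x pc by (simp add: a_minus_def)
          ultimately have "a_r_coset (E i) ?B x = a_r_coset (E i) ?B \<zero>\<^bsub>E i\<^esub>"
            using Ei.coset_eq_iff[OF B, of x "\<zero>\<^bsub>E i\<^esub>"] x pc by simp
          also have "\<dots> = ?B" using Ei.operator_subgroupD(2)[OF B] unfolding Ei.coset_eq by force
          finally show ?thesis .
        qed
        moreover have "\<zero>\<^bsub>E i\<^esub> \<in> ?Z \<inter> gE i n" using Ei.operator_subgroupD(3)[OF Z] by simp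
        ultimately show "carrier (local_cohomology_component R E gE d \<aa> i n) =
                     {\<zero>\<^bsub>local_cohomology_component R E gE d \<aa> i n\<^esub>}"
          unfolding local_cohomology_component_simps Xs by auto
      next
        assume it: "i = t"
        have "modules_isomorphic (R\<lparr>carrier := gr 0\<rparr>)
                     (local_cohomology_component R E gE d \<aa> i n) (local_cohomology_component R E gE d I i n)"
        proof (rule Ei.quotient_isomorphism[OF _ B B' BB'])
          show "gr 0 \<subseteq> carrier R" using gr.piece_carrier by blast
          show "?Z \<inter> gE i n \<subseteq> carrier (E i)" "?Z' \<inter> gE i n \<subseteq> carrier (E i)" using pc by blast+
          show "?Z \<inter> gE i n \<subseteq> ?Z' \<inter> gE i n" using ZZ' by blast
          show "x \<ominus>\<^bsub>E i\<^esub> y \<in> ?Z \<inter> gE i n" if "x \<in> ?Z \<inter> gE i n" "y \<in> ?Z \<inter> gE i n" for x y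
            using that Ei.operator_subgroupD(6)[OF Z, of x y] Ei.gM.piece_add Ei.gM.piece_neg by (simp add: a_minus_def)
        qed (use inj surj in \<open>simp_all only: local_cohomology_component_simps Xs Is\<close>)
        thus "modules_isomorphic (R\<lparr>carrier := gr 0\<rparr>)
                     (local_cohomology_component R E gE d \<aa> i n)
                     (local_cohomology_component R E gE d I t n)" using it by simp
      qed
    qed
    show "\<forall>\<^sub>F n in at_top.
           (i \<noteq> t \<longrightarrow> carrier (local_cohomology_component R E gE d \<aa> i n) =
                     {\<zero>\<^bsub>local_cohomology_component R E gE d \<aa> i n\<^esub>}) \<and>
           (i = t \<longrightarrow> modules_isomorphic (R\<lparr>carrier := gr 0\<rparr>)
                     (local_cohomology_component R E gE d \<aa> i n)
                     (local_cohomology_component R E gE d I t n))"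
      unfolding eventually_at_top_linorder using main by blast
  qed
qed

end
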